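(* Let $d\ge 2$ be an integer, $q_\circ(d)=\frac{2(d+1)}{d-1}$, $q\in(2,\infty)\setminus\{q_\circ(d)\}$ and $s\in\mathbb R$. Set $s_c(q,d)=\frac{d+1}{4}-\frac{d-1}{2q}$ if $2\le q<q_\circ(d)$ and $s_c(q,d)=\frac d2-\frac dq$ if $q\ge q_\circ(d)$. Then there is a constant $C$ such that $$\Big\| \sup_{t \in (0,1)} \big|e^{it\sqrt{-\Delta}}f\big|\Big\|_{L^{q}(B^d(0,1))} \le C \|f\|_{H^s(\mathbb{R}^d)}\quad\text{for all } f\in H^s(\mathbb R^d)$$ if and only if $s\ge s_c(q,d)$.
   Context: The wave operator is $e^{it\sqrt{-\Delta}}f(x)=\frac1{(2\pi)^d}\int_{\mathbb R^d}e^{i(x\cdot\xi+t|\xi|)}\widehat f(\xi)\,d\xi$, with $\widehat f(\xi)=\int e^{-ix\cdot\xi}f(x)\,dx$. $H^s(\mathbb R^d)$ is the inhomogeneous $L^2$ Sobolev space with norm $\|(1-\Delta)^{s/2}f\|_{L^2}$, and $B^d(0,1)$ is the unit ball of $\mathbb R^d$ centered at the origin. As usual, such maximal estimates may be read as a priori estimates for Schwartz functions $f$ with constants independent of $f$, extended to the whole Sobolev space by density. *)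

theory Defs
  imports "HOL-Analysis.Analysis"
begin

definition partial_derivative ::
    "'a::euclidean_space \<Rightarrow> ('a \<Rightarrow> complex) \<Rightarrow> 'a \<Rightarrow> complex" where
  "partial_derivative b f = (\<lambda>x. frechet_derivative f (at x) b)"

primrec iterated_partial ::
    "'a::euclidean_space list \<Rightarrow> ('a \<Rightarrow> complex) \<Rightarrow> 'a \<Rightarrow> complex" where
  "iterated_partial [] f = f"
| "iterated_partial (b # bs) f = partial_derivative b (iterated_partial bs f)"

(* frechet_derivative is a junk value where f is not differentiable; requiring every iterated
   partial derivative to be (Frechet) differentiable everywhere amounts to f being smooth, so that
   all derivatives below are genuine. *)
definition schwartz :: "('a::euclidean_space \<Rightarrow> complex) \<Rightarrow> bool" where
  "schwartz f \<longleftrightarrow> (\<forall>bs \<in> lists Basis.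
     (\<forall>x. iterated_partial bs f differentiable (at x)) \<and>
     (\<forall>k::nat. \<exists>B. \<forall>x. norm x ^ k * norm (iterated_partial bs f x) \<le> B))"

definition fourier :: "('a::euclidean_space \<Rightarrow> complex) \<Rightarrow> 'a \<Rightarrow> complex" where
  "fourier f \<xi> = (LINT x|lborel. exp (- (\<i> * of_real (x \<bullet> \<xi>))) * f x)"

definition inverse_fourier :: "('a::euclidean_space \<Rightarrow> complex) \<Rightarrow> 'a \<Rightarrow> complex" where
  "inverse_fourier g x =
     of_real (1 / (2 * pi) ^ DIM('a)) *
     (LINT \<xi>|lborel. exp (\<i> * of_real (x \<bullet> \<xi>)) * g \<xi>)"

definition wave :: "real \<Rightarrow> ('a::euclidean_space \<Rightarrow> complex) \<Rightarrow> 'a \<Rightarrow> complex" where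
  "wave t f x =
     of_real (1 / (2 * pi) ^ DIM('a)) *
     (LINT \<xi>|lborel. exp (\<i> * of_real (x \<bullet> \<xi> + t * norm \<xi>)) * fourier f \<xi>)"

(* (1 - Laplacian)^(s/2), the Fourier multiplier with symbol (1 + |xi|^2)^(s/2). *)
definition bessel_potential ::
    "real \<Rightarrow> ('a::euclidean_space \<Rightarrow> complex) \<Rightarrow> 'a \<Rightarrow> complex" where
  "bessel_potential s f =
     inverse_fourier (\<lambda>\<xi>. of_real ((1 + (norm \<xi>)\<^sup>2) powr (s / 2)) * fourier f \<xi>)"

(* For p > 0. *)
definition ennreal_powr :: "ennreal \<Rightarrow> real \<Rightarrow> ennreal" where
  "ennreal_powr y p = (if y = \<infinity> then \<infinity> else ennreal (enn2real y powr p))"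

(* The L^p(A) norm, for 0 < p < infinity, of a function with values in [0, infinity]; a
   complex-valued function enters through its absolute value. *)
definition Lp_norm ::
    "real \<Rightarrow> 'a::euclidean_space set \<Rightarrow> ('a \<Rightarrow> ennreal) \<Rightarrow> ennreal" where
  "Lp_norm p A g = ennreal_powr (\<integral>\<^sup>+x\<in>A. ennreal_powr (g x) p \<partial>lborel) (1 / p)"

definition sobolev_norm :: "real \<Rightarrow> ('a::euclidean_space \<Rightarrow> complex) \<Rightarrow> ennreal" where
  "sobolev_norm s f = Lp_norm 2 UNIV (\<lambda>x. ennreal (norm (bessel_potential s f x)))"

definition wave_maximal :: "('a::euclidean_space \<Rightarrow> complex) \<Rightarrow> 'a \<Rightarrow> ennreal" where
  "wave_maximal f x = (SUP t\<in>{0<..<1}. ennreal (norm (wave t f x)))"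

definition q_circ :: "nat \<Rightarrow> real" where
  "q_circ d = 2 * (real d + 1) / (real d - 1)"

(* For d >= 2 and q >= 2. *)
definition s_crit :: "real \<Rightarrow> nat \<Rightarrow> real" where
  "s_crit q d =
     (if q < q_circ d then (real d + 1) / 4 - (real d - 1) / (2 * q)
      else real d / 2 - real d / q)"

end

theory Submission
  imports Defs "HOL-Probability.Probability" "HOL-Complex_Analysis.Complex_Analysis"
begin

text \<open>
  Sufficiency. Linearise the level set of the maximal function of a wave with frequencies at most
  \<open>N\<close> by choosing a time from a lattice at each point, and apply \<open>T T\<^sup>*\<close>. With the weight
  \<open>exp (- |\<xi>| / N)\<close>, the kernel of \<open>T T\<^sup>*\<close> is the Poisson kernel at the complex time
  \<open>1 / N - i t\<close>, which is explicit. Estimating close times by Bessel's inequality and distant times by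
  the dispersive bound, then optimising in the threshold, gives the weak type bound at \<open>q_circ d\<close>.
  Since \<open>q \<noteq> q_circ d\<close>, the exponent \<open>q\<close> lies strictly between \<open>q_circ d\<close> and a second exponent (2, or a
  large one) at which the \<open>L\<^sup>2\<close> or the \<open>L\<^sup>\<infinity>\<close> bound applies, and the two weak type bounds depend on \<open>N\<close> in the
  same way after rescaling. Hence the dyadic pieces can be summed at the critical exponent without
  any loss. A Taylor expansion in time passes from the lattice to all times.

  Necessity. Gaussian packets that focus at a point of space-time at scale \<open>1 / N\<close> give the exponent
  \<open>d / 2 - d / q\<close>, and Knapp packets, adapted to a \<open>1 \<times> N powr (- 1 / 2)\<close> tube, give
  \<open>(d + 1) / 4 - (d - 1) / (2 q)\<close>.
\<close>

section \<open>Fourier transforms on Euclidean space\<close>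

text \<open>The weight \<open>exp (- |\<xi>| / N)\<close> stands in for a smooth frequency cutoff:
  its kernel has a closed form, so the decay is read off from an algebraic factorisation and no
  stationary phase is needed. That the weight has no compact support does no harm, since it only has
  to be bounded below on \<open>|\<xi>| \<le> N\<close>.

  The obstacle is the summation over dyadic frequencies: estimating each piece strongly and using
  the triangle inequality would only reach \<open>s > s_crit\<close>. The endpoint is saved by
  having weak type bounds on both sides of \<open>q\<close> with a common dependence on
  \<open>N\<close>. In the product of two pieces at different frequencies the exponents can then be
  moved in opposite directions, and this gains a factor that is geometric in the distance of the
  scales. In both regimes \<open>q_circ d\<close> is an end of the interval of exponents, so it is
  interior to neither.

  In the converse direction the Sobolev weight is controlled through an upper bound on the
  frequencies alone, which produces \<open>max s 0\<close> instead of \<open>s\<close>; the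
  positivity of \<open>s_crit\<close> removes the maximum at the end.\<close>

lemma lborel_eq_distr_PiM:
  "(lborel :: 'a::euclidean_space measure) =
     distr (\<Pi>\<^sub>M b\<in>(Basis :: 'a set). lborel) borel (\<lambda>f. \<Sum>b\<in>Basis. f b *\<^sub>R b)"
  by (subst lborel_def) (simp add: lborel_eq_real)

lemma
  fixes \<phi> :: "'a::euclidean_space \<Rightarrow> real \<Rightarrow> complex"
  assumes int: "\<And>b. b \<in> Basis \<Longrightarrow> integrable lborel (\<phi> b)"
  shows integrable_prod_Basis: "integrable lborel (\<lambda>x::'a. \<Prod>b\<in>Basis. \<phi> b (x \<bullet> b))"
    and integral_prod_Basis:
      "(LINT x|lborel. (\<Prod>b\<in>Basis. \<phi> b (x \<bullet> b))) = (\<Prod>b\<in>(Basis::'a set). (LINT y|lborel. \<phi> b y))"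
proof -
  interpret product_sigma_finite "\<lambda>_::'a. lborel :: real measure" ..
  have [measurable]: "b \<in> Basis \<Longrightarrow> \<phi> b \<in> borel_measurable borel" for b
    using borel_measurable_integrable[OF int] by simp
  have m1: "(\<lambda>f. \<Sum>b\<in>Basis. f b *\<^sub>R b) \<in> measurable (\<Pi>\<^sub>M b\<in>(Basis :: 'a set). lborel) borel"
    by measurable
  have m2: "(\<lambda>x::'a. \<Prod>b\<in>Basis. \<phi> b (x \<bullet> b)) \<in> borel_measurable borel"
    by measurable
  have eq: "(\<Prod>b\<in>Basis. \<phi> b ((\<Sum>c\<in>Basis. f c *\<^sub>R c) \<bullet> b)) = (\<Prod>b\<in>Basis. \<phi> b (f b))"
    for f :: "'a \<Rightarrow> real"
    by (intro prod.cong refl) (simp add: inner_sum_left_Basis)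
  show "integrable lborel (\<lambda>x::'a. \<Prod>b\<in>Basis. \<phi> b (x \<bullet> b))"
    by (subst lborel_eq_distr_PiM, subst integrable_distr_eq[OF m1 m2])
       (simp add: eq product_integrable_prod int)
  show "(LINT x|lborel. (\<Prod>b\<in>Basis. \<phi> b (x \<bullet> b))) = (\<Prod>b\<in>(Basis::'a set). (LINT y|lborel. \<phi> b y))"
    by (subst lborel_eq_distr_PiM, subst integral_distr[OF m1 m2])
       (simp add: eq product_integral_prod int)
qed

section \<open>Gaussian integrals with an oscillating factor\<close>

text \<open>The value is the characteristic function of the standard normal law, whose density is
  this Gaussian divided by \<open>sqrt (2 * pi)\<close>.\<close>

lemma
  fixes t :: real
  shows integrable_cis_std_gauss: "integrable lborel (\<lambda>x. cis (x * t) * of_real (exp (- (x\<^sup>2 / 2))))"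
    and integral_cis_std_gauss: "(LINT x|lborel. cis (x * t) * of_real (exp (- (x\<^sup>2 / 2)))) =
          of_real (sqrt (2 * pi) * exp (- (t\<^sup>2 / 2)))"
proof -
  have eq: "cis (x * t) * of_real (exp (- (x\<^sup>2 / 2))) =
      of_real (sqrt (2*pi)) * (std_normal_density x *\<^sub>R iexp (t * x))" for x
    by (simp add: std_normal_density_def cis_conv_exp scaleR_conv_of_real mult_ac)
  have "integrable std_normal_distribution (\<lambda>x. iexp (t * x))"
    by (intro prob_space.integrable_iexp real_distribution.axioms(1) real_dist_normal_dist) auto
  then have i: "integrable lborel (\<lambda>x. std_normal_density x *\<^sub>R iexp (t * x))"
    by (subst (asm) integrable_density) auto
  then show "integrable lborel (\<lambda>x. cis (x * t) * of_real (exp (- (x\<^sup>2 / 2))))"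
    unfolding eq by (intro integrable_mult_right)
  have "char std_normal_distribution t = (LINT x|lborel. std_normal_density x *\<^sub>R iexp (t * x))"
    unfolding char_def by (subst integral_density) auto
  then have "(LINT x|lborel. std_normal_density x *\<^sub>R iexp (t * x)) = of_real (exp (- (t\<^sup>2 / 2)))"
    by (simp add: char_std_normal_distribution)
  then show "(LINT x|lborel. cis (x * t) * of_real (exp (- (x\<^sup>2 / 2)))) =
          of_real (sqrt (2 * pi) * exp (- (t\<^sup>2 / 2)))"
    unfolding eq by (subst integral_mult_right_zero) simp
qed

lemma
  fixes a t :: real
  assumes "a > 0"
  shows integrable_cis_gauss_real:
        "integrable lborel (\<lambda>x. cis (x * t) * of_real (exp (- (a * x\<^sup>2 / 2))))"
    and integral_cis_gauss_real:
        "(LINT x|lborel. cis (x * t) * of_real (exp (- (a * x\<^sup>2 / 2)))) =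
          of_real (sqrt (2 * pi / a) * exp (- (t\<^sup>2 / (2 * a))))"
proof -
  let ?f = "\<lambda>x. cis (x * (t / sqrt a)) * of_real (exp (- (x\<^sup>2 / 2))) :: complex"
  have eq: "?f (0 + sqrt a * x) = cis (x * t) * of_real (exp (- (a * x\<^sup>2 / 2)))" for x
    using assms by (simp add: power_mult_distrib)
  have nz: "sqrt a \<noteq> 0" using assms by simp
  show "integrable lborel (\<lambda>x. cis (x * t) * of_real (exp (- (a * x\<^sup>2 / 2))))"
    using lborel_integrable_real_affine[of ?f, OF integrable_cis_std_gauss nz, of 0] unfolding eq .
  have "of_real (sqrt (2 * pi) * exp (- ((t / sqrt a)\<^sup>2 / 2))) =
      sqrt a *\<^sub>R (LINT x|lborel. cis (x * t) * of_real (exp (- (a * x\<^sup>2 / 2))))"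
    using lborel_integral_real_affine[OF nz, of ?f 0] assms unfolding eq integral_cis_std_gauss by simp
  then have "(LINT x|lborel. cis (x * t) * of_real (exp (- (a * x\<^sup>2 / 2)))) =
      inverse (sqrt a) *\<^sub>R of_real (sqrt (2 * pi) * exp (- ((t / sqrt a)\<^sup>2 / 2)))"
    using nz by simp
  also have "\<dots> = of_real (sqrt (2 * pi / a) * exp (- (t\<^sup>2 / (2 * a))))"
    using assms by (simp add: scaleR_conv_of_real real_sqrt_divide power_divide field_simps)
  finally show "(LINT x|lborel. cis (x * t) * of_real (exp (- (a * x\<^sup>2 / 2)))) =
          of_real (sqrt (2 * pi / a) * exp (- (t\<^sup>2 / (2 * a))))" .
qed

lemma cis_sum: "finite I \<Longrightarrow> cis (\<Sum>i\<in>I. f i) = (\<Prod>i\<in>I. cis (f i))"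
  by (induction I rule: finite_induct) (auto simp: cis_mult[symmetric])

lemma
  fixes \<xi> :: "'a::euclidean_space"
  assumes "a > 0"
  shows integrable_cis_gauss:
        "integrable lborel (\<lambda>x. cis (x \<bullet> \<xi>) * of_real (exp (- (a * (norm x)\<^sup>2 / 2))))"
    and integral_cis_gauss:
        "(LINT x|lborel. cis (x \<bullet> \<xi>) * of_real (exp (- (a * (norm x)\<^sup>2 / 2)))) =
          of_real (sqrt (2 * pi / a) ^ DIM('a) * exp (- ((norm \<xi>)\<^sup>2 / (2 * a))))"
proof -
  define \<phi> :: "'a \<Rightarrow> real \<Rightarrow> complex"
    where "\<phi> b y = cis (y * (\<xi> \<bullet> b)) * of_real (exp (- (a * y\<^sup>2 / 2)))" for b y
  have i: "integrable lborel (\<phi> b)" for b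
    unfolding \<phi>_def by (rule integrable_cis_gauss_real[OF assms])
  have n: "(norm x)\<^sup>2 = (\<Sum>b\<in>Basis. (x \<bullet> b)\<^sup>2)" for x :: 'a
    by (subst power2_norm_eq_inner, subst euclidean_inner) (simp add: power2_eq_square)
  have eq: "(\<Prod>b\<in>Basis. \<phi> b (x \<bullet> b)) = cis (x \<bullet> \<xi>) * of_real (exp (- (a * (norm x)\<^sup>2 / 2)))" for x
  proof -
    have "(\<Prod>b\<in>Basis. \<phi> b (x \<bullet> b)) = cis (\<Sum>b\<in>Basis. (x \<bullet> b) * (\<xi> \<bullet> b)) *
        of_real (exp (\<Sum>b\<in>Basis. - (a * (x \<bullet> b)\<^sup>2 / 2)))"
      unfolding \<phi>_def by (simp add: prod.distrib cis_sum exp_sum)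
    also have "(\<Sum>b\<in>Basis. (x \<bullet> b) * (\<xi> \<bullet> b)) = x \<bullet> \<xi>"
      by (rule euclidean_inner[symmetric])
    also have "(\<Sum>b\<in>Basis. - (a * (x \<bullet> b)\<^sup>2 / 2)) = - (a * (norm x)\<^sup>2 / 2)"
      unfolding n by (simp add: sum_negf sum_distrib_left sum_divide_distrib)
    finally show ?thesis .
  qed
  show "integrable lborel (\<lambda>x. cis (x \<bullet> \<xi>) * of_real (exp (- (a * (norm x)\<^sup>2 / 2))))"
    using integrable_prod_Basis[of \<phi>, OF i] unfolding eq .
  have "(LINT x|lborel. cis (x \<bullet> \<xi>) * of_real (exp (- (a * (norm x)\<^sup>2 / 2)))) =
      (\<Prod>b\<in>(Basis::'a set). (LINT y|lborel. \<phi> b y))"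
    using integral_prod_Basis[of \<phi>, OF i] unfolding eq .
  also have "\<dots> = (\<Prod>b\<in>(Basis::'a set). of_real (sqrt (2 * pi / a) * exp (- ((\<xi> \<bullet> b)\<^sup>2 / (2 * a)))))"
    unfolding \<phi>_def by (simp only: integral_cis_gauss_real[OF assms])
  also have "\<dots> = of_real (sqrt (2 * pi / a) ^ DIM('a) * exp (\<Sum>b\<in>Basis. - ((\<xi> \<bullet> b)\<^sup>2 / (2 * a))))"
    by (simp add: prod.distrib exp_sum)
  also have "(\<Sum>b\<in>Basis. - ((\<xi> \<bullet> b)\<^sup>2 / (2 * a))) = - ((norm \<xi>)\<^sup>2 / (2 * a))"
    unfolding n by (simp add: sum_negf sum_divide_distrib)
  finally show "(LINT x|lborel. cis (x \<bullet> \<xi>) * of_real (exp (- (a * (norm x)\<^sup>2 / 2)))) =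
          of_real (sqrt (2 * pi / a) ^ DIM('a) * exp (- ((norm \<xi>)\<^sup>2 / (2 * a))))" .
qed

lemma
  assumes "a > 0"
  shows integrable_gauss: "integrable lborel (\<lambda>x::'a::euclidean_space. exp (- (a * (norm x)\<^sup>2 / 2)))"
    and integral_gauss: "(LINT x::'a|lborel. exp (- (a * (norm x)\<^sup>2 / 2))) = sqrt (2 * pi / a) ^ DIM('a)"
  using integrable_Re[OF integrable_cis_gauss[OF assms, of "0::'a"]]
    arg_cong[OF integral_cis_gauss[OF assms, of "0::'a"], of Re]
    integral_Re[OF integrable_cis_gauss[OF assms, of "0::'a"]]
  by (simp_all del: of_real_exp of_real_mult of_real_power)

text \<open>Each factor \<open>1 + (x \<bullet> b)\<^sup>2\<close> is at most
  \<open>1 + (norm x)\<^sup>2\<close>, so a product of one-dimensional Cauchy densities dominates.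
  The exponent \<open>DIM('a)\<close> is simply the number of factors.\<close>

lemma integrable_norm_powr:
  "integrable lborel (\<lambda>x::'a::euclidean_space. 1 / (1 + (norm x)\<^sup>2) ^ DIM('a))"
proof (rule Bochner_Integration.integrable_bound)
  let ?f = "\<lambda>y::real. complex_of_real (inverse (1 + y\<^sup>2))"
  have "integrable lborel ?f"
    using integrable_inverse_1_plus_square
    by (intro integrable_of_real) (simp add: set_integrable_def)
  from integrable_prod_Basis[of "\<lambda>_. ?f", OF this]
  show "integrable lborel (\<lambda>x::'a. \<Prod>b\<in>Basis. ?f (x \<bullet> b))" .
  show "AE x::'a in lborel. norm (1 / (1 + (norm x)\<^sup>2) ^ DIM('a)) \<le> norm (\<Prod>b\<in>Basis. ?f (x \<bullet> b))"
  proof (intro AE_I2)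
    fix x :: 'a
    have "norm (\<Prod>b\<in>Basis. ?f (x \<bullet> b)) = inverse (\<Prod>b\<in>Basis. 1 + (x \<bullet> b)\<^sup>2)"
      by (simp only: prod_norm[symmetric] norm_of_real prod_inversef[symmetric])
         (simp add: abs_of_nonneg prod_inversef[symmetric])
    moreover have "(\<Prod>b\<in>Basis. 1 + (x \<bullet> b)\<^sup>2) \<le> (\<Prod>b\<in>(Basis::'a set). 1 + (norm x)\<^sup>2)"
      by (intro prod_mono conjI add_left_mono) (auto simp: Basis_le_norm power2_le_iff_abs_le)
    moreover have "(\<Prod>b\<in>Basis. 1 + (x \<bullet> b)\<^sup>2) > 0"
      by (intro prod_pos) (simp add: add_pos_nonneg)
    ultimately show "norm (1 / (1 + (norm x)\<^sup>2) ^ DIM('a)) \<le> norm (\<Prod>b\<in>Basis. ?f (x \<bullet> b))"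
      by (simp add: divide_inverse le_imp_inverse_le)
  qed
qed measurable

lemma integrable_of_decay:
  fixes f :: "'a::euclidean_space \<Rightarrow> 'b::{banach,second_countable_topology}"
  assumes "f \<in> borel_measurable borel" and "\<And>x. norm (f x) * (1 + (norm x)\<^sup>2) ^ DIM('a) \<le> C"
  shows "integrable lborel f"
proof (rule Bochner_Integration.integrable_bound[OF integrable_mult_right[OF integrable_norm_powr, of C]])
  show "f \<in> borel_measurable lborel" using assms(1) by simp
  show "AE x in lborel. norm (f x) \<le> norm (C * (1 / (1 + (norm x)\<^sup>2) ^ DIM('a)))"
  proof (intro AE_I2)
    fix x :: 'a
    have "(1 + (norm x)\<^sup>2) ^ DIM('a) > 0" by (simp add: add_pos_nonneg)
    then have "norm (f x) \<le> C / (1 + (norm x)\<^sup>2) ^ DIM('a)"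
      using assms(2)[of x] by (simp add: pos_le_divide_eq)
    then show "norm (f x) \<le> norm (C * (1 / (1 + (norm x)\<^sup>2) ^ DIM('a)))"
      by (rule order_trans) (simp add: divide_right_mono)
  qed
qed

section \<open>The Fourier integral and Bessel's inequality\<close>

text \<open>Positive phase and no constant: waves and inverse transforms are then of the form
  \<open>ft\<close> up to a factor, while \<open>fourier\<close> is its reflection.\<close>

definition ft :: "('a::euclidean_space \<Rightarrow> complex) \<Rightarrow> 'a \<Rightarrow> complex" where
  "ft g \<xi> = (LINT x|lborel. cis (\<xi> \<bullet> x) * g x)"

lemma measurable_cis [measurable]: "cis \<in> borel_measurable borel"
  by (intro borel_measurable_continuous_onI continuous_intros)

lemma measurable_cnj [measurable]: "cnj \<in> borel_measurable borel"
  by (intro borel_measurable_continuous_onI continuous_intros)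

lemma integrable_cis_mult:
  assumes "integrable M g" "\<phi> \<in> borel_measurable M"
  shows "integrable M (\<lambda>x. cis (\<phi> x) * g x)"
  by (rule Bochner_Integration.integrable_bound[OF assms(1)])
     (use assms in \<open>auto simp: norm_mult\<close>)

lemma integrable_ft [intro]: "integrable lborel g \<Longrightarrow> integrable lborel (\<lambda>x. cis (\<xi> \<bullet> x) * g x)"
  by (intro integrable_cis_mult) auto

lemma norm_ft_le: "integrable lborel g \<Longrightarrow> norm (ft g \<xi>) \<le> (LINT x|lborel. norm (g x))"
  unfolding ft_def using integral_norm_bound[of lborel "\<lambda>x. cis (\<xi> \<bullet> x) * g x"]
  by (simp add: norm_mult)

lemma continuous_ft:
  assumes "integrable lborel g"
  shows "continuous_on UNIV (ft g)"
proof -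
  have "isCont (ft g) \<xi>" for \<xi>
  proof (rule continuous_at_sequentiallyI)
    fix u assume u: "u \<longlonglongrightarrow> \<xi>"
    have [measurable]: "g \<in> borel_measurable borel"
      using borel_measurable_integrable[OF assms] by simp
    show "(\<lambda>n. ft g (u n)) \<longlonglongrightarrow> ft g \<xi>"
      unfolding ft_def
    proof (rule integral_dominated_convergence[where w = "\<lambda>x. norm (g x)"])
      show "AE x in lborel. (\<lambda>n. cis (u n \<bullet> x) * g x) \<longlonglongrightarrow> cis (\<xi> \<bullet> x) * g x"
        by (intro AE_I2 tendsto_intros u)
    qed (use assms in \<open>auto simp: norm_mult\<close>)
  qed
  then show ?thesis by (simp add: continuous_on_eq_continuous_at)
qed

lemma measurable_ft [measurable]: "integrable lborel g \<Longrightarrow> ft g \<in> borel_measurable borel"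
  by (intro borel_measurable_continuous_onI continuous_ft)

lemma integrable_pair_mult:
  fixes f :: "'a \<Rightarrow> complex" and g :: "'b \<Rightarrow> complex"
  assumes "sigma_finite_measure M" "sigma_finite_measure N" "integrable M f" "integrable N g"
  shows "integrable (M \<Otimes>\<^sub>M N) (\<lambda>p. f (fst p) * g (snd p))"
proof -
  interpret pair_sigma_finite M N using assms(1,2) by (simp add: pair_sigma_finite_def)
  have [measurable]: "f \<in> borel_measurable M" "g \<in> borel_measurable N" using assms by auto
  show ?thesis
  proof (rule Fubini_integrable)
    show "integrable M (\<lambda>x. \<integral>y. norm (f (fst (x, y)) * g (snd (x, y))) \<partial>N)"
      using assms by (simp add: norm_mult)
    show "AE x in M. integrable N (\<lambda>y. f (fst (x, y)) * g (snd (x, y)))"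
      using assms by simp
  qed simp
qed

lemma integrable_lborel_pair_mult:
  fixes f g :: "'a::euclidean_space \<Rightarrow> complex"
  assumes "integrable lborel f" "integrable lborel g"
  shows "integrable (lborel \<Otimes>\<^sub>M lborel) (\<lambda>p. f (fst p) * g (snd p))"
  by (intro integrable_pair_mult assms) (simp_all add: lborel.sigma_finite_measure_axioms)

lemma integrable_cnj [intro]: "integrable M f \<Longrightarrow> integrable M (\<lambda>x. cnj (f x))"
  by (rule Bochner_Integration.integrable_bound[of M f])
     (auto intro: measurable_compose[OF _ measurable_cnj])

text \<open>Expand both transforms and integrate in \<xi> first; the integrable weight
  \<open>w\<close> makes the triple integral absolutely convergent. With a Gaussian weight this
  yields Plancherel, with the weight \<open>exp (- (z * |\<xi>|))\<close> it is the
  \<open>T T\<^sup>*\<close> identity with an explicit kernel.\<close>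

lemma ft_bilinear:
  fixes w g h :: "'a::euclidean_space \<Rightarrow> complex"
  assumes w: "integrable lborel w" and g: "integrable lborel g" and h: "integrable lborel h"
  shows "(LINT \<xi>|lborel. w \<xi> * (ft g \<xi> * cnj (ft h \<xi>))) =
    (LINT p|(lborel \<Otimes>\<^sub>M lborel). g (fst p) * cnj (h (snd p)) * ft w (fst p - snd p))"
proof -
  let ?L = "lborel :: 'a measure"
  interpret B: pair_sigma_finite ?L "?L \<Otimes>\<^sub>M ?L"
    by (simp add: pair_sigma_finite_def lborel_pair.sigma_finite_measure_axioms lborel.sigma_finite_measure_axioms)
  have [measurable]: "w \<in> borel_measurable borel" "g \<in> borel_measurable borel" "h \<in> borel_measurable borel"
    using assms borel_measurable_integrable by fastforce+
  have gh: "integrable (?L \<Otimes>\<^sub>M ?L) (\<lambda>p. g (fst p) * cnj (h (snd p)))"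
    by (rule integrable_lborel_pair_mult) (use g h in auto)
  have i3: "integrable (?L \<Otimes>\<^sub>M (?L \<Otimes>\<^sub>M ?L))
      (\<lambda>q. cis (fst q \<bullet> (fst (snd q) - snd (snd q))) * (w (fst q) * (g (fst (snd q)) * cnj (h (snd (snd q))))))"
    by (intro integrable_cis_mult integrable_pair_mult w gh)
       (simp_all add: lborel_pair.sigma_finite_measure_axioms lborel.sigma_finite_measure_axioms)
  have e1: "w \<xi> * (ft g \<xi> * cnj (ft h \<xi>)) =
     (LINT p|(?L \<Otimes>\<^sub>M ?L). cis (\<xi> \<bullet> (fst p - snd p)) * (w \<xi> * (g (fst p) * cnj (h (snd p)))))" for \<xi>
  proof -
    have i: "integrable (?L \<Otimes>\<^sub>M ?L) (\<lambda>p. cis (\<xi> \<bullet> fst p) * g (fst p) * cnj (cis (\<xi> \<bullet> snd p) * h (snd p)))"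
      by (rule integrable_lborel_pair_mult) (intro integrable_ft integrable_cnj g h)+
    have "ft g \<xi> * cnj (ft h \<xi>) =
        (LINT x|?L. (LINT y|?L. cis (\<xi> \<bullet> x) * g x * cnj (cis (\<xi> \<bullet> y) * h y)))"
      unfolding ft_def
      by (simp only: integral_mult_right_zero integral_mult_left_zero Bochner_Integration.integral_cnj)
    also have "\<dots> = (LINT p|(?L \<Otimes>\<^sub>M ?L). cis (\<xi> \<bullet> fst p) * g (fst p) * cnj (cis (\<xi> \<bullet> snd p) * h (snd p)))"
      using lborel_pair.integral_fst'[OF i] by (simp only: fst_conv snd_conv)
    finally have "w \<xi> * (ft g \<xi> * cnj (ft h \<xi>)) =
       (LINT p|(?L \<Otimes>\<^sub>M ?L). w \<xi> * (cis (\<xi> \<bullet> fst p) * g (fst p) * cnj (cis (\<xi> \<bullet> snd p) * h (snd p))))"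
      by simp
    also have "\<dots> = (LINT p|(?L \<Otimes>\<^sub>M ?L). cis (\<xi> \<bullet> (fst p - snd p)) * (w \<xi> * (g (fst p) * cnj (h (snd p)))))"
      by (rule Bochner_Integration.integral_cong) (auto simp: inner_diff_right cis_divide[symmetric] cis_cnj divide_inverse)
    finally show ?thesis .
  qed
  have e2: "g (fst p) * cnj (h (snd p)) * ft w (fst p - snd p) =
    (LINT \<xi>|?L. cis (\<xi> \<bullet> (fst p - snd p)) * (w \<xi> * (g (fst p) * cnj (h (snd p)))))" for p
    unfolding ft_def by (subst integral_mult_right_zero[symmetric]) (simp add: inner_commute mult_ac)
  show ?thesis
    unfolding e1 e2
    using B.Fubini_integral[of "\<lambda>\<xi> p. cis (\<xi> \<bullet> (fst p - snd p)) * (w \<xi> * (g (fst p) * cnj (h (snd p))))"] i3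
    by (simp add: case_prod_beta')
qed

lemma ft_gauss:
  fixes z :: "'a::euclidean_space"
  assumes "\<epsilon> > 0"
  shows "ft (\<lambda>\<xi>. of_real (exp (- (\<epsilon> * (norm \<xi>)\<^sup>2 / 2)))) z =
    of_real (sqrt (2 * pi / \<epsilon>) ^ DIM('a) * exp (- ((norm z)\<^sup>2 / (2 * \<epsilon>))))"
  unfolding ft_def using integral_cis_gauss[OF assms, of z] by (simp add: inner_commute)

lemma nn_integral_gauss_kernel:
  assumes "\<epsilon> > 0"
  shows "(\<integral>\<^sup>+y. ennreal (sqrt (2 * pi / \<epsilon>) ^ DIM('a) * exp (- ((norm (y - x :: 'a::euclidean_space))\<^sup>2 / (2 * \<epsilon>)))) \<partial>lborel)
    = ennreal ((2 * pi) ^ DIM('a))"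
proof -
  let ?f = "\<lambda>y::'a. sqrt (2 * pi / \<epsilon>) ^ DIM('a) * exp (- ((norm y)\<^sup>2 / (2 * \<epsilon>)))"
  have e: "exp (- ((norm y)\<^sup>2 / (2 * \<epsilon>))) = exp (- (inverse \<epsilon> * (norm y)\<^sup>2 / 2))" for y :: 'a
    using assms by (simp add: field_simps)
  have "(\<integral>\<^sup>+y. ennreal (?f (y - x)) \<partial>lborel) = (\<integral>\<^sup>+y. ennreal (?f (y - x)) \<partial>distr lborel borel (\<lambda>y. x + y))"
    by (simp only: lborel_distr_plus)
  also have "\<dots> = (\<integral>\<^sup>+y. ennreal (?f y) \<partial>lborel)"
    by (subst nn_integral_distr) auto
  also have "\<dots> = ennreal (LINT y|lborel. ?f y)"
    by (rule nn_integral_eq_integral) (unfold e, use assms in \<open>intro integrable_mult_right integrable_gauss AE_I2, auto\<close>)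
  also have "(LINT y|lborel. ?f y) = sqrt (2 * pi / \<epsilon>) ^ DIM('a) * sqrt (2 * pi / inverse \<epsilon>) ^ DIM('a)"
    unfolding e using integral_gauss[of "inverse \<epsilon>", where 'a = 'a] assms by simp
  also have "\<dots> = (2 * pi) ^ DIM('a)"
  proof -
    have "sqrt (2 * pi / \<epsilon>) * sqrt (2 * pi / inverse \<epsilon>) = sqrt ((2 * pi)\<^sup>2)"
      unfolding real_sqrt_mult[symmetric] using assms by (simp add: power2_eq_square)
    also have "\<dots> = 2 * pi" by (subst real_sqrt_abs) simp
    finally show ?thesis by (simp only: power_mult_distrib[symmetric])
  qed
  finally show ?thesis .
qed

text \<open>The Gaussian weight makes the quadratic form finite for \<open>g\<close> that is merely
  integrable, and its transform is again a positive Gaussian.\<close>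

lemma gauss_mollified_ft:
  fixes g :: "'a::euclidean_space \<Rightarrow> complex"
  assumes g: "integrable lborel g" and "\<epsilon> > 0"
  shows "integrable lborel (\<lambda>\<xi>. exp (- (\<epsilon> * (norm \<xi>)\<^sup>2 / 2)) * (norm (ft g \<xi>))\<^sup>2)" (is ?A)
    and "of_real (LINT \<xi>|lborel. exp (- (\<epsilon> * (norm \<xi>)\<^sup>2 / 2)) * (norm (ft g \<xi>))\<^sup>2) =
     (LINT p|(lborel \<Otimes>\<^sub>M lborel). g (fst p) * cnj (g (snd p)) *
       of_real (sqrt (2 * pi / \<epsilon>) ^ DIM('a) * exp (- ((norm (fst p - snd p))\<^sup>2 / (2 * \<epsilon>)))))" (is ?B)
proof -
  let ?w = "\<lambda>\<xi>::'a. exp (- (\<epsilon> * (norm \<xi>)\<^sup>2 / 2))"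
  have [measurable]: "ft g \<in> borel_measurable borel" by (rule measurable_ft[OF g])
  have w: "integrable lborel ?w" by (rule integrable_gauss[OF assms(2)])
  show ?A
  proof (rule Bochner_Integration.integrable_bound[OF integrable_mult_right[OF w, of "(LINT x|lborel. norm (g x))\<^sup>2"]])
    show "AE \<xi> in lborel. norm (?w \<xi> * (norm (ft g \<xi>))\<^sup>2) \<le> norm ((LINT x|lborel. norm (g x))\<^sup>2 * ?w \<xi>)"
      by (intro AE_I2) (simp add: power_mono norm_ft_le[OF g])
  qed simp
  have e: "of_real (?w \<xi> * (norm (ft g \<xi>))\<^sup>2) = of_real (?w \<xi>) * (ft g \<xi> * cnj (ft g \<xi>))" for \<xi>
    by (simp only: of_real_mult complex_norm_square)
  show ?B
    unfolding integral_complex_of_real[symmetric] e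
    by (subst ft_bilinear) (use g w assms(2) in \<open>auto simp: ft_gauss intro: integrable_of_real simp del: of_real_exp of_real_mult of_real_power\<close>)
qed


text \<open>Schur's test: split \<open>|g x| |g y|\<close> into half the sum of the squares and use
  that the Gaussian kernel has mass \<open>(2 * pi) ^ DIM('a)\<close> in each variable, whatever
  \<epsilon> is. The estimate is made in the extended reals, so an infinite right-hand side is
  allowed.\<close>

lemma bessel_ft_aux:
  fixes g :: "'a::euclidean_space \<Rightarrow> complex"
  assumes g: "integrable lborel g" and \<epsilon>: "\<epsilon> > 0"
  shows "(\<integral>\<^sup>+\<xi>. ennreal (exp (- (\<epsilon> * (norm \<xi>)\<^sup>2 / 2)) * (norm (ft g \<xi>))\<^sup>2) \<partial>lborel)
    \<le> ennreal ((2 * pi) ^ DIM('a)) * (\<integral>\<^sup>+x. ennreal ((norm (g x))\<^sup>2) \<partial>lborel)"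
proof -
  let ?L = "lborel :: 'a measure"
  define k where "k x y = sqrt (2 * pi / \<epsilon>) ^ DIM('a) * exp (- ((norm (x - y))\<^sup>2 / (2 * \<epsilon>)))" for x y :: 'a
  define a where "a x = (norm (g x))\<^sup>2 / 2" for x
  have [measurable]: "g \<in> borel_measurable borel" using borel_measurable_integrable[OF g] by simp
  have [measurable]: "a \<in> borel_measurable borel" unfolding a_def by measurable
  have [measurable]: "(\<lambda>p. k (fst p) (snd p)) \<in> borel_measurable (?L \<Otimes>\<^sub>M ?L)"
    unfolding k_def by measurable
  have [measurable]: "(\<lambda>y. k x y) \<in> borel_measurable borel" "(\<lambda>x. k x y) \<in> borel_measurable borel" for x y
    unfolding k_def by measurable
  have a0: "a x \<ge> 0" for x unfolding a_def by simp
  have k0: "k x y \<ge> 0" for x y unfolding k_def using \<epsilon> by simp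
  have k1: "(\<integral>\<^sup>+x. ennreal (k x y) \<partial>?L) = ennreal ((2 * pi) ^ DIM('a))" for y
    unfolding k_def by (rule nn_integral_gauss_kernel[OF \<epsilon>])
  have k2: "(\<integral>\<^sup>+y. ennreal (k x y) \<partial>?L) = ennreal ((2 * pi) ^ DIM('a))" for x
    using k1[of x] unfolding k_def by (simp add: norm_minus_commute)
  define I where "I = (LINT \<xi>|?L. exp (- (\<epsilon> * (norm \<xi>)\<^sup>2 / 2)) * (norm (ft g \<xi>))\<^sup>2)"
  let ?F = "\<lambda>p. g (fst p) * cnj (g (snd p)) * of_real (k (fst p) (snd p))"
  have I0: "I \<ge> 0" unfolding I_def by (intro Bochner_Integration.integral_nonneg) auto
  have "(\<integral>\<^sup>+\<xi>. ennreal (exp (- (\<epsilon> * (norm \<xi>)\<^sup>2 / 2)) * (norm (ft g \<xi>))\<^sup>2) \<partial>?L) = ennreal I"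
    unfolding I_def by (intro nn_integral_eq_integral gauss_mollified_ft g \<epsilon>) simp
  also have "I = norm (of_real I :: complex)" using I0 by simp
  also have "of_real I = (LINT p|(?L \<Otimes>\<^sub>M ?L). ?F p)"
    unfolding I_def k_def by (rule gauss_mollified_ft(2)[OF g \<epsilon>])
  also have "ennreal (norm (LINT p|(?L \<Otimes>\<^sub>M ?L). ?F p)) \<le> (\<integral>\<^sup>+p. ennreal (norm (?F p)) \<partial>(?L \<Otimes>\<^sub>M ?L))"
    by (cases "integrable (?L \<Otimes>\<^sub>M ?L) ?F")
       (auto simp: not_integrable_integral_eq intro: integral_norm_bound_ennreal)
  also have "\<dots> \<le> (\<integral>\<^sup>+p. ennreal (a (fst p)) * ennreal (k (fst p) (snd p)) +
                     ennreal (a (snd p)) * ennreal (k (fst p) (snd p)) \<partial>(?L \<Otimes>\<^sub>M ?L))"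
  proof (rule nn_integral_mono)
    fix p
    have "norm (g (fst p)) * norm (g (snd p)) \<le> a (fst p) + a (snd p)"
      unfolding a_def using sum_squares_bound[of "norm (g (fst p))" "norm (g (snd p))"] by simp
    then have "norm (?F p) \<le> a (fst p) * k (fst p) (snd p) + a (snd p) * k (fst p) (snd p)"
      using mult_right_mono[OF _ k0[of "fst p" "snd p"]] k0[of "fst p" "snd p"]
      by (simp add: norm_mult distrib_right[symmetric])
    then have "ennreal (norm (?F p)) \<le> ennreal (a (fst p) * k (fst p) (snd p) + a (snd p) * k (fst p) (snd p))"
      by (rule ennreal_leI)
    also have "\<dots> = ennreal (a (fst p)) * ennreal (k (fst p) (snd p)) +
                     ennreal (a (snd p)) * ennreal (k (fst p) (snd p))"
      by (simp add: ennreal_plus ennreal_mult a0 k0)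
    finally show "ennreal (norm (?F p)) \<le> ennreal (a (fst p)) * ennreal (k (fst p) (snd p)) +
                     ennreal (a (snd p)) * ennreal (k (fst p) (snd p))" .
  qed
  also have "\<dots> = (\<integral>\<^sup>+p. ennreal (a (fst p)) * ennreal (k (fst p) (snd p)) \<partial>(?L \<Otimes>\<^sub>M ?L)) +
      (\<integral>\<^sup>+p. ennreal (a (snd p)) * ennreal (k (fst p) (snd p)) \<partial>(?L \<Otimes>\<^sub>M ?L))"
    by (intro nn_integral_add) auto
  also have "(\<integral>\<^sup>+p. ennreal (a (fst p)) * ennreal (k (fst p) (snd p)) \<partial>(?L \<Otimes>\<^sub>M ?L)) =
      (\<integral>\<^sup>+x. \<integral>\<^sup>+y. ennreal (a x) * ennreal (k x y) \<partial>?L \<partial>?L)"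
    using lborel.nn_integral_fst[of "\<lambda>p. ennreal (a (fst p)) * ennreal (k (fst p) (snd p))" ?L] by simp
  also have "\<dots> = (\<integral>\<^sup>+x. ennreal (a x) * ennreal ((2 * pi) ^ DIM('a)) \<partial>?L)"
    by (subst nn_integral_cmult) (auto simp: k2)
  also have "(\<integral>\<^sup>+p. ennreal (a (snd p)) * ennreal (k (fst p) (snd p)) \<partial>(?L \<Otimes>\<^sub>M ?L)) =
      (\<integral>\<^sup>+y. \<integral>\<^sup>+x. ennreal (a y) * ennreal (k x y) \<partial>?L \<partial>?L)"
    using lborel_pair.nn_integral_snd[of "\<lambda>p. ennreal (a (snd p)) * ennreal (k (fst p) (snd p))"] by simp
  also have "\<dots> = (\<integral>\<^sup>+x. ennreal (a x) * ennreal ((2 * pi) ^ DIM('a)) \<partial>?L)"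
    by (subst nn_integral_cmult) (auto simp: k1)
  also have "(\<integral>\<^sup>+x. ennreal (a x) * ennreal ((2 * pi) ^ DIM('a)) \<partial>?L) +
      (\<integral>\<^sup>+x. ennreal (a x) * ennreal ((2 * pi) ^ DIM('a)) \<partial>?L) =
      (\<integral>\<^sup>+x. ennreal ((2 * pi) ^ DIM('a)) * ennreal ((norm (g x))\<^sup>2) \<partial>?L)"
    by (subst nn_integral_add[symmetric])
       (auto simp: a_def ennreal_mult[symmetric] ennreal_plus[symmetric] simp del: ennreal_plus intro!: nn_integral_cong)
  also have "\<dots> = ennreal ((2 * pi) ^ DIM('a)) * (\<integral>\<^sup>+x. ennreal ((norm (g x))\<^sup>2) \<partial>lborel)"
    by (rule nn_integral_cmult) auto
  finally show ?thesis .
qed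

text \<open>Let the Gaussian weight increase to 1. The passage is by Fatou's lemma, which yields one
  half of Plancherel's identity.\<close>

lemma bessel_ft:
  fixes g :: "'a::euclidean_space \<Rightarrow> complex"
  assumes g: "integrable lborel g"
  shows "(\<integral>\<^sup>+\<xi>. ennreal ((norm (ft g \<xi>))\<^sup>2) \<partial>lborel)
    \<le> ennreal ((2 * pi) ^ DIM('a)) * (\<integral>\<^sup>+x. ennreal ((norm (g x))\<^sup>2) \<partial>lborel)" (is "_ \<le> ?R")
proof -
  let ?f = "\<lambda>n \<xi>. ennreal (exp (- (inverse (real (Suc n)) * (norm \<xi>)\<^sup>2 / 2)) * (norm (ft g \<xi>))\<^sup>2)"
  have [measurable]: "ft g \<in> borel_measurable borel" by (rule measurable_ft[OF g])
  have lim: "(\<lambda>n. ?f n \<xi>) \<longlonglongrightarrow> ennreal ((norm (ft g \<xi>))\<^sup>2)" for \<xi>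
  proof -
    have "(\<lambda>n. exp (- (inverse (real (Suc n)) * (norm \<xi>)\<^sup>2 / 2)) * (norm (ft g \<xi>))\<^sup>2)
        \<longlonglongrightarrow> exp (- (0 * (norm \<xi>)\<^sup>2 / 2)) * (norm (ft g \<xi>))\<^sup>2"
      by (intro tendsto_intros LIMSEQ_inverse_real_of_nat) simp
    then show ?thesis by (intro tendsto_ennrealI) simp
  qed
  have "(\<integral>\<^sup>+\<xi>. ennreal ((norm (ft g \<xi>))\<^sup>2) \<partial>lborel) = (\<integral>\<^sup>+\<xi>. liminf (\<lambda>n. ?f n \<xi>) \<partial>lborel)"
    by (intro nn_integral_cong lim_imp_Liminf[symmetric] lim) simp
  also have "\<dots> \<le> liminf (\<lambda>n. \<integral>\<^sup>+\<xi>. ?f n \<xi> \<partial>lborel)"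
    by (rule nn_integral_liminf) measurable
  also have "\<dots> \<le> ?R"
    by (intro Liminf_le always_eventually allI bessel_ft_aux g) simp_all
  finally show ?thesis .
qed

section \<open>Gaussian approximate identity and the other half of Plancherel\<close>

lemma lborel_integral_affine:
  fixes f :: "'a::euclidean_space \<Rightarrow> complex"
  assumes [measurable]: "f \<in> borel_measurable borel" and "c > 0"
  shows "(LINT y|lborel. f y) = c ^ DIM('a) *\<^sub>R (LINT x|lborel. f (t + c *\<^sub>R x))"
proof -
  have "(LINT y|lborel. f y) = (LINT y|density (distr lborel borel (\<lambda>x. t + c *\<^sub>R x)) (\<lambda>_. \<bar>c\<bar>^DIM('a)). f y)"
    using assms(2) by (subst lborel_affine[of c t]) auto
  also have "\<dots> = (LINT y|distr lborel borel (\<lambda>x. t + c *\<^sub>R x). c ^ DIM('a) *\<^sub>R f y)"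
    using assms(2) by (subst integral_density) (auto simp: ennreal_power)
  also have "\<dots> = (LINT x|lborel. c ^ DIM('a) *\<^sub>R f (t + c *\<^sub>R x))"
    by (rule integral_distr) auto
  finally show ?thesis by simp
qed

text \<open>The substitution of \<open>x + sqrt (\<epsilon> n) *\<^sub>R y\<close> for
  \<open>y\<close> turns \<open>J n x\<close> into an average of \<open>g\<close> near
  \<open>x\<close> against one fixed Gaussian \<open>w\<close> of mass
  \<open>(2 * pi) ^ DIM('a)\<close>; continuity at \<open>x\<close> and the bound \<open>B\<close>
  give dominated convergence.\<close>

lemma gauss_mollify_tendsto:
  fixes g :: "'a::euclidean_space \<Rightarrow> complex"
  assumes cont: "continuous_on UNIV g" and bd: "\<And>x. norm (g x) \<le> B"
    and \<epsilon>: "\<And>n. \<epsilon> n > 0" "\<epsilon> \<longlonglongrightarrow> 0"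
  defines "J \<equiv> \<lambda>n x. LINT y|lborel. g y * of_real (sqrt (2 * pi / \<epsilon> n) ^ DIM('a) * exp (- ((norm (x - y))\<^sup>2 / (2 * \<epsilon> n))))"
  shows "(\<lambda>n. J n x) \<longlonglongrightarrow> of_real ((2 * pi) ^ DIM('a)) * g x" and "norm (J n x) \<le> B * (2 * pi) ^ DIM('a)"
proof -
  have [measurable]: "g \<in> borel_measurable borel" by (rule borel_measurable_continuous_onI[OF cont])
  define w :: "'a \<Rightarrow> real" where "w y = sqrt (2 * pi) ^ DIM('a) * exp (- (1 * (norm y)\<^sup>2 / 2))" for y
  define C :: real where "C = (2 * pi) ^ DIM('a)"
  have w: "integrable lborel w" unfolding w_def by (intro integrable_mult_right integrable_gauss) simp
  have [measurable]: "w \<in> borel_measurable borel" unfolding w_def by measurable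
  have w0: "w y \<ge> 0" for y unfolding w_def by simp
  have wi: "(LINT y|lborel. w y) = C"
  proof -
    have "(LINT y|lborel. w y) = sqrt (2 * pi) ^ DIM('a) * sqrt (2 * pi / 1) ^ DIM('a)"
      unfolding w_def integral_mult_right_zero by (subst integral_gauss) simp_all
    then show ?thesis unfolding C_def by (simp only: power_mult_distrib[symmetric]) simp
  qed
  have J: "J n x = (LINT y|lborel. g (x + sqrt (\<epsilon> n) *\<^sub>R y) * of_real (w y))" for n
  proof -
    have p: "sqrt (\<epsilon> n) ^ DIM('a) * sqrt (2 * pi / \<epsilon> n) ^ DIM('a) = sqrt (2 * pi) ^ DIM('a)"
      unfolding power_mult_distrib[symmetric] real_sqrt_mult[symmetric] using \<epsilon>(1)[of n] by simp
    have "J n x = sqrt (\<epsilon> n) ^ DIM('a) *\<^sub>R (LINT y|lborel. g (x + sqrt (\<epsilon> n) *\<^sub>R y) *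
        of_real (sqrt (2 * pi / \<epsilon> n) ^ DIM('a) * exp (- ((norm (x - (x + sqrt (\<epsilon> n) *\<^sub>R y)))\<^sup>2 / (2 * \<epsilon> n)))))"
      unfolding J_def using \<epsilon>(1)[of n]
      by (intro lborel_integral_affine[of "\<lambda>y. g y * of_real (sqrt (2 * pi / \<epsilon> n) ^ DIM('a) *
            exp (- ((norm (x - y))\<^sup>2 / (2 * \<epsilon> n))))"]) auto
    also have "\<dots> = (LINT y|lborel. g (x + sqrt (\<epsilon> n) *\<^sub>R y) * of_real (w y))"
      unfolding p[symmetric] w_def using \<epsilon>(1)[of n]
      by (subst integral_scaleR_right[symmetric]) (simp add: scaleR_conv_of_real power_mult_distrib mult_ac)
    finally show ?thesis .
  qed
  have integrable_g: "integrable lborel (\<lambda>y. g (x + sqrt (\<epsilon> n) *\<^sub>R y) * of_real (w y))" for n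
  proof (rule Bochner_Integration.integrable_bound[OF integrable_mult_right[OF w, of B]])
    show "AE y in lborel. norm (g (x + sqrt (\<epsilon> n) *\<^sub>R y) * of_real (w y)) \<le> norm (B * w y)"
    proof (rule AE_I2)
      fix y
      have "norm (g (x + sqrt (\<epsilon> n) *\<^sub>R y)) * w y \<le> B * w y" by (rule mult_right_mono[OF bd w0])
      then show "norm (g (x + sqrt (\<epsilon> n) *\<^sub>R y) * of_real (w y)) \<le> norm (B * w y)"
        using w0[of y] by (simp add: norm_mult)
    qed
  qed simp
  have "(\<lambda>n. LINT y|lborel. g (x + sqrt (\<epsilon> n) *\<^sub>R y) * of_real (w y))
      \<longlonglongrightarrow> (LINT y|lborel. g x * of_real (w y))"
  proof (rule integral_dominated_convergence[where w = "\<lambda>y. B * w y"])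
    show "AE y in lborel. (\<lambda>n. g (x + sqrt (\<epsilon> n) *\<^sub>R y) * of_real (w y)) \<longlonglongrightarrow> g x * of_real (w y)"
    proof (intro AE_I2 tendsto_mult tendsto_const)
      fix y
      have "(\<lambda>n. x + sqrt (\<epsilon> n) *\<^sub>R y) \<longlonglongrightarrow> x + sqrt 0 *\<^sub>R y"
        by (intro tendsto_intros \<epsilon>(2))
      then have "(\<lambda>n. x + sqrt (\<epsilon> n) *\<^sub>R y) \<longlonglongrightarrow> x" by simp
      moreover have "isCont g x" using cont by (simp add: continuous_on_eq_continuous_at)
      ultimately show "(\<lambda>n. g (x + sqrt (\<epsilon> n) *\<^sub>R y)) \<longlonglongrightarrow> g x"
        by (rule isCont_tendsto_compose[rotated])
    qed
    show "AE y in lborel. norm (g (x + sqrt (\<epsilon> n) *\<^sub>R y) * of_real (w y)) \<le> B * w y" for n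
      by (intro AE_I2) (auto simp: norm_mult w0 intro!: mult_right_mono bd)
  qed (use w in auto)
  moreover have "(LINT y|lborel. g x * of_real (w y)) = of_real C * g x"
    unfolding integral_mult_right_zero integral_complex_of_real wi by (rule mult.commute)
  ultimately show "(\<lambda>n. J n x) \<longlonglongrightarrow> of_real ((2 * pi) ^ DIM('a)) * g x"
    unfolding J C_def[symmetric] by (simp add: wi mult.commute)
  have b: "norm (g (x + sqrt (\<epsilon> n) *\<^sub>R y) * of_real (w y)) \<le> B * w y" for y
    unfolding norm_mult norm_of_real abs_of_nonneg[OF w0] by (rule mult_right_mono[OF bd w0])
  have "norm (J n x) \<le> (LINT y|lborel. B * w y)"
    unfolding J
    by (rule Bochner_Integration.integral_norm_bound_integral) (use w b in \<open>auto intro!: integrable_g\<close>)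
  then show "norm (J n x) \<le> B * (2 * pi) ^ DIM('a)" unfolding C_def[symmetric] by (simp add: wi)
qed

lemma measurable_gauss_kernel:
  "(\<lambda>p. sqrt (2 * pi / c) ^ DIM('a) * exp (- ((norm (fst p - snd p :: 'a::euclidean_space))\<^sup>2 / (2 * c))))
     \<in> borel_measurable (lborel \<Otimes>\<^sub>M lborel)"
  by measurable

text \<open>By Fubini the mollified energy \<open>I n\<close> is the pairing of \<open>g\<close>
  with the mollified \<open>cnj g\<close>, hence tends to \<open>(2 * pi) ^ DIM('a)\<close> times
  the squared norm of \<open>g\<close>. On the Fourier side each \<open>I n\<close> is at most the
  full energy, because the weight is at most 1. Together with \<open>bessel_ft\<close> this is
  Plancherel's identity for the functions that occur in the Sobolev norm.\<close>

lemma plancherel_lower: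
  fixes g :: "'a::euclidean_space \<Rightarrow> complex"
  assumes g: "integrable lborel g" and cont: "continuous_on UNIV g" and bd: "\<And>x. norm (g x) \<le> B"
  shows "ennreal ((2 * pi) ^ DIM('a)) * (\<integral>\<^sup>+x. ennreal ((norm (g x))\<^sup>2) \<partial>lborel)
     \<le> (\<integral>\<^sup>+\<xi>. ennreal ((norm (ft g \<xi>))\<^sup>2) \<partial>lborel)" (is "_ \<le> ?R")
proof -
  let ?L = "lborel :: 'a measure"
  define C where "C = (2 * pi) ^ DIM('a)"
  have C0: "C \<ge> 0" unfolding C_def by simp
  define \<epsilon> where "\<epsilon> n = inverse (real (Suc n))" for n
  have \<epsilon>: "\<epsilon> n > 0" "\<epsilon> \<longlonglongrightarrow> 0" for n
    unfolding \<epsilon>_def by (rule positive_imp_inverse_positive, simp, rule LIMSEQ_inverse_real_of_nat)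
  define k where "k n x y = sqrt (2 * pi / \<epsilon> n) ^ DIM('a) * exp (- ((norm (x - y))\<^sup>2 / (2 * \<epsilon> n)))" for n and x y :: 'a
  define J where "J n x = (LINT y|?L. cnj (g y) * of_real (k n x y))" for n x
  define I where "I n = (LINT \<xi>|?L. exp (- (\<epsilon> n * (norm \<xi>)\<^sup>2 / 2)) * (norm (ft g \<xi>))\<^sup>2)" for n
  have [measurable]: "g \<in> borel_measurable borel" using borel_measurable_integrable[OF g] by simp
  have [measurable]: "ft g \<in> borel_measurable borel" by (rule measurable_ft[OF g])
  have cont': "continuous_on UNIV (\<lambda>x. cnj (g x))" by (intro continuous_intros cont)
  have bd': "norm (cnj (g x)) \<le> B" for x using bd by simp
  have B0: "B \<ge> 0" using bd[of 0] norm_ge_zero order_trans by blast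
  have Jlim: "(\<lambda>n. J n x) \<longlonglongrightarrow> of_real C * cnj (g x)" for x
    unfolding J_def k_def C_def by (rule gauss_mollify_tendsto(1)[OF cont' bd' \<epsilon>])
  have Jbd: "norm (J n x) \<le> B * C" for n x
    unfolding J_def k_def C_def by (rule gauss_mollify_tendsto(2)[OF cont' bd' \<epsilon>])
  have Im: "(\<lambda>x. J n x) \<in> borel_measurable borel" for n
    using measurable_gauss_kernel[of "\<epsilon> n"] unfolding J_def k_def by measurable
  have IJ: "of_real (I n) = (LINT x|?L. g x * J n x)" for n
  proof -
    have i: "integrable (?L \<Otimes>\<^sub>M ?L) (\<lambda>p. g (fst p) * cnj (g (snd p)) * of_real (k n (fst p) (snd p)))"
    proof (rule Bochner_Integration.integrable_bound)
      show "integrable (?L \<Otimes>\<^sub>M ?L) (\<lambda>p. of_real (sqrt (2 * pi / \<epsilon> n) ^ DIM('a)) * (g (fst p) * cnj (g (snd p))))"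
        by (intro integrable_mult_right integrable_lborel_pair_mult integrable_cnj g)
      show "AE p in ?L \<Otimes>\<^sub>M ?L. norm (g (fst p) * cnj (g (snd p)) * of_real (k n (fst p) (snd p)))
          \<le> norm (of_real (sqrt (2 * pi / \<epsilon> n) ^ DIM('a)) * (g (fst p) * cnj (g (snd p))))"
      proof (intro AE_I2)
        fix p
        have "norm (of_real (k n (fst p) (snd p)) :: complex) \<le>
            norm (of_real (sqrt (2 * pi / \<epsilon> n) ^ DIM('a)) :: complex)"
          using \<epsilon>(1)[of n] unfolding k_def norm_of_real
          by (simp add: abs_mult mult_left_le)
        from mult_left_mono[OF this norm_ge_zero[of "g (fst p) * cnj (g (snd p))"]]
        show "norm (g (fst p) * cnj (g (snd p)) * of_real (k n (fst p) (snd p)))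
          \<le> norm (of_real (sqrt (2 * pi / \<epsilon> n) ^ DIM('a)) * (g (fst p) * cnj (g (snd p))))"
          by (metis mult.commute norm_mult)
      qed
      show "(\<lambda>p. g (fst p) * cnj (g (snd p)) * of_real (k n (fst p) (snd p))) \<in> borel_measurable (?L \<Otimes>\<^sub>M ?L)"
        using measurable_gauss_kernel[of "\<epsilon> n"] unfolding k_def by measurable
    qed
    have "of_real (I n) = (LINT p|(?L \<Otimes>\<^sub>M ?L). g (fst p) * cnj (g (snd p)) * of_real (k n (fst p) (snd p)))"
      using gauss_mollified_ft(2)[OF g \<epsilon>(1)[of n]] unfolding I_def k_def .
    also have "\<dots> = (LINT x|?L. LINT y|?L. g x * (cnj (g y) * of_real (k n x y)))"
      using lborel_pair.integral_fst'[OF i] by (simp only: fst_conv snd_conv mult.assoc)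
    finally show ?thesis unfolding J_def by (simp only: integral_mult_right_zero)
  qed
  have sq: "integrable ?L (\<lambda>x. (norm (g x))\<^sup>2)"
  proof (rule Bochner_Integration.integrable_bound[OF integrable_mult_right[OF integrable_norm[OF g], of B]])
    show "AE x in ?L. norm ((norm (g x))\<^sup>2) \<le> norm (B * norm (g x))"
      using bd B0 by (intro AE_I2) (simp add: power2_eq_square mult_right_mono)
  qed simp
  have lim1: "(\<lambda>n. LINT x|?L. g x * J n x) \<longlonglongrightarrow> (LINT x|?L. g x * (of_real C * cnj (g x)))"
  proof (rule integral_dominated_convergence[where w = "\<lambda>x. norm (g x) * (B * C)"])
    show "AE x in ?L. norm (g x * J n x) \<le> norm (g x) * (B * C)" for n
      unfolding norm_mult using Jbd by (intro AE_I2 mult_left_mono) auto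
    show "AE x in ?L. (\<lambda>n. g x * J n x) \<longlonglongrightarrow> g x * (of_real C * cnj (g x))"
      by (intro AE_I2 tendsto_intros Jlim)
    show "(\<lambda>x. g x * J n x) \<in> borel_measurable ?L" for n
      using borel_measurable_times[OF _ Im[of n], of g] by simp
    show "integrable ?L (\<lambda>x. norm (g x) * (B * C))"
      by (intro integrable_mult_left integrable_norm g)
  qed simp
  have sq_eq: "g x * (of_real C * cnj (g x)) = of_real (C * (norm (g x))\<^sup>2)" for x
    unfolding of_real_mult complex_norm_square by (simp add: mult_ac)
  have e1: "(LINT x|?L. g x * (of_real C * cnj (g x))) = of_real (C * (LINT x|?L. (norm (g x))\<^sup>2))"
    unfolding sq_eq by (subst integral_complex_of_real) simp
  have e2: "Re (LINT x|?L. g x * J n x) = I n" for n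
    by (subst IJ[symmetric]) (rule Re_complex_of_real)
  have e3: "Re (LINT x|?L. g x * (of_real C * cnj (g x))) = C * (LINT x|?L. (norm (g x))\<^sup>2)"
    by (subst e1) (rule Re_complex_of_real)
  have "I \<longlonglongrightarrow> C * (LINT x|?L. (norm (g x))\<^sup>2)"
    using tendsto_Re[OF lim1] unfolding e2 e3 .
  then have lim: "(\<lambda>n. ennreal (I n)) \<longlonglongrightarrow> ennreal (C * (LINT x|?L. (norm (g x))\<^sup>2))"
    by (rule tendsto_ennrealI)
  have le: "ennreal (I n) \<le> ?R" for n
  proof -
    have p: "exp (- (\<epsilon> n * (norm \<xi>)\<^sup>2 / 2)) * (norm (ft g \<xi>))\<^sup>2 \<le> (norm (ft g \<xi>))\<^sup>2" for \<xi>
    proof (rule mult_left_le_one_le)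
      have "\<epsilon> n * (norm \<xi>)\<^sup>2 \<ge> 0" by (intro mult_nonneg_nonneg less_imp_le[OF \<epsilon>(1)] zero_le_power2)
      then show "exp (- (\<epsilon> n * (norm \<xi>)\<^sup>2 / 2)) \<le> 1" by simp
    qed (rule zero_le_power2, rule exp_ge_zero)
    have "(\<integral>\<^sup>+\<xi>. ennreal (exp (- (\<epsilon> n * (norm \<xi>)\<^sup>2 / 2)) * (norm (ft g \<xi>))\<^sup>2) \<partial>?L) = ennreal (I n)"
      unfolding I_def by (intro nn_integral_eq_integral gauss_mollified_ft g \<epsilon>(1)) simp
    then have "ennreal (I n) = (\<integral>\<^sup>+\<xi>. ennreal (exp (- (\<epsilon> n * (norm \<xi>)\<^sup>2 / 2)) * (norm (ft g \<xi>))\<^sup>2) \<partial>?L)"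
      by (rule sym)
    also have "\<dots> \<le> ?R"
      by (rule nn_integral_mono, rule ennreal_leI, rule p)
    finally show ?thesis .
  qed
  have "ennreal ((2 * pi) ^ DIM('a)) * (\<integral>\<^sup>+x. ennreal ((norm (g x))\<^sup>2) \<partial>?L) = ennreal (C * (LINT x|?L. (norm (g x))\<^sup>2))"
    unfolding C_def[symmetric] using sq by (subst nn_integral_eq_integral) (auto simp: ennreal_mult C0)
  also have "\<dots> \<le> ?R"
    by (rule tendsto_upperbound[OF lim always_eventually]) (use le in auto)
  finally show ?thesis .
qed

section \<open>The Poisson kernel at complex times\<close>

text \<open>Keep a single term of the exponential series at
  \<open>\<delta> * (1 + r)\<close>.\<close>

lemma exp_neg_le_power:
  fixes \<delta> r :: real
  assumes "\<delta> > 0" "r \<ge> 0"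
  shows "(1 + r) ^ m * exp (- (\<delta> * r)) \<le> exp \<delta> * fact m / \<delta> ^ m"
proof -
  have "(\<delta> * (1 + r)) ^ m / fact m \<le> (\<Sum>n\<le>m. (\<delta> * (1 + r)) ^ n / fact n)"
    using assms by (intro member_le_sum) auto
  also have "\<dots> \<le> exp (\<delta> * (1 + r))"
    using sum_le_suminf[OF summable_exp_generic[of "\<delta> * (1 + r)"], of "{..m}"] assms
    by (simp add: exp_def divide_inverse mult_ac)
  finally have "(\<delta> * (1 + r)) ^ m \<le> fact m * exp (\<delta> * (1 + r))"
    by (simp add: field_simps)
  moreover have "exp (\<delta> * (1 + r)) = exp \<delta> * exp (\<delta> * r)"
    by (simp add: exp_add[symmetric] distrib_left)
  ultimately have "\<delta> ^ m * (1 + r) ^ m \<le> fact m * (exp \<delta> * exp (\<delta> * r))"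
    unfolding power_mult_distrib by simp
  then have "\<delta> ^ m * ((1 + r) ^ m * exp (- (\<delta> * r))) \<le> fact m * exp \<delta>"
    by (simp add: exp_minus field_simps)
  then show ?thesis using assms by (simp add: field_simps)
qed

lemma integrable_exp_norm:
  assumes "\<delta> > 0"
  shows "integrable lborel (\<lambda>x::'a::euclidean_space. norm x ^ k * exp (- (\<delta> * norm x)))"
proof (rule integrable_of_decay)
  fix x :: 'a
  let ?r = "norm x" and ?m = "k + 2 * DIM('a)"
  have "?r ^ k * (1 + ?r\<^sup>2) ^ DIM('a) \<le> (1 + ?r) ^ k * ((1 + ?r)\<^sup>2) ^ DIM('a)"
    by (intro mult_mono power_mono) (auto simp: power2_eq_square algebra_simps)
  also have "\<dots> = (1 + ?r) ^ ?m" by (simp add: power_add power_mult)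
  finally have "norm (?r ^ k * exp (- (\<delta> * ?r))) * (1 + ?r\<^sup>2) ^ DIM('a) \<le> (1 + ?r) ^ ?m * exp (- (\<delta> * ?r))"
    by (simp add: abs_mult mult_ac)
  also have "\<dots> \<le> exp \<delta> * fact ?m / \<delta> ^ ?m" by (rule exp_neg_le_power) (use assms in auto)
  finally show "norm (?r ^ k * exp (- (\<delta> * ?r))) * (1 + ?r\<^sup>2) ^ DIM('a) \<le> exp \<delta> * fact ?m / \<delta> ^ ?m" .
qed measurable

section \<open>Gaussian subordination of the exponential\<close>

lemma gauss_real_1: "integrable lborel (\<lambda>w::real. exp (- w\<^sup>2))" "(LINT w::real|lborel. exp (- w\<^sup>2)) = sqrt pi"
  using integrable_gauss[of 2, where 'a = real] integral_gauss[of 2, where 'a = real] by simp_all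

lemma integral_odd_eq_0:
  fixes h :: "real \<Rightarrow> real"
  assumes "\<And>w. h (- w) = - h w"
  shows "(LINT w|lborel. h w) = 0"
  using lborel_integral_real_affine[of "-1" h 0] assms by simp

text \<open>Glasser's substitution \<open>w = v - a / (2 v)\<close> turns the integrand into a Gaussian.\<close>

lemma subordination_pos:
  fixes a :: real
  assumes a: "a > 0"
  defines "f \<equiv> \<lambda>v. exp (- v\<^sup>2 - a\<^sup>2 / (4 * v\<^sup>2))"
  shows "integrable lborel (\<lambda>v. indicator {0<..} v * f v)"
    and "(LINT v|lborel. indicator {0<..} v * f v) = sqrt pi / 2 * exp (- a)"
proof -
  \<comment> \<open>\<open>g w\<close> below is the positive root \<open>v\<close> of
    \<open>v - a / (2 * v) = w\<close>, that is, the inverse of the substitution, and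
    \<open>g'\<close> is its derivative.\<close>
  define q where "q w = sqrt (w\<^sup>2 + 2 * a)" for w :: real
  define g where "g w = (w + q w) / 2" for w :: real
  define g' where "g' w = (1 + w / q w) / 2" for w :: real
  have q2: "(q w)\<^sup>2 = w\<^sup>2 + 2 * a" for w unfolding q_def using a by simp
  have qpos: "q w > 0" for w unfolding q_def using a by (simp add: add_nonneg_pos)
  have qgt: "\<bar>w\<bar> < q w" for w
    unfolding q_def by (rule real_less_rsqrt) (use a in simp)
  have gpos: "g w > 0" for w unfolding g_def using qgt[of w] by simp
  have g'pos: "g' w > 0" for w
  proof -
    have "\<bar>w / q w\<bar> < 1" using qgt[of w] qpos[of w] by (simp add: abs_divide)
    then have "- 1 < w / q w" by linarith
    then show ?thesis unfolding g'_def by simp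
  qed
  have der: "(g has_field_derivative g' w) (at w within UNIV)" for w
  proof -
    have "(q has_field_derivative inverse (sqrt (w\<^sup>2 + 2 * a)) / 2 * (2 * w)) (at w)"
      unfolding q_def
    proof (rule DERIV_chain2[where f = sqrt])
      show "(sqrt has_field_derivative inverse (sqrt (w\<^sup>2 + 2 * a)) / 2) (at (w\<^sup>2 + 2 * a))"
        by (rule DERIV_real_sqrt) (use a in \<open>simp add: add_nonneg_pos\<close>)
      show "((\<lambda>x. x\<^sup>2 + 2 * a) has_field_derivative 2 * w) (at w)"
        by (auto intro!: derivative_eq_intros)
    qed
    then have "((\<lambda>w. (w + q w) / 2) has_field_derivative (1 + inverse (sqrt (w\<^sup>2 + 2 * a)) / 2 * (2 * w)) / 2) (at w)"
      by (intro DERIV_cdivide DERIV_add DERIV_ident)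
    moreover have "inverse (q w) / 2 * (2 * w) = w / q w"
      using qpos[of w] by (simp add: field_simps)
    ultimately show ?thesis unfolding g_def g'_def q_def by (simp only:)
  qed
  have gw: "g w - a / (2 * g w) = w" for w
  proof -
    have q: "q w = 2 * g w - w" unfolding g_def by (simp add: field_simps)
    have "(2 * g w - w) * (2 * g w - w) = w * w + 2 * a"
      using q2[of w] unfolding q power2_eq_square .
    then have "a = (g w - w) * (2 * g w)" by (simp add: algebra_simps)
    then have "a / (2 * g w) = g w - w"
      using gpos[of w] by (metis less_irrefl mult_pos_pos nonzero_divide_eq_eq zero_less_numeral)
    then show ?thesis by simp
  qed
  have inj: "inj_on g UNIV"
    by (rule inj_on_inverseI[where g = "\<lambda>v. v - a / (2 * v)"]) (rule gw)
  have img: "g ` UNIV = {0<..}"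
  proof (intro equalityI subsetI)
    fix v :: real assume v: "v \<in> {0<..}"
    let ?w = "v - a / (2 * v)"
    have "?w\<^sup>2 + 2 * a = (v + a / (2 * v))\<^sup>2"
      using v by (simp add: power2_eq_square field_simps)
    then have "q ?w = v + a / (2 * v)" unfolding q_def using v a by simp
    then have "g ?w = v" unfolding g_def by simp
    then show "v \<in> g ` UNIV" by (metis UNIV_I image_eqI)
  qed (use gpos in auto)
  have fg: "f (g w) = exp (- a) * exp (- w\<^sup>2)" for w
  proof -
    have "(g w)\<^sup>2 + a\<^sup>2 / (4 * (g w)\<^sup>2) = (g w - a / (2 * g w))\<^sup>2 + a"
      using gpos[of w] by (simp add: power2_eq_square field_simps)
    also have "\<dots> = w\<^sup>2 + a" unfolding gw ..
    finally have "- (g w)\<^sup>2 - a\<^sup>2 / (4 * (g w)\<^sup>2) = - a + - w\<^sup>2" by simp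
    then show ?thesis unfolding f_def by (simp only: exp_add)
  qed
  \<comment> \<open>The odd part of \<open>g' w\<close> times the Gaussian. It integrates to zero,
    so only the constant part 1/2 of \<open>g'\<close> contributes.\<close>
  define h where "h w = exp (- w\<^sup>2) * (w / q w)" for w :: real
  have [measurable]: "q \<in> borel_measurable borel" unfolding q_def by measurable
  have hint: "integrable lborel h"
  proof (rule Bochner_Integration.integrable_bound[OF gauss_real_1(1)])
    show "AE w in lborel. norm (h w) \<le> norm (exp (- w\<^sup>2))"
    proof (rule AE_I2)
      fix w
      have "\<bar>w / q w\<bar> \<le> 1" using qgt[of w] qpos[of w] by simp
      from mult_left_mono[OF this exp_ge_zero[of "- w\<^sup>2"]]
      show "norm (h w) \<le> norm (exp (- w\<^sup>2))" unfolding h_def real_norm_def abs_mult by simp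
    qed
    show "h \<in> borel_measurable lborel" unfolding h_def by measurable
  qed
  have hodd: "(LINT w|lborel. h w) = 0"
    by (rule integral_odd_eq_0) (simp add: h_def q_def)
  have eq: "\<bar>g' w\<bar> * f (g w) = exp (- a) / 2 * (exp (- w\<^sup>2) + h w)" for w
    unfolding abs_of_pos[OF g'pos] fg h_def unfolding g'_def by (simp add: algebra_simps)
  have i1: "integrable lborel (\<lambda>w. exp (- a) / 2 * (exp (- w\<^sup>2) + h w))"
    by (intro integrable_mult_right Bochner_Integration.integrable_add hint gauss_real_1)
  have v1: "(LINT w|lborel. exp (- a) / 2 * (exp (- w\<^sup>2) + h w)) = sqrt pi / 2 * exp (- a)"
    unfolding integral_mult_right_zero
    by (subst Bochner_Integration.integral_add) (simp_all add: hint gauss_real_1 hodd)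
  have "(\<lambda>w. \<bar>g' w\<bar> * f (g w)) absolutely_integrable_on UNIV \<and>
      integral UNIV (\<lambda>w. \<bar>g' w\<bar> * f (g w)) = sqrt pi / 2 * exp (- a)"
  proof
    show "(\<lambda>w. \<bar>g' w\<bar> * f (g w)) absolutely_integrable_on UNIV"
      unfolding eq set_integrable_def using i1 by (simp add: integrable_completion)
    show "integral UNIV (\<lambda>w. \<bar>g' w\<bar> * f (g w)) = sqrt pi / 2 * exp (- a)"
      unfolding eq using has_integral_integral_lborel[OF i1, unfolded v1] by (rule integral_unique)
  qed
  then have *: "f absolutely_integrable_on {0<..}" "integral {0<..} f = sqrt pi / 2 * exp (- a)"
    using has_absolute_integral_change_of_variables_1'[OF _ der inj, of f "sqrt pi / 2 * exp (- a)"]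
    unfolding img by auto
  have m: "(\<lambda>v. indicator {0<..} v * f v) \<in> borel_measurable lborel"
    unfolding f_def by measurable
  show "integrable lborel (\<lambda>v. indicator {0<..} v * f v)"
    using *(1) m unfolding set_integrable_def by (simp add: integrable_completion)
  show "(LINT v|lborel. indicator {0<..} v * f v) = sqrt pi / 2 * exp (- a)"
    using set_lebesgue_integral_eq_integral(2)[OF *(1)] *(2) m
    unfolding set_lebesgue_integral_def by (simp add: integral_completion)
qed

lemma subordination:
  fixes a :: real
  assumes a: "a \<ge> 0"
  shows "integrable lborel (\<lambda>v. indicator {0<..} v * exp (- v\<^sup>2 - a\<^sup>2 / (4 * v\<^sup>2)))" (is ?A)
    and "(LINT v|lborel. indicator {0<..} v * exp (- v\<^sup>2 - a\<^sup>2 / (4 * v\<^sup>2))) = sqrt pi / 2 * exp (- a)" (is ?B)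
proof -
  have "?A \<and> ?B"
  proof (cases "a = 0")
    case True
    have ae: "AE v in lborel. indicator {0<..} v * exp (- v\<^sup>2) = indicator {0..} v *\<^sub>R exp (- v\<^sup>2 :: real)"
      using AE_lborel_singleton[of "0::real"] by eventually_elim (auto simp: indicator_def)
    have m: "(\<lambda>v::real. indicator {0<..} v * exp (- v\<^sup>2)) \<in> borel_measurable lborel"
      "(\<lambda>v::real. indicator {0..} v *\<^sub>R exp (- v\<^sup>2)) \<in> borel_measurable lborel" by measurable
    have "integrable lborel (\<lambda>v::real. indicator {0<..} v * exp (- v\<^sup>2))"
      using integrable_cong_AE[OF m ae] gaussian_moment_0 by (simp add: has_bochner_integral_iff)
    moreover have "(LINT v::real|lborel. indicator {0<..} v * exp (- v\<^sup>2)) = sqrt pi / 2"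
      using integral_cong_AE[OF m ae] gaussian_moment_0 by (simp add: has_bochner_integral_iff)
    ultimately show ?thesis using True by simp
  next
    case False
    then show ?thesis using subordination_pos[of a] a by simp
  qed
  then show ?A ?B by auto
qed

text \<open>The integral is half of a Gamma value, so this is the Poisson constant
  \<open>2 ^ d * pi powr ((d - 1) / 2) * Gamma ((d + 1) / 2)\<close>. It is left unevaluated: what
  matters later is its sign and its independence of the time and the point.\<close>

definition poisson_const :: "'a::euclidean_space itself \<Rightarrow> real" where
  "poisson_const _ = 2 / sqrt pi * (2 * sqrt pi) ^ DIM('a) *
     (LINT w|lborel. indicator {0<..} w * (w ^ DIM('a) * exp (- w\<^sup>2)))"

lemma poisson_const_nonneg: "poisson_const TYPE('a::euclidean_space) \<ge> 0"
proof -
  have "0 \<le> indicator {0<..} w * (w ^ DIM('a) * exp (- w\<^sup>2))" for w :: real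
    by (cases "w > 0") auto
  then show ?thesis
    unfolding poisson_const_def
    by (intro mult_nonneg_nonneg[OF _ Bochner_Integration.integral_nonneg]) auto
qed

text \<open>Subordination with \<open>a = z * norm \<xi>\<close> writes the exponential as a
  superposition of Gaussians in \<xi>. Each of them is transformed explicitly, and the remaining
  integral in \<open>v\<close> is a moment of a Gaussian.\<close>

lemma ft_exp_norm_real:
  fixes x :: "'a::euclidean_space"
  assumes z: "z > 0"
  shows "ft (\<lambda>\<xi>. of_real (exp (- (z * norm \<xi>)))) x =
    of_real (poisson_const TYPE('a) * z / sqrt (z\<^sup>2 + (norm x)\<^sup>2) ^ Suc DIM('a))"
proof -
  let ?L = "lborel :: 'a measure" and ?R = "lborel :: real measure"
  define s where "s \<xi> v = indicator {0<..} v * exp (- v\<^sup>2 - (z * norm \<xi>)\<^sup>2 / (4 * v\<^sup>2))" for \<xi> :: 'a and v :: real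
  have s0: "s \<xi> v \<ge> 0" for \<xi> v unfolding s_def by (simp add: indicator_def)
  have zn: "z * norm \<xi> \<ge> 0" for \<xi> :: 'a using z by simp
  have si: "integrable ?R (s \<xi>)" and sv: "(LINT v|lborel. s \<xi> v) = sqrt pi / 2 * exp (- (z * norm \<xi>))" for \<xi>
    using subordination[OF zn[of \<xi>]] unfolding s_def by auto
  have [measurable]: "(\<lambda>p. s (fst p) (snd p)) \<in> borel_measurable (?L \<Otimes>\<^sub>M ?R)"
    unfolding s_def by measurable
  have int: "integrable (?L \<Otimes>\<^sub>M ?R) (\<lambda>p. cis (x \<bullet> fst p) * of_real (s (fst p) (snd p)))"
  proof (rule lborel_pair.Fubini_integrable)
    show "integrable ?L (\<lambda>\<xi>. LINT v|lborel. norm (cis (x \<bullet> fst (\<xi>, v)) * of_real (s (fst (\<xi>, v)) (snd (\<xi>, v)))))"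
      using integrable_exp_norm[OF z, of 0, where 'a = 'a] by (simp add: norm_mult s0 sv)
    show "AE \<xi> in ?L. integrable ?R (\<lambda>v. cis (x \<bullet> fst (\<xi>, v)) * of_real (s (fst (\<xi>, v)) (snd (\<xi>, v))))"
      by (intro AE_I2) (simp add: si integrable_of_real)
  qed simp
  have inner: "(LINT \<xi>|?L. cis (x \<bullet> \<xi>) * of_real (s \<xi> v)) =
      of_real (indicator {0<..} v * ((2 * sqrt pi / z) ^ DIM('a) * (v ^ DIM('a) * exp (- (v\<^sup>2 * ((z\<^sup>2 + (norm x)\<^sup>2) / z\<^sup>2))))))" for v
  proof (cases "v > 0")
    case True
    define a where "a = z\<^sup>2 / (2 * v\<^sup>2)"
    have a: "a > 0" unfolding a_def using z True by simp
    have "s \<xi> v = exp (- v\<^sup>2) * exp (- (a * (norm \<xi>)\<^sup>2 / 2))" for \<xi>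
      unfolding s_def a_def exp_add[symmetric] using True by (simp add: power_mult_distrib field_simps)
    then have "(LINT \<xi>|?L. cis (x \<bullet> \<xi>) * of_real (s \<xi> v)) =
        of_real (exp (- v\<^sup>2)) * (LINT \<xi>|?L. cis (\<xi> \<bullet> x) * of_real (exp (- (a * (norm \<xi>)\<^sup>2 / 2))))"
      by (subst integral_mult_right_zero[symmetric]) (simp add: inner_commute mult_ac)
    also have "\<dots> = of_real (sqrt (2 * pi / a) ^ DIM('a) * (exp (- v\<^sup>2) * exp (- ((norm x)\<^sup>2 / (2 * a)))))"
      unfolding integral_cis_gauss[OF a] by simp
    also have "sqrt (2 * pi / a) = (2 * sqrt pi / z) * v"
    proof -
      have "2 * pi / a = (2 * sqrt pi / z * v)\<^sup>2"
        unfolding a_def using z True by (simp add: power_mult_distrib power_divide)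
      then show ?thesis using z True by simp
    qed
    also have "exp (- v\<^sup>2) * exp (- ((norm x)\<^sup>2 / (2 * a))) = exp (- (v\<^sup>2 * ((z\<^sup>2 + (norm x)\<^sup>2) / z\<^sup>2)))"
      unfolding a_def exp_add[symmetric] using z True by (simp add: field_simps)
    finally show ?thesis unfolding power_mult_distrib[of "2 * sqrt pi / z" v] using True
      by (simp add: mult_ac)
  qed (simp add: s_def)
  \<comment> \<open>Rescaling by \<open>\<beta>\<close> turns the integral in \<open>v\<close> into
    the one inside \<open>poisson_const\<close>. The factor \<open>v ^ DIM('a)\<close> together with
    the Jacobian gives the power \<open>Suc DIM('a)\<close> in the kernel.\<close>
  define \<beta> where "\<beta> = sqrt (z\<^sup>2 + (norm x)\<^sup>2) / z"
  have zx: "z\<^sup>2 + (norm x)\<^sup>2 > 0" using z by (simp add: add_pos_nonneg)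
  have \<beta>: "\<beta> > 0" unfolding \<beta>_def using z zx by simp
  have \<beta>2: "(z\<^sup>2 + (norm x)\<^sup>2) / z\<^sup>2 = \<beta>\<^sup>2" unfolding \<beta>_def using zx by (simp add: power_divide)
  have scale: "(LINT v|lborel. indicator {0<..} v * (v ^ DIM('a) * exp (- (v\<^sup>2 * \<beta>\<^sup>2)))) =
      (LINT w|lborel. indicator {0<..} w * (w ^ DIM('a) * exp (- w\<^sup>2))) / \<beta> ^ Suc DIM('a)"
  proof -
    let ?h = "\<lambda>w::real. indicator {0<..} w * (w ^ DIM('a) * exp (- w\<^sup>2))"
    have "?h (0 + \<beta> * v) = \<beta> ^ DIM('a) * (indicator {0<..} v * (v ^ DIM('a) * exp (- (v\<^sup>2 * \<beta>\<^sup>2))))" for v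
      using \<beta> by (simp add: indicator_def power_mult_distrib zero_less_mult_iff mult_ac)
    then have "(LINT w|lborel. ?h w) = \<beta> * (\<beta> ^ DIM('a) * (LINT v|lborel. indicator {0<..} v * (v ^ DIM('a) * exp (- (v\<^sup>2 * \<beta>\<^sup>2)))))"
      using lborel_integral_real_affine[of \<beta> ?h 0] \<beta> by simp
    then show ?thesis using \<beta> by (simp add: field_simps)
  qed
  have "of_real (sqrt pi / 2) * ft (\<lambda>\<xi>. of_real (exp (- (z * norm \<xi>)))) x =
      (LINT \<xi>|?L. LINT v|?R. cis (x \<bullet> \<xi>) * of_real (s \<xi> v))"
    unfolding ft_def by (subst integral_mult_right_zero[symmetric])
      (simp only: integral_mult_right_zero integral_complex_of_real sv, simp add: mult_ac)
  also have "\<dots> = (LINT v|?R. LINT \<xi>|?L. cis (x \<bullet> \<xi>) * of_real (s \<xi> v))"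
    by (rule lborel_pair.Fubini_integral[symmetric]) (use int in \<open>simp add: case_prod_beta'\<close>)
  also have "\<dots> = of_real (LINT v|?R. (2 * sqrt pi / z) ^ DIM('a) * (indicator {0<..} v * (v ^ DIM('a) * exp (- (v\<^sup>2 * \<beta>\<^sup>2)))))"
    unfolding inner \<beta>2 integral_complex_of_real by (simp add: mult_ac)
  also have "\<dots> = of_real ((2 * sqrt pi / z) ^ DIM('a) *
      ((LINT w|lborel. indicator {0<..} w * (w ^ DIM('a) * exp (- w\<^sup>2))) / \<beta> ^ Suc DIM('a)))"
    unfolding integral_mult_right_zero scale ..
  also have "\<dots> = of_real (sqrt pi / 2) * of_real (poisson_const TYPE('a) * z / sqrt (z\<^sup>2 + (norm x)\<^sup>2) ^ Suc DIM('a))"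
    unfolding of_real_mult[symmetric] of_real_eq_iff poisson_const_def \<beta>_def using z
    by (simp add: field_simps power_divide)
  finally show ?thesis by (rule mult_left_cancel[THEN iffD1, rotated]) simp
qed

section \<open>Continuation of the kernel to complex times\<close>

text \<open>The mean value inequality on a half-plane; it bounds all difference quotients in
  \<open>z\<close> by one integrable function of \<open>r = norm \<xi>\<close>.\<close>

lemma exp_complex_diff_bound:
  fixes w z :: complex
  assumes "Re w \<ge> \<delta>" "Re z \<ge> \<delta>" "r \<ge> 0"
  shows "norm (exp (- (w * of_real r)) - exp (- (z * of_real r))) \<le> r * exp (- (\<delta> * r)) * norm (w - z)"
proof (rule field_differentiable_bound[where S = "{w. Re w \<ge> \<delta>}" and f' = "\<lambda>w. - of_real r * exp (- (w * of_real r))"])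
  show "convex {w. Re w \<ge> \<delta>}" by (rule convex_halfspace_Re_ge)
  show "((\<lambda>w. exp (- (w * of_real r))) has_field_derivative - of_real r * exp (- (w * of_real r))) (at w within {w. Re w \<ge> \<delta>})" for w
    by (rule derivative_eq_intros refl | simp)+
  show "norm (- of_real r * exp (- (w * of_real r))) \<le> r * exp (- (\<delta> * r))" if "w \<in> {w. Re w \<ge> \<delta>}" for w
    using that assms(3) by (auto simp: norm_mult intro!: mult_left_mono mult_right_mono)
qed (use assms in auto)

lemma integrable_exp_norm_complex:
  assumes "Re z > 0"
  shows "integrable lborel (\<lambda>\<xi>::'a::euclidean_space. exp (- (z * of_real (norm \<xi>))))"
proof (rule Bochner_Integration.integrable_bound[OF integrable_exp_norm[OF assms, of 0]])
  show "AE \<xi>::'a in lborel. norm (exp (- (z * of_real (norm \<xi>)))) \<le> norm (norm \<xi> ^ 0 * exp (- (Re z * norm \<xi>)))"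
    by (intro AE_I2) simp
qed measurable

lemma holomorphic_ft_exp_norm:
  fixes x :: "'a::euclidean_space"
  shows "(\<lambda>z. ft (\<lambda>\<xi>. exp (- (z * of_real (norm \<xi>)))) x) holomorphic_on {z. Re z > 0}"
proof (rule holomorphic_onI)
  let ?f = "\<lambda>z \<xi>. cis (x \<bullet> \<xi>) * exp (- (z * of_real (norm \<xi>)))"
  let ?F = "\<lambda>z. ft (\<lambda>\<xi>. exp (- (z * of_real (norm \<xi>)))) x"
  fix z :: complex assume "z \<in> {z. Re z > 0}"
  then have z: "Re z > 0" by simp
  \<comment> \<open>Half the distance to the imaginary axis: points within \<delta> of
    \<open>z\<close> still have real part at least \<delta>, so a single dominating function serves
    the whole sequence.\<close>
  define \<delta> where "\<delta> = Re z / 2"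
  have \<delta>: "\<delta> > 0" "\<delta> \<le> Re z" using z unfolding \<delta>_def by auto
  let ?D = "LINT \<xi>|lborel. cis (x \<bullet> \<xi>) * (- of_real (norm \<xi>) * exp (- (z * of_real (norm \<xi>))))"
  have "((\<lambda>w. (?F w - ?F z) / (w - z)) \<longlongrightarrow> ?D) (at z)"
    unfolding tendsto_at_iff_sequentially
  proof (intro allI impI)
    fix X :: "nat \<Rightarrow> complex" assume X: "\<forall>i. X i \<in> UNIV - {z}" "X \<longlonglongrightarrow> z"
    obtain N where N: "\<And>n. n \<ge> N \<Longrightarrow> dist (X n) z < \<delta>"
      using metric_LIMSEQ_D[OF X(2) \<delta>(1)] by blast
    define Y where "Y n = X (n + N)" for n
    have Y: "Y \<longlonglongrightarrow> z" unfolding Y_def by (rule LIMSEQ_ignore_initial_segment[OF X(2)])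
    have Yz: "Y n \<noteq> z" for n using X(1) unfolding Y_def by auto
    have YRe: "Re (Y n) \<ge> \<delta>" for n
      using N[of "n + N"] abs_Re_le_cmod[of "Y n - z"] unfolding Y_def \<delta>_def dist_norm by simp
    have lim: "(\<lambda>n. LINT \<xi>|lborel. (?f (Y n) \<xi> - ?f z \<xi>) / (Y n - z)) \<longlonglongrightarrow> ?D"
    proof (rule integral_dominated_convergence[where w = "\<lambda>\<xi>. norm \<xi> ^ 1 * exp (- (\<delta> * norm \<xi>))"])
      show "AE \<xi> in lborel. (\<lambda>n. (?f (Y n) \<xi> - ?f z \<xi>) / (Y n - z)) \<longlonglongrightarrow>
          cis (x \<bullet> \<xi>) * (- of_real (norm \<xi>) * exp (- (z * of_real (norm \<xi>))))"
      proof (rule AE_I2)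
        fix \<xi> :: 'a
        have "((\<lambda>w. ?f w \<xi>) has_field_derivative cis (x \<bullet> \<xi>) * (- of_real (norm \<xi>) * exp (- (z * of_real (norm \<xi>))))) (at z)"
          by (rule derivative_eq_intros refl | simp)+
        then have "((\<lambda>w. (?f w \<xi> - ?f z \<xi>) / (w - z)) \<longlongrightarrow>
            cis (x \<bullet> \<xi>) * (- of_real (norm \<xi>) * exp (- (z * of_real (norm \<xi>))))) (at z)"
          by (simp only: has_field_derivative_iff)
        from this[unfolded tendsto_at_iff_sequentially] Y Yz
        show "(\<lambda>n. (?f (Y n) \<xi> - ?f z \<xi>) / (Y n - z)) \<longlonglongrightarrow>
          cis (x \<bullet> \<xi>) * (- of_real (norm \<xi>) * exp (- (z * of_real (norm \<xi>))))"
          unfolding o_def by blast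
      qed
      show "AE \<xi> in lborel. norm ((?f (Y n) \<xi> - ?f z \<xi>) / (Y n - z)) \<le> norm \<xi> ^ 1 * exp (- (\<delta> * norm \<xi>))" for n
      proof (rule AE_I2)
        fix \<xi> :: 'a
        have "norm (?f (Y n) \<xi> - ?f z \<xi>) = norm (exp (- (Y n * of_real (norm \<xi>))) - exp (- (z * of_real (norm \<xi>))))"
          unfolding right_diff_distrib[symmetric] norm_mult by simp
        also have "\<dots> \<le> norm \<xi> * exp (- (\<delta> * norm \<xi>)) * norm (Y n - z)"
          by (rule exp_complex_diff_bound) (use YRe \<delta> in auto)
        finally show "norm ((?f (Y n) \<xi> - ?f z \<xi>) / (Y n - z)) \<le> norm \<xi> ^ 1 * exp (- (\<delta> * norm \<xi>))"
          using Yz[of n] by (simp add: norm_divide pos_divide_le_eq)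
      qed
      show "integrable lborel (\<lambda>\<xi>::'a. norm \<xi> ^ 1 * exp (- (\<delta> * norm \<xi>)))"
        by (rule integrable_exp_norm[OF \<delta>(1)])
    qed measurable
    have eq: "(LINT \<xi>|lborel. (?f (Y n) \<xi> - ?f z \<xi>) / (Y n - z)) = (?F (Y n) - ?F z) / (Y n - z)" for n
    proof -
      have "Re (Y n) > 0" using YRe[of n] \<delta>(1) by linarith
      then show ?thesis
        unfolding ft_def integral_divide_zero
        by (subst Bochner_Integration.integral_diff) (use z in \<open>auto intro!: integrable_ft integrable_exp_norm_complex\<close>)
    qed
    have "(\<lambda>n. (?F (X (n + N)) - ?F z) / (X (n + N) - z)) \<longlonglongrightarrow> ?D"
      using lim unfolding eq unfolding Y_def .
    then show "((\<lambda>w. (?F w - ?F z) / (w - z)) \<circ> X) \<longlonglongrightarrow> ?D"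
      unfolding o_def by (rule LIMSEQ_offset)
  qed
  then have "(?F has_field_derivative ?D) (at z)" by (simp only: has_field_derivative_iff)
  then show "?F field_differentiable at z within {z. Re z > 0}"
    by (meson field_differentiable_at_within field_differentiable_def)
qed

text \<open>Keeps the argument of \<open>csqrt\<close> off its branch cut, so that the closed form
  of the kernel is holomorphic in the whole right half-plane.\<close>

lemma sq_plus_not_nonpos:
  fixes z :: complex
  assumes "Re z > 0"
  shows "z\<^sup>2 + of_real (r\<^sup>2) \<notin> \<real>\<^sub>\<le>\<^sub>0"
proof
  assume "z\<^sup>2 + of_real (r\<^sup>2) \<in> \<real>\<^sub>\<le>\<^sub>0"
  then have "Re (z\<^sup>2 + of_real (r\<^sup>2)) \<le> 0" "Im (z\<^sup>2 + of_real (r\<^sup>2)) = 0"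
    by (auto simp: complex_nonpos_Reals_iff)
  then have "(Re z)\<^sup>2 - (Im z)\<^sup>2 + r\<^sup>2 \<le> 0" "Re z * Im z = 0"
    by (auto simp: power2_eq_square)
  then show False using assms by (auto simp: sum_power2_le_zero_iff)
qed

text \<open>Identity theorem: both sides are holomorphic for \<open>Re z > 0\<close> and agree on
  the positive reals, which accumulate at 1. Evaluating at \<open>Re z = 1 / N\<close> with a
  nonzero imaginary part gives the kernel of a damped wave.\<close>

lemma ft_exp_norm:
  fixes x :: "'a::euclidean_space"
  assumes z: "Re z > 0"
  shows "ft (\<lambda>\<xi>. exp (- (z * of_real (norm \<xi>)))) x =
    of_real (poisson_const TYPE('a)) * z / csqrt (z\<^sup>2 + of_real ((norm x)\<^sup>2)) ^ Suc DIM('a)"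
proof -
  let ?F = "\<lambda>z. ft (\<lambda>\<xi>. exp (- (z * of_real (norm \<xi>)))) x"
  let ?G = "\<lambda>z. of_real (poisson_const TYPE('a)) * z / csqrt (z\<^sup>2 + of_real ((norm x)\<^sup>2)) ^ Suc DIM('a)"
  let ?S = "{z. Re z > 0}"
  have "?F z - ?G z = 0"
  proof (rule analytic_continuation[where S = ?S and U = "of_real ` {0<..}" and \<xi> = 1 and f = "\<lambda>z. ?F z - ?G z"])
    show "(\<lambda>z. ?F z - ?G z) holomorphic_on ?S"
    proof (intro holomorphic_intros holomorphic_ft_exp_norm)
      show "z\<^sup>2 + of_real ((norm x)\<^sup>2) \<notin> \<real>\<^sub>\<le>\<^sub>0" if "z \<in> ?S" for z
        using that sq_plus_not_nonpos by blast
      show "csqrt (z\<^sup>2 + of_real ((norm x)\<^sup>2)) ^ Suc DIM('a) \<noteq> 0" if "z \<in> ?S" for z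
        using that sq_plus_not_nonpos[of z "norm x"] by auto
    qed
    show "open ?S" by (rule open_halfspace_Re_gt)
    show "connected ?S" by (intro convex_connected convex_halfspace_Re_gt)
    show "(1::complex) islimpt of_real ` {0<..}"
      unfolding islimpt_approachable
    proof (intro allI impI)
      fix e :: real assume "e > 0"
      then show "\<exists>x'\<in>complex_of_real ` {0<..}. x' \<noteq> 1 \<and> dist x' 1 < e"
        by (intro bexI[of _ "of_real (1 + e / 2)"] conjI)
           (auto simp: dist_norm complex_eq_iff norm_divide)
    qed
    show "?F w - ?G w = 0" if w: "w \<in> of_real ` {0<..}" for w
    proof -
      obtain r where r: "r > 0" "w = of_real r" using w by auto
      have "?F w = of_real (poisson_const TYPE('a) * r / sqrt (r\<^sup>2 + (norm x)\<^sup>2) ^ Suc DIM('a))"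
        using ft_exp_norm_real[OF r(1), of x] unfolding r by (simp add: exp_of_real[symmetric])
      also have "\<dots> = ?G w"
        unfolding r of_real_power[symmetric] of_real_add[symmetric]
        by (subst of_real_sqrt[symmetric]) simp_all
      finally show ?thesis by simp
    qed
  qed (use z in auto)
  then show ?thesis by simp
qed

text \<open>The factorisation \<open>z\<^sup>2 + r\<^sup>2 = (r + i z) (r - i z)\<close> makes the kernel of size
  \<open>|z|\<close> over \<open>(Re z |z|)\<close> to the power \<open>(d + 1) / 2\<close>: this is the dispersive estimate.\<close>

lemma norm_sq_plus_ge:
  fixes z :: complex
  assumes "Re z > 0" "r \<ge> 0"
  shows "norm (z\<^sup>2 + of_real (r\<^sup>2)) \<ge> Re z * norm z"
proof -
  have f: "z\<^sup>2 + of_real (r\<^sup>2) = (of_real r + \<i> * z) * (of_real r - \<i> * z)"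
    by (simp add: power2_eq_square algebra_simps)
  have n1: "norm (of_real r + \<i> * z) = sqrt ((r - Im z)\<^sup>2 + (Re z)\<^sup>2)"
    and n2: "norm (of_real r - \<i> * z) = sqrt ((r + Im z)\<^sup>2 + (Re z)\<^sup>2)"
    by (simp_all add: cmod_def)
  have nz: "norm z = sqrt ((Im z)\<^sup>2 + (Re z)\<^sup>2)" by (simp add: cmod_def add.commute)
  have ge: "sqrt (t + (Re z)\<^sup>2) \<ge> Re z" if "t \<ge> 0" for t
    using that assms(1) by (intro real_le_rsqrt) simp
  show ?thesis
  \<comment> \<open>The sign of \<open>Im z\<close> decides in which of the two factors it
    reinforces \<open>r\<close>. That factor is at least \<open>norm z\<close>; the other one is at
    least \<open>Re z\<close>.\<close>
  proof (cases "Im z \<ge> 0")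
    case True
    then have "norm (of_real r - \<i> * z) \<ge> norm z"
      unfolding n2 nz using assms(2) by (intro real_sqrt_le_mono add_right_mono power_mono) auto
    moreover have "norm (of_real r + \<i> * z) \<ge> Re z" unfolding n1 by (rule ge) simp
    ultimately show ?thesis unfolding f norm_mult using assms(1) by (intro mult_mono) auto
  next
    case False
    then have "(- Im z)\<^sup>2 \<le> (r - Im z)\<^sup>2" using assms(2) by (intro power_mono) auto
    then have "norm (of_real r + \<i> * z) \<ge> norm z"
      unfolding n1 nz by (intro real_sqrt_le_mono add_right_mono) simp
    moreover have "norm (of_real r - \<i> * z) \<ge> Re z" unfolding n2 by (rule ge) simp
    ultimately show ?thesis unfolding f norm_mult using assms(1)
      by (subst mult.commute[of "Re z"]) (intro mult_mono, auto)
  qed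
qed

lemma dispersive_estimate:
  fixes x :: "'a::euclidean_space"
  assumes z: "Re z > 0"
  shows "norm (ft (\<lambda>\<xi>. exp (- (z * of_real (norm \<xi>)))) x) \<le>
    poisson_const TYPE('a) * (norm z / sqrt (Re z * norm z) ^ Suc DIM('a))"
proof -
  have zz: "norm z > 0" using z by auto
  have "sqrt (Re z * norm z) ^ Suc DIM('a) \<le> sqrt (norm (z\<^sup>2 + of_real ((norm x)\<^sup>2))) ^ Suc DIM('a)"
    using norm_sq_plus_ge[OF z, of "norm x"] z by (intro power_mono real_sqrt_le_mono) auto
  moreover have "sqrt (Re z * norm z) ^ Suc DIM('a) > 0" using z zz by simp
  ultimately have "norm z / sqrt (norm (z\<^sup>2 + of_real ((norm x)\<^sup>2))) ^ Suc DIM('a) \<le> norm z / sqrt (Re z * norm z) ^ Suc DIM('a)"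
    by (intro divide_left_mono) (auto intro: less_le_trans mult_pos_pos)
  then have "poisson_const TYPE('a) * (norm z / sqrt (norm (z\<^sup>2 + of_real ((norm x)\<^sup>2))) ^ Suc DIM('a)) \<le>
      poisson_const TYPE('a) * (norm z / sqrt (Re z * norm z) ^ Suc DIM('a))"
    by (rule mult_left_mono[OF _ poisson_const_nonneg])
  then show ?thesis
    unfolding ft_exp_norm[OF z] using poisson_const_nonneg[where 'a = 'a]
    by (simp add: norm_mult norm_divide norm_power norm_csqrt del: power_Suc)
qed

section \<open>Weak type estimates at a fixed frequency scale\<close>

lemma ft_duality:
  fixes g h :: "'a::euclidean_space \<Rightarrow> complex"
  assumes g: "integrable lborel g" and h: "integrable lborel h"
  shows "(LINT x|lborel. g x * ft h x) = (LINT \<xi>|lborel. ft g \<xi> * h \<xi>)"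
proof -
  have i: "integrable (lborel \<Otimes>\<^sub>M lborel) (\<lambda>p. cis (fst p \<bullet> snd p) * (g (fst p) * h (snd p)))"
    by (intro integrable_cis_mult integrable_lborel_pair_mult g h) simp
  have "(LINT x|lborel. g x * ft h x) = (LINT x|lborel. LINT \<xi>|lborel. cis (x \<bullet> \<xi>) * (g x * h \<xi>))"
    unfolding ft_def integral_mult_right_zero[symmetric] by (simp add: mult_ac)
  also have "\<dots> = (LINT \<xi>|lborel. LINT x|lborel. cis (x \<bullet> \<xi>) * (g x * h \<xi>))"
    by (rule lborel_pair.Fubini_integral[symmetric]) (use i in \<open>simp add: case_prod_beta'\<close>)
  also have "\<dots> = (LINT \<xi>|lborel. ft g \<xi> * h \<xi>)"
    unfolding ft_def integral_mult_left_zero[symmetric] by (simp add: mult_ac inner_commute)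
  finally show ?thesis .
qed

lemma cauchy_schwarz_integral:
  fixes f g :: "'a \<Rightarrow> real"
  assumes [measurable]: "f \<in> borel_measurable M" "g \<in> borel_measurable M"
    and f: "integrable M (\<lambda>x. (f x)\<^sup>2)" and g: "integrable M (\<lambda>x. (g x)\<^sup>2)"
  shows "integrable M (\<lambda>x. f x * g x)"
    and "(LINT x|M. \<bar>f x * g x\<bar>)\<^sup>2 \<le> (LINT x|M. (f x)\<^sup>2) * (LINT x|M. (g x)\<^sup>2)"
proof -
  show i: "integrable M (\<lambda>x. f x * g x)"
  proof (rule Bochner_Integration.integrable_bound[OF Bochner_Integration.integrable_add[OF f g]])
    show "AE x in M. norm (f x * g x) \<le> norm ((f x)\<^sup>2 + (g x)\<^sup>2)"
    proof (rule AE_I2)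
      fix x
      have "2 * (\<bar>f x\<bar> * \<bar>g x\<bar>) \<le> (f x)\<^sup>2 + (g x)\<^sup>2"
        using sum_squares_bound[of "\<bar>f x\<bar>" "\<bar>g x\<bar>"] by simp
      moreover have "0 \<le> \<bar>f x\<bar> * \<bar>g x\<bar>" by simp
      ultimately show "norm (f x * g x) \<le> norm ((f x)\<^sup>2 + (g x)\<^sup>2)"
        unfolding real_norm_def abs_mult by linarith
    qed
  qed simp
  have "ennreal ((LINT x|M. \<bar>f x * g x\<bar>)\<^sup>2) = (\<integral>\<^sup>+x. ennreal \<bar>f x\<bar> * ennreal \<bar>g x\<bar> \<partial>M)\<^sup>2"
    using i by (simp add: ennreal_mult[symmetric] abs_mult[symmetric] nn_integral_eq_integral ennreal_power)
  also have "\<dots> \<le> (\<integral>\<^sup>+x. (ennreal \<bar>f x\<bar>)\<^sup>2 \<partial>M) * (\<integral>\<^sup>+x. (ennreal \<bar>g x\<bar>)\<^sup>2 \<partial>M)"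
    by (rule Cauchy_Schwarz_nn_integral) measurable
  also have "\<dots> = ennreal ((LINT x|M. (f x)\<^sup>2) * (LINT x|M. (g x)\<^sup>2))"
    using f g by (simp add: ennreal_power nn_integral_eq_integral ennreal_mult)
  finally show "(LINT x|M. \<bar>f x * g x\<bar>)\<^sup>2 \<le> (LINT x|M. (f x)\<^sup>2) * (LINT x|M. (g x)\<^sup>2)"
    by (subst (asm) ennreal_le_iff) (auto intro!: mult_nonneg_nonneg Bochner_Integration.integral_nonneg)
qed

lemma bessel_ft_integrable:
  fixes g :: "'a::euclidean_space \<Rightarrow> complex"
  assumes g: "integrable lborel g" and g2: "integrable lborel (\<lambda>x. (norm (g x))\<^sup>2)"
  shows "integrable lborel (\<lambda>\<xi>. (norm (ft g \<xi>))\<^sup>2)"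
    and "(LINT \<xi>|lborel. (norm (ft g \<xi>))\<^sup>2) \<le> (2 * pi) ^ DIM('a) * (LINT x|lborel. (norm (g x))\<^sup>2)"
proof -
  let ?R = "(2 * pi) ^ DIM('a) * (LINT x|lborel. (norm (g x))\<^sup>2)"
  have [measurable]: "ft g \<in> borel_measurable borel" by (rule measurable_ft[OF g])
  have R0: "?R \<ge> 0" by (intro mult_nonneg_nonneg Bochner_Integration.integral_nonneg) auto
  have le: "(\<integral>\<^sup>+\<xi>. ennreal ((norm (ft g \<xi>))\<^sup>2) \<partial>lborel) \<le> ennreal ?R"
    using bessel_ft[OF g] nn_integral_eq_integral[OF g2] by (simp add: ennreal_mult')
  show i: "integrable lborel (\<lambda>\<xi>. (norm (ft g \<xi>))\<^sup>2)"
    by (rule integrableI_bounded) (use le in \<open>auto intro: le_less_trans\<close>)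
  show "(LINT \<xi>|lborel. (norm (ft g \<xi>))\<^sup>2) \<le> ?R"
    using le R0 unfolding nn_integral_eq_integral[OF i, simplified] by (simp add: ennreal_le_iff)
qed

text \<open>The summand 1 in the distance matters: for \<open>Y < 1\<close> not even the diagonal
  counts as near, so the bound \<open>2 * Y\<close> holds for every positive \<open>Y\<close>,
  however small, and the threshold may later be chosen freely.\<close>

lemma card_near_le:
  assumes "Y > (0::real)"
  shows "real (card {j::nat. j < N \<and> 1 + \<bar>real k - real j\<bar> \<le> Y}) \<le> 2 * Y"
proof (cases "Y < 1")
  case True
  then have "{j::nat. j < N \<and> 1 + \<bar>real k - real j\<bar> \<le> Y} = {}" by auto
  then show ?thesis using assms by (simp only: card.empty)
next
  case False
  define n where "n = nat \<lfloor>Y - 1\<rfloor>"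
  have n: "real n \<le> Y - 1" unfolding n_def using False by simp
  have "{j::nat. j < N \<and> 1 + \<bar>real k - real j\<bar> \<le> Y} \<subseteq> {k - n..k + n}"
  proof
    fix j assume "j \<in> {j::nat. j < N \<and> 1 + \<bar>real k - real j\<bar> \<le> Y}"
    then have "\<bar>real k - real j\<bar> \<le> Y - 1" by auto
    then have "of_int \<bar>int k - int j\<bar> \<le> Y - 1" by simp
    then have "\<bar>int k - int j\<bar> \<le> \<lfloor>Y - 1\<rfloor>" by (simp only: le_floor_iff)
    moreover have "int n = \<lfloor>Y - 1\<rfloor>" unfolding n_def using False by simp
    ultimately have "\<bar>int k - int j\<bar> \<le> int n" by simp
    then show "j \<in> {k - n..k + n}" by auto
  qed
  then have "card {j::nat. j < N \<and> 1 + \<bar>real k - real j\<bar> \<le> Y} \<le> card {k - n..k + n}"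
    by (intro card_mono) auto
  also have "\<dots> \<le> 2 * n + 1" by simp
  finally have "real (card {j::nat. j < N \<and> 1 + \<bar>real k - real j\<bar> \<le> Y}) \<le> 2 * real n + 1" by simp
  then show ?thesis using n by simp
qed

text \<open>The complex time is \<open>(1 - \<i> * \<delta>) / N\<close>, where \<delta> is the time
  difference in lattice steps. Its modulus is \<open>S / N\<close> with
  \<open>S = sqrt (1 + \<delta>\<^sup>2)\<close>, which is at least
  \<open>(1 + \<bar>\<delta>\<bar>) / 2\<close> and so exceeds \<open>Y / 2\<close>; the power of
  \<open>S\<close> in the dispersive bound is nonpositive.\<close>

lemma dispersive_lattice:
  fixes x :: "'a::euclidean_space" and \<delta> Y :: real
  assumes N: "N > 0" and Y: "0 < Y" "Y < 1 + \<bar>\<delta>\<bar>"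
  shows "norm (ft (\<lambda>\<xi>. exp (- (Complex (1 / N) (- (\<delta> / N)) * of_real (norm \<xi>)))) x) \<le>
    poisson_const TYPE('a) * (N ^ DIM('a) * (Y / 2) powr (- (real DIM('a) - 1) / 2))"
proof -
  let ?D = "DIM('a)"
  let ?z = "Complex (1 / N) (- (\<delta> / N))"
  define S where "S = sqrt (1 + \<delta>\<^sup>2)"
  have S1: "S \<ge> 1" unfolding S_def by simp
  have nz: "norm ?z = S / N"
  proof -
    have "(1 / N)\<^sup>2 + (- (\<delta> / N))\<^sup>2 = (1 + \<delta>\<^sup>2) / N\<^sup>2" by (simp add: power_divide add_divide_distrib)
    then show ?thesis unfolding S_def cmod_def using N by (simp add: real_sqrt_divide)
  qed
  have "sqrt (1 / N * (S / N)) = sqrt S / N"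
    using N by (simp add: real_sqrt_divide real_sqrt_mult)
  then have "norm ?z / sqrt (Re ?z * norm ?z) ^ Suc ?D = (S / N) / (sqrt S / N) ^ Suc ?D"
    unfolding nz by simp
  also have "\<dots> = N ^ ?D * (S / sqrt S ^ Suc ?D)"
    using N S1 by (simp add: power_divide field_simps)
  also have "S / sqrt S ^ Suc ?D = S powr (- (real ?D - 1) / 2)"
  proof -
    have "sqrt S ^ Suc ?D = S powr (real (Suc ?D) / 2)"
    proof -
      have "sqrt S ^ Suc ?D = (S powr (1 / 2)) ^ Suc ?D" using S1 by (simp add: powr_half_sqrt)
      also have "\<dots> = (S powr (1 / 2)) powr real (Suc ?D)" using S1 by (subst powr_realpow) auto
      also have "\<dots> = S powr (real (Suc ?D) / 2)" unfolding powr_powr by simp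
      finally show ?thesis .
    qed
    then have "S / sqrt S ^ Suc ?D = S powr 1 / S powr (real (Suc ?D) / 2)" using S1 by simp
    also have "\<dots> = S powr (1 - real (Suc ?D) / 2)" by (simp only: powr_diff)
    also have "1 - real (Suc ?D) / 2 = - (real ?D - 1) / 2" by (simp add: field_simps)
    finally show ?thesis .
  qed
  also have "S powr (- (real ?D - 1) / 2) \<le> (Y / 2) powr (- (real ?D - 1) / 2)"
  proof (rule powr_mono2')
    have "((1 + \<bar>\<delta>\<bar>) / 2)\<^sup>2 \<le> 1 + \<delta>\<^sup>2"
      using sum_squares_bound[of 1 "\<bar>\<delta>\<bar>"] by (simp add: power2_eq_square field_simps)
    then have "(1 + \<bar>\<delta>\<bar>) / 2 \<le> S" unfolding S_def by (rule real_le_rsqrt)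
    then show "Y / 2 \<le> S" using Y by simp
  qed (use Y DIM_positive[where 'a = 'a] in \<open>auto simp: Suc_le_eq\<close>)
  finally have "norm ?z / sqrt (Re ?z * norm ?z) ^ Suc ?D \<le> N ^ ?D * (Y / 2) powr (- (real ?D - 1) / 2)"
    using N by simp
  then have "poisson_const TYPE('a) * (norm ?z / sqrt (Re ?z * norm ?z) ^ Suc ?D) \<le>
      poisson_const TYPE('a) * (N ^ ?D * (Y / 2) powr (- (real ?D - 1) / 2))"
    by (rule mult_left_mono[OF _ poisson_const_nonneg])
  with dispersive_estimate[of ?z x] N show ?thesis by (simp del: power_Suc)
qed

text \<open>The pairs of times at distance less than \<open>Y\<close> are estimated by Bessel's inequality, the other
  ones by the dispersive estimate.\<close>

lemma wave_quadratic_form_le: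
  fixes g :: "nat \<Rightarrow> 'a::euclidean_space \<Rightarrow> complex" and E :: "nat \<Rightarrow> 'a set"
  assumes N: "N > 0" and Y: "Y > (0::real)"
    and gm: "\<And>k. g k \<in> borel_measurable borel" and gE: "\<And>k x. norm (g k x) \<le> indicator (E k) x"
    and Em: "\<And>k. E k \<in> sets borel" and Ef: "\<And>k. emeasure lborel (E k) < \<infinity>"
  defines "B \<equiv> \<lambda>\<xi>. \<Sum>k<N. cis (real k / real N * norm \<xi>) * ft (g k) \<xi>"
    and "\<mu> \<equiv> \<Sum>k<N. measure lborel (E k)"
  shows "integrable lborel (\<lambda>\<xi>. exp (- (norm \<xi> / N)) * (norm (B \<xi>))\<^sup>2)" (is ?I)
    and "(LINT \<xi>|lborel. exp (- (norm \<xi> / N)) * (norm (B \<xi>))\<^sup>2) \<le>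
      2 * (2 * pi) ^ DIM('a) * (Y * \<mu>) +
      poisson_const TYPE('a) * (real N ^ DIM('a) * (Y / 2) powr (- (real DIM('a) - 1) / 2)) * \<mu>\<^sup>2" (is ?J)
proof -
  let ?L = "lborel :: 'a measure"
  note [measurable] = gm Em
  define m where "m k = measure lborel (E k)" for k
  have m0: "m k \<ge> 0" for k unfolding m_def by simp
  have Ei: "integrable ?L (indicator (E k) :: 'a \<Rightarrow> real)" for k
    using Em Ef by (intro integrable_real_indicator) auto
  have gi: "integrable ?L (g k)" for k
    by (rule Bochner_Integration.integrable_bound[OF Ei[of k]]) (use gE gm in auto)
  have gm1: "(LINT x|?L. norm (g k x)) \<le> m k" for k
    using integral_mono[OF integrable_norm[OF gi] Ei gE, of k] unfolding m_def by simp
  have g2le: "(norm (g k x))\<^sup>2 \<le> indicator (E k) x" for k x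
    using gE[of k x] by (cases "x \<in> E k") (auto simp: power_le_one)
  have g2i: "integrable ?L (\<lambda>x. (norm (g k x))\<^sup>2)" for k
    by (rule Bochner_Integration.integrable_bound[OF Ei[of k]]) (use g2le gm in auto)
  have g2m: "(LINT x|?L. (norm (g k x))\<^sup>2) \<le> m k" for k
    using integral_mono[OF g2i Ei g2le, of k] unfolding m_def by simp
  define A where "A k = ft (g k)" for k
  have Am [measurable]: "A k \<in> borel_measurable borel" for k
    unfolding A_def by (rule measurable_ft[OF gi])
  have Ab: "norm (A k \<xi>) \<le> m k" for k \<xi>
    unfolding A_def using norm_ft_le[OF gi] gm1 by (rule order_trans)
  have A2i: "integrable ?L (\<lambda>\<xi>. (norm (A k \<xi>))\<^sup>2)" for k
    unfolding A_def by (rule bessel_ft_integrable[OF gi g2i])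
  have A2m: "(LINT \<xi>|?L. (norm (A k \<xi>))\<^sup>2) \<le> (2 * pi) ^ DIM('a) * m k" for k
  proof -
    have "(2 * pi) ^ DIM('a) * (LINT x|?L. (norm (g k x))\<^sup>2) \<le> (2 * pi) ^ DIM('a) * m k"
      by (rule mult_left_mono[OF g2m]) simp
    then show ?thesis unfolding A_def using bessel_ft_integrable(2)[OF gi g2i, of k] by linarith
  qed
  \<comment> \<open>With this \<open>z\<close>, the function \<open>w k j\<close> is the damping
    weight times the phase at time \<open>k / N\<close> and the conjugate phase at time
    \<open>j / N\<close>: expanding the square of \<open>B\<close> produces exactly these
    weights.\<close>
  define z where "z k j = Complex (1 / real N) (- ((real k - real j) / real N))" for k j :: nat
  define w where "w k j \<xi> = exp (- (z k j * of_real (norm \<xi>)))" for k j and \<xi> :: 'a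
  have zpos: "Re (z k j) > 0" for k j unfolding z_def using N by simp
  have wi: "integrable ?L (w k j)" for k j
    using integrable_exp_norm_complex[OF zpos] unfolding w_def .
  have nw: "norm (w k j \<xi>) = exp (- (norm \<xi> / N))" for k j \<xi>
    unfolding w_def z_def by simp
  have ii: "integrable ?L (\<lambda>\<xi>. w k j \<xi> * (A k \<xi> * cnj (A j \<xi>)))" for k j
  proof (rule Bochner_Integration.integrable_bound[OF integrable_mult_right[OF wi[of k j], of "of_real (m k * m j)"]])
    have "norm (A k \<xi>) * norm (A j \<xi>) \<le> m k * m j" for \<xi>
      using Ab m0 by (intro mult_mono) auto
    then have "norm (w k j \<xi>) * (norm (A k \<xi>) * norm (A j \<xi>)) \<le> norm (w k j \<xi>) * (m k * m j)" for \<xi>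
      by (rule mult_left_mono) simp
    then show "AE \<xi> in ?L. norm (w k j \<xi> * (A k \<xi> * cnj (A j \<xi>))) \<le> norm (of_real (m k * m j) * w k j \<xi>)"
      using m0[of k] m0[of j] by (intro AE_I2) (simp add: norm_mult mult.commute abs_mult)
  qed (use wi[of k j] in measurable)
  define I where "I k j = (LINT \<xi>|?L. w k j \<xi> * (A k \<xi> * cnj (A j \<xi>)))" for k j
  have w_eq: "of_real (exp (- (norm \<xi> / N))) * (cis (real k / real N * norm \<xi>) * cnj (cis (real j / real N * norm \<xi>))) = w k j \<xi>" for k j \<xi>
  proof -
    have "cis (real k / real N * norm \<xi>) * cnj (cis (real j / real N * norm \<xi>)) =
        cis ((real k - real j) / real N * norm \<xi>)"
      by (simp add: cis_cnj cis_mult diff_divide_distrib left_diff_distrib)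
    moreover have "- (z k j * of_real (norm \<xi>)) = Complex (- (norm \<xi> / N)) ((real k - real j) / real N * norm \<xi>)"
      unfolding z_def by (simp add: complex_eq_iff)
    ultimately show ?thesis unfolding w_def by (simp add: exp_eq_polar)
  qed
  have pw: "of_real (exp (- (norm \<xi> / N)) * (norm (B \<xi>))\<^sup>2) = (\<Sum>k<N. \<Sum>j<N. w k j \<xi> * (A k \<xi> * cnj (A j \<xi>)))" for \<xi>
  proof -
    have "of_real (exp (- (norm \<xi> / N)) * (norm (B \<xi>))\<^sup>2) = of_real (exp (- (norm \<xi> / N))) * (B \<xi> * cnj (B \<xi>))"
      by (simp only: of_real_mult complex_norm_square)
    also have "B \<xi> * cnj (B \<xi>) = (\<Sum>k<N. \<Sum>j<N. (cis (real k / real N * norm \<xi>) * A k \<xi>) *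
        (cnj (cis (real j / real N * norm \<xi>)) * cnj (A j \<xi>)))"
      unfolding B_def A_def[symmetric] by (simp only: cnj_sum complex_cnj_mult sum_product)
    also have "of_real (exp (- (norm \<xi> / N))) * \<dots> =
        (\<Sum>k<N. \<Sum>j<N. of_real (exp (- (norm \<xi> / N))) * (cis (real k / real N * norm \<xi>) *
           cnj (cis (real j / real N * norm \<xi>))) * (A k \<xi> * cnj (A j \<xi>)))"
      unfolding sum_distrib_left by (intro sum.cong refl) (simp only: mult_ac)
    finally show ?thesis unfolding w_eq .
  qed
  have int_c: "integrable ?L (\<lambda>\<xi>. of_real (exp (- (norm \<xi> / N)) * (norm (B \<xi>))\<^sup>2) :: complex)"
    unfolding pw by (intro Bochner_Integration.integrable_sum ii)
  show ?I using integrable_Re[OF int_c] by simp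
  define Q where "Q = (LINT \<xi>|?L. exp (- (norm \<xi> / N)) * (norm (B \<xi>))\<^sup>2)"
  have "of_real Q = (LINT \<xi>|?L. (\<Sum>k<N. \<Sum>j<N. w k j \<xi> * (A k \<xi> * cnj (A j \<xi>))))"
    unfolding Q_def pw[symmetric] by (rule integral_complex_of_real[symmetric])
  also have "\<dots> = (\<Sum>k<N. \<Sum>j<N. I k j)"
    unfolding I_def by (subst Bochner_Integration.integral_sum, intro Bochner_Integration.integrable_sum ii)
      (intro sum.cong refl Bochner_Integration.integral_sum ii)
  finally have Qsum: "of_real Q = (\<Sum>k<N. \<Sum>j<N. I k j)" .
  \<comment> \<open>Valid for all pairs and meant for the near ones: the weight has modulus at most
    1, and Bessel's inequality controls both transforms.\<close>
  have Ia: "norm (I k j) \<le> (2 * pi) ^ DIM('a) * ((m k + m j) / 2)" for k j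
  proof -
    have le: "norm (w k j \<xi> * (A k \<xi> * cnj (A j \<xi>))) \<le> ((norm (A k \<xi>))\<^sup>2 + (norm (A j \<xi>))\<^sup>2) / 2" for \<xi>
    proof -
      have "norm (w k j \<xi> * (A k \<xi> * cnj (A j \<xi>))) \<le> norm (A k \<xi>) * norm (A j \<xi>)"
        unfolding norm_mult nw complex_mod_cnj by (rule mult_left_le_one_le) auto
      then show ?thesis using sum_squares_bound[of "norm (A k \<xi>)" "norm (A j \<xi>)"] by simp
    qed
    have "norm (I k j) \<le> (LINT \<xi>|?L. ((norm (A k \<xi>))\<^sup>2 + (norm (A j \<xi>))\<^sup>2) / 2)"
      unfolding I_def by (rule Bochner_Integration.integral_norm_bound_integral[OF ii _ le]) (use A2i in auto)
    also have "\<dots> = ((LINT \<xi>|?L. (norm (A k \<xi>))\<^sup>2) + (LINT \<xi>|?L. (norm (A j \<xi>))\<^sup>2)) / 2"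
      using A2i by simp
    also have "\<dots> \<le> ((2 * pi) ^ DIM('a) * m k + (2 * pi) ^ DIM('a) * m j) / 2"
      using A2m[of k] A2m[of j] by simp
    also have "\<dots> = (2 * pi) ^ DIM('a) * ((m k + m j) / 2)" by (simp add: distrib_left)
    finally show ?thesis .
  qed
  define K where "K = poisson_const TYPE('a) * (real N ^ DIM('a) * (Y / 2) powr (- (real DIM('a) - 1) / 2))"
  have K0: "K \<ge> 0" unfolding K_def by (intro mult_nonneg_nonneg poisson_const_nonneg) auto
  \<comment> \<open>On the physical side the kernel is bounded by \<open>K\<close>, which leaves the
    product of the two \<open>L\<^sup>1\<close> norms, each at most the measure of its set.\<close>
  have Ib: "norm (I k j) \<le> K * (m k * m j)" if far: "\<not> 1 + \<bar>real k - real j\<bar> \<le> Y" for k j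
  proof -
    have Kx: "norm (ft (w k j) x) \<le> K" for x
      unfolding w_def z_def K_def by (rule dispersive_lattice) (use N Y far in auto)
    have pi: "integrable (?L \<Otimes>\<^sub>M ?L) (\<lambda>p. of_real (norm (g k (fst p))) * of_real (norm (g j (snd p))) :: complex)"
      by (intro integrable_lborel_pair_mult integrable_of_real integrable_norm gi)
    have pi': "integrable (?L \<Otimes>\<^sub>M ?L) (\<lambda>p. norm (g k (fst p)) * norm (g j (snd p)))"
      using integrable_Re[OF pi] by simp
    have "I k j = (LINT p|(?L \<Otimes>\<^sub>M ?L). g k (fst p) * cnj (g j (snd p)) * ft (w k j) (fst p - snd p))"
      unfolding I_def A_def by (rule ft_bilinear[OF wi gi gi])
    also have "norm \<dots> \<le> (LINT p|(?L \<Otimes>\<^sub>M ?L). K * (norm (g k (fst p)) * norm (g j (snd p))))"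
    proof (rule Bochner_Integration.integral_norm_bound_integral)
      have le: "norm (g k (fst p) * cnj (g j (snd p)) * ft (w k j) (fst p - snd p)) \<le>
          K * (norm (g k (fst p)) * norm (g j (snd p)))" for p
        unfolding norm_mult complex_mod_cnj mult.commute[of K] by (rule mult_left_mono[OF Kx]) auto
      then show "norm (g k (fst p) * cnj (g j (snd p)) * ft (w k j) (fst p - snd p)) \<le>
          K * (norm (g k (fst p)) * norm (g j (snd p)))" for p .
      show ki: "integrable (?L \<Otimes>\<^sub>M ?L) (\<lambda>p. K * (norm (g k (fst p)) * norm (g j (snd p))))"
        by (intro integrable_mult_right pi')
      show "integrable (?L \<Otimes>\<^sub>M ?L) (\<lambda>p. g k (fst p) * cnj (g j (snd p)) * ft (w k j) (fst p - snd p))"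
      proof (rule Bochner_Integration.integrable_bound[OF ki])
        have [measurable]: "ft (w k j) \<in> borel_measurable borel" by (rule measurable_ft[OF wi])
        show "(\<lambda>p. g k (fst p) * cnj (g j (snd p)) * ft (w k j) (fst p - snd p)) \<in> borel_measurable (?L \<Otimes>\<^sub>M ?L)"
          by measurable
      qed (use order_trans[OF le abs_ge_self] in \<open>intro AE_I2, simp\<close>)
    qed
    also have "\<dots> = K * ((LINT x|?L. norm (g k x)) * (LINT x|?L. norm (g j x)))"
      using lborel_pair.integral_fst'[OF pi'] by simp
    also have "\<dots> \<le> K * (m k * m j)"
      using gm1[of k] gm1[of j] K0 m0 by (intro mult_left_mono mult_mono) auto
    finally show ?thesis .
  qed
  let ?near = "\<lambda>k j. 1 + \<bar>real k - real j\<bar> \<le> Y"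
  let ?c = "(2 * pi) ^ DIM('a)"
  have c0: "?c \<ge> 0" by simp
  have "Q \<le> norm (of_real Q :: complex)" by simp
  also have "\<dots> \<le> (\<Sum>k<N. \<Sum>j<N. norm (I k j))"
    unfolding Qsum by (intro order_trans[OF norm_sum] sum_mono norm_sum)
  \<comment> \<open>The nonnegative far bound is added for every pair, near or not, so that its
    double sum factors into \<open>\<mu>\<^sup>2\<close>.\<close>
  also have "\<dots> \<le> (\<Sum>k<N. \<Sum>j<N. ?c * ((if ?near k j then m k / 2 else 0) + (if ?near k j then m j / 2 else 0)) + K * (m k * m j))"
  proof (intro sum_mono)
    fix k j
    have "0 \<le> K * (m k * m j)" using K0 m0 by simp
    then show "norm (I k j) \<le> ?c * ((if ?near k j then m k / 2 else 0) + (if ?near k j then m j / 2 else 0)) + K * (m k * m j)"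
      using Ia[of k j] Ib[of k j] by (cases "?near k j") (auto simp: add_divide_distrib)
  qed
  also have "\<dots> = ?c * ((\<Sum>k<N. \<Sum>j<N. if ?near k j then m k / 2 else 0) + (\<Sum>k<N. \<Sum>j<N. if ?near k j then m j / 2 else 0))
      + K * (\<Sum>k<N. \<Sum>j<N. m k * m j)"
    by (simp only: sum.distrib sum_distrib_left distrib_left)
  also have "(\<Sum>k<N. \<Sum>j<N. if ?near k j then m j / 2 else 0) = (\<Sum>k<N. \<Sum>j<N. if ?near k j then m k / 2 else 0)"
    by (subst sum.swap) (simp add: abs_minus_commute)
  also have "(\<Sum>k<N. \<Sum>j<N. m k * m j) = \<mu>\<^sup>2"
    unfolding \<mu>_def m_def[symmetric] power2_eq_square sum_product ..
  also have "(\<Sum>k<N. \<Sum>j<N. if ?near k j then m k / 2 else 0) \<le> (\<Sum>k<N. Y * m k)"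
  proof (rule sum_mono)
    fix k
    have "(\<Sum>j<N. if ?near k j then m k / 2 else 0) = (\<Sum>j\<in>{j. j < N \<and> ?near k j}. m k / 2)"
      by (rule sum.mono_neutral_cong_right) auto
    also have "\<dots> = real (card {j. j < N \<and> ?near k j}) * (m k / 2)" by simp
    also have "\<dots> \<le> 2 * Y * (m k / 2)"
      by (rule mult_right_mono[OF card_near_le[OF Y]]) (use m0 in simp)
    finally show "(\<Sum>j<N. if ?near k j then m k / 2 else 0) \<le> Y * m k" by simp
  qed
  also have "(\<Sum>k<N. Y * m k) = Y * \<mu>" unfolding \<mu>_def m_def[symmetric] sum_distrib_left ..
  finally have "Q \<le> ?c * (Y * \<mu> + Y * \<mu>) + K * \<mu>\<^sup>2" using c0 by simp
  then show ?J unfolding Q_def[symmetric] K_def[symmetric] by (simp add: algebra_simps)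
qed

section \<open>Level sets of half-wave maximal functions\<close>

text \<open>Takes the Fourier side function \<open>H\<close> as its argument, so that frequency
  restriction is plain multiplication; for \<open>H = fourier f\<close> it is
  \<open>wave t f\<close> up to the constant \<open>(2 * pi) ^ DIM('a)\<close>.\<close>

definition half_wave :: "real \<Rightarrow> ('a::euclidean_space \<Rightarrow> complex) \<Rightarrow> 'a \<Rightarrow> complex" where
  "half_wave t H x = ft (\<lambda>\<xi>. cis (t * norm \<xi>) * H \<xi>) x"

definition wave_level_set :: "nat \<Rightarrow> ('a::euclidean_space \<Rightarrow> complex) \<Rightarrow> real \<Rightarrow> 'a set" where
  "wave_level_set N H \<alpha> = {x \<in> ball 0 1. \<exists>k<N. norm (half_wave (real k / real N) H x) > \<alpha>}"

definition band_limited :: "real \<Rightarrow> ('a::euclidean_space \<Rightarrow> complex) \<Rightarrow> bool" where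
  "band_limited R H \<longleftrightarrow> integrable lborel H \<and> integrable lborel (\<lambda>\<xi>. (norm (H \<xi>))\<^sup>2) \<and>
     (\<forall>\<xi>. norm \<xi> > R \<longrightarrow> H \<xi> = 0)"

definition l2norm :: "('a::euclidean_space \<Rightarrow> complex) \<Rightarrow> real" where
  "l2norm H = sqrt (LINT \<xi>|lborel. (norm (H \<xi>))\<^sup>2)"

lemma l2norm_nonneg: "l2norm H \<ge> 0"
  unfolding l2norm_def by (simp add: Bochner_Integration.integral_nonneg)

lemma l2norm_sq: "(l2norm H)\<^sup>2 = (LINT \<xi>|lborel. (norm (H \<xi>))\<^sup>2)"
  unfolding l2norm_def by (simp add: Bochner_Integration.integral_nonneg)

lemma integrable_half_wave:
  "integrable lborel H \<Longrightarrow> integrable lborel (\<lambda>\<xi>. cis (t * norm \<xi>) * H \<xi>)"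
  by (intro integrable_cis_mult) auto

lemma measurable_half_wave [measurable]:
  "integrable lborel H \<Longrightarrow> half_wave t H \<in> borel_measurable borel"
  unfolding half_wave_def[abs_def] by (intro measurable_ft integrable_half_wave)

lemma norm_half_wave_le:
  assumes "integrable lborel H"
  shows "norm (half_wave t H x) \<le> (LINT \<xi>|lborel. norm (H \<xi>))"
  unfolding half_wave_def using norm_ft_le[OF integrable_half_wave[OF assms, of t]]
  by (simp add: norm_mult)

lemma wave_level_set_measurable:
  assumes "integrable lborel H"
  shows "wave_level_set N H \<alpha> \<in> sets borel"
proof -
  have [measurable]: "half_wave t H \<in> borel_measurable borel" for t
    by (rule measurable_half_wave[OF assms])
  have "wave_level_set N H \<alpha> = (\<Union>k<N. {x. norm (half_wave (real k / real N) H x) > \<alpha>}) \<inter> ball 0 1"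
    unfolding wave_level_set_def by auto
  also have "\<dots> \<in> sets borel" by measurable
  finally show ?thesis .
qed

lemma emeasure_wave_level_set_finite: "emeasure lborel (wave_level_set N H \<alpha>) < \<infinity>"
proof -
  have "emeasure lborel (wave_level_set N H \<alpha>) \<le> emeasure lborel (ball 0 1 :: 'a set)"
    by (intro emeasure_mono) (auto simp: wave_level_set_def)
  also have "\<dots> < \<infinity>" by (rule emeasure_bounded_finite) simp
  finally show ?thesis .
qed

lemma cnj_sgn_mult: "cnj (sgn z) * z = of_real (norm z)"
proof (cases "z = 0")
  case False
  have "cnj (sgn z) * z = (z * cnj z) / of_real (norm z)"
    by (simp add: sgn_eq)
  also have "\<dots> = of_real ((norm z)\<^sup>2 / norm z)"
    by (simp only: complex_norm_square[symmetric] of_real_divide)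
  also have "(norm z)\<^sup>2 / norm z = norm z" by (simp add: power2_eq_square)
  finally show ?thesis .
qed simp

text \<open>Duality (\<open>T T\<^sup>*\<close>): the level set is split according to the first time at which the wave is
  large. The weight \<open>exp (- |\<xi>| / N)\<close> is harmless on the support of \<open>H\<close>, and it makes the kernel
  of \<open>T T\<^sup>*\<close> explicit.\<close>

lemma wave_level_set_duality:
  fixes H :: "'a::euclidean_space \<Rightarrow> complex"
  assumes H: "band_limited (real N) H" and N: "N > 0" and \<alpha>: "\<alpha> > 0" and Y: "Y > 0"
  defines "\<mu> \<equiv> measure lborel (wave_level_set N H \<alpha>)"
  shows "(\<alpha> * \<mu>)\<^sup>2 \<le> (l2norm H)\<^sup>2 * (exp 1 * (2 * (2 * pi) ^ DIM('a) * (Y * \<mu>) +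
      poisson_const TYPE('a) * (real N ^ DIM('a) * (Y / 2) powr (- (real DIM('a) - 1) / 2)) * \<mu>\<^sup>2))"
proof -
  let ?L = "lborel :: 'a measure"
  have Hi: "integrable ?L H" and H2: "integrable ?L (\<lambda>\<xi>. (norm (H \<xi>))\<^sup>2)"
    and Hs: "\<And>\<xi>. norm \<xi> > real N \<Longrightarrow> H \<xi> = 0"
    using H unfolding band_limited_def by auto
  have [measurable]: "H \<in> borel_measurable borel" using borel_measurable_integrable[OF Hi] by simp
  define u where "u k = half_wave (real k / real N) H" for k
  have um [measurable]: "u k \<in> borel_measurable borel" for k
    unfolding u_def by (rule measurable_half_wave[OF Hi])
  define E where "E k = ball 0 1 \<inter> ({x. norm (u k x) > \<alpha>} \<inter> (\<Inter>j\<in>{..<k}. {x. \<not> norm (u j x) > \<alpha>}))" for k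
  have Em [measurable]: "E k \<in> sets borel" for k
  proof (cases "k = 0")
    case True
    then have "E k = ball 0 1 \<inter> {x. norm (u k x) > \<alpha>}" unfolding E_def by auto
    also have "\<dots> \<in> sets borel" by measurable
    finally show ?thesis .
  next
    case False
    have "{x. norm (u k x) > \<alpha>} \<in> sets borel" by measurable
    moreover have "(\<Inter>j\<in>{..<k}. {x. \<not> norm (u j x) > \<alpha>}) \<in> sets borel"
    proof (rule sets.finite_INT)
      show "{x. \<not> norm (u j x) > \<alpha>} \<in> sets borel" for j by measurable
    qed (use False in auto)
    ultimately show ?thesis unfolding E_def by auto
  qed
  have Ef: "emeasure ?L (E k) < \<infinity>" for k
  proof -
    have "emeasure ?L (E k) \<le> emeasure ?L (ball 0 1)" by (intro emeasure_mono) (auto simp: E_def)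
    also have "\<dots> < \<infinity>" by (rule emeasure_bounded_finite) simp
    finally show ?thesis .
  qed
  have un: "(\<Union>k<N. E k) = wave_level_set N H \<alpha>"
  proof (intro equalityI subsetI)
    fix x assume "x \<in> wave_level_set N H \<alpha>"
    then have x: "x \<in> ball 0 1" "\<exists>k. k < N \<and> norm (u k x) > \<alpha>"
      unfolding wave_level_set_def u_def by auto
    define k where "k = (LEAST k. k < N \<and> norm (u k x) > \<alpha>)"
    have k: "k < N \<and> norm (u k x) > \<alpha>" unfolding k_def by (rule LeastI_ex[OF x(2)])
    have "\<not> norm (u j x) > \<alpha>" if "j < k" for j
      using not_less_Least[of j "\<lambda>k. k < N \<and> norm (u k x) > \<alpha>"] that k unfolding k_def by auto
    then show "x \<in> (\<Union>k<N. E k)" using k x(1) unfolding E_def by auto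
  qed (auto simp: E_def wave_level_set_def u_def)
  have disj: "disjoint_family_on E {..<N}"
  proof -
    have "E i \<inter> E j = {}" if "i < j" for i j using that unfolding E_def by auto
    then show ?thesis unfolding disjoint_family_on_def by (metis Int_commute linorder_neqE_nat)
  qed
  have \<mu>: "\<mu> = (\<Sum>k<N. measure ?L (E k))"
    unfolding \<mu>_def un[symmetric]
    by (rule measure_finite_Union) (use disj Ef in \<open>auto simp: less_top\<close>)
  define g where "g k x = indicator (E k) x * cnj (sgn (u k x))" for k x
  have gm [measurable]: "g k \<in> borel_measurable borel" for k
    unfolding g_def sgn_eq by measurable
  have gE: "norm (g k x) \<le> indicator (E k) x" for k x
    unfolding g_def by (auto simp: norm_mult norm_sgn indicator_def)
  have Ei: "integrable ?L (indicator (E k) :: 'a \<Rightarrow> real)" for k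
    using Em Ef by (intro integrable_real_indicator) auto
  have gi: "integrable ?L (g k)" for k
    by (rule Bochner_Integration.integrable_bound[OF Ei[of k]]) (use gE gm in auto)
  define B where "B \<xi> = (\<Sum>k<N. cis (real k / real N * norm \<xi>) * ft (g k) \<xi>)" for \<xi>
  have Bm [measurable]: "B \<in> borel_measurable borel"
  proof -
    have [measurable]: "ft (g k) \<in> borel_measurable borel" for k by (rule measurable_ft[OF gi])
    show ?thesis unfolding B_def[abs_def] by measurable
  qed
  define Q where "Q = (LINT \<xi>|?L. exp (- (norm \<xi> / N)) * (norm (B \<xi>))\<^sup>2)"
  have Qi: "integrable ?L (\<lambda>\<xi>. exp (- (norm \<xi> / N)) * (norm (B \<xi>))\<^sup>2)"
    unfolding B_def by (rule wave_quadratic_form_le(1)[OF N Y gm gE Em Ef])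
  have Qle: "Q \<le> 2 * (2 * pi) ^ DIM('a) * (Y * \<mu>) +
      poisson_const TYPE('a) * (real N ^ DIM('a) * (Y / 2) powr (- (real DIM('a) - 1) / 2)) * \<mu>\<^sup>2"
    unfolding Q_def B_def \<mu> by (rule wave_quadratic_form_le(2)[OF N Y gm gE Em Ef])
  have gu: "g k x * u k x = of_real (indicator (E k) x * norm (u k x))" for k x
    unfolding g_def using cnj_sgn_mult[of "u k x"] by (simp add: indicator_def)
  have ub: "norm (u k x) \<le> (LINT \<xi>|?L. norm (H \<xi>))" for k x
    unfolding u_def by (rule norm_half_wave_le[OF Hi])
  have Eui: "integrable ?L (\<lambda>x. indicator (E k) x * norm (u k x))" for k
  proof (rule Bochner_Integration.integrable_bound[OF integrable_mult_left[OF Ei[of k], of "LINT \<xi>|?L. norm (H \<xi>)"]])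
    show "AE x in ?L. norm (indicator (E k) x * norm (u k x)) \<le> norm (indicator (E k) x * (LINT \<xi>|?L. norm (H \<xi>)))"
      using ub by (intro AE_I2) (auto simp: indicator_def intro: order_trans[OF _ abs_ge_self])
  qed measurable
  have BHi: "integrable ?L (\<lambda>\<xi>. ft (g k) \<xi> * (cis (real k / real N * norm \<xi>) * H \<xi>))" for k
  proof (rule Bochner_Integration.integrable_bound[OF integrable_mult_right[OF Hi, of "of_real (LINT x|?L. norm (g k x))"]])
    have [measurable]: "ft (g k) \<in> borel_measurable borel" by (rule measurable_ft[OF gi])
    show "(\<lambda>\<xi>. ft (g k) \<xi> * (cis (real k / real N * norm \<xi>) * H \<xi>)) \<in> borel_measurable ?L" by measurable
    show "AE \<xi> in ?L. norm (ft (g k) \<xi> * (cis (real k / real N * norm \<xi>) * H \<xi>)) \<le>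
        norm (of_real (LINT x|?L. norm (g k x)) * H \<xi>)"
      using norm_ft_le[OF gi[of k]]
      by (intro AE_I2) (auto simp: norm_mult intro!: mult_right_mono order_trans[OF _ abs_ge_self])
  qed
  have "\<alpha> * \<mu> = (\<Sum>k<N. LINT x|?L. indicator (E k) x * \<alpha>)"
    unfolding \<mu> sum_distrib_left by (intro sum.cong refl) (use Em in simp)
  also have "\<dots> \<le> (\<Sum>k<N. LINT x|?L. indicator (E k) x * norm (u k x))"
  proof (intro sum_mono integral_mono Eui)
    show "integrable ?L (\<lambda>x. indicator (E k) x * \<alpha>)" for k by (intro integrable_mult_left Ei)
    show "indicator (E k) x * \<alpha> \<le> indicator (E k) x * norm (u k x)" for k x
      by (auto simp: indicator_def E_def)
  qed
  finally have le1: "\<alpha> * \<mu> \<le> (\<Sum>k<N. LINT x|?L. indicator (E k) x * norm (u k x))" .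
  have "of_real (\<Sum>k<N. LINT x|?L. indicator (E k) x * norm (u k x)) = (\<Sum>k<N. LINT x|?L. g k x * u k x)"
    unfolding of_real_sum gu integral_complex_of_real ..
  also have "\<dots> = (\<Sum>k<N. LINT \<xi>|?L. ft (g k) \<xi> * (cis (real k / real N * norm \<xi>) * H \<xi>))"
    unfolding u_def half_wave_def by (intro sum.cong refl ft_duality gi integrable_half_wave Hi)
  also have "\<dots> = (LINT \<xi>|?L. (\<Sum>k<N. ft (g k) \<xi> * (cis (real k / real N * norm \<xi>) * H \<xi>)))"
    by (rule Bochner_Integration.integral_sum[symmetric]) (rule BHi)
  also have "\<dots> = (LINT \<xi>|?L. B \<xi> * H \<xi>)"
    unfolding B_def sum_distrib_right by (simp only: mult_ac)
  finally have eq1: "of_real (\<Sum>k<N. LINT x|?L. indicator (E k) x * norm (u k x)) = (LINT \<xi>|?L. B \<xi> * H \<xi>)" .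
  define f where "f \<xi> = norm (H \<xi>)" for \<xi>
  \<comment> \<open>The factor \<open>exp 1\<close> compensates the weight on
    \<open>norm \<xi> \<le> N\<close>, so that inserting \<open>b\<close> for \<open>B\<close> costs
    nothing on the support of \<open>H\<close>.\<close>
  define b where "b \<xi> = sqrt (exp 1 * exp (- (norm \<xi> / N))) * norm (B \<xi>)" for \<xi>
  have fb: "norm (B \<xi> * H \<xi>) \<le> \<bar>f \<xi> * b \<xi>\<bar>" for \<xi>
  proof (cases "norm \<xi> \<le> real N")
    case True
    then have "norm \<xi> / N \<le> 1" using N by simp
    then have "1 \<le> exp 1 * exp (- (norm \<xi> / N))" unfolding exp_add[symmetric] by simp
    then have "1 \<le> sqrt (exp 1 * exp (- (norm \<xi> / N)))" by simp
    then have "1 * norm (B \<xi>) \<le> b \<xi>" unfolding b_def by (rule mult_right_mono) simp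
    then have "norm (H \<xi>) * norm (B \<xi>) \<le> f \<xi> * b \<xi>" unfolding f_def by (intro mult_left_mono) auto
    then show ?thesis unfolding norm_mult by (simp add: mult.commute)
  next
    case False
    then show ?thesis using Hs[of \<xi>] by simp
  qed
  have b2: "(b \<xi>)\<^sup>2 = exp 1 * (exp (- (norm \<xi> / N)) * (norm (B \<xi>))\<^sup>2)" for \<xi>
    unfolding b_def power_mult_distrib by simp
  have b2i: "integrable ?L (\<lambda>\<xi>. (b \<xi>)\<^sup>2)" unfolding b2 by (intro integrable_mult_right Qi)
  have fm: "f \<in> borel_measurable ?L" "b \<in> borel_measurable ?L"
    unfolding f_def[abs_def] b_def[abs_def] by measurable
  have f2i: "integrable ?L (\<lambda>\<xi>. (f \<xi>)\<^sup>2)" unfolding f_def by (rule H2)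
  note cs = cauchy_schwarz_integral[OF fm f2i b2i]
  have "\<alpha> * \<mu> \<le> norm (LINT \<xi>|?L. B \<xi> * H \<xi>)"
    unfolding eq1[symmetric] norm_of_real using le1 by linarith
  also have "\<dots> \<le> (LINT \<xi>|?L. \<bar>f \<xi> * b \<xi>\<bar>)"
  proof (rule Bochner_Integration.integral_norm_bound_integral)
    show "integrable ?L (\<lambda>\<xi>. \<bar>f \<xi> * b \<xi>\<bar>)" using cs(1) by (rule integrable_abs)
    then show "integrable ?L (\<lambda>\<xi>. B \<xi> * H \<xi>)"
      by (rule Bochner_Integration.integrable_bound) (use fb in auto)
  qed (rule fb)
  finally have "(\<alpha> * \<mu>)\<^sup>2 \<le> (LINT \<xi>|?L. \<bar>f \<xi> * b \<xi>\<bar>)\<^sup>2"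
    using \<alpha> by (intro power_mono) (auto simp: \<mu>_def)
  also have "\<dots> \<le> (LINT \<xi>|?L. (f \<xi>)\<^sup>2) * (LINT \<xi>|?L. (b \<xi>)\<^sup>2)" by (rule cs(2))
  also have "\<dots> = (l2norm H)\<^sup>2 * (exp 1 * Q)"
    unfolding l2norm_sq b2 f_def Q_def by simp
  also have "\<dots> \<le> (l2norm H)\<^sup>2 * (exp 1 * (2 * (2 * pi) ^ DIM('a) * (Y * \<mu>) +
      poisson_const TYPE('a) * (real N ^ DIM('a) * (Y / 2) powr (- (real DIM('a) - 1) / 2)) * \<mu>\<^sup>2))"
    by (intro mult_left_mono Qle) auto
  finally show ?thesis .
qed

text \<open>In \<open>wave_level_set_duality\<close> the near term grows with the threshold
  \<open>Y\<close> and the far term decreases. Balancing them turns the bound into an implicit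
  inequality for the measure, because the optimal \<open>Y\<close> is itself a power of the
  measure.\<close>

lemma wave_level_set_strichartz:
  assumes d: "DIM('a::euclidean_space) \<ge> 2"
  obtains C where "C \<ge> 0" and "\<And>N (H :: 'a \<Rightarrow> complex) \<alpha>. N > 0 \<Longrightarrow> band_limited (real N) H \<Longrightarrow> \<alpha> > 0 \<Longrightarrow>
     measure lborel (wave_level_set N H \<alpha>) \<le>
       C * real N powr (2 * real DIM('a) / (real DIM('a) - 1)) *
         (l2norm H / \<alpha>) powr (2 * (real DIM('a) + 1) / (real DIM('a) - 1))"
proof -
  define D where "D = real DIM('a)"
  have D: "D \<ge> 2" using d unfolding D_def by simp
  define \<theta> where "\<theta> = (D - 1) / 2"
  define \<rho> where "\<rho> = (D + 1) / (D - 1)"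
  define C1 where "C1 = exp 1 * (2 * (2 * pi) ^ DIM('a) + poisson_const TYPE('a) * 2 powr \<theta>)"
  have C1: "C1 \<ge> 0" unfolding C1_def using poisson_const_nonneg[where 'a = 'a] by simp
  have \<rho>: "\<rho> > 0" unfolding \<rho>_def using D by simp
  have main: "measure lborel (wave_level_set N H \<alpha>) \<le>
       C1 powr \<rho> * real N powr (2 * D / (D - 1)) * (l2norm H / \<alpha>) powr (2 * (D + 1) / (D - 1))"
    if N: "N > 0" and H: "band_limited (real N) H" and \<alpha>: "\<alpha> > 0" for N and H :: "'a \<Rightarrow> complex" and \<alpha>
  proof -
    define \<mu> where "\<mu> = measure lborel (wave_level_set N H \<alpha>)"
    define a where "a = l2norm H"
    have a0: "a \<ge> 0" unfolding a_def by (rule l2norm_nonneg)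
    show ?thesis
    proof (cases "\<mu> = 0")
      case True
      then show ?thesis unfolding \<mu>_def by simp
    next
      case False
      then have \<mu>: "\<mu> > 0" unfolding \<mu>_def by (simp add: zero_less_measure_iff)
      define M where "M = real N ^ DIM('a) * \<mu>"
      have M: "M > 0" unfolding M_def using N \<mu> by simp
      \<comment> \<open>The solution of \<open>M * Y powr (- \<theta>) = Y\<close>, at which the
        near and the far terms have the same size.\<close>
      define Y where "Y = M powr (2 / (D + 1))"
      have Y: "Y > 0" unfolding Y_def using M by simp
      have MY: "M * Y powr (- \<theta>) = Y"
      proof -
        have "M * Y powr (- \<theta>) = M powr 1 * M powr (2 / (D + 1) * (- \<theta>))"
          unfolding Y_def powr_powr using M by simp
        also have "\<dots> = M powr (1 + 2 / (D + 1) * (- \<theta>))" by (simp only: powr_add)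
        also have "1 + 2 / (D + 1) * (- \<theta>) = 2 / (D + 1)"
          unfolding \<theta>_def using D by (simp add: field_simps)
        finally show ?thesis unfolding Y_def .
      qed
      have Y2: "(Y / 2) powr (- \<theta>) = Y powr (- \<theta>) * 2 powr \<theta>"
        using Y by (simp add: powr_divide powr_minus_divide)
      have "(\<alpha> * \<mu>)\<^sup>2 \<le> a\<^sup>2 * (exp 1 * (2 * (2 * pi) ^ DIM('a) * (Y * \<mu>) +
          poisson_const TYPE('a) * (real N ^ DIM('a) * (Y / 2) powr (- \<theta>)) * \<mu>\<^sup>2))"
        using wave_level_set_duality[OF H N \<alpha> Y] unfolding \<mu>_def a_def \<theta>_def D_def by (simp add: minus_divide_left)
      also have "poisson_const TYPE('a) * (real N ^ DIM('a) * (Y / 2) powr (- \<theta>)) * \<mu>\<^sup>2 =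
          poisson_const TYPE('a) * 2 powr \<theta> * ((M * Y powr (- \<theta>)) * \<mu>)"
        unfolding Y2 M_def power2_eq_square by (simp only: mult_ac)
      also have "a\<^sup>2 * (exp 1 * (2 * (2 * pi) ^ DIM('a) * (Y * \<mu>) + poisson_const TYPE('a) * 2 powr \<theta> * ((M * Y powr (- \<theta>)) * \<mu>)))
          = (C1 * a\<^sup>2 * Y) * \<mu>"
        unfolding MY C1_def by (simp add: algebra_simps)
      finally have "(\<alpha>\<^sup>2 * \<mu>) * \<mu> \<le> (C1 * a\<^sup>2 * Y) * \<mu>" by (simp add: power2_eq_square mult_ac)
      then have "\<alpha>\<^sup>2 * \<mu> \<le> C1 * a\<^sup>2 * Y" using \<mu> by simp
      then have "\<mu> / Y \<le> C1 * (a / \<alpha>)\<^sup>2"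
        using \<alpha> Y by (simp add: field_simps power_divide)
      \<comment> \<open>As \<open>Y\<close> is a power of \<mu> smaller than the first,
        \<open>\<mu> / Y\<close> is still a positive power \<open>1 / \<rho>\<close> of \<mu>,
        corrected by a power of \<open>N\<close>. Raising to the power \<rho> solves for
        \<mu>.\<close>
      moreover have "\<mu> / Y = (\<mu> * real N powr (- (2 * D / (D - 1)))) powr (1 / \<rho>)"
      proof -
        have e1: "1 - 2 / (D + 1) = 1 / \<rho>" unfolding \<rho>_def using D by (simp add: field_simps)
        have e2: "D * (2 / (D + 1)) = (2 * D / (D - 1)) * (1 / \<rho>)"
        proof -
          have "1 / \<rho> = (D - 1) / (D + 1)" unfolding \<rho>_def by simp
          then show ?thesis using D by simp
        qed
        have "Y = real N powr (D * (2 / (D + 1))) * \<mu> powr (2 / (D + 1))"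
          unfolding Y_def M_def using N \<mu> by (simp add: powr_mult D_def powr_realpow[symmetric] powr_powr)
        then have "\<mu> / Y = \<mu> powr 1 / \<mu> powr (2 / (D + 1)) / real N powr (D * (2 / (D + 1)))"
          using \<mu> by simp
        also have "\<dots> = \<mu> powr (1 / \<rho>) * real N powr (- (2 * D / (D - 1)) * (1 / \<rho>))"
          unfolding powr_diff[symmetric] e1 e2 by (simp add: powr_minus_divide)
        also have "\<dots> = (\<mu> * real N powr (- (2 * D / (D - 1)))) powr (1 / \<rho>)"
          using \<mu> by (simp only: powr_mult powr_powr)
        finally show ?thesis .
      qed
      ultimately have "((\<mu> * real N powr (- (2 * D / (D - 1)))) powr (1 / \<rho>)) powr \<rho> \<le> (C1 * (a / \<alpha>)\<^sup>2) powr \<rho>"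
        using \<rho> by (intro powr_mono2) auto
      then have "\<mu> * real N powr (- (2 * D / (D - 1))) \<le> (C1 * (a / \<alpha>)\<^sup>2) powr \<rho>"
        using \<rho> \<mu> N by (simp add: powr_powr)
      also have "\<dots> = C1 powr \<rho> * (a / \<alpha>) powr (2 * (D + 1) / (D - 1))"
      proof -
        have "(a / \<alpha>)\<^sup>2 = (a / \<alpha>) powr 2" using a0 \<alpha> by simp
        then show ?thesis using C1 by (simp add: powr_mult powr_powr \<rho>_def)
      qed
      finally show ?thesis
        using N unfolding \<mu>_def[symmetric] a_def[symmetric] by (simp add: powr_minus_divide field_simps)
    qed
  qed
  show ?thesis by (rule that[of "C1 powr \<rho>"]) (use main in \<open>auto simp: D_def\<close>)
qed

text \<open>Chebyshev's inequality with the maximum over the times replaced by a sum of squares. The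
  loss of the factor \<open>N\<close>, the number of times, is the correct one for the low
  regime.\<close>

lemma wave_level_set_L2:
  fixes H :: "'a::euclidean_space \<Rightarrow> complex"
  assumes H: "band_limited R H" and \<alpha>: "\<alpha> > 0"
  shows "measure lborel (wave_level_set N H \<alpha>) \<le> (2 * pi) ^ DIM('a) * (real N * (l2norm H / \<alpha>)\<^sup>2)"
proof -
  let ?L = "lborel :: 'a measure" and ?E = "wave_level_set N H \<alpha>"
  have Hi: "integrable ?L H" and H2: "integrable ?L (\<lambda>\<xi>. (norm (H \<xi>))\<^sup>2)"
    using H unfolding band_limited_def by auto
  let ?u = "\<lambda>k. half_wave (real k / real N) H"
  have u: "integrable ?L (\<lambda>x. (norm (?u k x))\<^sup>2)"
    "(LINT x|?L. (norm (?u k x))\<^sup>2) \<le> (2 * pi) ^ DIM('a) * (l2norm H)\<^sup>2" for k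
  proof -
    have s: "integrable ?L (\<lambda>\<xi>. (norm (cis (real k / real N * norm \<xi>) * H \<xi>))\<^sup>2)"
      using H2 by (simp add: norm_mult)
    show "integrable ?L (\<lambda>x. (norm (?u k x))\<^sup>2)"
      unfolding half_wave_def by (rule bessel_ft_integrable(1)[OF integrable_half_wave[OF Hi] s])
    show "(LINT x|?L. (norm (?u k x))\<^sup>2) \<le> (2 * pi) ^ DIM('a) * (l2norm H)\<^sup>2"
      using bessel_ft_integrable(2)[OF integrable_half_wave[OF Hi] s] unfolding half_wave_def l2norm_sq
      by (simp add: norm_mult)
  qed
  have Em: "?E \<in> sets ?L" using wave_level_set_measurable[OF Hi] by simp
  have Ei: "integrable ?L (indicator ?E :: 'a \<Rightarrow> real)"
    using Em emeasure_wave_level_set_finite by (intro integrable_real_indicator) auto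
  have "\<alpha>\<^sup>2 * measure ?L ?E = (LINT x|?L. \<alpha>\<^sup>2 * indicator ?E x)" using Em by simp
  also have "\<dots> \<le> (LINT x|?L. (\<Sum>k<N. (norm (?u k x))\<^sup>2))"
  proof (rule integral_mono)
    show "\<alpha>\<^sup>2 * indicator ?E x \<le> (\<Sum>k<N. (norm (?u k x))\<^sup>2)" for x
    proof (cases "x \<in> ?E")
      case True
      then obtain k where k: "k < N" "norm (?u k x) > \<alpha>" unfolding wave_level_set_def by auto
      have "\<alpha>\<^sup>2 \<le> (norm (?u k x))\<^sup>2" using k \<alpha> by (intro power_mono) auto
      also have "\<dots> \<le> (\<Sum>k<N. (norm (?u k x))\<^sup>2)" using k by (intro member_le_sum) auto
      finally show ?thesis using True by simp
    qed (simp add: sum_nonneg)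
  qed (use u Ei in \<open>auto intro!: integrable_mult_right Bochner_Integration.integrable_sum\<close>)
  also have "\<dots> = (\<Sum>k<N. LINT x|?L. (norm (?u k x))\<^sup>2)"
    by (rule Bochner_Integration.integral_sum) (rule u)
  also have "\<dots> \<le> (\<Sum>k<N. (2 * pi) ^ DIM('a) * (l2norm H)\<^sup>2)" by (intro sum_mono u)
  finally show ?thesis using \<alpha> by (simp add: field_simps power_divide)
qed

text \<open>Cauchy-Schwarz on the frequency ball of radius \<open>R\<close>; the square root of its
  volume is the factor \<open>R powr (d / 2)\<close>.\<close>

lemma norm_half_wave_le_l2:
  fixes H :: "'a::euclidean_space \<Rightarrow> complex"
  assumes H: "band_limited R H" and R: "R > 0"
  shows "norm (half_wave t H x) \<le> sqrt (measure lborel (cball (0::'a) 1)) * (R powr (real DIM('a) / 2) * l2norm H)"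
proof -
  let ?L = "lborel :: 'a measure"
  have Hi: "integrable ?L H" and H2: "integrable ?L (\<lambda>\<xi>. (norm (H \<xi>))\<^sup>2)"
    and Hs: "\<And>\<xi>. norm \<xi> > R \<Longrightarrow> H \<xi> = 0"
    using H unfolding band_limited_def by auto
  have [measurable]: "H \<in> borel_measurable borel" using borel_measurable_integrable[OF Hi] by simp
  let ?i = "indicator (cball (0::'a) R) :: 'a \<Rightarrow> real"
  have i2: "(\<lambda>\<xi>. (?i \<xi>)\<^sup>2) = ?i" by (auto simp: indicator_def)
  have ii: "integrable ?L ?i" by (intro integrable_real_indicator) (use emeasure_bounded_finite[OF bounded_cball, of "0::'a" R] in auto)
  have "norm (half_wave t H x) \<le> (LINT \<xi>|?L. \<bar>norm (H \<xi>) * ?i \<xi>\<bar>)"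
  proof -
    have "(LINT \<xi>|?L. norm (H \<xi>)) = (LINT \<xi>|?L. \<bar>norm (H \<xi>) * ?i \<xi>\<bar>)"
      by (rule Bochner_Integration.integral_cong) (use Hs in \<open>auto simp: indicator_def\<close>)
    then show ?thesis using norm_half_wave_le[OF Hi, of t x] by simp
  qed
  also have "\<dots> \<le> sqrt ((LINT \<xi>|?L. (norm (H \<xi>))\<^sup>2) * (LINT \<xi>|?L. (?i \<xi>)\<^sup>2))"
    by (rule real_le_rsqrt, rule cauchy_schwarz_integral) (use H2 ii i2 in auto)
  also have "(LINT \<xi>|?L. (?i \<xi>)\<^sup>2) = measure lborel (cball (0::'a) R)" unfolding i2 by simp
  also have "\<dots> = R powr real DIM('a) * measure lborel (cball (0::'a) 1)"
    using content_cball[of R "0::'a"] content_cball[of 1 "0::'a"] R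
    by (simp add: powr_realpow mult.commute)
  also have "sqrt ((LINT \<xi>|?L. (norm (H \<xi>))\<^sup>2) * (R powr real DIM('a) * measure lborel (cball (0::'a) 1))) =
      sqrt (measure lborel (cball (0::'a) 1)) * (R powr (real DIM('a) / 2) * l2norm H)"
    unfolding l2norm_def real_sqrt_mult using R by (simp add: powr_half_sqrt[symmetric] powr_powr)
  finally show ?thesis .
qed

section \<open>Summation of weak type estimates\<close>

text \<open>Replace every \<open>a i\<close> by the largest one. This does the work of Hoelder's
  inequality for all \<open>q > 0\<close> at once, without a dual exponent.\<close>

lemma sum_mult_powr_le:
  fixes w a :: "'i \<Rightarrow> real"
  assumes I: "finite I" and w: "\<And>i. i \<in> I \<Longrightarrow> w i \<ge> 0" and a: "\<And>i. i \<in> I \<Longrightarrow> a i \<ge> 0" and q: "q > 0"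
  shows "(\<Sum>i\<in>I. w i * a i) powr q \<le> (\<Sum>i\<in>I. w i) powr q * (\<Sum>i\<in>I. a i powr q)"
proof (cases "I = {}")
  case False
  define m where "m = Max (a ` I)"
  have "m \<in> a ` I" unfolding m_def using I False by (intro Max_in) auto
  then obtain i0 where i0: "i0 \<in> I" "m = a i0" by auto
  have le: "a i \<le> m" if "i \<in> I" for i unfolding m_def using I that by simp
  have m0: "m \<ge> 0" using i0 a by simp
  have "(\<Sum>i\<in>I. w i * a i) \<le> (\<Sum>i\<in>I. w i * m)" by (intro sum_mono mult_left_mono le w)
  also have "\<dots> = (\<Sum>i\<in>I. w i) * m" by (simp add: sum_distrib_right)
  finally have "(\<Sum>i\<in>I. w i * a i) powr q \<le> ((\<Sum>i\<in>I. w i) * m) powr q"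
    using q by (intro powr_mono2) (auto intro!: sum_nonneg mult_nonneg_nonneg w a)
  also have "\<dots> = (\<Sum>i\<in>I. w i) powr q * m powr q"
    by (rule powr_mult)
  also have "m powr q \<le> (\<Sum>i\<in>I. a i powr q)"
    unfolding i0 using I i0 by (intro member_le_sum) auto
  finally show ?thesis by (simp add: mult_left_mono)
qed simp

lemma powr_mult_powr_le_add:
  fixes x y :: real
  assumes "x \<ge> 0" "y \<ge> 0" "0 < \<theta>" "\<theta> < 1"
  shows "x powr \<theta> * y powr (1 - \<theta>) \<le> x + y"
proof -
  define m where "m = max x y"
  have "x powr \<theta> * y powr (1 - \<theta>) \<le> m powr \<theta> * m powr (1 - \<theta>)"
    using assms unfolding m_def by (intro mult_mono powr_mono2) auto
  also have "\<dots> = m powr 1" by (simp flip: powr_add)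
  also have "\<dots> = m" using assms unfolding m_def by simp
  also have "\<dots> \<le> x + y" using assms unfolding m_def by simp
  finally show ?thesis .
qed

text \<open>Normalise by \<open>U\<close> and \<open>V\<close> and apply
  \<open>powr_mult_powr_le_add\<close> pointwise. The factor 2 is the price of that crude form of
  Young's inequality; if \<open>U\<close> or \<open>V\<close> vanishes, so does the integrand almost
  everywhere.\<close>

lemma holder_nn_integral:
  fixes u v :: "'a \<Rightarrow> real"
  assumes [measurable]: "u \<in> borel_measurable M" "v \<in> borel_measurable M"
    and u0: "\<And>x. u x \<ge> 0" and v0: "\<And>x. v x \<ge> 0"
    and U: "(\<integral>\<^sup>+x. ennreal (u x) \<partial>M) \<le> ennreal U" "U \<ge> 0"
    and V: "(\<integral>\<^sup>+x. ennreal (v x) \<partial>M) \<le> ennreal V" "V \<ge> 0"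
    and \<theta>: "0 < \<theta>" "\<theta> < 1"
  shows "(\<integral>\<^sup>+x. ennreal (u x powr \<theta> * v x powr (1 - \<theta>)) \<partial>M) \<le> ennreal (2 * (U powr \<theta> * V powr (1 - \<theta>)))"
proof (cases "U = 0 \<or> V = 0")
  case True
  have "AE x in M. u x powr \<theta> * v x powr (1 - \<theta>) = 0"
  proof (cases "U = 0")
    case True
    then have "(\<integral>\<^sup>+x. ennreal (u x) \<partial>M) = 0" using U by simp
    then have "AE x in M. ennreal (u x) = 0" by (subst (asm) nn_integral_0_iff_AE) auto
    then show ?thesis by eventually_elim (use u0 in \<open>auto simp: ennreal_eq_0_iff antisym\<close>)
  next
    case False
    then have "(\<integral>\<^sup>+x. ennreal (v x) \<partial>M) = 0" using V True by simp
    then have "AE x in M. ennreal (v x) = 0" by (subst (asm) nn_integral_0_iff_AE) auto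
    then show ?thesis by eventually_elim (use v0 in \<open>auto simp: ennreal_eq_0_iff antisym\<close>)
  qed
  then have "(\<integral>\<^sup>+x. ennreal (u x powr \<theta> * v x powr (1 - \<theta>)) \<partial>M) = (\<integral>\<^sup>+x. 0 \<partial>M)"
    by (intro nn_integral_cong_AE) (auto elim: eventually_mono)
  then show ?thesis by simp
next
  case False
  then have UV: "U > 0" "V > 0" using U V by auto
  define c where "c = U powr \<theta> * V powr (1 - \<theta>)"
  have c: "c > 0" unfolding c_def using UV by simp
  have pw: "u x powr \<theta> * v x powr (1 - \<theta>) \<le> c / U * u x + c / V * v x" for x
  proof -
    have "(u x / U) powr \<theta> * (v x / V) powr (1 - \<theta>) \<le> u x / U + v x / V"
      using u0 v0 UV \<theta> by (intro powr_mult_powr_le_add) auto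
    then have "c * ((u x / U) powr \<theta> * (v x / V) powr (1 - \<theta>)) \<le> c * (u x / U + v x / V)"
      using c by (intro mult_left_mono) auto
    moreover have "c * ((u x / U) powr \<theta> * (v x / V) powr (1 - \<theta>)) = u x powr \<theta> * v x powr (1 - \<theta>)"
      unfolding c_def powr_divide using UV by simp
    ultimately show ?thesis by (simp add: distrib_left mult.commute)
  qed
  have "(\<integral>\<^sup>+x. ennreal (u x powr \<theta> * v x powr (1 - \<theta>)) \<partial>M) \<le>
      (\<integral>\<^sup>+x. ennreal (c / U) * ennreal (u x) + ennreal (c / V) * ennreal (v x) \<partial>M)"
    using pw c UV u0 v0 by (intro nn_integral_mono) (simp add: ennreal_mult[symmetric] ennreal_plus[symmetric] del: ennreal_plus)
  also have "\<dots> = ennreal (c / U) * (\<integral>\<^sup>+x. ennreal (u x) \<partial>M) + ennreal (c / V) * (\<integral>\<^sup>+x. ennreal (v x) \<partial>M)"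
    by (subst nn_integral_add) (auto simp: nn_integral_cmult)
  also have "\<dots> \<le> ennreal (c / U) * ennreal U + ennreal (c / V) * ennreal V"
    by (intro add_mono mult_left_mono U V) auto
  also have "\<dots> = ennreal (2 * c)"
    using c UV by (simp add: ennreal_mult[symmetric] ennreal_plus[symmetric] del: ennreal_plus)
  finally show ?thesis unfolding c_def .
qed

section \<open>Strong bounds between two weak type bounds\<close>

lemma suminf_ennreal_geometric:
  assumes "c \<ge> 0" "0 \<le> r" "r < 1"
  shows "(\<Sum>n. ennreal (c * r ^ n)) = ennreal (c / (1 - r))"
proof (rule suminf_ennreal_eq)
  have "(\<lambda>n. c * r ^ n) sums (c * (1 / (1 - r)))"
    using assms by (intro sums_mult geometric_sums) auto
  then show "(\<lambda>n. c * r ^ n) sums (c / (1 - r))" by simp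
qed (use assms in auto)

lemma nth_le_suminf_ennreal: "f n \<le> (\<Sum>n. f n :: ennreal)"
  using sum_le_suminf[OF summableI, of "{n}" f] by simp

text \<open>One dyadic shell contains \<open>G\<close>, and its term alone dominates. Shells above
  and below 1 are kept in separate series because a different weak type bound is used for
  each.\<close>

lemma dyadic_majorant:
  fixes G :: real
  assumes G: "G > 0" and p: "p > 0"
  shows "ennreal (G powr p) \<le>
    (\<Sum>n. ennreal (2 powr (real (Suc n) * p)) * indicator {2 ^ n<..} G) +
    (\<Sum>n. ennreal (2 powr (- real n * p)) * indicator {1 / 2 ^ Suc n<..} G)"
proof (cases "G > 1")
  case True
  obtain k where "G < 2 ^ k" using real_arch_pow[of 2 G] by auto
  then have ex: "\<exists>k. G \<le> 2 ^ k" by (auto intro: less_imp_le)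
  define k where "k = (LEAST k. G \<le> 2 ^ k)"
  have k: "G \<le> 2 ^ k" unfolding k_def by (rule LeastI_ex[OF ex])
  then obtain n where n: "k = Suc n" using True by (cases k) auto
  have "\<not> G \<le> 2 ^ n" using not_less_Least[of n "\<lambda>k. G \<le> 2 ^ k"] n unfolding k_def by auto
  then have "G \<in> {2 ^ n<..}" by auto
  have "G powr p \<le> (2 ^ Suc n) powr p" using k n G p by (intro powr_mono2) auto
  also have "\<dots> = 2 powr (real (Suc n) * p)" by (subst powr_realpow[symmetric]) (simp_all add: powr_powr)
  finally have "ennreal (G powr p) \<le> ennreal (2 powr (real (Suc n) * p)) * indicator {2 ^ n<..} G"
    using \<open>G \<in> {2 ^ n<..}\<close> by (simp add: ennreal_leI)
  also have "\<dots> \<le> (\<Sum>n. ennreal (2 powr (real (Suc n) * p)) * indicator {2 ^ n<..} G)"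
    by (rule nth_le_suminf_ennreal[of "\<lambda>n. ennreal (2 powr (real (Suc n) * p)) * indicator {2 ^ n<..} G"])
  finally show ?thesis by (rule order_trans) simp
next
  case False
  obtain k where "(1 / 2) ^ k < G" using real_arch_pow_inv[OF G, of "1 / 2"] by auto
  then have ex: "\<exists>k. 1 / 2 ^ k < G" by (auto simp: power_one_over)
  define k where "k = (LEAST k. 1 / 2 ^ k < G)"
  have k: "1 / 2 ^ k < G" unfolding k_def by (rule LeastI_ex[OF ex])
  then obtain n where n: "k = Suc n" using False by (cases k) auto
  have "\<not> 1 / 2 ^ n < G" using not_less_Least[of n "\<lambda>k. 1 / 2 ^ k < G"] n unfolding k_def by auto
  then have le: "G \<le> 1 / 2 ^ n" by simp
  have "G powr p \<le> (1 / 2 ^ n) powr p" using le G p by (intro powr_mono2) auto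
  also have "(1 / 2 ^ n) = (2::real) powr (- real n)" by (simp add: powr_minus_divide powr_realpow)
  also have "\<dots> powr p = 2 powr (- real n * p)" by (simp add: powr_powr)
  finally have "ennreal (G powr p) \<le> ennreal (2 powr (- real n * p)) * indicator {1 / 2 ^ Suc n<..} G"
    using k n by (simp add: ennreal_leI)
  also have "\<dots> \<le> (\<Sum>n. ennreal (2 powr (- real n * p)) * indicator {1 / 2 ^ Suc n<..} G)"
    by (rule nth_le_suminf_ennreal[of "\<lambda>n. ennreal (2 powr (- real n * p)) * indicator {1 / 2 ^ Suc n<..} G"])
  finally show ?thesis by (rule order_trans) simp
qed

lemma strong_type_of_weak_type:
  fixes F :: "'a \<Rightarrow> real"
  assumes Fm [measurable]: "F \<in> borel_measurable M" and F0: "\<And>x. F x \<ge> 0"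
    and h: "h \<ge> 0" and W: "W \<ge> 0" and p: "0 < p0" "p0 < p" "p < p1"
    and w0: "\<And>\<alpha>. \<alpha> > 0 \<Longrightarrow> emeasure M {x \<in> space M. F x > \<alpha>} \<le> ennreal (W * (h / \<alpha>) powr p0)"
    and w1: "\<And>\<alpha>. \<alpha> > 0 \<Longrightarrow> emeasure M {x \<in> space M. F x > \<alpha>} \<le> ennreal (W * (h / \<alpha>) powr p1)"
  shows "(\<integral>\<^sup>+x. ennreal (F x powr p) \<partial>M) \<le>
    ennreal ((2 powr p / (1 - 2 powr (p - p1)) + 2 powr p0 / (1 - 2 powr (p0 - p))) * (W * h powr p))"
proof (cases "h = 0")
  case True
  have "AE x in M. F x \<le> inverse (real (Suc n))" for n
  proof (rule AE_I)
    show "{x \<in> space M. \<not> F x \<le> inverse (real (Suc n))} \<subseteq> {x \<in> space M. F x > inverse (real (Suc n))}" by auto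
    show "emeasure M {x \<in> space M. F x > inverse (real (Suc n))} = 0"
      using w0[of "inverse (real (Suc n))"] True by simp
  qed measurable
  then have "AE x in M. \<forall>n. F x \<le> inverse (real (Suc n))" by (simp add: AE_all_countable)
  then have "AE x in M. F x powr p = 0"
  proof eventually_elim
    case (elim x)
    have "F x \<le> 0" by (rule LIMSEQ_le_const[OF LIMSEQ_inverse_real_of_nat]) (use elim in blast)
    then show ?case using F0[of x] by simp
  qed
  then have "(\<integral>\<^sup>+x. ennreal (F x powr p) \<partial>M) = (\<integral>\<^sup>+x. 0 \<partial>M)"
    by (intro nn_integral_cong_AE) (auto elim: eventually_mono)
  then show ?thesis by simp
next
  case False
  then have h: "h > 0" using h by simp
  let ?c1 = "2 powr p / (1 - 2 powr (p - p1))" and ?c2 = "2 powr p0 / (1 - 2 powr (p0 - p))"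
  have r1: "2 powr (p - p1) < 1" using p by (simp add: powr_less_one)
  have r2: "2 powr (p0 - p) < 1" using p by (simp add: powr_less_one)
  have hp: "h powr p \<ge> 0" by simp
  have set1: "indicator {c<..} (F x / h) = (indicator {x \<in> space M. F x > c * h} x :: ennreal)"
    if "x \<in> space M" for c x
    using that h by (auto simp: indicator_def pos_less_divide_eq)
  have "(\<integral>\<^sup>+x. ennreal (F x powr p) \<partial>M) \<le>
    (\<integral>\<^sup>+x. (\<Sum>n. ennreal (h powr p * 2 powr (real (Suc n) * p)) * indicator {x \<in> space M. F x > 2 ^ n * h} x) +
          (\<Sum>n. ennreal (h powr p * 2 powr (- real n * p)) * indicator {x \<in> space M. F x > 1 / 2 ^ Suc n * h} x) \<partial>M)"
  proof (rule nn_integral_mono)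
    fix x assume x: "x \<in> space M"
    show "ennreal (F x powr p) \<le> (\<Sum>n. ennreal (h powr p * 2 powr (real (Suc n) * p)) * indicator {x \<in> space M. F x > 2 ^ n * h} x) +
          (\<Sum>n. ennreal (h powr p * 2 powr (- real n * p)) * indicator {x \<in> space M. F x > 1 / 2 ^ Suc n * h} x)"
    proof (cases "F x = 0")
      case False
      then have G: "F x / h > 0" using F0[of x] h by simp
      have p': "p > 0" using p by simp
      have "ennreal (F x powr p) = ennreal (h powr p) * ennreal ((F x / h) powr p)"
        using h by (simp add: ennreal_mult[symmetric] powr_divide)
      also have "\<dots> \<le> ennreal (h powr p) * ((\<Sum>n. ennreal (2 powr (real (Suc n) * p)) * indicator {2 ^ n<..} (F x / h)) +
          (\<Sum>n. ennreal (2 powr (- real n * p)) * indicator {1 / 2 ^ Suc n<..} (F x / h)))"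
        by (rule mult_left_mono[OF dyadic_majorant[OF G p']]) simp
      also have "\<dots> = (\<Sum>n. ennreal (h powr p * 2 powr (real (Suc n) * p)) * indicator {x \<in> space M. F x > 2 ^ n * h} x) +
          (\<Sum>n. ennreal (h powr p * 2 powr (- real n * p)) * indicator {x \<in> space M. F x > 1 / 2 ^ Suc n * h} x)"
        unfolding distrib_left ennreal_suminf_cmult[symmetric] set1[OF x] ennreal_mult[OF hp powr_ge_zero] mult.assoc ..
      finally show ?thesis .
    qed (use p in simp)
  qed
  also have "\<dots> = (\<Sum>n. ennreal (h powr p * 2 powr (real (Suc n) * p)) * emeasure M {x \<in> space M. F x > 2 ^ n * h}) +
      (\<Sum>n. ennreal (h powr p * 2 powr (- real n * p)) * emeasure M {x \<in> space M. F x > 1 / 2 ^ Suc n * h})"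
    by (subst nn_integral_add) (simp_all add: nn_integral_suminf nn_integral_cmult_indicator del: power_Suc)
  also have "\<dots> \<le> (\<Sum>n. ennreal (W * h powr p * 2 powr p * (2 powr (p - p1)) ^ n)) +
      (\<Sum>n. ennreal (W * h powr p * 2 powr p0 * (2 powr (p0 - p)) ^ n))"
  proof (intro add_mono suminf_le summableI allI)
    fix n
    have e: "(h / (2 ^ n * h)) powr p1 = 2 powr (- real n * p1)"
    proof -
      have "h / (2 ^ n * h) = 2 powr (- real n)" using h by (simp add: powr_minus_divide powr_realpow)
      then show ?thesis by (simp add: powr_powr)
    qed
    have "ennreal (h powr p * 2 powr (real (Suc n) * p)) * emeasure M {x \<in> space M. F x > 2 ^ n * h} \<le>
        ennreal (h powr p * 2 powr (real (Suc n) * p)) * ennreal (W * (h / (2 ^ n * h)) powr p1)"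
      by (intro mult_left_mono w1) (use h in auto)
    also have "\<dots> = ennreal (W * h powr p * (2 powr (real (Suc n) * p) * 2 powr (- real n * p1)))"
      unfolding e using W by (simp add: ennreal_mult[symmetric] mult_ac)
    also have "2 powr (real (Suc n) * p) * 2 powr (- real n * p1) = 2 powr p * (2 powr (p - p1)) ^ n"
      by (simp add: powr_realpow[symmetric] powr_powr powr_add[symmetric] algebra_simps)
    finally show "ennreal (h powr p * 2 powr (real (Suc n) * p)) * emeasure M {x \<in> space M. F x > 2 ^ n * h} \<le>
        ennreal (W * h powr p * 2 powr p * (2 powr (p - p1)) ^ n)" by (simp add: mult.assoc)
  next
    fix n
    have e: "(h / (1 / 2 ^ Suc n * h)) powr p0 = 2 powr (real (Suc n) * p0)"
    proof -
      have "h / (1 / 2 ^ Suc n * h) = 2 powr (real (Suc n))" using h by (subst powr_realpow) auto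
      then show ?thesis by (simp only: powr_powr)
    qed
    have "ennreal (h powr p * 2 powr (- real n * p)) * emeasure M {x \<in> space M. F x > 1 / 2 ^ Suc n * h} \<le>
        ennreal (h powr p * 2 powr (- real n * p)) * ennreal (W * (h / (1 / 2 ^ Suc n * h)) powr p0)"
      by (intro mult_left_mono w0) (use h in auto)
    also have "\<dots> = ennreal (W * h powr p * (2 powr (- real n * p) * 2 powr (real (Suc n) * p0)))"
      unfolding e using W by (simp add: ennreal_mult[symmetric] mult_ac)
    also have "2 powr (- real n * p) * 2 powr (real (Suc n) * p0) = 2 powr p0 * (2 powr (p0 - p)) ^ n"
      by (simp add: powr_realpow[symmetric] powr_powr powr_add[symmetric] algebra_simps)
    finally show "ennreal (h powr p * 2 powr (- real n * p)) * emeasure M {x \<in> space M. F x > 1 / 2 ^ Suc n * h} \<le>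
        ennreal (W * h powr p * 2 powr p0 * (2 powr (p0 - p)) ^ n)" by (simp add: mult.assoc)
  qed
  also have "\<dots> = ennreal (W * h powr p * 2 powr p / (1 - 2 powr (p - p1))) + ennreal (W * h powr p * 2 powr p0 / (1 - 2 powr (p0 - p)))"
    using W r1 r2 by (simp only: suminf_ennreal_geometric mult_nonneg_nonneg powr_ge_zero)
  also have "\<dots> = ennreal ((?c1 + ?c2) * (W * h powr p))"
    using W r1 r2 by (subst ennreal_plus[symmetric]) (simp_all add: algebra_simps)
  finally show ?thesis .
qed

section \<open>Summation over dyadic scales\<close>

lemma sum_two_sided_geometric:
  fixes r :: real
  assumes r: "0 < r" "r < 1"
  shows "(\<Sum>j<J. r powr \<bar>real j - real m\<bar>) \<le> 2 / (1 - r)"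
proof -
  have g: "(\<Sum>i\<in>I. r ^ i) \<le> 1 / (1 - r)" if "finite I" for I
    using sum_le_suminf[OF summable_geometric, of r I] that r by (simp add: suminf_geometric)
  have "(\<Sum>j<J. r powr \<bar>real j - real m\<bar>) \<le> (\<Sum>j\<in>{..m} \<union> {m..<J}. r powr \<bar>real j - real m\<bar>)"
    by (intro sum_mono2) auto
  also have "\<dots> \<le> (\<Sum>j\<in>{..m}. r powr \<bar>real j - real m\<bar>) + (\<Sum>j\<in>{m..<J}. r powr \<bar>real j - real m\<bar>)"
    by (subst sum_Un) (auto intro!: sum_nonneg)
  also have "(\<Sum>j\<in>{..m}. r powr \<bar>real j - real m\<bar>) = (\<Sum>j\<in>{..m}. r ^ (m - j))"
    using r by (intro sum.cong refl) (auto simp: powr_realpow[symmetric] of_nat_diff)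
  also have "\<dots> = (\<Sum>i\<in>{..m}. r ^ i)"
    by (rule sum.reindex_bij_witness[where i = "\<lambda>j. m - j" and j = "\<lambda>j. m - j"]) auto
  also have "(\<Sum>j\<in>{m..<J}. r powr \<bar>real j - real m\<bar>) = (\<Sum>j\<in>{m..<J}. r ^ (j - m))"
    using r by (intro sum.cong refl) (auto simp: powr_realpow[symmetric] of_nat_diff)
  also have "\<dots> = (\<Sum>i\<in>{0..<J - m}. r ^ i)"
    by (subst sum.atLeastLessThan_shift_0) simp
  finally show ?thesis using g[of "{..m}"] g[of "{0..<J - m}"] by simp
qed

text \<open>If the maximum of the \<open>F j\<close> is attained at \<open>m\<close>, then
  \<open>F j \<le> sqrt (F j * F m)\<close>, and a geometric weight in \<open>|j - m|\<close> makes the sum over \<open>j\<close> converge.\<close>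

lemma sum_powr_le_pairs:
  fixes F :: "nat \<Rightarrow> real"
  assumes F0: "\<And>j. F j \<ge> 0" and q: "q > 0" and \<epsilon>: "\<epsilon> > 0"
  shows "(\<Sum>j<J. F j) powr q \<le> (2 / (1 - 2 powr (- (\<epsilon> / q)))) powr q *
    (\<Sum>j<J. \<Sum>m<J. 2 powr (\<epsilon> * \<bar>real j - real m\<bar>) * (F j * F m) powr (q / 2))"
proof (cases "J = 0")
  case False
  \<comment> \<open>Chosen so that removing the weight costs
    \<open>(r powr (- t)) powr q = 2 powr (\<epsilon> * t)\<close>, the loss that appears in the
    statement.\<close>
  define r where "r = 2 powr (- (\<epsilon> / q))"
  have r: "0 < r" "r < 1" unfolding r_def using \<epsilon> q by (auto simp: powr_less_one)
  have "Max (F ` {..<J}) \<in> F ` {..<J}" using False by (intro Max_in) auto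
  then obtain m where m: "m < J" "F m = Max (F ` {..<J})" by auto
  have le: "F j \<le> F m" if "j < J" for j unfolding m using that by simp
  define t where "t j = \<bar>real j - real m\<bar>" for j
  have "(\<Sum>j<J. F j) = (\<Sum>j<J. r powr t j * (r powr (- t j) * F j))"
    using r by (intro sum.cong refl) (simp add: powr_minus_divide)
  also have "\<dots> powr q \<le> (\<Sum>j<J. r powr t j) powr q * (\<Sum>j<J. (r powr (- t j) * F j) powr q)"
    by (rule sum_mult_powr_le) (use F0 q in auto)
  also have "\<dots> \<le> (2 / (1 - r)) powr q * (\<Sum>j<J. 2 powr (\<epsilon> * t j) * (F j * F m) powr (q / 2))"
  proof (intro mult_mono sum_mono)
    show "(\<Sum>j<J. r powr t j) powr q \<le> (2 / (1 - r)) powr q"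
      unfolding t_def using r q by (intro powr_mono2 sum_two_sided_geometric) (auto intro!: sum_nonneg)
    fix j assume "j \<in> {..<J}"
    then have "F j * F j \<le> F j * F m" using le F0 by (intro mult_left_mono) auto
    then have "(F j * F j) powr (q / 2) \<le> (F j * F m) powr (q / 2)" using q F0 by (intro powr_mono2) auto
    moreover have "(F j * F j) powr (q / 2) = F j powr q"
      by (simp add: powr_mult powr_add[symmetric])
    moreover have "(r powr (- t j)) powr q = 2 powr (\<epsilon> * t j)"
      unfolding r_def powr_powr using q by simp
    ultimately show "(r powr (- t j) * F j) powr q \<le> 2 powr (\<epsilon> * t j) * (F j * F m) powr (q / 2)"
      by (simp add: powr_mult mult_left_mono)
  qed (auto intro!: sum_nonneg)
  also have "(\<Sum>j<J. 2 powr (\<epsilon> * t j) * (F j * F m) powr (q / 2)) \<le>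
      (\<Sum>j<J. \<Sum>m<J. 2 powr (\<epsilon> * \<bar>real j - real m\<bar>) * (F j * F m) powr (q / 2))"
    unfolding t_def by (intro sum_mono member_le_sum) (use m in auto)
  finally show ?thesis unfolding r_def by (simp add: mult_left_mono)
qed (use q in simp)

text \<open>The two weak type bounds give strong bounds at exponents slightly above and slightly
  below \<open>q\<close>. For two pieces at scales \<open>j \<le> m\<close> the larger exponent is
  put on \<open>F j\<close> and the smaller one on \<open>F m\<close>. The factors
  \<open>2 powr (- \<kappa> * j)\<close> and \<open>2 powr (- \<kappa> * m)\<close> then enter with
  unequal weights, which gains \<open>2 powr (- \<kappa> * \<delta> * (m - j))\<close> over the
  symmetric splitting. This beats the loss in \<open>sum_powr_le_pairs\<close>. The constant is the
  same for all \<open>F\<close>, \<open>M\<close>, \<open>h\<close> and \<open>J\<close>.\<close>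

lemma weak_type_summation:
  fixes \<kappa> p0 p1 q K0 :: real
  assumes \<kappa>: "\<kappa> > 0" and p: "0 < p0" "p0 < q" "q < p1" and K0: "K0 \<ge> 0"
  obtains C where "C \<ge> 0" and
    "\<And>(F :: nat \<Rightarrow> 'a \<Rightarrow> real) M h J.
      (\<And>j. F j \<in> borel_measurable M) \<Longrightarrow> (\<And>j x. F j x \<ge> 0) \<Longrightarrow> (\<And>j. h j \<ge> 0) \<Longrightarrow>
      (\<And>j \<alpha> p. \<alpha> > 0 \<Longrightarrow> p \<in> {p0, p1} \<Longrightarrow>
        emeasure M {x \<in> space M. F j x > \<alpha>} \<le> ennreal (K0 * 2 powr (- \<kappa> * real j) * (h j / \<alpha>) powr p)) \<Longrightarrow>
      (\<integral>\<^sup>+x. ennreal ((\<Sum>j<J. F j x) powr q) \<partial>M) \<le> ennreal (C * (\<Sum>j<J. 2 powr (- \<kappa> * real j) * h j powr q))"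
proof -
  \<comment> \<open>Half of the smaller gap between \<open>1 / q\<close> and the reciprocals of the
    endpoints, so that \<open>1 / q - \<eta>\<close> and \<open>1 / q + \<eta>\<close> both stay
    strictly between these reciprocals.\<close>
  define \<eta> where "\<eta> = min (1 / p0 - 1 / q) (1 / q - 1 / p1) / 2"
  have q: "q > 0" using p by simp
  have "1 / p0 - 1 / q > 0" "1 / q - 1 / p1 > 0" using p by (auto simp: frac_less2)
  then have \<eta>: "\<eta> > 0" "\<eta> < 1 / p0 - 1 / q" "\<eta> < 1 / q - 1 / p1" unfolding \<eta>_def by auto
  have ip1: "1 / p1 > 0" using p by simp
  define pp where "pp = 1 / (1 / q - \<eta>)"
  define pm where "pm = 1 / (1 / q + \<eta>)"
  have iq: "1 / q - \<eta> > 0" using \<eta> ip1 by linarith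
  have iq': "1 / q + \<eta> > 0" using \<eta> q by (simp add: add_pos_pos)
  have pp: "p0 < pp" "pp < p1"
  proof -
    have "1 / p1 < 1 / q - \<eta>" using \<eta> by linarith
    then have "1 / (1 / q - \<eta>) < 1 / (1 / p1)" by (rule divide_strict_left_mono) (rule zero_less_one, rule mult_pos_pos[OF iq ip1])
    then show "pp < p1" unfolding pp_def by simp
    have "1 / q - \<eta> < 1 / p0" using \<eta> p q \<open>1 / p0 - 1 / q > 0\<close> by linarith
    then have "1 / (1 / p0) < 1 / (1 / q - \<eta>)" using iq p by (intro divide_strict_left_mono) auto
    then show "p0 < pp" unfolding pp_def by simp
  qed
  have pm: "p0 < pm" "pm < p1"
  proof -
    have "1 / q + \<eta> < 1 / p0" using \<eta> by linarith
    then have "1 / (1 / p0) < 1 / (1 / q + \<eta>)" using iq' p by (intro divide_strict_left_mono) auto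
    then show "p0 < pm" unfolding pm_def by simp
    have "1 / p1 < 1 / q + \<eta>" using \<eta> \<open>1 / q - 1 / p1 > 0\<close> by linarith
    then have "1 / (1 / q + \<eta>) < 1 / (1 / p1)" by (rule divide_strict_left_mono) (rule zero_less_one, rule mult_pos_pos[OF iq' ip1])
    then show "pm < p1" unfolding pm_def by simp
  qed
  \<comment> \<open>Forced by the requirement that the Hoelder weight \<theta> satisfies
    \<open>pp * \<theta> = q / 2\<close>; the same value gives
    \<open>pm * (1 - \<theta>) = q / 2\<close>.\<close>
  define \<delta> where "\<delta> = q * \<eta> / 2"
  define \<theta> where "\<theta> = 1 / 2 - \<delta>"
  have \<delta>: "\<delta> > 0" unfolding \<delta>_def using q \<eta> by simp
  have "q * \<eta> < 1"
    using mult_strict_left_mono[OF _ q, of \<eta> "1 / q"] iq q by simp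
  then have \<theta>: "0 < \<theta>" "\<theta> < 1" unfolding \<theta>_def using \<delta> by (auto simp: \<delta>_def)
  have ppt: "pp * \<theta> = q / 2"
  proof -
    have "\<theta> = (q / 2) * (1 / q - \<eta>)" unfolding \<theta>_def \<delta>_def using q by (simp add: algebra_simps)
    then show ?thesis unfolding pp_def using iq by simp
  qed
  have pmt: "pm * (1 - \<theta>) = q / 2"
  proof -
    have "1 - \<theta> = (q / 2) * (1 / q + \<eta>)" unfolding \<theta>_def \<delta>_def using q by (simp add: algebra_simps)
    then show ?thesis unfolding pm_def using iq' by simp
  qed
  define cst where "cst p = 2 powr p / (1 - 2 powr (p - p1)) + 2 powr p0 / (1 - 2 powr (p0 - p))" for p
  have cst0: "cst p \<ge> 0" if "p0 < p" "p < p1" for p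
    unfolding cst_def using that by (intro add_nonneg_nonneg divide_nonneg_nonneg) (auto simp: powr_le_one_le intro!: less_imp_le powr_less_one)
  define K where "K = (cst pp + cst pm) * K0"
  have Kc: "cst pp * K0 \<le> K" "cst pm * K0 \<le> K" "K \<ge> 0"
    unfolding K_def using cst0[OF pp] cst0[OF pm] K0 by (auto simp: distrib_right)
  \<comment> \<open>Half of the gain \<open>\<kappa> * \<delta>\<close>: after the loss
    \<open>2 powr (\<epsilon> * \<bar>j - m\<bar>)\<close> a decay with the same rate \<epsilon> is
    left for the double sum.\<close>
  define \<epsilon> where "\<epsilon> = \<kappa> * \<delta> / 2"
  have \<epsilon>: "\<epsilon> > 0" unfolding \<epsilon>_def using \<kappa> \<delta> by simp
  define W where "W = (2 / (1 - 2 powr (- (\<epsilon> / q)))) powr q"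
  define G where "G = 2 / (1 - 2 powr (- \<epsilon>))"
  have r: "0 < 2 powr (- \<epsilon>)" "2 powr (- \<epsilon>) < (1::real)" using \<epsilon> by (auto intro: powr_less_one)
  have G0: "G \<ge> 0" unfolding G_def using r by simp
  define C where "C = W * (2 * K * (2 * G))"
  have W0: "W \<ge> 0" unfolding W_def by simp
  have C0: "C \<ge> 0" unfolding C_def using W0 Kc(3) G0 by simp
  have main: "(\<integral>\<^sup>+x. ennreal ((\<Sum>j<J. F j x) powr q) \<partial>M) \<le> ennreal (C * (\<Sum>j<J. 2 powr (- \<kappa> * real j) * h j powr q))"
    if Fm: "\<And>j. F j \<in> borel_measurable M" and F0: "\<And>j x. F j x \<ge> 0" and h: "\<And>j. h j \<ge> 0"
    and wt: "\<And>j \<alpha> p. \<alpha> > 0 \<Longrightarrow> p \<in> {p0, p1} \<Longrightarrow>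
        emeasure M {x \<in> space M. F j x > \<alpha>} \<le> ennreal (K0 * 2 powr (- \<kappa> * real j) * (h j / \<alpha>) powr p)"
    for F :: "nat \<Rightarrow> 'a \<Rightarrow> real" and M h J
  proof -
    note [measurable] = Fm
    define Wj where "Wj j = K0 * 2 powr (- \<kappa> * real j)" for j
    have Wj0: "Wj j \<ge> 0" for j unfolding Wj_def using K0 by simp
    have strong: "(\<integral>\<^sup>+x. ennreal (F j x powr p) \<partial>M) \<le> ennreal (cst p * (Wj j * h j powr p))"
      if "p0 < p" "p < p1" for p j
      unfolding cst_def
      by (rule strong_type_of_weak_type) (use Fm F0 h Wj0 that assms(2) wt in \<open>auto simp: Wj_def\<close>)
    have st: "(\<integral>\<^sup>+x. ennreal (F j x powr p) \<partial>M) \<le> ennreal (K * 2 powr (- \<kappa> * real j) * h j powr p)"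
      if "p \<in> {pp, pm}" for p j
    proof -
      have c: "p0 < p" "p < p1" "cst p * K0 \<le> K" using that pp pm Kc by auto
      have "cst p * (Wj j * h j powr p) = (cst p * K0) * (2 powr (- \<kappa> * real j) * h j powr p)"
        unfolding Wj_def by simp
      also have "\<dots> \<le> K * (2 powr (- \<kappa> * real j) * h j powr p)" by (intro mult_right_mono c) auto
      finally have "ennreal (cst p * (Wj j * h j powr p)) \<le> ennreal (K * 2 powr (- \<kappa> * real j) * h j powr p)"
        by (intro ennreal_leI) (simp add: mult.assoc)
      then show ?thesis using strong[OF c(1,2), of j] by (rule order_trans[rotated])
    qed
    define X where "X j = 2 powr (- \<kappa> * real j) * h j powr q" for j
    have X0: "X j \<ge> 0" for j unfolding X_def by simp
    \<comment> \<open>For \<open>j \<le> m\<close> the weight of scale \<open>j\<close> is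
      \<open>\<theta> < 1 / 2\<close> and that of scale \<open>m\<close> is
      \<open>1 - \<theta>\<close>, so the higher frequency, which carries the smaller factor, counts
      more.\<close>
    have pair_le: "(\<integral>\<^sup>+x. ennreal ((F j x * F m x) powr (q / 2)) \<partial>M) \<le>
        ennreal (2 * K * (2 powr (- (2 * \<epsilon>) * \<bar>real j - real m\<bar>) * (X j + X m)))" if jm: "j \<le> m" for j m
    proof -
      let ?U = "K * 2 powr (- \<kappa> * real j) * h j powr pp" and ?V = "K * 2 powr (- \<kappa> * real m) * h m powr pm"
      have "(F j x * F m x) powr (q / 2) = (F j x powr pp) powr \<theta> * (F m x powr pm) powr (1 - \<theta>)" for x
        unfolding powr_powr ppt pmt by (rule powr_mult)
      then have "(\<integral>\<^sup>+x. ennreal ((F j x * F m x) powr (q / 2)) \<partial>M) =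
          (\<integral>\<^sup>+x. ennreal ((F j x powr pp) powr \<theta> * (F m x powr pm) powr (1 - \<theta>)) \<partial>M)" by simp
      also have "\<dots> \<le> ennreal (2 * (?U powr \<theta> * ?V powr (1 - \<theta>)))"
        by (rule holder_nn_integral) (use st \<theta> Kc(3) in auto)
      also have "?U powr \<theta> * ?V powr (1 - \<theta>) = K * (2 powr (- (2 * \<epsilon>) * \<bar>real j - real m\<bar>) * (X j powr (1 / 2) * X m powr (1 - 1 / 2)))"
      proof -
        have k: "K powr \<theta> * K powr (1 - \<theta>) = K"
        proof (cases "K = 0")
          case False
          then show ?thesis using Kc(3) by (simp flip: powr_add)
        qed simp
        have e: "- \<kappa> * real j * \<theta> + - \<kappa> * real m * (1 - \<theta>) =
            - (2 * \<epsilon>) * \<bar>real j - real m\<bar> + (- \<kappa> * real j * (1 / 2) + - \<kappa> * real m * (1 - 1 / 2))"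
          unfolding \<theta>_def \<epsilon>_def using jm by (simp add: algebra_simps)
        have "?U powr \<theta> * ?V powr (1 - \<theta>) = (K powr \<theta> * K powr (1 - \<theta>)) *
            (2 powr (- \<kappa> * real j * \<theta>) * 2 powr (- \<kappa> * real m * (1 - \<theta>))) * (h j powr (q / 2) * h m powr (q / 2))"
          unfolding powr_mult powr_powr ppt pmt by (simp only: mult_ac)
        also have "\<dots> = K * (2 powr (- (2 * \<epsilon>) * \<bar>real j - real m\<bar>) *
            (2 powr (- \<kappa> * real j * (1 / 2)) * 2 powr (- \<kappa> * real m * (1 - 1 / 2)))) * (h j powr (q / 2) * h m powr (q / 2))"
          unfolding k unfolding powr_add[symmetric] e by (simp only: mult_ac)
        also have "\<dots> = K * (2 powr (- (2 * \<epsilon>) * \<bar>real j - real m\<bar>) * (X j powr (1 / 2) * X m powr (1 - 1 / 2)))"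
          unfolding X_def powr_mult powr_powr by (simp add: mult_ac)
        finally show ?thesis .
      qed
      also have "ennreal (2 * (K * (2 powr (- (2 * \<epsilon>) * \<bar>real j - real m\<bar>) * (X j powr (1 / 2) * X m powr (1 - 1 / 2))))) \<le>
          ennreal (2 * (K * (2 powr (- (2 * \<epsilon>) * \<bar>real j - real m\<bar>) * (X j + X m))))"
        by (intro ennreal_leI mult_left_mono powr_mult_powr_le_add X0) (use Kc(3) in auto)
      finally show ?thesis by (simp add: mult.assoc)
    qed
    have pair: "(\<integral>\<^sup>+x. ennreal ((F j x * F m x) powr (q / 2)) \<partial>M) \<le>
        ennreal (2 * K * (2 powr (- (2 * \<epsilon>) * \<bar>real j - real m\<bar>) * (X j + X m)))" for j m
      using pair_le[of j m] pair_le[of m j]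
      by (cases "j \<le> m") (simp_all add: mult.commute add.commute abs_minus_commute)
    have "(\<integral>\<^sup>+x. ennreal ((\<Sum>j<J. F j x) powr q) \<partial>M) \<le>
      (\<integral>\<^sup>+x. ennreal W * (\<Sum>j<J. \<Sum>m<J. ennreal (2 powr (\<epsilon> * \<bar>real j - real m\<bar>)) * ennreal ((F j x * F m x) powr (q / 2))) \<partial>M)"
    proof (rule nn_integral_mono)
      fix x
      have "ennreal ((\<Sum>j<J. F j x) powr q) \<le> ennreal (W * (\<Sum>j<J. \<Sum>m<J. 2 powr (\<epsilon> * \<bar>real j - real m\<bar>) * (F j x * F m x) powr (q / 2)))"
        unfolding W_def by (intro ennreal_leI sum_powr_le_pairs F0 q \<epsilon>)
      also have "\<dots> = ennreal W * (\<Sum>j<J. \<Sum>m<J. ennreal (2 powr (\<epsilon> * \<bar>real j - real m\<bar>)) * ennreal ((F j x * F m x) powr (q / 2)))"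
        using W0 by (simp add: ennreal_mult sum_nonneg flip: sum_ennreal)
      finally show "ennreal ((\<Sum>j<J. F j x) powr q) \<le>
        ennreal W * (\<Sum>j<J. \<Sum>m<J. ennreal (2 powr (\<epsilon> * \<bar>real j - real m\<bar>)) * ennreal ((F j x * F m x) powr (q / 2)))" .
    qed
    also have "\<dots> = ennreal W * (\<Sum>j<J. \<Sum>m<J. ennreal (2 powr (\<epsilon> * \<bar>real j - real m\<bar>)) *
        (\<integral>\<^sup>+x. ennreal ((F j x * F m x) powr (q / 2)) \<partial>M))"
      by (simp add: nn_integral_cmult nn_integral_sum)
    also have "\<dots> \<le> ennreal W * (\<Sum>j<J. \<Sum>m<J. ennreal (2 powr (\<epsilon> * \<bar>real j - real m\<bar>)) *
        ennreal (2 * K * (2 powr (- (2 * \<epsilon>) * \<bar>real j - real m\<bar>) * (X j + X m))))"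
      by (intro mult_left_mono sum_mono pair) auto
    also have "\<dots> = ennreal (W * (\<Sum>j<J. \<Sum>m<J. 2 powr (\<epsilon> * \<bar>real j - real m\<bar>) *
        (2 * K * (2 powr (- (2 * \<epsilon>) * \<bar>real j - real m\<bar>) * (X j + X m)))))"
      using W0 Kc(3) X0 by (simp add: ennreal_mult sum_nonneg flip: sum_ennreal)
    also have "\<dots> \<le> ennreal (C * (\<Sum>j<J. X j))"
    proof (rule ennreal_leI)
      let ?r = "2 powr (- \<epsilon>)"
      have "(\<Sum>j<J. \<Sum>m<J. 2 powr (\<epsilon> * \<bar>real j - real m\<bar>) *
        (2 * K * (2 powr (- (2 * \<epsilon>) * \<bar>real j - real m\<bar>) * (X j + X m)))) =
        (\<Sum>j<J. \<Sum>m<J. 2 * K * (?r powr \<bar>real j - real m\<bar> * X j + ?r powr \<bar>real j - real m\<bar> * X m))"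
      proof (intro sum.cong refl)
        fix j m
        let ?t = "\<bar>real j - real m\<bar>"
        have "2 powr (\<epsilon> * ?t) * 2 powr (- (2 * \<epsilon>) * ?t) = ?r powr ?t"
          unfolding powr_powr powr_add[symmetric] by (simp add: algebra_simps)
        moreover have "2 powr (\<epsilon> * ?t) * (2 * K * (2 powr (- (2 * \<epsilon>) * ?t) * (X j + X m))) =
            2 * K * ((2 powr (\<epsilon> * ?t) * 2 powr (- (2 * \<epsilon>) * ?t)) * (X j + X m))"
          by (simp only: mult_ac)
        ultimately show "2 powr (\<epsilon> * ?t) * (2 * K * (2 powr (- (2 * \<epsilon>) * ?t) * (X j + X m))) =
            2 * K * (?r powr ?t * X j + ?r powr ?t * X m)"
          by (simp only: distrib_left)
      qed
      also have "\<dots> = 2 * K * ((\<Sum>j<J. \<Sum>m<J. ?r powr \<bar>real j - real m\<bar> * X j) + (\<Sum>j<J. \<Sum>m<J. ?r powr \<bar>real j - real m\<bar> * X m))"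
        by (simp only: sum.distrib sum_distrib_left distrib_left)
      also have "(\<Sum>j<J. \<Sum>m<J. ?r powr \<bar>real j - real m\<bar> * X m) = (\<Sum>j<J. \<Sum>m<J. ?r powr \<bar>real j - real m\<bar> * X j)"
        by (subst sum.swap) (simp add: abs_minus_commute)
      also have "2 * K * ((\<Sum>j<J. \<Sum>m<J. ?r powr \<bar>real j - real m\<bar> * X j) + (\<Sum>j<J. \<Sum>m<J. ?r powr \<bar>real j - real m\<bar> * X j)) \<le>
          2 * K * ((\<Sum>j<J. G * X j) + (\<Sum>j<J. G * X j))"
      proof -
        have "(\<Sum>m<J. ?r powr \<bar>real j - real m\<bar> * X j) \<le> G * X j" for j
        proof -
          have "(\<Sum>m<J. ?r powr \<bar>real m - real j\<bar>) \<le> G"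
            unfolding G_def by (rule sum_two_sided_geometric[OF r])
          then have "(\<Sum>m<J. ?r powr \<bar>real m - real j\<bar>) * X j \<le> G * X j" by (rule mult_right_mono[OF _ X0])
          then show ?thesis by (simp add: sum_distrib_right abs_minus_commute)
        qed
        then show ?thesis using Kc(3) by (intro mult_left_mono add_mono sum_mono) auto
      qed
      also have "\<dots> = 2 * K * (2 * G) * (\<Sum>j<J. X j)" by (simp add: sum_distrib_left[symmetric])
      finally show "W * (\<Sum>j<J. \<Sum>m<J. 2 powr (\<epsilon> * \<bar>real j - real m\<bar>) *
        (2 * K * (2 powr (- (2 * \<epsilon>) * \<bar>real j - real m\<bar>) * (X j + X m)))) \<le> C * (\<Sum>j<J. X j)"
        unfolding C_def using W0 by (simp add: mult_left_mono mult.assoc)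
    qed
    finally show ?thesis unfolding X_def .
  qed
  show ?thesis by (rule that[OF C0 main])
qed

text \<open>The two regimes of the critical exponent: with \<open>h\<close> as below, \<open>h powr q * N powr (- \<kappa>)\<close> is
  \<open>(N powr s * l2norm H) powr q\<close>, where \<open>s\<close> is the critical exponent.\<close>

lemma powr_rescale:
  fixes N a \<alpha> :: real
  assumes "N > 0" "a \<ge> 0" "\<alpha> > 0"
  shows "N powr (- \<kappa>) * (N powr e * a / \<alpha>) powr p = N powr (e * p - \<kappa>) * (a / \<alpha>) powr p"
proof -
  have "(N powr e * a / \<alpha>) powr p = N powr (e * p) * (a / \<alpha>) powr p"
    unfolding times_divide_eq_right[symmetric] powr_mult powr_powr ..
  moreover have "N powr (- \<kappa>) * N powr (e * p) = N powr (e * p - \<kappa>)"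
    by (simp add: powr_add[symmetric])
  ultimately show ?thesis by (simp add: mult.assoc[symmetric])
qed

text \<open>The numbers \<open>\<kappa> = (d - 1) / 2\<close> and \<open>e = (d + 1) / 4\<close> are
  determined by two equations: \<open>e * p - \<kappa>\<close> must be 1 at \<open>p = 2\<close>,
  the power of \<open>N\<close> in the \<open>L\<^sup>2\<close> bound, and
  \<open>2 * d / (d - 1)\<close> at \<open>p = q_circ d\<close>, the power in
  \<open>wave_level_set_strichartz\<close>.\<close>

lemma weak_type_low:
  assumes d: "DIM('a::euclidean_space) \<ge> 2"
  obtains C where "C \<ge> 0" and "\<And>N (H :: 'a \<Rightarrow> complex) \<alpha> p. N > 0 \<Longrightarrow> band_limited (real N) H \<Longrightarrow> \<alpha> > 0 \<Longrightarrow>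
     p \<in> {2, 2 * (real DIM('a) + 1) / (real DIM('a) - 1)} \<Longrightarrow>
     measure lborel (wave_level_set N H \<alpha>) \<le> C * (real N powr (- ((real DIM('a) - 1) / 2)) *
        (real N powr ((real DIM('a) + 1) / 4) * l2norm H / \<alpha>) powr p)"
proof -
  define D where "D = real DIM('a)"
  have D: "D \<ge> 2" using d unfolding D_def by simp
  obtain C where C: "C \<ge> 0" and st: "\<And>N (H :: 'a \<Rightarrow> complex) \<alpha>. N > 0 \<Longrightarrow> band_limited (real N) H \<Longrightarrow> \<alpha> > 0 \<Longrightarrow>
     measure lborel (wave_level_set N H \<alpha>) \<le> C * real N powr (2 * D / (D - 1)) * (l2norm H / \<alpha>) powr (2 * (D + 1) / (D - 1))"
    using wave_level_set_strichartz[OF d] unfolding D_def by metis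
  define C' where "C' = C + (2 * pi) ^ DIM('a)"
  have main: "measure lborel (wave_level_set N H \<alpha>) \<le> C' * (real N powr (- ((D - 1) / 2)) *
        (real N powr ((D + 1) / 4) * l2norm H / \<alpha>) powr p)"
    if N: "N > 0" and H: "band_limited (real N) H" and \<alpha>: "\<alpha> > 0" and p: "p \<in> {2, 2 * (D + 1) / (D - 1)}"
    for N and H :: "'a \<Rightarrow> complex" and \<alpha> p
  proof -
    let ?a = "l2norm H"
    have eq: "real N powr (- ((D - 1) / 2)) * (real N powr ((D + 1) / 4) * ?a / \<alpha>) powr p =
        real N powr ((D + 1) / 4 * p - (D - 1) / 2) * (?a / \<alpha>) powr p"
      by (rule powr_rescale) (use N \<alpha> l2norm_nonneg in auto)
    have nn: "0 \<le> real N powr ((D + 1) / 4 * p - (D - 1) / 2) * (?a / \<alpha>) powr p" by simp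
    show ?thesis
    proof (cases "p = 2")
      case True
      have "(?a / \<alpha>)\<^sup>2 = (?a / \<alpha>) powr 2" using \<alpha> l2norm_nonneg[of H] by simp
      moreover have "(D + 1) / 4 * p - (D - 1) / 2 = 1" using True by (simp add: field_simps)
      ultimately have "measure lborel (wave_level_set N H \<alpha>) \<le>
          (2 * pi) ^ DIM('a) * (real N powr ((D + 1) / 4 * p - (D - 1) / 2) * (?a / \<alpha>) powr p)"
        using wave_level_set_L2[OF H \<alpha>, of N] N True by simp
      also have "\<dots> \<le> C' * (real N powr ((D + 1) / 4 * p - (D - 1) / 2) * (?a / \<alpha>) powr p)"
        unfolding C'_def using C by (intro mult_right_mono nn) auto
      finally show ?thesis unfolding eq .
    next
      case False
      then have p: "p = 2 * (D + 1) / (D - 1)" using p by simp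
      have nz: "D - 1 \<noteq> 0" using D by simp
      have pD: "p * (D - 1) = 2 * (D + 1)" unfolding p using nz by simp
      have "((D + 1) / 4 * p - (D - 1) / 2) * (D - 1) = (D + 1) / 4 * (p * (D - 1)) - (D - 1) / 2 * (D - 1)"
        by (simp only: left_diff_distrib mult.assoc)
      also have "\<dots> = 2 * D" unfolding pD by (simp add: field_simps)
      finally have ex: "(D + 1) / 4 * p - (D - 1) / 2 = 2 * D / (D - 1)"
        by (rule nonzero_eq_divide_eq[OF nz, THEN iffD2])
      have "measure lborel (wave_level_set N H \<alpha>) \<le>
          C * (real N powr (2 * D / (D - 1)) * (?a / \<alpha>) powr p)"
        using st[OF N H \<alpha>] unfolding p by (simp only: mult.assoc)
      then have "measure lborel (wave_level_set N H \<alpha>) \<le>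
          C * (real N powr ((D + 1) / 4 * p - (D - 1) / 2) * (?a / \<alpha>) powr p)"
        unfolding ex .
      also have "\<dots> \<le> C' * (real N powr ((D + 1) / 4 * p - (D - 1) / 2) * (?a / \<alpha>) powr p)"
        unfolding C'_def by (intro mult_right_mono nn) auto
      finally show ?thesis unfolding eq .
    qed
  qed
  show ?thesis by (rule that[of C']) (use main C in \<open>auto simp: C'_def D_def\<close>)
qed

text \<open>The uniform bound fixes \<open>e = d / 2\<close>, and agreement with
  \<open>wave_level_set_strichartz\<close> at \<open>q_circ d\<close> then fixes
  \<open>\<kappa> = d\<close>. With \<open>t\<close> the normalised quotient of norm and height, the
  level set is empty unless \<open>b * t > 1\<close>. In that case a larger exponent only increases
  \<open>(b * t) powr p\<close>, so the bound at \<open>q_circ d\<close> implies the one at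
  \<open>p1\<close>.\<close>

lemma weak_type_high:
  fixes p1 :: real
  assumes d: "DIM('a::euclidean_space) \<ge> 2" and p1: "p1 \<ge> 2 * (real DIM('a) + 1) / (real DIM('a) - 1)"
  obtains C where "C \<ge> 0" and "\<And>N (H :: 'a \<Rightarrow> complex) \<alpha> p. N > 0 \<Longrightarrow> band_limited (real N) H \<Longrightarrow> \<alpha> > 0 \<Longrightarrow>
     p \<in> {2 * (real DIM('a) + 1) / (real DIM('a) - 1), p1} \<Longrightarrow>
     measure lborel (wave_level_set N H \<alpha>) \<le> C * (real N powr (- real DIM('a)) *
        (real N powr (real DIM('a) / 2) * l2norm H / \<alpha>) powr p)"
proof -
  define D where "D = real DIM('a)"
  have D: "D \<ge> 2" using d unfolding D_def by simp
  define q0 where "q0 = 2 * (D + 1) / (D - 1)"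
  obtain C where C: "C \<ge> 0" and st: "\<And>N (H :: 'a \<Rightarrow> complex) \<alpha>. N > 0 \<Longrightarrow> band_limited (real N) H \<Longrightarrow> \<alpha> > 0 \<Longrightarrow>
     measure lborel (wave_level_set N H \<alpha>) \<le> C * real N powr (2 * D / (D - 1)) * (l2norm H / \<alpha>) powr q0"
    using wave_level_set_strichartz[OF d] unfolding D_def q0_def by metis
  define b where "b = sqrt (measure lborel (cball (0::'a) 1))"
  have b: "b \<ge> 0" unfolding b_def by simp
  define C' where "C' = C * (1 + b powr (p1 - q0))"
  have main: "measure lborel (wave_level_set N H \<alpha>) \<le> C' * (real N powr (- D) *
        (real N powr (D / 2) * l2norm H / \<alpha>) powr p)"
    if N: "N > 0" and H: "band_limited (real N) H" and \<alpha>: "\<alpha> > 0" and p: "p \<in> {q0, p1}"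
    for N and H :: "'a \<Rightarrow> complex" and \<alpha> p
  proof -
    define t where "t = real N powr (D / 2) * l2norm H / \<alpha>"
    have t0: "t \<ge> 0" unfolding t_def using \<alpha> l2norm_nonneg[of H] by simp
    have eq: "real N powr (- D) * t powr q0 = real N powr (2 * D / (D - 1)) * (l2norm H / \<alpha>) powr q0"
    proof -
      have "D / 2 * q0 - D = 2 * D / (D - 1)"
        unfolding q0_def using D by (simp add: field_simps)
      then show ?thesis unfolding t_def
        by (subst powr_rescale) (use N \<alpha> l2norm_nonneg in auto)
    qed
    have m0: "measure lborel (wave_level_set N H \<alpha>) \<le> C * (real N powr (- D) * t powr q0)"
      using st[OF N H \<alpha>] unfolding eq by (simp add: mult.assoc)
    show ?thesis
    \<comment> \<open>In the first case \<alpha> is at least the uniform bound of the wave.\<close>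
    proof (cases "b * t \<le> 1")
      case True
      have "wave_level_set N H \<alpha> = {}"
      proof -
        have "norm (half_wave s H x) \<le> \<alpha>" for s x
        proof -
          have "norm (half_wave s H x) \<le> b * (real N powr (D / 2) * l2norm H)"
            unfolding b_def D_def by (rule norm_half_wave_le_l2[OF H]) (use N in simp)
          also have "\<dots> = (b * t) * \<alpha>" unfolding t_def using \<alpha> by simp
          also have "\<dots> \<le> \<alpha>" using mult_right_mono[OF True, of \<alpha>] \<alpha> by simp
          finally show ?thesis .
        qed
        then show ?thesis unfolding wave_level_set_def by (auto simp: not_less)
      qed
      then show ?thesis using C unfolding C'_def by simp
    next
      case False
      have le: "t powr q0 \<le> (1 + b powr (p1 - q0)) * t powr p"
      proof (cases "p = q0")
        case True
        then show ?thesis by (simp add: distrib_right)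
      next
        case False
        then have p: "p = p1" using p by simp
        have pos: "b > 0" "t > 0" using \<open>\<not> b * t \<le> 1\<close> b t0 by (cases "b = 0"; cases "t = 0"; auto)+
        have "1 \<le> (b * t) powr (p1 - q0)"
          using \<open>\<not> b * t \<le> 1\<close> p1 unfolding q0_def D_def by (intro ge_one_powr_ge_zero) auto
        then have "1 * t powr q0 \<le> (b * t) powr (p1 - q0) * t powr q0" by (rule mult_right_mono) simp
        also have "\<dots> = b powr (p1 - q0) * t powr p1"
          using pos by (simp add: powr_mult powr_diff)
        also have "\<dots> \<le> (1 + b powr (p1 - q0)) * t powr p1" by (intro mult_right_mono) auto
        finally show ?thesis unfolding p by simp
      qed
      have "C * (real N powr (- D) * t powr q0) \<le> C * (real N powr (- D) * ((1 + b powr (p1 - q0)) * t powr p))"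
        using C by (intro mult_left_mono le) auto
      then show ?thesis using m0 unfolding t_def[symmetric] C'_def by (simp add: mult_ac)
    qed
  qed
  show ?thesis by (rule that[of C']) (use main C in \<open>auto simp: C'_def D_def q0_def\<close>)
qed

section \<open>Schwartz functions and the Sobolev norm\<close>

lemma exp_i_eq_cis: "exp (\<i> * of_real t) = cis t" "exp (- (\<i> * of_real t)) = cis (- t)"
  by (simp_all add: cis_conv_exp)

lemma fourier_eq_ft: "fourier f \<xi> = ft f (- \<xi>)"
  unfolding fourier_def ft_def exp_i_eq_cis by (simp add: inner_commute)

section \<open>Integration by parts and decay of the transform\<close>

lemma integrable_translate:
  fixes k :: "'a::euclidean_space \<Rightarrow> complex"
  assumes k: "integrable lborel k"
  shows "integrable lborel (\<lambda>x. k (x + c))" and "(LINT x|lborel. k (x + c)) = (LINT x|lborel. k x)"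
proof -
  have [measurable]: "k \<in> borel_measurable borel" using borel_measurable_integrable[OF k] by simp
  have i: "integrable (distr lborel borel ((+) c)) k" using k by (simp only: lborel_distr_plus)
  have "integrable lborel (\<lambda>x. k (c + x))"
    using i by (subst (asm) integrable_distr_eq) auto
  then show "integrable lborel (\<lambda>x. k (x + c))" by (simp add: add.commute)
  have "(LINT x|lborel. k x) = (LINT x|distr lborel borel ((+) c). k x)" by (simp only: lborel_distr_plus)
  also have "\<dots> = (LINT x|lborel. k (c + x))" by (subst integral_distr) auto
  finally show "(LINT x|lborel. k (x + c)) = (LINT x|lborel. k x)" by (simp add: add.commute)
qed

text \<open>The integral of a directional derivative vanishes: average \<open>h (x + b) - h x\<close> over \<open>x\<close>.\<close>

lemma integral_directional_derivative_eq_0: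
  fixes h k :: "'a::euclidean_space \<Rightarrow> complex"
  assumes h: "integrable lborel h" and k: "integrable lborel k" and kc: "continuous_on UNIV k"
    and der: "\<And>x. (h has_derivative (h' x)) (at x)" and hk: "\<And>x. h' x b = k x"
  shows "(LINT x|lborel. k x) = 0"
proof -
  let ?L = "lborel :: 'a measure" and ?R = "lborel :: real measure"
  have [measurable]: "k \<in> borel_measurable borel" using borel_measurable_integrable[OF k] by simp
  let ?F = "\<lambda>t x. indicator {0..1} t *\<^sub>R k (x + t *\<^sub>R b)"
  have int: "integrable (?R \<Otimes>\<^sub>M ?L) (\<lambda>p. ?F (fst p) (snd p))"
  proof (rule lborel_pair.Fubini_integrable)
    have n: "(LINT x|lborel. norm (?F (fst (t, x)) (snd (t, x)))) = indicator {0..1} t * (LINT x|lborel. norm (k x))" for t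
    proof -
      have "(LINT x|?L. norm (k (x + t *\<^sub>R b))) = (LINT x|?L. norm (k x))"
        using integrable_translate(2)[OF integrable_of_real[OF integrable_norm[OF k]], of "t *\<^sub>R b"]
        by (simp only: integral_complex_of_real of_real_eq_iff)
      then show ?thesis by simp
    qed
    have "integrable ?R (\<lambda>t. indicator {0..1} t * (LINT x|lborel. norm (k x)))"
      by (intro integrable_mult_left integrable_real_indicator) auto
    then show "integrable ?R (\<lambda>t. LINT x|lborel. norm (?F (fst (t, x)) (snd (t, x))))" unfolding n .
    show "AE t in ?R. integrable ?L (\<lambda>x. ?F (fst (t, x)) (snd (t, x)))"
      by (intro AE_I2) (simp add: integrable_translate(1)[OF k])
  qed measurable
  have inner: "(LINT t|?R. ?F t x) = h (x + b) - h x" for x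
  proof -
    have cont: "continuous_on {0..1} (\<lambda>t. k (x + t *\<^sub>R b))"
      by (intro continuous_on_compose2[OF kc]) (auto intro!: continuous_intros)
    have "((\<lambda>t. k (x + t *\<^sub>R b)) has_integral h (x + 1 *\<^sub>R b) - h (x + 0 *\<^sub>R b)) {0..1}"
    proof (rule fundamental_theorem_of_calculus)
      fix t :: real
      have "((\<lambda>t. h (x + t *\<^sub>R b)) has_derivative (\<lambda>r. h' (x + t *\<^sub>R b) (r *\<^sub>R b))) (at t within {0..1})"
        by (rule has_derivative_compose[OF _ der]) (auto intro!: derivative_eq_intros)
      moreover have "h' (x + t *\<^sub>R b) (r *\<^sub>R b) = r *\<^sub>R k (x + t *\<^sub>R b)" for r
        using linear_scale[OF has_derivative_linear[OF der]] hk by simp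
      ultimately show "((\<lambda>t. h (x + t *\<^sub>R b)) has_vector_derivative k (x + t *\<^sub>R b)) (at t within {0..1})"
        unfolding has_vector_derivative_def by simp
    qed simp
    moreover have "set_integrable lborel {0..1} (\<lambda>t. k (x + t *\<^sub>R b))"
      by (rule borel_integrable_compact[OF _ cont, unfolded set_integrable_def[symmetric]]) simp
    ultimately show ?thesis
      using set_borel_integral_eq_integral(2)[of "{0..1}" "\<lambda>t. k (x + t *\<^sub>R b)"]
      unfolding set_lebesgue_integral_def by (simp add: integral_unique)
  qed
  have "(LINT x|?L. LINT t|?R. ?F t x) = (LINT t|?R. LINT x|?L. ?F t x)"
    by (rule lborel_pair.Fubini_integral) (use int in \<open>simp add: case_prod_beta'\<close>)
  also have "\<dots> = (LINT t|?R. indicator {0..1} t *\<^sub>R (LINT x|?L. k x))"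
    by (simp add: integrable_translate(2)[OF k])
  also have "\<dots> = (LINT x|?L. k x)"
    by (subst integral_scaleR_left) (auto intro!: integrable_real_indicator)
  finally have "(LINT x|?L. k x) = (LINT x|?L. h (x + b) - h x)" unfolding inner by simp
  also have "\<dots> = 0"
    by (subst Bochner_Integration.integral_diff) (simp_all add: integrable_translate[OF h] h)
  finally show ?thesis .
qed

text \<open>The derivative of \<open>cis (\<xi> \<bullet> x) * g x\<close> along \<open>b\<close>
  has integral zero, and the product rule splits it into the two sides.\<close>

lemma ft_partial_derivative:
  fixes g :: "'a::euclidean_space \<Rightarrow> complex"
  assumes g: "integrable lborel g" and diff: "\<And>x. g differentiable (at x)"
    and dg: "integrable lborel (partial_derivative b g)" and dgc: "continuous_on UNIV (partial_derivative b g)"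
  shows "ft (partial_derivative b g) \<xi> = - (\<i> * of_real (\<xi> \<bullet> b)) * ft g \<xi>"
proof -
  have gc: "continuous_on UNIV g"
    using diff differentiable_imp_continuous_within by (auto simp: continuous_on_eq_continuous_at)
  let ?h = "\<lambda>x. cis (\<xi> \<bullet> x) * g x"
  let ?k = "\<lambda>x. cis (\<xi> \<bullet> x) * partial_derivative b g x + \<i> * of_real (\<xi> \<bullet> b) * (cis (\<xi> \<bullet> x) * g x)"
  have "(LINT x|lborel. ?k x) = 0"
  proof (rule integral_directional_derivative_eq_0)
    show "integrable lborel ?h" by (rule integrable_ft[OF g])
    show "integrable lborel ?k"
      by (intro Bochner_Integration.integrable_add integrable_mult_right integrable_ft g dg)
    show "continuous_on UNIV ?k" by (intro continuous_intros gc dgc)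
    fix x
    have "((\<lambda>x. cis (\<xi> \<bullet> x)) has_derivative (\<lambda>y. (\<xi> \<bullet> y) *\<^sub>R (\<i> * cis (\<xi> \<bullet> x)))) (at x)"
    proof -
      have "(cis has_derivative (\<lambda>r. r *\<^sub>R (\<i> * cis (\<xi> \<bullet> x)))) (at (\<xi> \<bullet> x))"
        using has_vector_derivative_iexp[of "\<xi> \<bullet> x" UNIV]
        unfolding has_vector_derivative_def exp_i_eq_cis .
      then show ?thesis
        by (intro has_derivative_compose[where f = "\<lambda>x. \<xi> \<bullet> x" and f' = "\<lambda>y. \<xi> \<bullet> y" and g = cis])
           (auto intro!: derivative_eq_intros)
    qed
    moreover have "(g has_derivative frechet_derivative g (at x)) (at x)"
      using diff frechet_derivative_works by blast
    ultimately show "(?h has_derivative (\<lambda>y. cis (\<xi> \<bullet> x) * frechet_derivative g (at x) y + (\<xi> \<bullet> y) *\<^sub>R (\<i> * cis (\<xi> \<bullet> x)) * g x)) (at x)"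
      by (rule has_derivative_mult)
    show "cis (\<xi> \<bullet> x) * frechet_derivative g (at x) b + (\<xi> \<bullet> b) *\<^sub>R (\<i> * cis (\<xi> \<bullet> x)) * g x = ?k x"
      unfolding partial_derivative_def by (simp add: scaleR_conv_of_real mult_ac)
  qed
  moreover have "(LINT x|lborel. ?k x) = ft (partial_derivative b g) \<xi> + \<i> * of_real (\<xi> \<bullet> b) * ft g \<xi>"
    unfolding ft_def
    by (subst Bochner_Integration.integral_add)
       (auto intro!: integrable_mult_right integrable_ft g dg simp: mult.assoc)
  ultimately show ?thesis by (simp add: add_eq_0_iff2)
qed

context
  fixes f :: "'a::euclidean_space \<Rightarrow> complex"
  assumes f: "schwartz f"
begin

lemma schwartz_iterated_differentiable:
  "bs \<in> lists Basis \<Longrightarrow> iterated_partial bs f differentiable (at x)"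
  using f unfolding schwartz_def by blast

lemma schwartz_iterated_continuous:
  "bs \<in> lists Basis \<Longrightarrow> continuous_on UNIV (iterated_partial bs f)"
  unfolding continuous_on_eq_continuous_at[OF open_UNIV]
  by (intro ballI differentiable_imp_continuous_within schwartz_iterated_differentiable)

lemma schwartz_iterated_integrable:
  assumes bs: "bs \<in> lists Basis"
  shows "integrable lborel (iterated_partial bs f)"
proof -
  let ?g = "iterated_partial bs f" and ?D = "DIM('a)"
  obtain B0 where B0: "\<And>x. norm x ^ 0 * norm (?g x) \<le> B0"
    using f bs unfolding schwartz_def by blast
  obtain B1 where B1: "\<And>x. norm x ^ (2 * ?D) * norm (?g x) \<le> B1"
    using f bs unfolding schwartz_def by blast
  show ?thesis
  proof (rule integrable_of_decay)
    show "?g \<in> borel_measurable borel"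
      by (rule borel_measurable_continuous_onI[OF schwartz_iterated_continuous[OF bs]])
    fix x :: 'a
    have "(1 + (norm x)\<^sup>2) ^ ?D \<le> (2 * max 1 ((norm x)\<^sup>2)) ^ ?D" by (intro power_mono) auto
    also have "\<dots> = 2 ^ ?D * max 1 ((norm x)\<^sup>2) ^ ?D" by (rule power_mult_distrib)
    also have "max 1 ((norm x)\<^sup>2) ^ ?D \<le> 1 + norm x ^ (2 * ?D)"
      unfolding max_def by (auto simp: power_mult)
    finally have "norm (?g x) * (1 + (norm x)\<^sup>2) ^ ?D \<le> norm (?g x) * (2 ^ ?D * (1 + norm x ^ (2 * ?D)))"
      by (simp add: mult_left_mono)
    also have "\<dots> = 2 ^ ?D * (norm x ^ 0 * norm (?g x) + norm x ^ (2 * ?D) * norm (?g x))"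
      by (simp add: algebra_simps)
    also have "\<dots> \<le> 2 ^ ?D * (B0 + B1)" by (intro mult_left_mono add_mono B0 B1) simp
    finally show "norm (?g x) * (1 + (norm x)\<^sup>2) ^ ?D \<le> 2 ^ ?D * (B0 + B1)" .
  qed
qed

lemma schwartz_integrable: "integrable lborel f"
  using schwartz_iterated_integrable[of "[]"] by simp

lemma schwartz_ft_iterated:
  assumes b: "b \<in> Basis"
  shows "ft (iterated_partial (replicate n b) f) \<xi> = (- (\<i> * of_real (\<xi> \<bullet> b))) ^ n * ft f \<xi>"
proof (induction n)
  case (Suc n)
  have l: "replicate m b \<in> lists Basis" for m using b by auto
  have "ft (partial_derivative b (iterated_partial (replicate n b) f)) \<xi> =
      - (\<i> * of_real (\<xi> \<bullet> b)) * ft (iterated_partial (replicate n b) f) \<xi>"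
  proof (rule ft_partial_derivative)
    show "integrable lborel (partial_derivative b (iterated_partial (replicate n b) f))"
      using schwartz_iterated_integrable[OF l[of "Suc n"]] by simp
    show "continuous_on UNIV (partial_derivative b (iterated_partial (replicate n b) f))"
      using schwartz_iterated_continuous[OF l[of "Suc n"]] by simp
  qed (intro schwartz_iterated_integrable schwartz_iterated_differentiable l)+
  then show ?case using Suc.IH by simp
qed simp

lemma schwartz_ft_component_bound:
  assumes b: "b \<in> Basis"
  obtains B where "\<And>\<xi>. \<bar>\<xi> \<bullet> b\<bar> ^ n * norm (ft f \<xi>) \<le> B"
proof
  fix \<xi>
  have l: "replicate n b \<in> lists Basis" using b by auto
  show "\<bar>\<xi> \<bullet> b\<bar> ^ n * norm (ft f \<xi>) \<le> (LINT x|lborel. norm (iterated_partial (replicate n b) f x))"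
    using norm_ft_le[OF schwartz_iterated_integrable[OF l], of \<xi>]
    unfolding schwartz_ft_iterated[OF b] by (simp add: norm_mult norm_power)
qed

text \<open>Mixed derivatives can be avoided: \<open>norm \<xi>\<close> is at most
  \<open>DIM('a)\<close> times the largest coordinate, and a power of one coordinate is produced by
  differentiating repeatedly in that single direction.\<close>

lemma schwartz_ft_decay:
  obtains B where "\<And>\<xi>. (1 + (norm \<xi>)\<^sup>2) ^ m * norm (ft f \<xi>) \<le> B"
proof -
  have "\<forall>b\<in>Basis. \<exists>B. \<forall>\<xi>. \<bar>\<xi> \<bullet> b\<bar> ^ (2 * m) * norm (ft f \<xi>) \<le> B"
    using schwartz_ft_component_bound by blast
  then obtain B where B: "\<And>b \<xi>. b \<in> Basis \<Longrightarrow> \<bar>\<xi> \<bullet> b\<bar> ^ (2 * m) * norm (ft f \<xi>) \<le> B b"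
    by metis
  let ?I = "LINT x|lborel. norm (f x)"
  let ?c = "2 ^ m * (1 + real DIM('a) ^ (2 * m))"
  have "(1 + (norm \<xi>)\<^sup>2) ^ m * norm (ft f \<xi>) \<le> 2 ^ m * (?I + real DIM('a) ^ (2 * m) * (\<Sum>b\<in>Basis. B b))" for \<xi>
  proof -
    define M where "M = Max ((\<lambda>b. \<bar>\<xi> \<bullet> b\<bar>) ` Basis)"
    have "M \<in> (\<lambda>b. \<bar>\<xi> \<bullet> b\<bar>) ` Basis" unfolding M_def by (intro Max_in) auto
    then obtain b where b: "b \<in> Basis" "M = \<bar>\<xi> \<bullet> b\<bar>" by auto
    have "norm \<xi> \<le> (\<Sum>b\<in>Basis. \<bar>\<xi> \<bullet> b\<bar>)" by (rule norm_le_l1)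
    also have "\<dots> \<le> (\<Sum>b\<in>(Basis :: 'a set). M)" unfolding M_def by (intro sum_mono Max_ge) auto
    finally have "norm \<xi> \<le> real DIM('a) * M" by simp
    then have "norm \<xi> ^ (2 * m) \<le> (real DIM('a) * M) ^ (2 * m)" by (intro power_mono) auto
    then have "norm \<xi> ^ (2 * m) * norm (ft f \<xi>) \<le> (real DIM('a) * M) ^ (2 * m) * norm (ft f \<xi>)"
      by (rule mult_right_mono) simp
    also have "\<dots> = real DIM('a) ^ (2 * m) * (\<bar>\<xi> \<bullet> b\<bar> ^ (2 * m) * norm (ft f \<xi>))"
      unfolding b(2) by (simp only: power_mult_distrib mult.assoc)
    also have "\<dots> \<le> real DIM('a) ^ (2 * m) * (\<Sum>b\<in>Basis. B b)"
    proof (intro mult_left_mono)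
      have B0: "0 \<le> B c" if "c \<in> Basis" for c
        using B[OF that, of 0] by (rule order_trans[rotated]) simp
      have "\<bar>\<xi> \<bullet> b\<bar> ^ (2 * m) * norm (ft f \<xi>) \<le> B b" by (rule B[OF b(1)])
      also have "\<dots> \<le> (\<Sum>b\<in>Basis. B b)" by (rule member_le_sum) (use b B0 in auto)
      finally show "\<bar>\<xi> \<bullet> b\<bar> ^ (2 * m) * norm (ft f \<xi>) \<le> (\<Sum>b\<in>Basis. B b)" .
    qed simp
    finally have h: "norm \<xi> ^ (2 * m) * norm (ft f \<xi>) \<le> real DIM('a) ^ (2 * m) * (\<Sum>b\<in>Basis. B b)" .
    have "(1 + (norm \<xi>)\<^sup>2) ^ m \<le> (2 * max 1 ((norm \<xi>)\<^sup>2)) ^ m" by (intro power_mono) auto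
    also have "\<dots> = 2 ^ m * max 1 ((norm \<xi>)\<^sup>2) ^ m" by (rule power_mult_distrib)
    also have "max 1 ((norm \<xi>)\<^sup>2) ^ m \<le> 1 + norm \<xi> ^ (2 * m)"
      unfolding max_def by (auto simp: power_mult)
    finally have "(1 + (norm \<xi>)\<^sup>2) ^ m * norm (ft f \<xi>) \<le> 2 ^ m * (1 + norm \<xi> ^ (2 * m)) * norm (ft f \<xi>)"
      by (intro mult_right_mono) auto
    also have "\<dots> = 2 ^ m * (norm (ft f \<xi>) + norm \<xi> ^ (2 * m) * norm (ft f \<xi>))"
      by (simp add: algebra_simps)
    also have "\<dots> \<le> 2 ^ m * (?I + real DIM('a) ^ (2 * m) * (\<Sum>b\<in>Basis. B b))"
      using h norm_ft_le[OF schwartz_integrable] by (intro mult_left_mono add_mono) auto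
    finally show ?thesis .
  qed
  then show ?thesis by (rule that)
qed

lemma schwartz_fourier_decay:
  obtains B where "\<And>\<xi>. (1 + (norm \<xi>)\<^sup>2) ^ m * norm (fourier f \<xi>) \<le> B"
proof -
  obtain B where "\<And>\<xi>. (1 + (norm \<xi>)\<^sup>2) ^ m * norm (ft f \<xi>) \<le> B" using schwartz_ft_decay by blast
  from this[of "- \<xi>" for \<xi>] show ?thesis by (intro that[of B]) (simp add: fourier_eq_ft)
qed

lemma continuous_fourier: "continuous_on UNIV (fourier f)"
proof -
  have "continuous_on UNIV (\<lambda>\<xi>. ft f (- \<xi>))"
    by (intro continuous_on_compose2[OF continuous_ft[OF schwartz_integrable]] continuous_intros) auto
  then show ?thesis unfolding fourier_eq_ft[abs_def] .
qed

lemma sobolev_multiplier_decay: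
  obtains B where "\<And>\<xi>. norm (of_real ((1 + (norm \<xi>)\<^sup>2) powr s) * fourier f \<xi>) * (1 + (norm \<xi>)\<^sup>2) ^ m \<le> B"
proof -
  define k where "k = nat \<lceil>\<bar>s\<bar>\<rceil>"
  have k: "s \<le> real k" unfolding k_def using of_nat_ceiling[of "\<bar>s\<bar>"] abs_ge_self[of s] by linarith
  obtain B where B: "\<And>\<xi>. (1 + (norm \<xi>)\<^sup>2) ^ (k + m) * norm (fourier f \<xi>) \<le> B"
    using schwartz_fourier_decay by blast
  have "norm (of_real ((1 + (norm \<xi>)\<^sup>2) powr s) * fourier f \<xi>) * (1 + (norm \<xi>)\<^sup>2) ^ m \<le> B" for \<xi>
  proof -
    have p: "1 + (norm \<xi>)\<^sup>2 > 0" by (simp add: add_pos_nonneg)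
    have "(1 + (norm \<xi>)\<^sup>2) powr s \<le> (1 + (norm \<xi>)\<^sup>2) powr real k" using k by (intro powr_mono) auto
    also have "\<dots> = (1 + (norm \<xi>)\<^sup>2) ^ k" using p by (rule powr_realpow)
    finally have "(1 + (norm \<xi>)\<^sup>2) powr s * norm (fourier f \<xi>) * (1 + (norm \<xi>)\<^sup>2) ^ m \<le>
        (1 + (norm \<xi>)\<^sup>2) ^ k * norm (fourier f \<xi>) * (1 + (norm \<xi>)\<^sup>2) ^ m"
      by (intro mult_right_mono) auto
    also have "\<dots> = (1 + (norm \<xi>)\<^sup>2) ^ (k + m) * norm (fourier f \<xi>)" by (simp add: power_add mult_ac)
    also have "\<dots> \<le> B" by (rule B)
    finally show ?thesis by (simp add: norm_mult)
  qed
  then show ?thesis by (rule that)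
qed

text \<open>These are the properties that \<open>bessel_ft\<close> and
  \<open>plancherel_lower\<close> ask of the function whose inverse transform is
  \<open>bessel_potential s f\<close>.\<close>

lemma sobolev_multiplier:
  defines "G \<equiv> \<lambda>s \<xi>. of_real ((1 + (norm \<xi>)\<^sup>2) powr (s / 2)) * fourier f \<xi>"
  shows "continuous_on UNIV (G s)" and "integrable lborel (G s)"
    and "\<exists>B. \<forall>\<xi>. norm (G s \<xi>) \<le> B" and "integrable lborel (\<lambda>\<xi>. (norm (G s \<xi>))\<^sup>2)"
proof -
  have p: "1 + (norm \<xi>)\<^sup>2 \<noteq> 0" for \<xi> :: 'a by (rule add_pos_nonneg[THEN less_imp_neq, symmetric]) auto
  show c: "continuous_on UNIV (G s)"
    unfolding G_def using p by (intro continuous_intros continuous_fourier) auto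
  obtain B where B: "\<And>\<xi>. norm (G s \<xi>) * (1 + (norm \<xi>)\<^sup>2) ^ 0 \<le> B"
    using sobolev_multiplier_decay[of "s / 2" 0] unfolding G_def by blast
  obtain B' where B': "\<And>\<xi>. norm (G s \<xi>) * (1 + (norm \<xi>)\<^sup>2) ^ DIM('a) \<le> B'"
    using sobolev_multiplier_decay[of "s / 2" "DIM('a)"] unfolding G_def by blast
  show b: "\<exists>B. \<forall>\<xi>. norm (G s \<xi>) \<le> B" using B by auto
  have gm: "G s \<in> borel_measurable borel" by (rule borel_measurable_continuous_onI[OF c])
  show i: "integrable lborel (G s)" by (rule integrable_of_decay[OF gm B'])
  show "integrable lborel (\<lambda>\<xi>. (norm (G s \<xi>))\<^sup>2)"
  proof (rule Bochner_Integration.integrable_bound[OF integrable_mult_right[OF integrable_norm[OF i], of B]])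
    have "norm (G s \<xi>) \<le> B" for \<xi> using B[of \<xi>] by simp
    moreover from this[of 0] have "B \<ge> 0" by (rule order_trans[rotated]) simp
    ultimately show "AE \<xi> in lborel. norm ((norm (G s \<xi>))\<^sup>2) \<le> norm (B * norm (G s \<xi>))"
      by (intro AE_I2) (simp add: power2_eq_square mult_right_mono)
  qed (use gm in simp)
qed

end

section \<open>The Sobolev norm on the Fourier side\<close>

lemma ennreal_powr_ennreal: "y \<ge> 0 \<Longrightarrow> ennreal_powr (ennreal y) p = ennreal (y powr p)"
  unfolding ennreal_powr_def by simp

lemma ennreal_powr_mono: "y \<le> z \<Longrightarrow> p \<ge> 0 \<Longrightarrow> ennreal_powr y p \<le> ennreal_powr z p"
  unfolding ennreal_powr_def by (auto simp: top_unique intro!: ennreal_leI powr_mono2 enn2real_mono simp: less_top)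

definition sobolev_energy :: "real \<Rightarrow> ('a::euclidean_space \<Rightarrow> complex) \<Rightarrow> real" where
  "sobolev_energy s f = (LINT \<xi>|lborel. (1 + (norm \<xi>)\<^sup>2) powr s * (norm (fourier f \<xi>))\<^sup>2)"

lemma sobolev_energy_nonneg: "sobolev_energy s f \<ge> 0"
  unfolding sobolev_energy_def by (intro Bochner_Integration.integral_nonneg) simp

text \<open>Both halves of Plancherel, applied to the multiplier. Squaring the constant of
  \<open>inverse_fourier\<close> gives \<open>(2 * pi) ^ DIM('a)\<close> to the power -2, Plancherel
  gives back one such factor, and one remains in the denominator.\<close>

lemma sobolev_norm_eq_energy:
  fixes f :: "'a::euclidean_space \<Rightarrow> complex"
  assumes f: "schwartz f"
  shows "sobolev_norm s f = ennreal (sqrt (sobolev_energy s f / (2 * pi) ^ DIM('a)))"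
proof -
  define G where "G \<xi> = of_real ((1 + (norm \<xi>)\<^sup>2) powr (s / 2)) * fourier f \<xi>" for \<xi>
  have c: "continuous_on UNIV G" and i: "integrable lborel G" and i2: "integrable lborel (\<lambda>\<xi>. (norm (G \<xi>))\<^sup>2)"
    using sobolev_multiplier[OF f, of s] unfolding G_def[abs_def] by auto
  obtain B where B: "\<And>\<xi>. norm (G \<xi>) \<le> B"
    using sobolev_multiplier(3)[OF f, of s] unfolding G_def[abs_def] by auto
  let ?P = "(2 * pi) ^ DIM('a) :: real"
  have P: "?P > 0" by simp
  have bp: "bessel_potential s f x = of_real (1 / ?P) * ft G x" for x
    unfolding bessel_potential_def inverse_fourier_def ft_def G_def exp_i_eq_cis ..
  have e: "(norm (G \<xi>))\<^sup>2 = (1 + (norm \<xi>)\<^sup>2) powr s * (norm (fourier f \<xi>))\<^sup>2" for \<xi>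
  proof -
    have "((1 + (norm \<xi>)\<^sup>2) powr (s / 2))\<^sup>2 = (1 + (norm \<xi>)\<^sup>2) powr s"
      unfolding power2_eq_square powr_add[symmetric] by simp
    then show ?thesis unfolding G_def by (simp add: norm_mult power_mult_distrib)
  qed
  have E: "(\<integral>\<^sup>+\<xi>. ennreal ((norm (G \<xi>))\<^sup>2) \<partial>lborel) = ennreal (sobolev_energy s f)"
    using nn_integral_eq_integral[OF i2] unfolding e sobolev_energy_def by simp
  have "(\<integral>\<^sup>+\<xi>. ennreal ((norm (ft G \<xi>))\<^sup>2) \<partial>lborel) = ennreal ?P * ennreal (sobolev_energy s f)"
    using bessel_ft[OF i] plancherel_lower[OF i c B] unfolding E by (rule antisym)
  then have F: "(\<integral>\<^sup>+\<xi>. ennreal ((norm (ft G \<xi>))\<^sup>2) \<partial>lborel) = ennreal (?P * sobolev_energy s f)"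
    using sobolev_energy_nonneg[of s f] by (simp add: ennreal_mult)
  have [measurable]: "ft G \<in> borel_measurable borel" by (rule measurable_ft[OF i])
  have "(\<integral>\<^sup>+x\<in>UNIV. ennreal_powr (ennreal (norm (bessel_potential s f x))) 2 \<partial>lborel) =
      (\<integral>\<^sup>+x. ennreal (1 / ?P\<^sup>2) * ennreal ((norm (ft G x))\<^sup>2) \<partial>lborel)"
    unfolding bp by (intro nn_integral_cong)
      (simp add: ennreal_powr_ennreal norm_mult norm_divide norm_power power_mult_distrib power_divide flip: ennreal_mult)
  also have "\<dots> = ennreal (1 / ?P\<^sup>2) * ennreal (?P * sobolev_energy s f)"
    by (subst nn_integral_cmult) (simp_all only: F, measurable)
  also have "\<dots> = ennreal (sobolev_energy s f / ?P)"
    using sobolev_energy_nonneg[of s f] P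
    by (subst ennreal_mult[symmetric]) (simp_all add: power2_eq_square)
  finally have "sobolev_norm s f = ennreal_powr (ennreal (sobolev_energy s f / ?P)) (1 / 2)"
    unfolding sobolev_norm_def Lp_norm_def by simp
  also have "\<dots> = ennreal (sqrt (sobolev_energy s f / ?P))"
    using sobolev_energy_nonneg[of s f] by (subst ennreal_powr_ennreal) (simp_all add: powr_half_sqrt)
  finally show ?thesis .
qed

section \<open>Dyadic decomposition of the maximal function\<close>

lemma ennreal_norm_sums_le:
  fixes g :: "nat \<Rightarrow> complex"
  assumes "g sums s"
  shows "ennreal (norm s) \<le> (\<Sum>n. ennreal (norm (g n)))"
proof (rule LIMSEQ_le_const2)
  show "(\<lambda>n. ennreal (norm (\<Sum>i<n. g i))) \<longlonglongrightarrow> ennreal (norm s)"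
    using assms unfolding sums_def by (intro tendsto_ennrealI tendsto_norm)
  have "ennreal (norm (\<Sum>i<n. g i)) \<le> (\<Sum>n. ennreal (norm (g n)))" for n
  proof -
    have "ennreal (norm (\<Sum>i<n. g i)) \<le> ennreal (\<Sum>i<n. norm (g i))" by (intro ennreal_leI norm_sum)
    also have "\<dots> = (\<Sum>i<n. ennreal (norm (g i)))" by (simp add: sum_ennreal)
    also have "\<dots> \<le> (\<Sum>n. ennreal (norm (g n)))" by (rule sum_le_suminf) auto
    finally show ?thesis .
  qed
  then show "\<exists>N. \<forall>n\<ge>N. ennreal (norm (\<Sum>i<n. g i)) \<le> (\<Sum>n. ennreal (norm (g n)))" by blast
qed

text \<open>A finite bound \<open>r\<close> on all the powers bounds every \<open>a n\<close> by
  \<open>r powr (1 / q)\<close>. This moves the exponent inside the supremum, where monotone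
  convergence can act.\<close>

lemma ennreal_powr_SUP_le:
  fixes a :: "nat \<Rightarrow> real"
  assumes a: "\<And>n. a n \<ge> 0" and q: "q > 0"
  shows "ennreal_powr (SUP n. ennreal (a n)) q \<le> (SUP n. ennreal (a n powr q))"
proof (cases "(SUP n. ennreal (a n powr q))" rule: ennreal_cases)
  case (real r)
  have "a n \<le> r powr (1 / q)" for n
  proof -
    have "ennreal (a n powr q) \<le> ennreal r" unfolding real(2)[symmetric] by (rule SUP_upper) simp
    then have "a n powr q \<le> r" using real(1) by simp
    then have "(a n powr q) powr (1 / q) \<le> r powr (1 / q)" using q by (intro powr_mono2) auto
    then show ?thesis using q a[of n] by (simp add: powr_powr)
  qed
  then have "(SUP n. ennreal (a n)) \<le> ennreal (r powr (1 / q))" by (intro SUP_least ennreal_leI)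
  then have "ennreal_powr (SUP n. ennreal (a n)) q \<le> ennreal_powr (ennreal (r powr (1 / q))) q"
    using q by (intro ennreal_powr_mono) auto
  also have "\<dots> = ennreal r" using q real(1) by (simp add: ennreal_powr_ennreal powr_powr)
  finally show ?thesis unfolding real(2) .
next
  case top
  show ?thesis unfolding top by (rule top_greatest)
qed

text \<open>Factor \<open>z i powr r\<close> as \<open>z i * z i powr (r - 1)\<close> and bound the
  second factor by the full sum. With \<open>r = q / 2\<close> it passes from the
  \<open>q\<close>-th powers of the dyadic norms to the energy.\<close>

lemma sum_powr_le_powr_sum:
  fixes z :: "'i \<Rightarrow> real"
  assumes I: "finite I" and z: "\<And>i. i \<in> I \<Longrightarrow> z i \<ge> 0" and r: "r \<ge> 1"
  shows "(\<Sum>i\<in>I. z i powr r) \<le> (\<Sum>i\<in>I. z i) powr r"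
proof -
  let ?Z = "\<Sum>i\<in>I. z i"
  have Z: "?Z \<ge> 0" by (intro sum_nonneg z)
  have e: "w powr r = w * w powr (r - 1)" if "w \<ge> 0" for w :: real
    using that by (cases "w = 0") (simp_all add: powr_mult_base)
  have "(\<Sum>i\<in>I. z i powr r) \<le> (\<Sum>i\<in>I. z i * ?Z powr (r - 1))"
  proof (rule sum_mono)
    fix i assume i: "i \<in> I"
    have "z i \<le> ?Z" using i z I by (intro member_le_sum) auto
    then have "z i powr (r - 1) \<le> ?Z powr (r - 1)" using r z[OF i] by (intro powr_mono2) auto
    then show "z i powr r \<le> z i * ?Z powr (r - 1)" unfolding e[OF z[OF i]] by (intro mult_left_mono z i)
  qed
  also have "\<dots> = ?Z powr r" unfolding e[OF Z] by (simp add: sum_distrib_right)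
  finally show ?thesis .
qed

section \<open>Frequency shells and lattice maximal functions\<close>

text \<open>The whole unit ball forms level 0. Sharp shells are enough, since the estimates use a
  piece only through its support and its \<open>L\<^sup>2\<close> norm.\<close>

definition dyadic_level :: "'a::euclidean_space \<Rightarrow> nat" where
  "dyadic_level \<xi> = (LEAST j. norm \<xi> \<le> 2 ^ j)"

lemma norm_le_dyadic_level: "norm \<xi> \<le> 2 ^ dyadic_level \<xi>"
proof -
  obtain k where "norm \<xi> < 2 ^ k" using real_arch_pow[of 2 "norm \<xi>"] by auto
  then have "norm \<xi> \<le> 2 ^ k" by simp
  then show ?thesis unfolding dyadic_level_def by (rule LeastI)
qed

lemma less_dyadic_level: "j < dyadic_level \<xi> \<Longrightarrow> 2 ^ j < norm \<xi>"
  using not_less_Least[of j "\<lambda>j. norm \<xi> \<le> 2 ^ j"] unfolding dyadic_level_def by auto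

lemma dyadic_level_le_iff: "dyadic_level \<xi> \<le> j \<longleftrightarrow> norm \<xi> \<le> 2 ^ j"
proof
  assume "dyadic_level \<xi> \<le> j"
  then have "(2::real) ^ dyadic_level \<xi> \<le> 2 ^ j" by (intro power_increasing) auto
  with norm_le_dyadic_level[of \<xi>] show "norm \<xi> \<le> 2 ^ j" by (rule order_trans)
next
  assume "norm \<xi> \<le> 2 ^ j"
  then show "dyadic_level \<xi> \<le> j" unfolding dyadic_level_def by (rule Least_le)
qed

lemma measurable_dyadic_level: "{\<xi>. dyadic_level \<xi> = j} \<in> sets borel"
proof (cases j)
  case 0
  have "{\<xi>::'a. dyadic_level \<xi> = j} = {\<xi>. dyadic_level \<xi> \<le> 0}" unfolding 0 by simp
  also have "\<dots> = cball 0 1" unfolding dyadic_level_le_iff by auto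
  finally show ?thesis by simp
next
  case (Suc i)
  have "{\<xi>::'a. dyadic_level \<xi> = j} = {\<xi>. dyadic_level \<xi> \<le> Suc i} - {\<xi>. dyadic_level \<xi> \<le> i}"
    unfolding Suc by auto
  also have "\<dots> = cball 0 (2 ^ Suc i) - cball 0 (2 ^ i)"
    unfolding dyadic_level_le_iff by (auto simp del: power_Suc)
  finally show ?thesis by simp
qed

text \<open>The extra factor is what the \<open>m\<close>-th Taylor term of the time evolution, with
  time counted in units of \<open>1 / 2 ^ j\<close>, does to the frequency \<xi>. Its modulus is at
  most 1 on the shell, so all orders \<open>m\<close> obey the same bounds.\<close>

definition dyadic_piece :: "nat \<Rightarrow> nat \<Rightarrow> ('a::euclidean_space \<Rightarrow> complex) \<Rightarrow> 'a \<Rightarrow> complex" where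
  "dyadic_piece j m H \<xi> = (\<i> * of_real (norm \<xi> / 2 ^ j)) ^ m * (indicator {\<xi>. dyadic_level \<xi> = j} \<xi> * H \<xi>)"

lemma norm_dyadic_piece_le:
  "norm (dyadic_piece j m H \<xi>) \<le> indicator {\<xi>. dyadic_level \<xi> = j} \<xi> * norm (H \<xi>)"
proof (cases "dyadic_level \<xi> = j")
  case True
  have "norm \<xi> / 2 ^ j \<le> 1" using norm_le_dyadic_level[of \<xi>] True by simp
  then have "(norm \<xi> / 2 ^ j) ^ m \<le> 1" by (intro power_le_one) auto
  then have "(norm \<xi> / 2 ^ j) ^ m * norm (H \<xi>) \<le> 1 * norm (H \<xi>)" by (rule mult_right_mono) simp
  then show ?thesis
    using True unfolding dyadic_piece_def by (simp add: norm_mult norm_power norm_divide)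
qed (simp add: dyadic_piece_def)

lemma dyadic_piece_0: "dyadic_piece j 0 H \<xi> = indicator {\<xi>. dyadic_level \<xi> = j} \<xi> * H \<xi>"
  unfolding dyadic_piece_def by simp

lemma
  fixes H :: "'a::euclidean_space \<Rightarrow> complex"
  assumes H: "integrable lborel H" and H2: "integrable lborel (\<lambda>\<xi>. (norm (H \<xi>))\<^sup>2)"
  shows integrable_dyadic_piece: "integrable lborel (dyadic_piece j m H)"
    and integrable_dyadic_piece_sq: "integrable lborel (\<lambda>\<xi>. (norm (dyadic_piece j m H \<xi>))\<^sup>2)"
    and band_limited_dyadic_piece: "band_limited (real (2 ^ j)) (dyadic_piece j m H)"
proof -
  have [measurable]: "H \<in> borel_measurable borel" using borel_measurable_integrable[OF H] by simp
  have [measurable]: "dyadic_piece j m H \<in> borel_measurable borel"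
  proof -
    have "(indicator {\<xi>. dyadic_level \<xi> = j} :: 'a \<Rightarrow> complex) \<in> borel_measurable borel"
      by (rule borel_measurable_indicator) (rule measurable_dyadic_level)
    moreover have "(\<lambda>\<xi>::'a. (\<i> * of_real (norm \<xi> / 2 ^ j)) ^ m) \<in> borel_measurable borel"
      by measurable
    ultimately show ?thesis
      unfolding dyadic_piece_def[abs_def] by (intro borel_measurable_times) simp_all
  qed
  have le: "norm (dyadic_piece j m H \<xi>) \<le> norm (H \<xi>)" for \<xi>
    using norm_dyadic_piece_le[of j m H \<xi>] by (cases "dyadic_level \<xi> = j") auto
  show i: "integrable lborel (dyadic_piece j m H)"
    by (rule Bochner_Integration.integrable_bound[OF H]) (use le in auto)
  show i2: "integrable lborel (\<lambda>\<xi>. (norm (dyadic_piece j m H \<xi>))\<^sup>2)"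
    by (rule Bochner_Integration.integrable_bound[OF H2]) (use le in \<open>simp_all add: power_mono\<close>)
  have "dyadic_piece j m H \<xi> = 0" if "norm \<xi> > real (2 ^ j)" for \<xi>
  proof -
    have "dyadic_level \<xi> \<noteq> j" using dyadic_level_le_iff[of \<xi> j] that by auto
    then show ?thesis by (simp add: dyadic_piece_def)
  qed
  then show "band_limited (real (2 ^ j)) (dyadic_piece j m H)"
    unfolding band_limited_def using i i2 by auto
qed

lemma l2norm_dyadic_piece_le:
  assumes H: "integrable lborel H" and H2: "integrable lborel (\<lambda>\<xi>. (norm (H \<xi>))\<^sup>2)"
  shows "l2norm (dyadic_piece j m H) \<le> l2norm (dyadic_piece j 0 H)"
  unfolding l2norm_def
proof (rule real_sqrt_le_mono, rule integral_mono)
  fix \<xi>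
  have "norm (dyadic_piece j m H \<xi>) \<le> norm (dyadic_piece j 0 H \<xi>)"
    using norm_dyadic_piece_le[of j m H \<xi>] unfolding dyadic_piece_0
    by (cases "dyadic_level \<xi> = j") simp_all
  then show "(norm (dyadic_piece j m H \<xi>))\<^sup>2 \<le> (norm (dyadic_piece j 0 H \<xi>))\<^sup>2"
    by (rule power_mono) simp
qed (rule integrable_dyadic_piece_sq[OF H H2])+

text \<open>The spacing \<open>1 / 2 ^ j\<close> of the times matches the frequency bound
  \<open>2 ^ j\<close>, so that between two lattice times the phase changes by at most 1.\<close>

definition dyadic_maximal :: "nat \<Rightarrow> nat \<Rightarrow> ('a::euclidean_space \<Rightarrow> complex) \<Rightarrow> 'a \<Rightarrow> real" where
  "dyadic_maximal j m H x = indicator (ball 0 1) x *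
     Max ((\<lambda>k. norm (half_wave (real k / real (2 ^ j)) (dyadic_piece j m H) x)) ` {..<2 ^ j})"

lemma dyadic_maximal_ge:
  assumes "x \<in> ball 0 1" "k < 2 ^ j"
  shows "norm (half_wave (real k / real (2 ^ j)) (dyadic_piece j m H) x) \<le> dyadic_maximal j m H x"
  unfolding dyadic_maximal_def using assms by (auto intro!: Max_ge)

lemma dyadic_maximal_nonneg: "dyadic_maximal j m H x \<ge> 0"
proof (cases "x \<in> ball 0 1")
  case True
  have "(0::nat) < 2 ^ j" by simp
  from order_trans[OF norm_ge_zero dyadic_maximal_ge[OF True this]] show ?thesis .
qed (simp add: dyadic_maximal_def)

lemma measurable_dyadic_maximal:
  assumes H: "integrable lborel H" and H2: "integrable lborel (\<lambda>\<xi>. (norm (H \<xi>))\<^sup>2)"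
  shows "dyadic_maximal j m H \<in> borel_measurable borel"
proof -
  have [measurable]: "half_wave t (dyadic_piece j m H) \<in> borel_measurable borel" for t
    by (rule measurable_half_wave[OF integrable_dyadic_piece[OF H H2]])
  have Maxm: "(\<lambda>x. Max ((\<lambda>k. norm (half_wave (real k / real (2 ^ j)) (dyadic_piece j m H) x)) ` {..<2 ^ j})) \<in> borel_measurable borel"
    by (rule borel_measurable_Max) (auto, measurable)
  show ?thesis
    unfolding dyadic_maximal_def[abs_def]
    by (intro borel_measurable_times borel_measurable_indicator Maxm) simp
qed

lemma dyadic_maximal_level_set:
  assumes "\<alpha> > 0"
  shows "{x. dyadic_maximal j m H x > \<alpha>} = wave_level_set (2 ^ j) (dyadic_piece j m H) \<alpha>"
proof (intro set_eqI)
  fix x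
  have "Max ((\<lambda>k. norm (half_wave (real k / real (2 ^ j)) (dyadic_piece j m H) x)) ` {..<2 ^ j}) > \<alpha> \<longleftrightarrow>
      (\<exists>k<2 ^ j. norm (half_wave (real k / real (2 ^ j)) (dyadic_piece j m H) x) > \<alpha>)"
    by (subst Max_gr_iff) (auto simp: lessThan_empty_iff)
  then show "x \<in> {x. dyadic_maximal j m H x > \<alpha>} \<longleftrightarrow> x \<in> wave_level_set (2 ^ j) (dyadic_piece j m H) \<alpha>"
    using assms unfolding dyadic_maximal_def wave_level_set_def by (auto simp: indicator_def)
qed

text \<open>Taylor expansion of \<open>cis (t |\<xi>|)\<close> around the largest multiple of \<open>2\<^sup>-\<^sup>j\<close> below \<open>t\<close>.\<close>

lemma half_wave_piece_le:
  fixes H :: "'a::euclidean_space \<Rightarrow> complex"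
  assumes H: "integrable lborel H" and H2: "integrable lborel (\<lambda>\<xi>. (norm (H \<xi>))\<^sup>2)"
    and x: "x \<in> ball 0 1" and t: "0 < t" "t < 1"
  shows "ennreal (norm (half_wave t (dyadic_piece j 0 H) x)) \<le> (\<Sum>m. ennreal (1 / fact m * dyadic_maximal j m H x))"
proof -
  let ?N = "(2::real) ^ j"
  define k where "k = nat \<lfloor>t * ?N\<rfloor>"
  have rk: "real k = of_int \<lfloor>t * ?N\<rfloor>" unfolding k_def using t by simp
  \<comment> \<open>The remaining time, counted in lattice steps. It lies in \<open>[0, 1]\<close>,
    which bounds the Taylor coefficients by \<open>1 / fact m\<close>.\<close>
  define \<theta> where "\<theta> = t * ?N - real k"
  have \<theta>: "0 \<le> \<theta>" "\<theta> \<le> 1" unfolding \<theta>_def rk by linarith+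
  have "real k \<le> t * ?N" using \<theta>(1) unfolding \<theta>_def by simp
  also have "\<dots> < 1 * ?N" using t by (intro mult_strict_right_mono) auto
  finally have "real k < real (2 ^ j)" by simp
  then have kN: "k < 2 ^ j" by (simp only: of_nat_less_iff)
  define F where "F m \<xi> = cis (x \<bullet> \<xi>) * (cis (real k / real (2 ^ j) * norm \<xi>) *
      ((of_real \<theta> ^ m / fact m) * dyadic_piece j m H \<xi>))" for m \<xi>
  have Fi: "integrable lborel (F m)" for m
    unfolding F_def
    by (intro integrable_ft integrable_half_wave integrable_mult_right integrable_dyadic_piece H H2)
  have \<theta>m: "norm (of_real \<theta> ^ m / fact m :: complex) \<le> 1 / fact m" for m
    using \<theta> by (simp add: norm_divide norm_power divide_right_mono power_le_one)
  have Fn: "norm (F m \<xi>) \<le> 1 / fact m * norm (H \<xi>)" for m \<xi>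
  proof -
    have "norm (dyadic_piece j m H \<xi>) \<le> norm (H \<xi>)"
      using norm_dyadic_piece_le[of j m H \<xi>] by (cases "dyadic_level \<xi> = j") auto
    then have "norm (of_real \<theta> ^ m / fact m :: complex) * norm (dyadic_piece j m H \<xi>) \<le> 1 / fact m * norm (H \<xi>)"
      using \<theta>m by (intro mult_mono) auto
    then show ?thesis unfolding F_def by (simp only: norm_mult norm_cis mult_1)
  qed
  have Fsum: "(\<lambda>m. F m \<xi>) sums (cis (x \<bullet> \<xi>) * (cis (t * norm \<xi>) * dyadic_piece j 0 H \<xi>))" for \<xi>
  proof -
    let ?w = "\<i> * of_real (norm \<xi> / ?N)"
    have "(\<lambda>m. (of_real \<theta> * ?w) ^ m /\<^sub>R fact m) sums exp (of_real \<theta> * ?w)" by (rule exp_converges)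
    then have "(\<lambda>m. cis (x \<bullet> \<xi>) * (cis (real k / real (2 ^ j) * norm \<xi>) * ((of_real \<theta> * ?w) ^ m /\<^sub>R fact m * dyadic_piece j 0 H \<xi>)))
        sums (cis (x \<bullet> \<xi>) * (cis (real k / real (2 ^ j) * norm \<xi>) * (exp (of_real \<theta> * ?w) * dyadic_piece j 0 H \<xi>)))"
      by (intro sums_mult sums_mult2)
    moreover have "exp (of_real \<theta> * ?w) = cis (\<theta> * (norm \<xi> / ?N))" by (simp add: cis_conv_exp mult_ac)
    moreover have "cis (real k / real (2 ^ j) * norm \<xi>) * cis (\<theta> * (norm \<xi> / ?N)) = cis (t * norm \<xi>)"
    proof -
      have "real k / real (2 ^ j) * norm \<xi> + \<theta> * (norm \<xi> / ?N) = t * norm \<xi>"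
        unfolding \<theta>_def by (simp add: field_simps)
      then show ?thesis by (simp only: cis_mult)
    qed
    moreover have "(of_real \<theta> * ?w) ^ m /\<^sub>R fact m * dyadic_piece j 0 H \<xi> = of_real \<theta> ^ m / fact m * dyadic_piece j m H \<xi>" for m
      unfolding dyadic_piece_def by (simp add: power_mult_distrib scaleR_conv_of_real field_simps)
    ultimately show ?thesis unfolding F_def by (simp only: mult.assoc[symmetric]) (simp only: mult.assoc)
  qed
  have "(\<lambda>m. LINT \<xi>|lborel. F m \<xi>) sums (LINT \<xi>|lborel. (\<Sum>m. F m \<xi>))"
  proof (rule sums_integral[OF Fi])
    have s: "summable (\<lambda>m. 1 / fact m * c :: real)" for c
      using summable_exp[of "1::real"] by (intro summable_mult2) (simp add: divide_inverse)
    show "AE \<xi> in lborel. summable (\<lambda>m. norm (F m \<xi>))"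
      by (intro AE_I2 summable_comparison_test[OF _ s]) (use Fn in auto)
    show "summable (\<lambda>m. LINT \<xi>|lborel. norm (F m \<xi>))"
    proof (rule summable_comparison_test[OF _ s[of "LINT \<xi>|lborel. norm (H \<xi>)"]])
      have "(LINT \<xi>|lborel. norm (F m \<xi>)) \<le> (LINT \<xi>|lborel. 1 / fact m * norm (H \<xi>))" for m
        by (rule integral_mono) (use Fi Fn H in auto)
      then show "\<exists>N. \<forall>m\<ge>N. norm (LINT \<xi>|lborel. norm (F m \<xi>)) \<le> 1 / fact m * (LINT \<xi>|lborel. norm (H \<xi>))"
        by (simp add: Bochner_Integration.integral_nonneg)
    qed
  qed
  also have "(LINT \<xi>|lborel. (\<Sum>m. F m \<xi>)) = half_wave t (dyadic_piece j 0 H) x"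
    unfolding half_wave_def ft_def sums_unique[OF Fsum, symmetric] ..
  finally have "ennreal (norm (half_wave t (dyadic_piece j 0 H) x)) \<le> (\<Sum>m. ennreal (norm (LINT \<xi>|lborel. F m \<xi>)))"
    by (rule ennreal_norm_sums_le)
  also have "\<dots> \<le> (\<Sum>m. ennreal (1 / fact m * dyadic_maximal j m H x))"
  proof (intro suminf_le summableI allI ennreal_leI)
    fix m
    have "(LINT \<xi>|lborel. F m \<xi>) = (of_real \<theta> ^ m / fact m) * half_wave (real k / real (2 ^ j)) (dyadic_piece j m H) x"
      unfolding F_def half_wave_def ft_def
      by (subst integral_mult_right_zero[symmetric]) (simp add: mult_ac)
    then show "norm (LINT \<xi>|lborel. F m \<xi>) \<le> 1 / fact m * dyadic_maximal j m H x"
      using mult_mono[OF \<theta>m[of m] dyadic_maximal_ge[OF x kN, of m H]] by (simp only: norm_mult) simp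
  qed
  finally show ?thesis .
qed

text \<open>The frequency sum and the Taylor sum are truncated at the same \<open>n\<close>, so that
  the right-hand side is the supremum of one increasing sequence of finite sums. It does not depend
  on \<open>t\<close>, hence it also bounds the supremum over all times.\<close>

lemma half_wave_le_dyadic:
  fixes H :: "'a::euclidean_space \<Rightarrow> complex"
  assumes H: "integrable lborel H" and H2: "integrable lborel (\<lambda>\<xi>. (norm (H \<xi>))\<^sup>2)"
    and x: "x \<in> ball 0 1" and t: "0 < t" "t < 1"
  shows "ennreal (norm (half_wave t H x)) \<le> (SUP n. ennreal (\<Sum>m<n. 1 / fact m * (\<Sum>j<n. dyadic_maximal j m H x)))"
proof -
  define F where "F j \<xi> = cis (x \<bullet> \<xi>) * (cis (t * norm \<xi>) * dyadic_piece j 0 H \<xi>)" for j \<xi>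
  have Fi: "integrable lborel (F j)" for j
    unfolding F_def by (intro integrable_ft integrable_half_wave integrable_dyadic_piece H H2)
  have Fn: "norm (F j \<xi>) = indicator {\<xi>. dyadic_level \<xi> = j} \<xi> * norm (H \<xi>)" for j \<xi>
    unfolding F_def dyadic_piece_0 by (simp add: norm_mult indicator_def)
  have Fsum: "(\<lambda>j. F j \<xi>) sums (cis (x \<bullet> \<xi>) * (cis (t * norm \<xi>) * H \<xi>))" for \<xi>
  proof -
    have "(\<lambda>j. F j \<xi>) sums F (dyadic_level \<xi>) \<xi>"
      by (rule sums_single[of "dyadic_level \<xi>" "\<lambda>j. F j \<xi>", THEN sums_cong[THEN iffD1, rotated]])
         (auto simp: F_def dyadic_piece_0)
    then show ?thesis by (simp add: F_def dyadic_piece_0)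
  qed
  have ps: "(\<Sum>j<n. norm (F j \<xi>)) \<le> norm (H \<xi>)" for n \<xi>
  proof -
    have "(\<Sum>j<n. norm (F j \<xi>)) = (\<Sum>j<n. if j = dyadic_level \<xi> then norm (H \<xi>) else 0)"
      unfolding Fn by (intro sum.cong) (auto simp: indicator_def)
    also have "\<dots> \<le> norm (H \<xi>)" by (simp add: sum.delta')
    finally show ?thesis .
  qed
  have "(\<lambda>j. LINT \<xi>|lborel. F j \<xi>) sums (LINT \<xi>|lborel. (\<Sum>j. F j \<xi>))"
  proof (rule sums_integral[OF Fi])
    show "AE \<xi> in lborel. summable (\<lambda>j. norm (F j \<xi>))"
      by (intro AE_I2 summableI_nonneg_bounded[of _ "norm (H _)"]) (use ps in auto)
    show "summable (\<lambda>j. LINT \<xi>|lborel. norm (F j \<xi>))"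
    proof (rule summableI_nonneg_bounded[of _ "LINT \<xi>|lborel. norm (H \<xi>)"])
      fix n
      have "(\<Sum>j<n. LINT \<xi>|lborel. norm (F j \<xi>)) = (LINT \<xi>|lborel. (\<Sum>j<n. norm (F j \<xi>)))"
        by (rule Bochner_Integration.integral_sum[symmetric]) (use Fi in auto)
      also have "\<dots> \<le> (LINT \<xi>|lborel. norm (H \<xi>))"
        by (rule integral_mono) (use Fi H ps in auto)
      finally show "(\<Sum>j<n. LINT \<xi>|lborel. norm (F j \<xi>)) \<le> (LINT \<xi>|lborel. norm (H \<xi>))" .
    qed (simp add: Bochner_Integration.integral_nonneg)
  qed
  also have "(LINT \<xi>|lborel. (\<Sum>j. F j \<xi>)) = half_wave t H x"
    unfolding half_wave_def ft_def sums_unique[OF Fsum, symmetric] ..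
  also have "(\<lambda>j. LINT \<xi>|lborel. F j \<xi>) = (\<lambda>j. half_wave t (dyadic_piece j 0 H) x)"
    unfolding half_wave_def ft_def F_def ..
  finally have "ennreal (norm (half_wave t H x)) \<le> (\<Sum>j. ennreal (norm (half_wave t (dyadic_piece j 0 H) x)))"
    by (rule ennreal_norm_sums_le)
  also have "\<dots> \<le> (\<Sum>j. \<Sum>m. ennreal (1 / fact m * dyadic_maximal j m H x))"
    by (intro suminf_le summableI allI half_wave_piece_le[OF H H2 x t])
  also have "\<dots> \<le> (SUP n. ennreal (\<Sum>m<n. 1 / fact m * (\<Sum>j<n. dyadic_maximal j m H x)))" (is "_ \<le> ?S")
    unfolding suminf_eq_SUP[of "\<lambda>j. \<Sum>m. ennreal (1 / fact m * dyadic_maximal j m H x)"]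
  proof (rule SUP_least)
    fix J
    have "(\<Sum>j<J. \<Sum>m. ennreal (1 / fact m * dyadic_maximal j m H x)) =
        (\<Sum>m. \<Sum>j<J. ennreal (1 / fact m * dyadic_maximal j m H x))"
      by (rule suminf_sum[symmetric]) simp
    also have "\<dots> = (SUP n. \<Sum>m<n. \<Sum>j<J. ennreal (1 / fact m * dyadic_maximal j m H x))"
      by (rule suminf_eq_SUP)
    also have "\<dots> \<le> ?S"
    proof (rule SUP_least)
      fix n
      have "(\<Sum>m<n. \<Sum>j<J. ennreal (1 / fact m * dyadic_maximal j m H x)) =
          ennreal (\<Sum>m<n. \<Sum>j<J. 1 / fact m * dyadic_maximal j m H x)"
        using dyadic_maximal_nonneg[of _ _ H x] by (simp add: sum_nonneg flip: sum_ennreal)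
      \<comment> \<open>All terms are nonnegative, so both truncations may be enlarged to a common
        one.\<close>
      also have "\<dots> \<le> ennreal (\<Sum>m<max n J. \<Sum>j<max n J. 1 / fact m * dyadic_maximal j m H x)"
      proof (rule ennreal_leI)
        have nn: "0 \<le> 1 / fact m * dyadic_maximal j m H x" for j m
          using dyadic_maximal_nonneg[of j m H x] by simp
        have "(\<Sum>m<n. \<Sum>j<J. 1 / fact m * dyadic_maximal j m H x) \<le> (\<Sum>m<n. \<Sum>j<max n J. 1 / fact m * dyadic_maximal j m H x)"
          by (intro sum_mono sum_mono2) (use nn in auto)
        also have "\<dots> \<le> (\<Sum>m<max n J. \<Sum>j<max n J. 1 / fact m * dyadic_maximal j m H x)"
          by (rule sum_mono2) (use nn in \<open>auto intro!: sum_nonneg\<close>)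
        finally show "(\<Sum>m<n. \<Sum>j<J. 1 / fact m * dyadic_maximal j m H x) \<le>
            (\<Sum>m<max n J. \<Sum>j<max n J. 1 / fact m * dyadic_maximal j m H x)" .
      qed
      also have "\<dots> = ennreal (\<Sum>m<max n J. 1 / fact m * (\<Sum>j<max n J. dyadic_maximal j m H x))"
        by (simp only: sum_distrib_left)
      also have "\<dots> \<le> ?S" by (rule SUP_upper) simp
      finally show "(\<Sum>m<n. \<Sum>j<J. ennreal (1 / fact m * dyadic_maximal j m H x)) \<le> ?S" .
    qed
    finally show "(\<Sum>j<J. \<Sum>m. ennreal (1 / fact m * dyadic_maximal j m H x)) \<le> ?S" .
  qed
  finally show ?thesis .
qed

section \<open>From weak type bounds to the maximal estimate\<close>

lemma sum_two_power_div_fact_le: "(\<Sum>m<n. 2 ^ m / fact m :: real) \<le> exp 2"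
  using sum_le_suminf[OF summable_exp_generic[of "2::real"], of "{..<n}"]
  by (simp add: exp_def divide_inverse mult.commute)

lemma sum_powr_taylor_weights_le:
  fixes q :: real
  assumes q: "q \<ge> 1"
  shows "(\<Sum>m<n. (2 ^ m / fact m :: real) powr q) \<le> exp 2 powr q"
proof -
  have "(\<Sum>m<n. (2 ^ m / fact m :: real) powr q) \<le> (\<Sum>m<n. 2 ^ m / fact m :: real) powr q"
    by (rule sum_powr_le_powr_sum) (use q in auto)
  also have "\<dots> \<le> exp 2 powr q"
    using q by (intro powr_mono2 sum_two_power_div_fact_le) (auto intro!: sum_nonneg)
  finally show ?thesis .
qed

text \<open>Split \<open>1 / fact m\<close> as \<open>(1 / 2) ^ m\<close> times
  \<open>2 ^ m / fact m\<close>. The first factor is summable and is used up by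
  \<open>sum_mult_powr_le\<close>; the second is still summable after taking \<open>q\<close>-th
  powers.\<close>

lemma taylor_sum_powr_le:
  fixes T :: "nat \<Rightarrow> real"
  assumes T: "\<And>m. T m \<ge> 0" and q: "q \<ge> 1"
  shows "(\<Sum>m<n. 1 / fact m * T m) powr q \<le> 2 powr q * (\<Sum>m<n. (2 ^ m / fact m) powr q * T m powr q)"
proof -
  have "(\<Sum>m<n. 1 / fact m * T m) = (\<Sum>m<n. (1 / 2) ^ m * (2 ^ m / fact m * T m))"
    by (intro sum.cong refl) (simp add: power_one_over)
  also have "\<dots> powr q \<le> (\<Sum>m<n. (1 / 2) ^ m) powr q * (\<Sum>m<n. (2 ^ m / fact m * T m) powr q)"
    by (rule sum_mult_powr_le) (use T q in auto)
  also have "(\<Sum>m<n. (1 / 2) ^ m) powr q \<le> (2::real) powr q"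
    using q sum_le_suminf[OF summable_geometric[of "1 / 2 :: real"], of "{..<n}"]
    by (intro powr_mono2) (auto simp: suminf_geometric intro!: sum_nonneg)
  finally show ?thesis
    unfolding powr_mult[of "2 ^ m / fact m" "T m" for m] by (simp add: mult_right_mono sum_nonneg)
qed

lemma
  fixes f :: "'a::euclidean_space \<Rightarrow> complex"
  assumes f: "schwartz f"
  shows integrable_fourier: "integrable lborel (fourier f)"
    and integrable_fourier_sq: "integrable lborel (\<lambda>\<xi>. (norm (fourier f \<xi>))\<^sup>2)"
    and integrable_sobolev_energy: "integrable lborel (\<lambda>\<xi>. (1 + (norm \<xi>)\<^sup>2) powr s * (norm (fourier f \<xi>))\<^sup>2)"
proof -
  have e: "(norm (of_real ((1 + (norm \<xi>)\<^sup>2) powr (s / 2)) * fourier f \<xi>))\<^sup>2 =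
      (1 + (norm \<xi>)\<^sup>2) powr s * (norm (fourier f \<xi>))\<^sup>2" for \<xi> s
  proof -
    have "((1 + (norm \<xi>)\<^sup>2) powr (s / 2))\<^sup>2 = (1 + (norm \<xi>)\<^sup>2) powr s"
      unfolding power2_eq_square powr_add[symmetric] by simp
    then show ?thesis by (simp add: norm_mult power_mult_distrib)
  qed
  show E: "integrable lborel (\<lambda>\<xi>. (1 + (norm \<xi>)\<^sup>2) powr s * (norm (fourier f \<xi>))\<^sup>2)" for s
    using sobolev_multiplier(4)[OF f, of s] unfolding e .
  have nz: "1 + (norm \<xi>)\<^sup>2 \<noteq> 0" for \<xi> :: 'a by (rule add_pos_nonneg[THEN less_imp_neq, symmetric]) auto
  show "integrable lborel (fourier f)" using sobolev_multiplier(2)[OF f, of 0] nz by simp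
  show "integrable lborel (\<lambda>\<xi>. (norm (fourier f \<xi>))\<^sup>2)" using E[of 0] nz by simp
qed

text \<open>Littlewood-Paley summation of the energy; for \<open>j > 0\<close> the frequencies of the piece \<open>j\<close>
  exceed \<open>2 ^ (j - 1)\<close>.\<close>

lemma sum_dyadic_energy_le:
  fixes f :: "'a::euclidean_space \<Rightarrow> complex"
  assumes f: "schwartz f" and s: "s \<ge> 0"
  shows "(\<Sum>j<n. (2 powr (s * real j) * l2norm (dyadic_piece j 0 (fourier f)))\<^sup>2) \<le> 4 powr s * sobolev_energy s f"
proof -
  let ?H = "fourier f"
  have H: "integrable lborel ?H" and H2: "integrable lborel (\<lambda>\<xi>. (norm (?H \<xi>))\<^sup>2)"
    by (rule integrable_fourier[OF f], rule integrable_fourier_sq[OF f])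
  note E = integrable_sobolev_energy[OF f, of s]
  have i: "integrable lborel (\<lambda>\<xi>. (2 powr (s * real j))\<^sup>2 * (norm (dyadic_piece j 0 ?H \<xi>))\<^sup>2)" for j
    by (intro integrable_mult_right integrable_dyadic_piece_sq[OF H H2])
  have "(\<Sum>j<n. (2 powr (s * real j) * l2norm (dyadic_piece j 0 ?H))\<^sup>2) =
      (\<Sum>j<n. LINT \<xi>|lborel. (2 powr (s * real j))\<^sup>2 * (norm (dyadic_piece j 0 ?H \<xi>))\<^sup>2)"
    unfolding power_mult_distrib l2norm_sq by simp
  also have "\<dots> = (LINT \<xi>|lborel. (\<Sum>j<n. (2 powr (s * real j))\<^sup>2 * (norm (dyadic_piece j 0 ?H \<xi>))\<^sup>2))"
    by (rule Bochner_Integration.integral_sum[symmetric]) (rule i)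
  also have "\<dots> \<le> (LINT \<xi>|lborel. 4 powr s * ((1 + (norm \<xi>)\<^sup>2) powr s * (norm (?H \<xi>))\<^sup>2))"
  proof (rule integral_mono)
    fix \<xi> :: 'a
    let ?l = "dyadic_level \<xi>"
    have "(\<Sum>j<n. (2 powr (s * real j))\<^sup>2 * (norm (dyadic_piece j 0 ?H \<xi>))\<^sup>2) =
        (\<Sum>j<n. if j = ?l then (2 powr (s * real ?l))\<^sup>2 * (norm (?H \<xi>))\<^sup>2 else 0)"
      unfolding dyadic_piece_0 by (intro sum.cong) auto
    also have "\<dots> \<le> (2 powr (s * real ?l))\<^sup>2 * (norm (?H \<xi>))\<^sup>2" by (simp add: sum.delta')
    also have "(2 powr (s * real ?l))\<^sup>2 \<le> 4 powr s * (1 + (norm \<xi>)\<^sup>2) powr s"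
    proof -
      have le: "(2 ^ ?l)\<^sup>2 \<le> 4 * (1 + (norm \<xi>)\<^sup>2)"
      proof (cases ?l)
        case 0
        then show ?thesis by (simp add: add_increasing2)
      next
        case (Suc i)
        then have "2 ^ i < norm \<xi>" by (intro less_dyadic_level) simp
        then have "(2 ^ Suc i)\<^sup>2 \<le> (2 * norm \<xi>)\<^sup>2" by (intro power_mono) auto
        also have "(2 * norm \<xi>)\<^sup>2 = 4 * (norm \<xi>)\<^sup>2" by (simp add: power_mult_distrib)
        finally show ?thesis unfolding Suc by (rule order_trans) simp
      qed
      have "(2 powr (s * real ?l))\<^sup>2 = ((2 ^ ?l)\<^sup>2) powr s"
        unfolding power2_eq_square powr_mult by (simp add: powr_realpow[symmetric] powr_powr mult.commute)
      also have "\<dots> \<le> (4 * (1 + (norm \<xi>)\<^sup>2)) powr s" using s le by (intro powr_mono2) auto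
      finally show ?thesis unfolding powr_mult .
    qed
    finally show "(\<Sum>j<n. (2 powr (s * real j))\<^sup>2 * (norm (dyadic_piece j 0 ?H \<xi>))\<^sup>2) \<le>
        4 powr s * ((1 + (norm \<xi>)\<^sup>2) powr s * (norm (?H \<xi>))\<^sup>2)"
      by (simp add: mult_right_mono mult.assoc)
  qed (intro Bochner_Integration.integrable_sum i integrable_mult_right E)+
  also have "\<dots> = 4 powr s * sobolev_energy s f" unfolding sobolev_energy_def by simp
  finally show ?thesis .
qed

lemma wave_eq_half_wave:
  fixes f :: "'a::euclidean_space \<Rightarrow> complex"
  shows "wave t f x = of_real (1 / (2 * pi) ^ DIM('a)) * half_wave t (fourier f) x"
proof -
  have e: "exp (\<i> * of_real (x \<bullet> \<xi> + t * norm \<xi>)) * fourier f \<xi> = cis (x \<bullet> \<xi>) * (cis (t * norm \<xi>) * fourier f \<xi>)" for \<xi>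
    unfolding exp_i_eq_cis cis_mult[symmetric] mult.assoc ..
  show ?thesis unfolding wave_def half_wave_def ft_def e ..
qed

text \<open>Scale \<open>j\<close> uses \<open>N = 2 ^ j\<close> lattice times. With
  \<open>h j = 2 powr (e * j) * a j\<close>, where \<open>a j\<close> is the norm of the
  \<open>j\<close>-th shell, the relation \<open>s * q = e * q - \<kappa>\<close> turns
  \<open>2 powr (- \<kappa> * j) * h j powr q\<close> into the \<open>q\<close>-th power of
  \<open>2 powr (s * j) * a j\<close>. As \<open>q \<ge> 2\<close>, the sum of these powers is
  controlled by the energy.\<close>

lemma maximal_estimate_of_weak_type:
  fixes \<kappa> e plo phi q s K0 :: real
  assumes \<kappa>: "\<kappa> > 0" and p: "0 < plo" "plo < q" "q < phi" and q: "q \<ge> 2" and s: "s \<ge> 0" "s * q = e * q - \<kappa>"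
    and K0: "K0 \<ge> 0"
    and weak: "\<And>N (H :: 'a::euclidean_space \<Rightarrow> complex) \<alpha> p. N > 0 \<Longrightarrow> band_limited (real N) H \<Longrightarrow> \<alpha> > 0 \<Longrightarrow> p \<in> {plo, phi} \<Longrightarrow>
      measure lborel (wave_level_set N H \<alpha>) \<le> K0 * (real N powr (- \<kappa>) * (real N powr e * l2norm H / \<alpha>) powr p)"
  obtains C where "C \<ge> 0" and "\<And>f :: 'a \<Rightarrow> complex. schwartz f \<Longrightarrow>
    Lp_norm q (ball 0 1) (wave_maximal f) \<le> ennreal C * sobolev_norm s f"
proof -
  show ?thesis
  proof (rule weak_type_summation[OF \<kappa> p K0, where 'a = 'a])
  fix C1 assume C1: "C1 \<ge> 0" and sumthm: "\<And>(F :: nat \<Rightarrow> 'a \<Rightarrow> real) M h J.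
      (\<And>j. F j \<in> borel_measurable M) \<Longrightarrow> (\<And>j x. F j x \<ge> 0) \<Longrightarrow> (\<And>j. h j \<ge> 0) \<Longrightarrow>
      (\<And>j \<alpha> p. \<alpha> > 0 \<Longrightarrow> p \<in> {plo, phi} \<Longrightarrow>
        emeasure M {x \<in> space M. F j x > \<alpha>} \<le> ennreal (K0 * 2 powr (- \<kappa> * real j) * (h j / \<alpha>) powr p)) \<Longrightarrow>
      (\<integral>\<^sup>+x. ennreal ((\<Sum>j<J. F j x) powr q) \<partial>M) \<le> ennreal (C1 * (\<Sum>j<J. 2 powr (- \<kappa> * real j) * h j powr q))"
  define P where "P = (2 * pi) ^ DIM('a)"
  have P: "P > 0" unfolding P_def by simp
  \<comment> \<open>In this order: the splitting of the Taylor weights, their sum, the summation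
    over the scales, and the passage from the shells to the energy.\<close>
  define C2 where "C2 = 2 powr q * exp 2 powr q * C1 * (4 powr s) powr (q / 2)"
  have C2: "C2 \<ge> 0" unfolding C2_def using C1 by simp
  \<comment> \<open>\<open>1 / P\<close> is the normalisation of \<open>wave\<close>, and
    \<open>sqrt P\<close> converts the energy into the Sobolev norm.\<close>
  define C where "C = (1 / P) * C2 powr (1 / q) * sqrt P"
  have C: "C \<ge> 0" unfolding C_def using P by simp
  have main: "Lp_norm q (ball 0 1) (wave_maximal f) \<le> ennreal C * sobolev_norm s f" if f: "schwartz f" for f :: "'a \<Rightarrow> complex"
  proof -
    let ?H = "fourier f" and ?L = "lborel :: 'a measure"
    have H: "integrable ?L ?H" and H2: "integrable ?L (\<lambda>\<xi>. (norm (?H \<xi>))\<^sup>2)"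
      by (rule integrable_fourier[OF f], rule integrable_fourier_sq[OF f])
    define En where "En = sobolev_energy s f"
    have En: "En \<ge> 0" unfolding En_def by (rule sobolev_energy_nonneg)
    have Mm [measurable]: "dyadic_maximal j m ?H \<in> borel_measurable borel" for j m
      by (rule measurable_dyadic_maximal[OF H H2])
    define a where "a j = l2norm (dyadic_piece j 0 ?H)" for j
    have a0: "a j \<ge> 0" for j unfolding a_def by (rule l2norm_nonneg)
    define h where "h j = 2 powr (e * real j) * a j" for j
    have h0: "h j \<ge> 0" for j unfolding h_def using a0 by simp
    have X: "(\<Sum>j<n. 2 powr (- \<kappa> * real j) * h j powr q) \<le> (4 powr s * En) powr (q / 2)" for n
    proof -
      have "2 powr (- \<kappa> * real j) * h j powr q = ((2 powr (s * real j) * a j)\<^sup>2) powr (q / 2)" for j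
      proof -
        have ex: "- \<kappa> * real j + e * real j * q = s * real j * q"
        proof -
          have "- \<kappa> * real j + e * real j * q = (e * q - \<kappa>) * real j" by (simp add: algebra_simps)
          then show ?thesis unfolding s(2)[symmetric] by (simp add: algebra_simps)
        qed
        have "2 powr (- \<kappa> * real j) * h j powr q = 2 powr (- \<kappa> * real j + e * real j * q) * a j powr q"
          unfolding h_def powr_mult powr_powr powr_add by (simp add: mult.assoc)
        also have "\<dots> = (2 powr (s * real j) * a j) powr q"
          unfolding ex powr_mult powr_powr ..
        also have "\<dots> = ((2 powr (s * real j) * a j) powr 2) powr (q / 2)" unfolding powr_powr by simp
        also have "(2 powr (s * real j) * a j) powr 2 = (2 powr (s * real j) * a j)\<^sup>2"
          using a0[of j] by simp
        finally show ?thesis .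
      qed
      then have "(\<Sum>j<n. 2 powr (- \<kappa> * real j) * h j powr q) = (\<Sum>j<n. ((2 powr (s * real j) * a j)\<^sup>2) powr (q / 2))"
        by simp
      also have "\<dots> \<le> (\<Sum>j<n. (2 powr (s * real j) * a j)\<^sup>2) powr (q / 2)"
        by (rule sum_powr_le_powr_sum) (use q in auto)
      also have "\<dots> \<le> (4 powr s * En) powr (q / 2)"
        using sum_dyadic_energy_le[OF f s(1), of n] q unfolding a_def En_def
        by (intro powr_mono2) (auto intro!: sum_nonneg)
      finally show ?thesis .
    qed
    have wt: "emeasure ?L {x \<in> space ?L. dyadic_maximal j m ?H x > \<alpha>} \<le> ennreal (K0 * 2 powr (- \<kappa> * real j) * (h j / \<alpha>) powr p)"
      if \<alpha>: "\<alpha> > 0" and p': "p \<in> {plo, phi}" for j m \<alpha> p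
    proof -
      let ?G = "dyadic_piece j m ?H"
      have N: "real (2 ^ j) powr r = 2 powr (r * real j)" for r
        by (simp add: powr_realpow[symmetric] powr_powr mult.commute)
      have "emeasure ?L {x \<in> space ?L. dyadic_maximal j m ?H x > \<alpha>} = emeasure ?L (wave_level_set (2 ^ j) ?G \<alpha>)"
        using dyadic_maximal_level_set[OF \<alpha>, of j m ?H] by simp
      also have "\<dots> = ennreal (measure ?L (wave_level_set (2 ^ j) ?G \<alpha>))"
        using emeasure_wave_level_set_finite by (intro emeasure_eq_ennreal_measure) (simp add: less_top[symmetric] less_imp_neq)
      also have "\<dots> \<le> ennreal (K0 * (real (2 ^ j) powr (- \<kappa>) * (real (2 ^ j) powr e * l2norm ?G / \<alpha>) powr p))"
        by (intro ennreal_leI weak band_limited_dyadic_piece[OF H H2] \<alpha> p') simp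
      \<comment> \<open>The order \<open>m\<close> can only decrease the norm of a piece, so the
        sequence \<open>h\<close> built from order 0 serves every \<open>m\<close>.\<close>
      also have "\<dots> \<le> ennreal (K0 * (2 powr (- \<kappa> * real j) * (h j / \<alpha>) powr p))"
        unfolding N h_def a_def using p' p \<alpha> K0 l2norm_dyadic_piece_le[OF H H2, of j m] l2norm_nonneg[of ?G]
        by (intro ennreal_leI mult_left_mono powr_mono2 divide_right_mono) auto
      finally show ?thesis by (simp add: mult.assoc)
    qed
    have Tle: "(\<integral>\<^sup>+x. ennreal ((\<Sum>j<n. dyadic_maximal j m ?H x) powr q) \<partial>?L) \<le> ennreal (C1 * (4 powr s * En) powr (q / 2))" for m n
    proof -
      have "(\<integral>\<^sup>+x. ennreal ((\<Sum>j<n. dyadic_maximal j m ?H x) powr q) \<partial>?L) \<le>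
          ennreal (C1 * (\<Sum>j<n. 2 powr (- \<kappa> * real j) * h j powr q))"
        by (rule sumthm) (use dyadic_maximal_nonneg h0 wt in auto)
      also have "\<dots> \<le> ennreal (C1 * (4 powr s * En) powr (q / 2))"
        by (intro ennreal_leI mult_left_mono X C1)
      finally show ?thesis .
    qed
    define S where "S n x = (\<Sum>m<n. 1 / fact m * (\<Sum>j<n. dyadic_maximal j m ?H x))" for n x
    have Sm [measurable]: "S n \<in> borel_measurable borel" for n unfolding S_def[abs_def] by measurable
    have T0: "0 \<le> (\<Sum>j<n. dyadic_maximal j m ?H x)" for n m x
      by (intro sum_nonneg dyadic_maximal_nonneg)
    have S0: "S n x \<ge> 0" for n x unfolding S_def by (intro sum_nonneg mult_nonneg_nonneg T0) auto
    have Smono: "S n x \<le> S n' x" if "n \<le> n'" for n n' x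
    proof -
      have "S n x \<le> (\<Sum>m<n. 1 / fact m * (\<Sum>j<n'. dyadic_maximal j m ?H x))"
        unfolding S_def using that
        by (intro sum_mono mult_left_mono sum_mono2) (auto intro: dyadic_maximal_nonneg)
      also have "\<dots> \<le> S n' x"
        unfolding S_def using that by (intro sum_mono2) (auto intro!: divide_nonneg_nonneg T0)
      finally show ?thesis .
    qed
    have Sint: "(\<integral>\<^sup>+x. ennreal (S n x powr q) \<partial>?L) \<le> ennreal (C2 * En powr (q / 2))" for n
    proof -
      let ?T = "\<lambda>m x. \<Sum>j<n. dyadic_maximal j m ?H x"
      let ?v = "\<lambda>m. (2 ^ m / fact m :: real) powr q"
      let ?K = "C1 * (4 powr s * En) powr (q / 2)"
      have K0: "?K \<ge> 0" using C1 by simp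
      have "(\<integral>\<^sup>+x. ennreal (S n x powr q) \<partial>?L) \<le>
          (\<integral>\<^sup>+x. ennreal (2 powr q) * (\<Sum>m<n. ennreal (?v m) * ennreal (?T m x powr q)) \<partial>?L)"
      proof (rule nn_integral_mono)
        fix x
        have "ennreal (S n x powr q) \<le> ennreal (2 powr q * (\<Sum>m<n. ?v m * ?T m x powr q))"
          unfolding S_def by (intro ennreal_leI taylor_sum_powr_le T0) (use q in simp)
        also have "\<dots> = ennreal (2 powr q) * (\<Sum>m<n. ennreal (?v m) * ennreal (?T m x powr q))"
          by (simp add: ennreal_mult sum_nonneg flip: sum_ennreal)
        finally show "ennreal (S n x powr q) \<le> ennreal (2 powr q) * (\<Sum>m<n. ennreal (?v m) * ennreal (?T m x powr q))" .
      qed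
      also have "\<dots> = ennreal (2 powr q) * (\<Sum>m<n. ennreal (?v m) * (\<integral>\<^sup>+x. ennreal (?T m x powr q) \<partial>?L))"
        by (simp add: nn_integral_cmult nn_integral_sum)
      also have "\<dots> \<le> ennreal (2 powr q) * (\<Sum>m<n. ennreal (?v m) * ennreal ?K)"
        by (intro mult_left_mono sum_mono Tle) auto
      also have "\<dots> = ennreal (2 powr q * ((\<Sum>m<n. ?v m) * ?K))"
        using K0 by (simp add: ennreal_mult sum_nonneg sum_distrib_right flip: sum_ennreal)
      also have "\<dots> \<le> ennreal (2 powr q * (exp 2 powr q * ?K))"
        by (intro ennreal_leI mult_left_mono mult_right_mono sum_powr_taylor_weights_le K0) (use q in auto)
      also have "2 powr q * (exp 2 powr q * ?K) = C2 * En powr (q / 2)"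
        unfolding C2_def powr_mult by (simp add: mult_ac)
      finally show ?thesis .
    qed
    have wm: "wave_maximal f x \<le> (SUP n. ennreal (S n x / P))" if x: "x \<in> ball 0 1" for x
      unfolding wave_maximal_def
    proof (rule SUP_least)
      fix t :: real assume "t \<in> {0<..<1}"
      then have t: "0 < t" "t < 1" by auto
      have "ennreal (norm (wave t f x)) = ennreal (1 / P) * ennreal (norm (half_wave t ?H x))"
        unfolding wave_eq_half_wave P_def[symmetric] using P by (simp add: norm_mult norm_divide ennreal_mult[symmetric])
      also have "\<dots> \<le> ennreal (1 / P) * (SUP n. ennreal (S n x))"
        unfolding S_def by (intro mult_left_mono half_wave_le_dyadic[OF H H2 x t]) simp
      also have "\<dots> = (SUP n. ennreal (1 / P) * ennreal (S n x))" by (rule SUP_mult_left_ennreal)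
      also have "\<dots> = (SUP n. ennreal (S n x / P))"
        using P S0 by (simp add: ennreal_mult[symmetric])
      finally show "ennreal (norm (wave t f x)) \<le> (SUP n. ennreal (S n x / P))" .
    qed
    have "(\<integral>\<^sup>+x\<in>ball 0 1. ennreal_powr (wave_maximal f x) q \<partial>?L) \<le> (\<integral>\<^sup>+x. (SUP n. ennreal ((S n x / P) powr q)) \<partial>?L)"
    proof (rule nn_integral_mono)
      fix x :: 'a
      show "ennreal_powr (wave_maximal f x) q * indicator (ball 0 1) x \<le> (SUP n. ennreal ((S n x / P) powr q))"
      proof (cases "x \<in> ball 0 1")
        case True
        have "ennreal_powr (wave_maximal f x) q \<le> ennreal_powr (SUP n. ennreal (S n x / P)) q"
          using q by (intro ennreal_powr_mono wm True) auto
        also have "\<dots> \<le> (SUP n. ennreal ((S n x / P) powr q))"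
          using q P S0 by (intro ennreal_powr_SUP_le) auto
        finally show ?thesis using True by simp
      qed simp
    qed
    also have "\<dots> = (SUP n. \<integral>\<^sup>+x. ennreal ((S n x / P) powr q) \<partial>?L)"
    proof (rule nn_integral_monotone_convergence_SUP)
      show "incseq (\<lambda>n x. ennreal ((S n x / P) powr q))"
        unfolding incseq_def le_fun_def using q P S0 Smono
        by (auto intro!: ennreal_leI powr_mono2 divide_right_mono)
    qed measurable
    also have "\<dots> \<le> ennreal ((1 / P) powr q * (C2 * En powr (q / 2)))"
    proof (rule SUP_least)
      fix n
      have "(\<integral>\<^sup>+x. ennreal ((S n x / P) powr q) \<partial>?L) = (\<integral>\<^sup>+x. ennreal ((1 / P) powr q) * ennreal (S n x powr q) \<partial>?L)"
        using P by (intro nn_integral_cong) (simp add: ennreal_mult[symmetric] powr_divide)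
      also have "\<dots> = ennreal ((1 / P) powr q) * (\<integral>\<^sup>+x. ennreal (S n x powr q) \<partial>?L)"
        by (rule nn_integral_cmult) measurable
      also have "\<dots> \<le> ennreal ((1 / P) powr q) * ennreal (C2 * En powr (q / 2))"
        by (intro mult_left_mono Sint) simp
      finally show "(\<integral>\<^sup>+x. ennreal ((S n x / P) powr q) \<partial>?L) \<le> ennreal ((1 / P) powr q * (C2 * En powr (q / 2)))"
        using C2 by (simp add: ennreal_mult)
    qed
    finally have "Lp_norm q (ball 0 1) (wave_maximal f) \<le> ennreal_powr (ennreal ((1 / P) powr q * (C2 * En powr (q / 2)))) (1 / q)"
      unfolding Lp_norm_def using q by (intro ennreal_powr_mono) auto
    also have "\<dots> = ennreal (((1 / P) powr q * (C2 * En powr (q / 2))) powr (1 / q))"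
      using C2 by (intro ennreal_powr_ennreal) auto
    also have "((1 / P) powr q * (C2 * En powr (q / 2))) powr (1 / q) = (1 / P) * (C2 powr (1 / q) * sqrt En)"
      unfolding powr_mult powr_powr using q P En by (simp add: powr_half_sqrt)
    also have "\<dots> = C * sqrt (En / P)"
      unfolding C_def using P by (simp add: real_sqrt_divide)
    also have "ennreal (C * sqrt (En / P)) = ennreal C * sobolev_norm s f"
      unfolding sobolev_norm_eq_energy[OF f] En_def[symmetric] P_def[symmetric] using C P En by (simp add: ennreal_mult)
    finally show ?thesis .
  qed
  show ?thesis by (rule that[OF C main])
  qed
qed

lemma sobolev_norm_mono:
  fixes f :: "'a::euclidean_space \<Rightarrow> complex"
  assumes f: "schwartz f" and st: "s \<le> t"
  shows "sobolev_norm s f \<le> sobolev_norm t f"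
proof -
  have "sobolev_energy s f \<le> sobolev_energy t f"
    unfolding sobolev_energy_def using st
    by (intro integral_mono integrable_sobolev_energy[OF f] mult_right_mono powr_mono) auto
  then show ?thesis
    unfolding sobolev_norm_eq_energy[OF f] by (intro ennreal_leI real_sqrt_le_mono divide_right_mono) auto
qed

lemma maximal_estimate_sufficient:
  fixes q s :: real
  assumes d: "DIM('a::euclidean_space) \<ge> 2" and q: "q > 2" "q \<noteq> q_circ DIM('a)" and s: "s \<ge> s_crit q DIM('a)"
  shows "\<exists>C\<ge>0. \<forall>f :: 'a \<Rightarrow> complex. schwartz f \<longrightarrow> Lp_norm q (ball 0 1) (wave_maximal f) \<le> ennreal C * sobolev_norm s f"
proof -
  define D where "D = real DIM('a)"
  have D: "D \<ge> 2" using d unfolding D_def by simp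
  have qc: "q_circ DIM('a) = 2 * (D + 1) / (D - 1)" unfolding q_circ_def D_def ..
  have qc2: "q_circ DIM('a) > 2" unfolding qc using D by (simp add: field_simps)
  obtain C where C: "C \<ge> 0" and est: "\<And>f :: 'a \<Rightarrow> complex. schwartz f \<Longrightarrow>
    Lp_norm q (ball 0 1) (wave_maximal f) \<le> ennreal C * sobolev_norm (s_crit q DIM('a)) f"
  proof (cases "q < q_circ DIM('a)")
    case True
    then have sc: "s_crit q DIM('a) = (D + 1) / 4 - (D - 1) / (2 * q)" unfolding s_crit_def D_def by simp
    obtain K where K: "K \<ge> 0" and w: "\<And>N (H :: 'a \<Rightarrow> complex) \<alpha> p. N > 0 \<Longrightarrow> band_limited (real N) H \<Longrightarrow> \<alpha> > 0 \<Longrightarrow>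
        p \<in> {2, q_circ DIM('a)} \<Longrightarrow> measure lborel (wave_level_set N H \<alpha>) \<le>
        K * (real N powr (- ((D - 1) / 2)) * (real N powr ((D + 1) / 4) * l2norm H / \<alpha>) powr p)"
      using weak_type_low[OF d] unfolding qc D_def by metis
    show ?thesis
    proof (rule maximal_estimate_of_weak_type[where \<kappa> = "(D - 1) / 2" and e = "(D + 1) / 4" and plo = 2 and phi = "q_circ DIM('a)"
          and q = q and s = "s_crit q DIM('a)" and 'a = 'a, OF _ _ _ _ _ _ _ K w])
      have "(D - 1) / (2 * q) \<le> (D - 1) / 4" using q D by (intro divide_left_mono) auto
      also have "\<dots> \<le> (D + 1) / 4" by simp
      finally show "s_crit q DIM('a) \<ge> 0" unfolding sc by simp
      show "s_crit q DIM('a) * q = (D + 1) / 4 * q - (D - 1) / 2"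
        unfolding sc using q by (simp add: field_simps)
    qed (use q True D that in auto)
  next
    case False
    then have q': "q > q_circ DIM('a)" using q by simp
    have sc: "s_crit q DIM('a) = D / 2 - D / q" using False unfolding s_crit_def D_def by simp
    \<comment> \<open>The upper endpoint is free, and any exponent above \<open>q\<close> would
      serve.\<close>
    have p1: "q + 1 \<ge> 2 * (real DIM('a) + 1) / (real DIM('a) - 1)" using q' unfolding qc D_def by simp
    obtain K where K: "K \<ge> 0" and w: "\<And>N (H :: 'a \<Rightarrow> complex) \<alpha> p. N > 0 \<Longrightarrow> band_limited (real N) H \<Longrightarrow> \<alpha> > 0 \<Longrightarrow>
        p \<in> {q_circ DIM('a), q + 1} \<Longrightarrow> measure lborel (wave_level_set N H \<alpha>) \<le>
        K * (real N powr (- D) * (real N powr (D / 2) * l2norm H / \<alpha>) powr p)"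
      using weak_type_high[OF d p1] unfolding qc D_def by metis
    show ?thesis
    proof (rule maximal_estimate_of_weak_type[where \<kappa> = D and e = "D / 2" and plo = "q_circ DIM('a)" and phi = "q + 1"
          and q = q and s = "s_crit q DIM('a)" and 'a = 'a, OF _ _ _ _ _ _ _ K w])
      have "D / q \<le> D / 2" using q D by (intro divide_left_mono) auto
      then show "s_crit q DIM('a) \<ge> 0" unfolding sc by simp
      show "s_crit q DIM('a) * q = D / 2 * q - D"
        unfolding sc using q by (simp add: left_diff_distrib)
    qed (use q q' qc2 D that in auto)
  qed
  have "Lp_norm q (ball 0 1) (wave_maximal f) \<le> ennreal C * sobolev_norm s f" if f: "schwartz f" for f :: "'a \<Rightarrow> complex"
    using est[OF f] mult_left_mono[OF sobolev_norm_mono[OF f s], of "ennreal C"] by (rule order_trans) simp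
  then show ?thesis using C by blast
qed

text \<open>Polynomials times one modulated Gaussian, generated so that closure under partial
  derivatives is visible rule by rule. Induction over this class replaces explicit Hermite
  polynomials in the proof that packets are Schwartz functions. The phase \<open>c\<close> becomes
  the centre in frequency and \<open>l\<close> the widths in frequency.\<close>

inductive_set gauss_span :: "('a::euclidean_space \<Rightarrow> real) \<Rightarrow> 'a \<Rightarrow> ('a \<Rightarrow> complex) set"
  for l :: "'a \<Rightarrow> real" and c :: 'a
where
  gauss: "(\<lambda>x. cis (c \<bullet> x) * of_real (exp (- ((\<Sum>b\<in>Basis. (l b * (x \<bullet> b))\<^sup>2) / 2)))) \<in> gauss_span l c"
| coord: "f \<in> gauss_span l c \<Longrightarrow> b \<in> Basis \<Longrightarrow> (\<lambda>x. of_real (x \<bullet> b) * f x) \<in> gauss_span l c"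
| scale: "f \<in> gauss_span l c \<Longrightarrow> (\<lambda>x. z * f x) \<in> gauss_span l c"
| add: "f \<in> gauss_span l c \<Longrightarrow> g \<in> gauss_span l c \<Longrightarrow> (\<lambda>x. f x + g x) \<in> gauss_span l c"

abbreviation gauss_packet :: "('a::euclidean_space \<Rightarrow> real) \<Rightarrow> 'a \<Rightarrow> 'a \<Rightarrow> complex" where
  "gauss_packet l c \<equiv> (\<lambda>x. cis (c \<bullet> x) * of_real (exp (- ((\<Sum>b\<in>Basis. (l b * (x \<bullet> b))\<^sup>2) / 2))))"

section \<open>Gaussian wave packets\<close>

lemma has_derivative_cis_inner:
  "((\<lambda>x. cis (c \<bullet> x)) has_derivative (\<lambda>y. (c \<bullet> y) *\<^sub>R (\<i> * cis (c \<bullet> x)))) (at x)"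
proof -
  have "(cis has_derivative (\<lambda>r. r *\<^sub>R (\<i> * cis (c \<bullet> x)))) (at (c \<bullet> x))"
    using has_vector_derivative_iexp[of "c \<bullet> x" UNIV]
    unfolding has_vector_derivative_def exp_i_eq_cis .
  then show ?thesis
    by (intro has_derivative_compose[where f = "\<lambda>x. c \<bullet> x" and f' = "\<lambda>y. c \<bullet> y" and g = cis])
       (auto intro!: derivative_eq_intros)
qed

lemma partial_derivative_eqI:
  assumes "(f has_derivative D) (at x)"
  shows "partial_derivative b f x = D b"
  unfolding partial_derivative_def using frechet_derivative_at[OF assms] by simp

lemma gauss_span_derivative:
  assumes "f \<in> gauss_span l c"
  shows "(\<forall>x. f differentiable (at x)) \<and> (\<forall>b\<in>Basis. partial_derivative b f \<in> gauss_span l c)"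
  using assms
proof induction
  case gauss
  let ?E = "\<lambda>x. exp (- ((\<Sum>b\<in>Basis. (l b * (x \<bullet> b))\<^sup>2) / 2))"
  let ?D = "\<lambda>x y. cis (c \<bullet> x) * of_real (- (\<Sum>b\<in>Basis. (l b)\<^sup>2 * (x \<bullet> b) * (y \<bullet> b)) * ?E x) +
       (c \<bullet> y) *\<^sub>R (\<i> * cis (c \<bullet> x)) * of_real (?E x)"
  have E: "(?E has_derivative (\<lambda>y. - (\<Sum>b\<in>Basis. (l b)\<^sup>2 * (x \<bullet> b) * (y \<bullet> b)) * ?E x)) (at x)" for x
  proof -
    have "((\<lambda>x. - ((\<Sum>b\<in>Basis. (l b * (x \<bullet> b))\<^sup>2) / 2)) has_derivative
        (\<lambda>y. - ((\<Sum>b\<in>Basis. 2 * ((l b)\<^sup>2 * (x \<bullet> b) * (y \<bullet> b))) / 2))) (at x)"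
      by (auto intro!: derivative_eq_intros sum.cong simp: power2_eq_square mult_ac)
    then have "((\<lambda>x. - ((\<Sum>b\<in>Basis. (l b * (x \<bullet> b))\<^sup>2) / 2)) has_derivative
        (\<lambda>y. - (\<Sum>b\<in>Basis. (l b)\<^sup>2 * (x \<bullet> b) * (y \<bullet> b)))) (at x)"
      by (simp add: sum_distrib_left[symmetric])
    from has_derivative_exp[OF this] show ?thesis
      by (rule has_derivative_eq_rhs) (simp add: fun_eq_iff mult.commute)
  qed
  have der: "(gauss_packet l c has_derivative ?D x) (at x)" for x
    by (rule has_derivative_mult[OF has_derivative_cis_inner has_derivative_of_real[OF E]])
  have pd: "partial_derivative b (gauss_packet l c) =
      (\<lambda>x. (\<i> * of_real (c \<bullet> b)) * gauss_packet l c x + of_real (- (l b)\<^sup>2) * (of_real (x \<bullet> b) * gauss_packet l c x))"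
    if b: "b \<in> Basis" for b
  proof
    fix x
    have "(\<Sum>b'\<in>Basis. (l b')\<^sup>2 * (x \<bullet> b') * (b \<bullet> b')) = (\<Sum>b'\<in>Basis. if b' = b then (l b)\<^sup>2 * (x \<bullet> b) else 0)"
      using b by (intro sum.cong) (auto simp: inner_Basis)
    also have "\<dots> = (l b)\<^sup>2 * (x \<bullet> b)" using b by (simp add: sum.delta)
    finally show "partial_derivative b (gauss_packet l c) x =
        (\<i> * of_real (c \<bullet> b)) * gauss_packet l c x + of_real (- (l b)\<^sup>2) * (of_real (x \<bullet> b) * gauss_packet l c x)"
      unfolding partial_derivative_eqI[OF der] by (simp add: scaleR_conv_of_real mult_ac)
  qed
  have "partial_derivative b (gauss_packet l c) \<in> gauss_span l c" if b: "b \<in> Basis" for b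
    unfolding pd[OF b]
    by (rule gauss_span.add[OF gauss_span.scale[OF gauss_span.gauss]
          gauss_span.scale[OF gauss_span.coord[OF gauss_span.gauss b]]])
  then show ?case using der unfolding differentiable_def by blast
next
  case (coord f b')
  have fd: "(f has_derivative frechet_derivative f (at x)) (at x)" for x
    using coord.IH frechet_derivative_works by blast
  have der: "((\<lambda>x. of_real (x \<bullet> b') * f x) has_derivative
      (\<lambda>y. of_real (x \<bullet> b') * frechet_derivative f (at x) y + of_real (y \<bullet> b') * f x)) (at x)" for x
    by (intro has_derivative_mult fd has_derivative_of_real) (auto intro!: derivative_eq_intros)
  have "partial_derivative b (\<lambda>x. of_real (x \<bullet> b') * f x) =
      (\<lambda>x. of_real (x \<bullet> b') * partial_derivative b f x + of_real (b \<bullet> b') * f x)" for b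
    unfolding partial_derivative_eqI[OF der, abs_def] partial_derivative_def ..
  then have "\<forall>b\<in>Basis. partial_derivative b (\<lambda>x. of_real (x \<bullet> b') * f x) \<in> gauss_span l c"
    using coord by (auto intro!: gauss_span.intros)
  then show ?case using der unfolding differentiable_def by blast
next
  case (scale f z)
  have fd: "(f has_derivative frechet_derivative f (at x)) (at x)" for x
    using scale.IH frechet_derivative_works by blast
  have der: "((\<lambda>x. z * f x) has_derivative (\<lambda>y. z * frechet_derivative f (at x) y)) (at x)" for x
    by (intro has_derivative_mult_right fd)
  have "partial_derivative b (\<lambda>x. z * f x) = (\<lambda>x. z * partial_derivative b f x)" for b
    unfolding partial_derivative_eqI[OF der, abs_def] partial_derivative_def ..
  then have "\<forall>b\<in>Basis. partial_derivative b (\<lambda>x. z * f x) \<in> gauss_span l c"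
    using scale by (auto intro!: gauss_span.intros)
  then show ?case using der unfolding differentiable_def by blast
next
  case (add f g)
  have fd: "(f has_derivative frechet_derivative f (at x)) (at x)" "(g has_derivative frechet_derivative g (at x)) (at x)" for x
    using add.IH frechet_derivative_works by blast+
  have der: "((\<lambda>x. f x + g x) has_derivative (\<lambda>y. frechet_derivative f (at x) y + frechet_derivative g (at x) y)) (at x)" for x
    by (intro has_derivative_add fd)
  have "partial_derivative b (\<lambda>x. f x + g x) = (\<lambda>x. partial_derivative b f x + partial_derivative b g x)" for b
    unfolding partial_derivative_eqI[OF der, abs_def] partial_derivative_def ..
  then have "\<forall>b\<in>Basis. partial_derivative b (\<lambda>x. f x + g x) \<in> gauss_span l c"
    using add by (auto intro!: gauss_span.intros)
  then show ?case using der unfolding differentiable_def by blast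
qed

text \<open>From \<open>2 * r - 1 \<le> r\<^sup>2\<close> the Gaussian is at most a constant times
  \<open>exp (- (m * r))\<close>, and \<open>exp_neg_le_power\<close> applies.\<close>

lemma power_mult_gauss_le:
  fixes m r :: real
  assumes "m > 0" "r \<ge> 0"
  shows "(1 + r) ^ k * exp (- (m * r\<^sup>2 / 2)) \<le> exp (m / 2) * (exp m * fact k / m ^ k)"
proof -
  have "2 * r - 1 \<le> r\<^sup>2" using sum_squares_bound[of r 1] by simp
  then have "m * (2 * r - 1) \<le> m * r\<^sup>2" using assms by (intro mult_left_mono) auto
  then have "- (m * r\<^sup>2 / 2) \<le> m / 2 + - (m * r)" by (simp add: algebra_simps)
  then have "exp (- (m * r\<^sup>2 / 2)) \<le> exp (m / 2) * exp (- (m * r))" by (simp flip: exp_add)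
  then have "(1 + r) ^ k * exp (- (m * r\<^sup>2 / 2)) \<le> (1 + r) ^ k * (exp (m / 2) * exp (- (m * r)))"
    using assms by (intro mult_left_mono) auto
  also have "\<dots> = exp (m / 2) * ((1 + r) ^ k * exp (- (m * r)))" by simp
  also have "\<dots> \<le> exp (m / 2) * (exp m * fact k / m ^ k)"
    by (intro mult_left_mono exp_neg_le_power assms) simp
  finally show ?thesis .
qed

lemma norm_sq_eq_sum: "(norm x)\<^sup>2 = (\<Sum>b\<in>Basis. (x \<bullet> b)\<^sup>2)" for x :: "'a::euclidean_space"
  by (subst power2_norm_eq_inner, subst euclidean_inner) (simp add: power2_eq_square)

text \<open>The exponent \<open>k\<close> has to vary in the induction, because multiplying by a
  coordinate uses one more power of \<open>norm x\<close>. For the packet itself the smallest width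
  \<open>m\<close> gives a radial Gaussian majorant.\<close>

lemma gauss_span_decay:
  fixes l :: "'a::euclidean_space \<Rightarrow> real"
  assumes l: "\<And>b. b \<in> Basis \<Longrightarrow> l b > 0" and f: "f \<in> gauss_span l c"
  shows "\<exists>B. \<forall>x. norm x ^ k * norm (f x) \<le> B"
  using f
proof (induction arbitrary: k)
  case gauss
  define m where "m = Min ((\<lambda>b. (l b)\<^sup>2) ` Basis)"
  have "m \<in> (\<lambda>b. (l b)\<^sup>2) ` Basis" unfolding m_def by (intro Min_in) auto
  then obtain b where "b \<in> Basis" "m = (l b)\<^sup>2" by blast
  then have m: "m > 0" using l[of b] by simp
  have "norm x ^ k * norm (gauss_packet l c x) \<le> exp (m / 2) * (exp m * fact k / m ^ k)" for x
  proof -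
    have "m * (norm x)\<^sup>2 \<le> (\<Sum>b\<in>Basis. (l b * (x \<bullet> b))\<^sup>2)"
      unfolding norm_sq_eq_sum sum_distrib_left power_mult_distrib m_def
      by (intro sum_mono mult_right_mono Min_le) auto
    then have "exp (- ((\<Sum>b\<in>Basis. (l b * (x \<bullet> b))\<^sup>2) / 2)) \<le> exp (- (m * (norm x)\<^sup>2 / 2))" by simp
    then have "norm x ^ k * norm (gauss_packet l c x) \<le> (1 + norm x) ^ k * exp (- (m * (norm x)\<^sup>2 / 2))"
      unfolding norm_mult norm_cis mult_1_left norm_of_real abs_exp_cancel
      by (intro mult_mono power_mono) auto
    also have "\<dots> \<le> exp (m / 2) * (exp m * fact k / m ^ k)" by (rule power_mult_gauss_le[OF m]) simp
    finally show ?thesis .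
  qed
  then show ?case by blast
next
  case (coord f b)
  obtain B where B: "\<And>x. norm x ^ Suc k * norm (f x) \<le> B" using coord.IH by blast
  have "norm x ^ k * norm (of_real (x \<bullet> b) * f x) \<le> B" for x
  proof -
    have "norm x ^ k * (\<bar>x \<bullet> b\<bar> * norm (f x)) \<le> norm x ^ k * (norm x * norm (f x))"
      using coord.hyps by (intro mult_left_mono mult_right_mono Basis_le_norm) auto
    also have "\<dots> = norm x ^ Suc k * norm (f x)" by simp
    finally show ?thesis using B[of x] by (simp add: norm_mult)
  qed
  then show ?case by blast
next
  case (scale f z)
  obtain B where B: "\<And>x. norm x ^ k * norm (f x) \<le> B" using scale.IH by blast
  have "norm x ^ k * norm (z * f x) \<le> norm z * B" for x
    using mult_left_mono[OF B[of x], of "norm z"] by (simp add: norm_mult mult_ac)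
  then show ?case by blast
next
  case (add f g)
  obtain B where B: "\<And>x. norm x ^ k * norm (f x) \<le> B" using add.IH(1) by blast
  obtain B' where B': "\<And>x. norm x ^ k * norm (g x) \<le> B'" using add.IH(2) by blast
  have "norm x ^ k * norm (f x + g x) \<le> B + B'" for x
  proof -
    have "norm x ^ k * norm (f x + g x) \<le> norm x ^ k * (norm (f x) + norm (g x))"
      by (intro mult_left_mono norm_triangle_ineq) auto
    also have "\<dots> \<le> B + B'" using B[of x] B'[of x] by (simp add: distrib_left)
    finally show ?thesis .
  qed
  then show ?case by blast
qed

lemma schwartz_gauss_packet:
  fixes l :: "'a::euclidean_space \<Rightarrow> real"
  assumes l: "\<And>b. b \<in> Basis \<Longrightarrow> l b > 0"
  shows "schwartz (gauss_packet l c)"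
proof -
  have it: "iterated_partial bs (gauss_packet l c) \<in> gauss_span l c" if "bs \<in> lists Basis" for bs
    using that
  proof (induction bs)
    case Nil
    show ?case by (simp add: gauss_span.gauss)
  next
    case (Cons b bs)
    then show ?case using gauss_span_derivative[of "iterated_partial bs (gauss_packet l c)" l c] by auto
  qed
  show ?thesis
    unfolding schwartz_def
  proof (intro ballI conjI allI)
    fix bs :: "'a list" and x k assume bs: "bs \<in> lists Basis"
    show "iterated_partial bs (gauss_packet l c) differentiable (at x)"
      using gauss_span_derivative[OF it[OF bs]] by blast
    show "\<exists>B. \<forall>x. norm x ^ k * norm (iterated_partial bs (gauss_packet l c) x) \<le> B"
      by (rule gauss_span_decay[OF _ it[OF bs]]) (rule l)
  qed
qed

section \<open>Packets in normalised frequency coordinates\<close>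

lemma fourier_gauss_packet:
  fixes l :: "'a::euclidean_space \<Rightarrow> real"
  assumes l: "\<And>b. b \<in> Basis \<Longrightarrow> l b > 0"
  shows "fourier (gauss_packet l c) \<xi> =
    of_real (sqrt (2 * pi) ^ DIM('a) / (\<Prod>b\<in>Basis. l b) * exp (- ((\<Sum>b\<in>Basis. (((\<xi> - c) \<bullet> b) / l b)\<^sup>2) / 2)))"
proof -
  define \<phi> :: "'a \<Rightarrow> real \<Rightarrow> complex"
    where "\<phi> b y = cis (y * ((c - \<xi>) \<bullet> b)) * of_real (exp (- ((l b)\<^sup>2 * y\<^sup>2 / 2)))" for b y
  have l2: "(l b)\<^sup>2 > 0" if "b \<in> Basis" for b using l[OF that] by simp
  have i: "integrable lborel (\<phi> b)" if "b \<in> Basis" for b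
    unfolding \<phi>_def by (rule integrable_cis_gauss_real[OF l2[OF that]])
  have eq: "exp (- (\<i> * of_real (x \<bullet> \<xi>))) * gauss_packet l c x = (\<Prod>b\<in>Basis. \<phi> b (x \<bullet> b))" for x
  proof -
    have "(\<Prod>b\<in>Basis. \<phi> b (x \<bullet> b)) = cis (\<Sum>b\<in>Basis. (x \<bullet> b) * ((c - \<xi>) \<bullet> b)) *
        of_real (exp (\<Sum>b\<in>Basis. - ((l b)\<^sup>2 * (x \<bullet> b)\<^sup>2 / 2)))"
      unfolding \<phi>_def by (simp add: prod.distrib cis_sum exp_sum)
    also have "(\<Sum>b\<in>Basis. (x \<bullet> b) * ((c - \<xi>) \<bullet> b)) = - (x \<bullet> \<xi>) + c \<bullet> x"
      unfolding euclidean_inner[symmetric] by (simp add: inner_diff_right inner_commute)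
    also have "(\<Sum>b\<in>Basis. - ((l b)\<^sup>2 * (x \<bullet> b)\<^sup>2 / 2)) = - ((\<Sum>b\<in>Basis. (l b * (x \<bullet> b))\<^sup>2) / 2)"
      unfolding power_mult_distrib sum_negf sum_divide_distrib ..
    finally show ?thesis unfolding exp_i_eq_cis cis_mult[symmetric] by (simp only: mult.assoc)
  qed
  have "fourier (gauss_packet l c) \<xi> = (\<Prod>b\<in>(Basis::'a set). (LINT y|lborel. \<phi> b y))"
    unfolding fourier_def eq by (rule integral_prod_Basis[OF i])
  also have "\<dots> = (\<Prod>b\<in>(Basis::'a set). of_real (sqrt (2 * pi) / l b * exp (- ((((\<xi> - c) \<bullet> b) / l b)\<^sup>2 / 2))))"
  proof (rule prod.cong[OF refl])
    fix b :: 'a assume b: "b \<in> Basis"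
    have "sqrt (2 * pi / (l b)\<^sup>2) = sqrt (2 * pi) / l b" using l[OF b] by (simp add: real_sqrt_divide)
    moreover have "((c - \<xi>) \<bullet> b)\<^sup>2 / (2 * (l b)\<^sup>2) = (((\<xi> - c) \<bullet> b) / l b)\<^sup>2 / 2"
      by (simp add: power_divide inner_diff_left power2_commute)
    ultimately show "(LINT y|lborel. \<phi> b y) = of_real (sqrt (2 * pi) / l b * exp (- ((((\<xi> - c) \<bullet> b) / l b)\<^sup>2 / 2)))"
      unfolding \<phi>_def integral_cis_gauss_real[OF l2[OF b]] by simp
  qed
  also have "\<dots> = of_real ((\<Prod>b\<in>(Basis::'a set). sqrt (2 * pi) / l b) * exp (\<Sum>b\<in>Basis. - ((((\<xi> - c) \<bullet> b) / l b)\<^sup>2 / 2)))"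
    unfolding of_real_prod[symmetric] prod.distrib exp_sum[OF finite_Basis] ..
  also have "(\<Prod>b\<in>(Basis::'a set). sqrt (2 * pi) / l b) = sqrt (2 * pi) ^ DIM('a) / (\<Prod>b\<in>Basis. l b)"
    unfolding prod_dividef by simp
  also have "(\<Sum>b\<in>Basis. - ((((\<xi> - c) \<bullet> b) / l b)\<^sup>2 / 2)) = - ((\<Sum>b\<in>Basis. (((\<xi> - c) \<bullet> b) / l b)\<^sup>2) / 2)"
    unfolding sum_negf sum_divide_distrib ..
  finally show ?thesis .
qed

text \<open>In the coordinates \<eta> the transform of every packet is the same standard Gaussian up
  to a constant, so the estimates become uniform in the centre \<open>c\<close> and the widths
  \<open>l\<close>.\<close>

definition diag_affine :: "('a::euclidean_space \<Rightarrow> real) \<Rightarrow> 'a \<Rightarrow> 'a \<Rightarrow> 'a" where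
  "diag_affine l c \<eta> = c + (\<Sum>b\<in>Basis. (l b * (\<eta> \<bullet> b)) *\<^sub>R b)"

lemma diag_affine_inner: "b \<in> Basis \<Longrightarrow> diag_affine l c \<eta> \<bullet> b = c \<bullet> b + l b * (\<eta> \<bullet> b)"
  unfolding diag_affine_def by (simp add: inner_add_left inner_sum_left_Basis)

lemma measurable_diag_affine [measurable]: "diag_affine l c \<in> borel_measurable borel"
  unfolding diag_affine_def[abs_def] by measurable

lemma lborel_integral_diag_affine:
  fixes \<phi> :: "'a::euclidean_space \<Rightarrow> 'b::{banach, second_countable_topology}"
  assumes l: "\<And>b. b \<in> Basis \<Longrightarrow> l b > 0" and [measurable]: "\<phi> \<in> borel_measurable borel"
  shows "(LINT y|lborel. \<phi> y) = (\<Prod>b\<in>Basis. l b) *\<^sub>R (LINT \<eta>|lborel. \<phi> (diag_affine l c \<eta>))"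
proof -
  have P: "(\<Prod>b\<in>Basis. \<bar>l b\<bar>) = (\<Prod>b\<in>Basis. l b)" by (intro prod.cong refl abs_of_pos l)
  have P0: "(\<Prod>b\<in>Basis. l b) \<ge> 0" by (intro prod_nonneg) (use l in \<open>auto intro: less_imp_le\<close>)
  have "(lborel :: 'a measure) = density (distr lborel borel (diag_affine l c)) (\<lambda>_. ennreal (\<Prod>b\<in>Basis. l b))"
    using lborel_affine_euclidean[of l c] l unfolding diag_affine_def[abs_def] P by fastforce
  then have "(LINT y|lborel. \<phi> y) = (LINT y|density (distr lborel borel (diag_affine l c)) (\<lambda>_. ennreal (\<Prod>b\<in>Basis. l b)). \<phi> y)"
    by simp
  also have "\<dots> = (LINT y|distr lborel borel (diag_affine l c). (\<Prod>b\<in>Basis. l b) *\<^sub>R \<phi> y)"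
    using P0 by (subst integral_density) auto
  also have "\<dots> = (LINT \<eta>|lborel. (\<Prod>b\<in>Basis. l b) *\<^sub>R \<phi> (diag_affine l c \<eta>))"
    by (rule integral_distr) auto
  finally show ?thesis by simp
qed

lemma fourier_gauss_packet_diag_affine:
  fixes l :: "'a::euclidean_space \<Rightarrow> real"
  assumes l: "\<And>b. b \<in> Basis \<Longrightarrow> l b > 0"
  shows "fourier (gauss_packet l c) (diag_affine l c \<eta>) =
    of_real (sqrt (2 * pi) ^ DIM('a) / (\<Prod>b\<in>Basis. l b) * exp (- ((norm \<eta>)\<^sup>2 / 2)))"
proof -
  have "(\<Sum>b\<in>Basis. (((diag_affine l c \<eta> - c) \<bullet> b) / l b)\<^sup>2) = (norm \<eta>)\<^sup>2"
    unfolding norm_sq_eq_sum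
  proof (rule sum.cong[OF refl])
    fix b :: 'a assume b: "b \<in> Basis"
    have "l b \<noteq> 0" using l[OF b] by simp
    then show "((diag_affine l c \<eta> - c) \<bullet> b / l b)\<^sup>2 = (\<eta> \<bullet> b)\<^sup>2"
      using b by (simp add: inner_diff_left diag_affine_inner)
  qed
  moreover have "fourier (gauss_packet l c) (diag_affine l c \<eta>) = of_real (sqrt (2 * pi) ^ DIM('a) / (\<Prod>b\<in>Basis. l b) *
      exp (- ((\<Sum>b\<in>Basis. (((diag_affine l c \<eta> - c) \<bullet> b) / l b)\<^sup>2) / 2)))"
    by (rule fourier_gauss_packet) (rule l)
  ultimately show ?thesis by (simp only:)
qed

lemma integrable_power_mult_gauss:
  "integrable lborel (\<lambda>\<eta>::'a::euclidean_space. (1 + norm \<eta>) ^ k * exp (- ((norm \<eta>)\<^sup>2 / 2)))"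
proof (rule integrable_of_decay)
  fix \<eta> :: 'a
  let ?r = "norm \<eta>" and ?m = "k + 2 * DIM('a)"
  have "(1 + ?r\<^sup>2) ^ DIM('a) \<le> ((1 + ?r)\<^sup>2) ^ DIM('a)"
    by (intro power_mono) (auto simp: power2_eq_square algebra_simps)
  then have "(1 + ?r) ^ k * (1 + ?r\<^sup>2) ^ DIM('a) \<le> (1 + ?r) ^ ?m"
    by (simp add: power_add power_mult mult_left_mono)
  then have "norm ((1 + ?r) ^ k * exp (- (?r\<^sup>2 / 2))) * (1 + ?r\<^sup>2) ^ DIM('a) \<le> (1 + ?r) ^ ?m * exp (- (1 * ?r\<^sup>2 / 2))"
    using mult_right_mono[of "(1 + ?r) ^ k * (1 + ?r\<^sup>2) ^ DIM('a)" "(1 + ?r) ^ ?m" "exp (- (?r\<^sup>2 / 2))"]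
    by (simp add: abs_mult mult_ac)
  also have "\<dots> \<le> exp (1 / 2) * (exp 1 * fact ?m / 1 ^ ?m)" by (rule power_mult_gauss_le) auto
  finally show "norm ((1 + ?r) ^ k * exp (- (?r\<^sup>2 / 2))) * (1 + ?r\<^sup>2) ^ DIM('a) \<le> exp (1 / 2) * (exp 1 * fact ?m / 1 ^ ?m)" .
qed measurable

text \<open>The frequencies are at most \<open>\<Lambda> * (1 + norm \<eta>)\<close>, and the excess
  goes into a Gaussian moment. The squared height contributes the inverse square of the product of
  the widths and the Jacobian one factor back. There is no lower bound on the frequencies, so a
  negative \<open>s\<close> is replaced by 0.\<close>

lemma sobolev_energy_gauss_packet_le:
  fixes s :: real
  obtains C where "C \<ge> 0" and "\<And>(l :: 'a::euclidean_space \<Rightarrow> real) c \<Lambda>. (\<And>b. b \<in> Basis \<Longrightarrow> 0 < l b \<and> l b \<le> \<Lambda>) \<Longrightarrow>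
     \<Lambda> \<ge> 1 \<Longrightarrow> norm c \<le> \<Lambda> \<Longrightarrow>
     sobolev_energy s (gauss_packet l c) \<le> C * (\<Lambda> powr max s 0)\<^sup>2 / (\<Prod>b\<in>Basis. l b)"
proof -
  \<comment> \<open>An integer above \<open>2 * max s 0\<close>, so that the Sobolev weight is
    absorbed by a polynomial moment.\<close>
  define k where "k = nat \<lceil>2 * max s 0\<rceil>"
  have k: "2 * max s 0 \<le> real k" unfolding k_def by linarith
  define I where "I = (LINT \<eta>::'a|lborel. (1 + norm \<eta>) ^ k * exp (- ((norm \<eta>)\<^sup>2 / 2)))"
  have I0: "I \<ge> 0" unfolding I_def by (intro Bochner_Integration.integral_nonneg) auto
  define C where "C = 2 powr max s 0 * (2 * pi) ^ DIM('a) * I"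
  have C0: "C \<ge> 0" unfolding C_def using I0 by simp
  have main: "sobolev_energy s (gauss_packet l c) \<le> C * (\<Lambda> powr max s 0)\<^sup>2 / (\<Prod>b\<in>Basis. l b)"
    if l': "\<And>b. b \<in> Basis \<Longrightarrow> 0 < l b \<and> l b \<le> \<Lambda>" and \<Lambda>: "\<Lambda> \<ge> 1" "norm c \<le> \<Lambda>"
    for l :: "'a \<Rightarrow> real" and c \<Lambda>
  proof -
    have l: "\<And>b. b \<in> Basis \<Longrightarrow> l b > 0" using l' by blast
    let ?f = "gauss_packet l c"
    have sf: "schwartz ?f" by (rule schwartz_gauss_packet[OF l])
    have fd: "fourier ?f (diag_affine l c \<eta>) =
        of_real (sqrt (2 * pi) ^ DIM('a) / (\<Prod>b\<in>Basis. l b) * exp (- ((norm \<eta>)\<^sup>2 / 2)))" for \<eta>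
      by (rule fourier_gauss_packet_diag_affine) (rule l)
    define P where "P = (\<Prod>b\<in>Basis. l b)"
    have P: "P > 0" unfolding P_def by (intro prod_pos) (use l in auto)
    have [measurable]: "fourier ?f \<in> borel_measurable borel"
      by (rule borel_measurable_continuous_onI[OF continuous_fourier[OF sf]])
    have "sobolev_energy s ?f = P * (LINT \<eta>|lborel. (1 + (norm (diag_affine l c \<eta>))\<^sup>2) powr s * (norm (fourier ?f (diag_affine l c \<eta>)))\<^sup>2)"
    proof -
      have "(\<lambda>\<xi>. (1 + (norm \<xi>)\<^sup>2) powr s * (norm (fourier ?f \<xi>))\<^sup>2) \<in> borel_measurable borel" by measurable
      from lborel_integral_diag_affine[OF l this, where c = c] show ?thesis
        unfolding sobolev_energy_def P_def by (simp only: real_scaleR_def)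
    qed
    also have "\<dots> \<le> P * (LINT \<eta>::'a|lborel. 2 powr max s 0 * (\<Lambda> powr max s 0)\<^sup>2 * ((2 * pi) ^ DIM('a) / P\<^sup>2) * ((1 + norm \<eta>) ^ k * exp (- ((norm \<eta>)\<^sup>2 / 2))))"
    proof (rule mult_left_mono)
      let ?g = "\<lambda>\<eta>::'a. 2 powr max s 0 * (\<Lambda> powr max s 0)\<^sup>2 * ((2 * pi) ^ DIM('a) / P\<^sup>2) * ((1 + norm \<eta>) ^ k * exp (- ((norm \<eta>)\<^sup>2 / 2)))"
      have gi: "integrable lborel ?g" by (intro integrable_mult_right integrable_power_mult_gauss)
      have pw: "(1 + (norm (diag_affine l c \<eta>))\<^sup>2) powr s * (norm (fourier ?f (diag_affine l c \<eta>)))\<^sup>2 \<le> ?g \<eta>" for \<eta>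
      proof -
        let ?r = "norm \<eta>"
        have "norm (\<Sum>b\<in>Basis. (l b * (\<eta> \<bullet> b)) *\<^sub>R b) \<le> \<Lambda> * ?r"
        proof (rule power2_le_imp_le)
          have "(norm (\<Sum>b\<in>Basis. (l b * (\<eta> \<bullet> b)) *\<^sub>R b))\<^sup>2 = (\<Sum>b\<in>Basis. (l b * (\<eta> \<bullet> b))\<^sup>2)"
            unfolding norm_sq_eq_sum by (intro sum.cong refl) (simp add: inner_sum_left_Basis)
          also have "\<dots> \<le> (\<Sum>b\<in>Basis. \<Lambda>\<^sup>2 * (\<eta> \<bullet> b)\<^sup>2)"
            unfolding power_mult_distrib using l' by (intro sum_mono mult_right_mono power_mono) (auto intro: less_imp_le)
          also have "\<dots> = (\<Lambda> * ?r)\<^sup>2" unfolding power_mult_distrib norm_sq_eq_sum sum_distrib_left ..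
          finally show "(norm (\<Sum>b\<in>Basis. (l b * (\<eta> \<bullet> b)) *\<^sub>R b))\<^sup>2 \<le> (\<Lambda> * ?r)\<^sup>2" .
        qed (use \<Lambda> in simp)
        then have "norm (diag_affine l c \<eta>) \<le> \<Lambda> * (1 + ?r)"
          unfolding diag_affine_def using \<Lambda> norm_triangle_ineq[of c "\<Sum>b\<in>Basis. (l b * (\<eta> \<bullet> b)) *\<^sub>R b"]
          by (simp add: distrib_left)
        then have "(norm (diag_affine l c \<eta>))\<^sup>2 \<le> (\<Lambda> * (1 + ?r))\<^sup>2" by (intro power_mono) auto
        moreover have "1 * 1 \<le> \<Lambda> * (1 + ?r)" using \<Lambda> by (intro mult_mono) auto
        then have "1 \<le> (\<Lambda> * (1 + ?r))\<^sup>2" by (simp add: one_le_power)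
        ultimately have le: "1 + (norm (diag_affine l c \<eta>))\<^sup>2 \<le> 2 * (\<Lambda> * (1 + ?r))\<^sup>2" by linarith
        have "(1 + (norm (diag_affine l c \<eta>))\<^sup>2) powr s \<le> (1 + (norm (diag_affine l c \<eta>))\<^sup>2) powr max s 0"
          by (intro powr_mono) auto
        also have "\<dots> \<le> (2 * (\<Lambda> * (1 + ?r))\<^sup>2) powr max s 0" by (intro powr_mono2 le) auto
        also have "\<dots> = 2 powr max s 0 * (\<Lambda> powr max s 0)\<^sup>2 * ((1 + ?r) powr (2 * max s 0))"
        proof -
          have "(1 + ?r)\<^sup>2 powr max s 0 = (1 + ?r) powr (2 * max s 0)"
            by (subst powr_numeral[symmetric]) (auto simp: powr_powr add_nonneg_nonneg simp del: powr_numeral)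
          then show ?thesis unfolding powr_mult power_mult_distrib by (simp add: power2_eq_square powr_mult)
        qed
        also have "(1 + ?r) powr (2 * max s 0) \<le> (1 + ?r) powr real k" using k by (intro powr_mono) auto
        also have "\<dots> = (1 + ?r) ^ k" by (rule powr_realpow) (simp add: add_pos_nonneg)
        finally have a: "(1 + (norm (diag_affine l c \<eta>))\<^sup>2) powr s \<le> 2 powr max s 0 * (\<Lambda> powr max s 0)\<^sup>2 * (1 + ?r) ^ k"
          by (simp add: mult_left_mono)
        have b: "(norm (fourier ?f (diag_affine l c \<eta>)))\<^sup>2 \<le> (2 * pi) ^ DIM('a) / P\<^sup>2 * exp (- (?r\<^sup>2 / 2))"
        proof -
          have "(norm (fourier ?f (diag_affine l c \<eta>)))\<^sup>2 = (sqrt (2 * pi) ^ DIM('a) / P * exp (- (?r\<^sup>2 / 2)))\<^sup>2"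
            unfolding fd P_def norm_of_real power2_abs ..
          also have "\<dots> = (2 * pi) ^ DIM('a) / P\<^sup>2 * (exp (- (?r\<^sup>2 / 2)) * exp (- (?r\<^sup>2 / 2)))"
          proof -
            have "(sqrt (2 * pi) ^ DIM('a))\<^sup>2 = (2 * pi) ^ DIM('a)"
              unfolding power2_eq_square power_mult_distrib[symmetric] by simp
            then show ?thesis unfolding power_mult_distrib power_divide by (simp only: power2_eq_square)
          qed
          also have "\<dots> \<le> (2 * pi) ^ DIM('a) / P\<^sup>2 * (exp (- (?r\<^sup>2 / 2)) * 1)"
            by (intro mult_left_mono) auto
          finally show ?thesis by simp
        qed
        have "(1 + (norm (diag_affine l c \<eta>))\<^sup>2) powr s * (norm (fourier ?f (diag_affine l c \<eta>)))\<^sup>2 \<le>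
            (2 powr max s 0 * (\<Lambda> powr max s 0)\<^sup>2 * (1 + ?r) ^ k) * ((2 * pi) ^ DIM('a) / P\<^sup>2 * exp (- (?r\<^sup>2 / 2)))"
          by (intro mult_mono a b) auto
        then show ?thesis by (simp only: mult_ac)
      qed
      show "(LINT \<eta>|lborel. (1 + (norm (diag_affine l c \<eta>))\<^sup>2) powr s * (norm (fourier ?f (diag_affine l c \<eta>)))\<^sup>2) \<le> (LINT \<eta>|lborel. ?g \<eta>)"
      proof (rule integral_mono[OF _ gi pw])
        show "integrable lborel (\<lambda>\<eta>. (1 + (norm (diag_affine l c \<eta>))\<^sup>2) powr s * (norm (fourier ?f (diag_affine l c \<eta>)))\<^sup>2)"
          by (rule Bochner_Integration.integrable_bound[OF gi]) (use order_trans[OF pw abs_ge_self] in auto)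
      qed
    qed (use P in simp)
    also have "\<dots> = C * (\<Lambda> powr max s 0)\<^sup>2 / P"
      unfolding integral_mult_right_zero I_def[symmetric] C_def using P by (simp add: power2_eq_square)
    finally show ?thesis unfolding P_def .
  qed
  show ?thesis by (rule that[OF C0 main])
qed

text \<open>In the coordinates \<eta> the modulus of the wave is that of a Gaussian average of the
  phase factor, hence exactly 1 for vanishing phase. If \<psi> bounds the deviation of the phase
  factor from 1 and has Gaussian average at most 1/2, at least 1/2 is left.\<close>

lemma wave_gauss_packet_ge:
  fixes l :: "'a::euclidean_space \<Rightarrow> real"
  assumes l: "\<And>b. b \<in> Basis \<Longrightarrow> l b > 0"
    and \<psi>i: "integrable lborel (\<lambda>\<eta>. \<psi> \<eta> * exp (- ((norm \<eta>)\<^sup>2 / 2)))"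
    and \<psi>: "\<And>\<eta>. norm (cis (x \<bullet> diag_affine l c \<eta> + t * norm (diag_affine l c \<eta>)) - 1) \<le> \<psi> \<eta>"
    and small: "(LINT \<eta>|lborel. \<psi> \<eta> * exp (- ((norm \<eta>)\<^sup>2 / 2))) \<le> sqrt (2 * pi) ^ DIM('a) / 2"
  shows "norm (wave t (gauss_packet l c) x) \<ge> 1 / 2"
proof -
  let ?f = "gauss_packet l c" and ?T = "diag_affine l c"
  define G where "G = sqrt (2 * pi) ^ DIM('a)"
  have G: "G > 0" unfolding G_def by simp
  have G2: "G * G = (2 * pi) ^ DIM('a)" unfolding G_def power_mult_distrib[symmetric] by simp
  have fd: "fourier ?f (?T \<eta>) = of_real (sqrt (2 * pi) ^ DIM('a) / (\<Prod>b\<in>Basis. l b) * exp (- ((norm \<eta>)\<^sup>2 / 2)))" for \<eta>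
    by (rule fourier_gauss_packet_diag_affine) (rule l)
  define P where "P = (\<Prod>b\<in>Basis. l b)"
  have P: "P > 0" unfolding P_def by (intro prod_pos) (use l in auto)
  have sf: "schwartz ?f" by (rule schwartz_gauss_packet[OF l])
  have [measurable]: "fourier ?f \<in> borel_measurable borel"
    by (rule borel_measurable_continuous_onI[OF continuous_fourier[OF sf]])
  let ?E = "\<lambda>\<eta>::'a. exp (- ((norm \<eta>)\<^sup>2 / 2))"
  have Ei: "integrable lborel ?E" and Ev: "(LINT \<eta>|lborel. ?E \<eta>) = G"
    using integrable_gauss[of 1, where 'a = 'a] integral_gauss[of 1, where 'a = 'a] unfolding G_def by simp_all
  have Eci: "integrable lborel (\<lambda>\<eta>. of_real (?E \<eta>) :: complex)" by (rule integrable_of_real[OF Ei])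
  let ?\<Phi> = "\<lambda>\<eta>. x \<bullet> ?T \<eta> + t * norm (?T \<eta>)"
  have ci: "integrable lborel (\<lambda>\<eta>. cis (?\<Phi> \<eta>) * of_real (?E \<eta>))"
    by (intro integrable_cis_mult Eci) measurable
  have "(LINT \<xi>|lborel. cis (x \<bullet> \<xi> + t * norm \<xi>) * fourier ?f \<xi>) =
      P *\<^sub>R (LINT \<eta>|lborel. cis (?\<Phi> \<eta>) * fourier ?f (?T \<eta>))"
  proof -
    have "(\<lambda>\<xi>. cis (x \<bullet> \<xi> + t * norm \<xi>) * fourier ?f \<xi>) \<in> borel_measurable borel" by measurable
    from lborel_integral_diag_affine[OF l this, where c = c] show ?thesis unfolding P_def .
  qed
  also have "(LINT \<eta>|lborel. cis (?\<Phi> \<eta>) * fourier ?f (?T \<eta>)) = of_real (G / P) * (LINT \<eta>|lborel. cis (?\<Phi> \<eta>) * of_real (?E \<eta>))"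
    unfolding fd G_def P_def
    by (subst integral_mult_right_zero[symmetric]) (simp add: mult_ac)
  also have "P *\<^sub>R \<dots> = of_real G * (LINT \<eta>|lborel. cis (?\<Phi> \<eta>) * of_real (?E \<eta>))"
    using P by (simp add: scaleR_conv_of_real)
  finally have "wave t ?f x = of_real (1 / (2 * pi) ^ DIM('a)) * (of_real G * (LINT \<eta>|lborel. cis (?\<Phi> \<eta>) * of_real (?E \<eta>)))"
    unfolding wave_def exp_i_eq_cis by simp
  then have w: "norm (wave t ?f x) = norm (LINT \<eta>|lborel. cis (?\<Phi> \<eta>) * of_real (?E \<eta>)) / G"
    unfolding G2[symmetric] using G by (simp add: norm_mult norm_divide)
  have "of_real G - (LINT \<eta>|lborel. cis (?\<Phi> \<eta>) * of_real (?E \<eta>)) =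
      (LINT \<eta>|lborel. of_real (?E \<eta>) - cis (?\<Phi> \<eta>) * of_real (?E \<eta>))"
    unfolding Ev[symmetric] integral_complex_of_real[symmetric]
    by (rule Bochner_Integration.integral_diff[symmetric, OF Eci ci])
  also have "norm \<dots> \<le> (LINT \<eta>|lborel. \<psi> \<eta> * ?E \<eta>)"
  proof (rule Bochner_Integration.integral_norm_bound_integral[OF Bochner_Integration.integrable_diff[OF Eci ci] \<psi>i])
    fix \<eta>
    have "of_real (?E \<eta>) - cis (?\<Phi> \<eta>) * of_real (?E \<eta>) = - (cis (?\<Phi> \<eta>) - 1) * of_real (?E \<eta>)"
      by (simp add: algebra_simps)
    then have "norm (of_real (?E \<eta>) - cis (?\<Phi> \<eta>) * of_real (?E \<eta>)) = norm (cis (?\<Phi> \<eta>) - 1) * ?E \<eta>"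
      by (simp only: norm_mult norm_minus_cancel norm_of_real abs_exp_cancel)
    also have "\<dots> \<le> \<psi> \<eta> * ?E \<eta>" by (rule mult_right_mono[OF \<psi>]) simp
    finally show "norm (of_real (?E \<eta>) - cis (?\<Phi> \<eta>) * of_real (?E \<eta>)) \<le> \<psi> \<eta> * ?E \<eta>" .
  qed
  finally have "norm (of_real G - (LINT \<eta>|lborel. cis (?\<Phi> \<eta>) * of_real (?E \<eta>))) \<le> G / 2"
    using small unfolding G_def by linarith
  moreover have "G = norm (of_real G :: complex)" using G by simp
  ultimately have "norm (LINT \<eta>|lborel. cis (?\<Phi> \<eta>) * of_real (?E \<eta>)) \<ge> G / 2"
    using norm_triangle_ineq2[of "of_real G" "LINT \<eta>|lborel. cis (?\<Phi> \<eta>) * of_real (?E \<eta>)"] by linarith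
  then show ?thesis unfolding w using G by (simp add: field_simps)
qed

section \<open>Necessity of the condition on the Sobolev exponent\<close>

lemma powr_bounded_imp_nonpos:
  fixes \<gamma> K :: real
  assumes "\<And>\<Lambda>. \<Lambda> \<ge> 1 \<Longrightarrow> \<Lambda> powr \<gamma> \<le> K"
  shows "\<gamma> \<le> 0"
proof (rule ccontr)
  assume "\<not> \<gamma> \<le> 0"
  then have \<gamma>: "\<gamma> > 0" by simp
  have "(\<bar>K\<bar> + 1) powr (1 / \<gamma>) \<ge> 1" using \<gamma> by (intro ge_one_powr_ge_zero) auto
  from assms[OF this] have "\<bar>K\<bar> + 1 \<le> K" using \<gamma> by (simp add: powr_powr)
  then show False by linarith
qed

lemma norm_cis_minus_1_le: "norm (cis \<phi> - 1) \<le> \<bar>\<phi>\<bar>"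
proof -
  have "(norm (cis \<phi> - 1))\<^sup>2 = (cos \<phi> - 1)\<^sup>2 + (sin \<phi>)\<^sup>2" by (simp add: cmod_power2)
  also have "\<dots> = 2 - 2 * cos \<phi>"
    using sin_cos_squared_add[of \<phi>] by (simp add: power2_eq_square algebra_simps)
  also have "\<dots> = (2 * sin (\<phi> / 2))\<^sup>2"
    using cos_double_sin[of "\<phi> / 2"] by (simp add: power2_eq_square)
  also have "\<dots> \<le> \<phi>\<^sup>2"
  proof -
    have "\<bar>2 * sin (\<phi> / 2)\<bar> \<le> \<bar>\<phi>\<bar>" using abs_sin_x_le_abs_x[of "\<phi> / 2"] by simp
    then show ?thesis by (rule abs_le_square_iff[THEN iffD1])
  qed
  finally have "norm (cis \<phi> - 1) \<le> sqrt (\<phi>\<^sup>2)" by (rule real_le_rsqrt)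
  then show ?thesis by simp
qed

lemma norm_cis_minus_1_le_2: "norm (cis \<phi> - 1) \<le> 2"
  using norm_triangle_ineq4[of "cis \<phi>" 1] by simp

lemma norm_cis_add_minus_1_le: "norm (cis (\<phi> + \<psi>) - 1) \<le> norm (cis \<phi> - 1) + norm (cis \<psi> - 1)"
proof -
  have "cis (\<phi> + \<psi>) - 1 = cis \<phi> * (cis \<psi> - 1) + (cis \<phi> - 1)"
    by (simp add: cis_mult[symmetric] algebra_simps)
  then have "norm (cis (\<phi> + \<psi>) - 1) \<le> norm (cis \<phi> * (cis \<psi> - 1)) + norm (cis \<phi> - 1)"
    by (metis norm_triangle_ineq)
  then show ?thesis by (simp add: norm_mult)
qed

text \<open>Chebyshev's inequality on \<open>S\<close> against the energy of the packet. Both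
  counterexamples thereby reduce to comparing the measure of a set on which the wave is large with
  the product of the widths; \<open>K\<close> depends on neither the packet nor the set.\<close>

lemma maximal_estimate_test:
  fixes q s C :: real
  assumes C: "C \<ge> 0" and q: "q > 0"
    and est: "\<And>f :: 'a::euclidean_space \<Rightarrow> complex. schwartz f \<Longrightarrow>
       Lp_norm q (ball 0 1) (wave_maximal f) \<le> ennreal C * sobolev_norm s f"
  obtains K where "K \<ge> 0" and "\<And>(l :: 'a \<Rightarrow> real) c \<Lambda> S. (\<And>b. b \<in> Basis \<Longrightarrow> 0 < l b \<and> l b \<le> \<Lambda>) \<Longrightarrow>
     \<Lambda> \<ge> 1 \<Longrightarrow> norm c \<le> \<Lambda> \<Longrightarrow> S \<in> sets borel \<Longrightarrow> S \<subseteq> ball 0 1 \<Longrightarrow>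
     (\<And>x. x \<in> S \<Longrightarrow> \<exists>t\<in>{0<..<1}. norm (wave t (gauss_packet l c) x) \<ge> 1 / 2) \<Longrightarrow>
     measure lborel S powr (1 / q) \<le> K * (\<Lambda> powr max s 0) * (\<Prod>b\<in>Basis. l b) powr (- 1 / 2)"
proof -
  obtain C1 where C1: "C1 \<ge> 0" and en: "\<And>(l :: 'a \<Rightarrow> real) c \<Lambda>. (\<And>b. b \<in> Basis \<Longrightarrow> 0 < l b \<and> l b \<le> \<Lambda>) \<Longrightarrow>
     \<Lambda> \<ge> 1 \<Longrightarrow> norm c \<le> \<Lambda> \<Longrightarrow>
     sobolev_energy s (gauss_packet l c) \<le> C1 * (\<Lambda> powr max s 0)\<^sup>2 / (\<Prod>b\<in>Basis. l b)"
    by (rule sobolev_energy_gauss_packet_le[of s, where 'a = 'a]) blast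
  define K where "K = 2 * (C * sqrt (C1 / (2 * pi) ^ DIM('a)))"
  have K: "K \<ge> 0" unfolding K_def using C C1 by simp
  have main: "measure lborel S powr (1 / q) \<le> K * (\<Lambda> powr max s 0) * (\<Prod>b\<in>Basis. l b) powr (- 1 / 2)"
    if l': "\<And>b. b \<in> Basis \<Longrightarrow> 0 < l b \<and> l b \<le> \<Lambda>" and \<Lambda>: "\<Lambda> \<ge> 1" "norm c \<le> \<Lambda>"
      and S: "S \<in> sets borel" "S \<subseteq> ball 0 1"
      and big: "\<And>x. x \<in> S \<Longrightarrow> \<exists>t\<in>{0<..<1}. norm (wave t (gauss_packet l c) x) \<ge> 1 / 2"
    for l :: "'a \<Rightarrow> real" and c \<Lambda> S
  proof -
    let ?f = "gauss_packet l c"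
    have sf: "schwartz ?f" by (rule schwartz_gauss_packet) (use l' in blast)
    define P where "P = (\<Prod>b\<in>Basis. l b)"
    have P: "P > 0" unfolding P_def by (intro prod_pos) (use l' in auto)
    have "emeasure lborel S \<le> emeasure lborel (ball 0 1 :: 'a set)" using S by (intro emeasure_mono) auto
    also have "\<dots> < \<infinity>" by (rule emeasure_bounded_finite) simp
    finally have Sf: "emeasure lborel S = ennreal (measure lborel S)"
      by (intro emeasure_eq_ennreal_measure) (simp add: less_top)
    have "ennreal ((1 / 2) powr q * measure lborel S) = (\<integral>\<^sup>+x. ennreal ((1 / 2) powr q) * indicator S x \<partial>lborel)"
      using S by (subst nn_integral_cmult_indicator) (simp_all add: Sf ennreal_mult)
    also have "\<dots> \<le> (\<integral>\<^sup>+x\<in>ball 0 1. ennreal_powr (wave_maximal ?f x) q \<partial>lborel)"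
    proof (rule nn_integral_mono)
      fix x :: 'a
      show "ennreal ((1 / 2) powr q) * indicator S x \<le> ennreal_powr (wave_maximal ?f x) q * indicator (ball 0 1) x"
      proof (cases "x \<in> S")
        case True
        obtain t where t: "t \<in> {0<..<1}" "norm (wave t ?f x) \<ge> 1 / 2" using big[OF True] by blast
        have "ennreal (1 / 2) \<le> ennreal (norm (wave t ?f x))" using t by (intro ennreal_leI)
        also have "\<dots> \<le> wave_maximal ?f x" unfolding wave_maximal_def using t(1) by (rule SUP_upper)
        finally have "ennreal_powr (ennreal (1 / 2)) q \<le> ennreal_powr (wave_maximal ?f x) q"
          using q by (intro ennreal_powr_mono) auto
        then have "ennreal ((1 / 2) powr q) \<le> ennreal_powr (wave_maximal ?f x) q"
          by (subst (asm) ennreal_powr_ennreal) simp_all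
        then show ?thesis using True S by auto
      qed simp
    qed
    finally have "ennreal_powr (ennreal ((1 / 2) powr q * measure lborel S)) (1 / q) \<le> Lp_norm q (ball 0 1) (wave_maximal ?f)"
      unfolding Lp_norm_def using q by (intro ennreal_powr_mono) auto
    also have "\<dots> \<le> ennreal C * sobolev_norm s ?f" by (rule est[OF sf])
    also have "\<dots> = ennreal (C * sqrt (sobolev_energy s ?f / (2 * pi) ^ DIM('a)))"
      unfolding sobolev_norm_eq_energy[OF sf] using C by (simp add: ennreal_mult sobolev_energy_nonneg)
    finally have "((1 / 2) powr q * measure lborel S) powr (1 / q) \<le> C * sqrt (sobolev_energy s ?f / (2 * pi) ^ DIM('a))"
      using C by (subst (asm) ennreal_powr_ennreal) (auto simp: sobolev_energy_nonneg)
    also have "((1 / 2) powr q * measure lborel S) powr (1 / q) = 1 / 2 * measure lborel S powr (1 / q)"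
      unfolding powr_mult powr_powr using q by simp
    also have "C * sqrt (sobolev_energy s ?f / (2 * pi) ^ DIM('a)) \<le> C * sqrt (C1 * (\<Lambda> powr max s 0)\<^sup>2 / P / (2 * pi) ^ DIM('a))"
      unfolding P_def using C by (intro mult_left_mono real_sqrt_le_mono divide_right_mono en l' \<Lambda>) auto
    also have "C1 * (\<Lambda> powr max s 0)\<^sup>2 / P / (2 * pi) ^ DIM('a) = (C1 / (2 * pi) ^ DIM('a)) * (\<Lambda> powr max s 0)\<^sup>2 * (1 / P)"
      by simp
    also have "sqrt \<dots> = sqrt (C1 / (2 * pi) ^ DIM('a)) * (\<Lambda> powr max s 0) * P powr (- 1 / 2)"
    proof -
      have "sqrt (1 / P) = P powr (- 1 / 2)"
        using P by (simp add: real_sqrt_divide powr_minus_divide powr_half_sqrt minus_divide_left[symmetric])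
      then show ?thesis unfolding real_sqrt_mult by simp
    qed
    finally show ?thesis unfolding K_def P_def by (simp add: mult_ac)
  qed
  show ?thesis by (rule that[OF K main])
qed

section \<open>The focusing and the Knapp examples\<close>

text \<open>The polynomial is the phase error in the Knapp example: one unit of
  \<open>norm \<eta>\<close> from the transversal directions, four from the displacement along the
  axis, and the square from the curvature of the cone. It also covers the focusing example, whose
  error is \<open>2 * norm \<eta>\<close>.\<close>

lemma gauss_moment_integrable:
  "integrable lborel (\<lambda>\<eta>::'a::euclidean_space. (5 * norm \<eta> + (norm \<eta>)\<^sup>2) * exp (- ((norm \<eta>)\<^sup>2 / 2)))"
proof (rule Bochner_Integration.integrable_bound[OF integrable_mult_right[OF integrable_power_mult_gauss[of 2], of 5]])
  have "5 * r + r\<^sup>2 \<le> 5 * (1 + r)\<^sup>2" if "r \<ge> 0" for r :: real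
    using that by (simp add: power2_eq_square algebra_simps)
  then show "AE \<eta>::'a in lborel. norm ((5 * norm \<eta> + (norm \<eta>)\<^sup>2) * exp (- ((norm \<eta>)\<^sup>2 / 2))) \<le>
      norm (5 * ((1 + norm \<eta>)\<^sup>2 * exp (- ((norm \<eta>)\<^sup>2 / 2))))"
    by (intro AE_I2) (simp add: abs_mult mult_right_mono flip: mult.assoc)
qed measurable

lemma gauss_moment_small:
  obtains \<delta> :: real where "0 < \<delta>" "\<delta> < 1"
    "(LINT \<eta>::'a::euclidean_space|lborel. \<delta> * (5 * norm \<eta> + (norm \<eta>)\<^sup>2) * exp (- ((norm \<eta>)\<^sup>2 / 2))) \<le> sqrt (2 * pi) ^ DIM('a) / 2"
proof -
  define I where "I = (LINT \<eta>::'a|lborel. (5 * norm \<eta> + (norm \<eta>)\<^sup>2) * exp (- ((norm \<eta>)\<^sup>2 / 2)))"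
  have I: "I \<ge> 0" unfolding I_def by (intro Bochner_Integration.integral_nonneg) auto
  define G where "G = sqrt (2 * pi) ^ DIM('a)"
  have G: "G > 0" unfolding G_def by simp
  define \<delta> where "\<delta> = min (1 / 2) (G / (2 * (I + 1)))"
  have \<delta>: "0 < \<delta>" "\<delta> < 1" unfolding \<delta>_def using G I by auto
  have "\<delta> * I \<le> G / (2 * (I + 1)) * (I + 1)"
    unfolding \<delta>_def using G I by (intro mult_mono) auto
  also have "\<dots> = G / 2"
  proof -
    have "I + 1 \<noteq> 0" using I by simp
    then show ?thesis by (simp add: divide_simps)
  qed
  finally have "\<delta> * I \<le> G / 2" .
  then have "(LINT \<eta>::'a|lborel. \<delta> * (5 * norm \<eta> + (norm \<eta>)\<^sup>2) * exp (- ((norm \<eta>)\<^sup>2 / 2))) \<le> sqrt (2 * pi) ^ DIM('a) / 2"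
    unfolding mult.assoc[of \<delta>] integral_mult_right_zero I_def[symmetric] G_def .
  with \<delta> show ?thesis by (rule that)
qed

text \<open>With centre 0 and all widths equal to \<Lambda>, the whole packet stays in phase on the
  ball of radius \<open>\<delta> / \<Lambda>\<close>. Its volume is of order
  \<open>\<Lambda> powr (- d)\<close> and the product of the widths is \<open>\<Lambda> ^ d\<close>,
  so the test compares \<open>\<Lambda> powr (- d / q)\<close> with
  \<open>\<Lambda> powr (max s 0 - d / 2)\<close> as \<Lambda> grows.\<close>

lemma focusing_example:
  fixes q s K :: real
  assumes q: "q > 0"
    and test: "\<And>(l :: 'a::euclidean_space \<Rightarrow> real) c \<Lambda> S. (\<And>b. b \<in> Basis \<Longrightarrow> 0 < l b \<and> l b \<le> \<Lambda>) \<Longrightarrow>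
     \<Lambda> \<ge> 1 \<Longrightarrow> norm c \<le> \<Lambda> \<Longrightarrow> S \<in> sets borel \<Longrightarrow> S \<subseteq> ball 0 1 \<Longrightarrow>
     (\<And>x. x \<in> S \<Longrightarrow> \<exists>t\<in>{0<..<1}. norm (wave t (gauss_packet l c) x) \<ge> 1 / 2) \<Longrightarrow>
     measure lborel S powr (1 / q) \<le> K * (\<Lambda> powr max s 0) * (\<Prod>b\<in>Basis. l b) powr (- 1 / 2)"
  shows "real DIM('a) / 2 - real DIM('a) / q \<le> max s 0"
proof -
  define D where "D = real DIM('a)"
  obtain \<delta> :: real where \<delta>: "0 < \<delta>" "\<delta> < 1" and small:
    "(LINT \<eta>::'a|lborel. \<delta> * (5 * norm \<eta> + (norm \<eta>)\<^sup>2) * exp (- ((norm \<eta>)\<^sup>2 / 2))) \<le> sqrt (2 * pi) ^ DIM('a) / 2"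
    by (rule gauss_moment_small)
  define v where "v = measure lborel (ball (0::'a) \<delta>)"
  have v: "v > 0" unfolding v_def using \<delta> by (simp add: content_ball_pos)
  have "\<Lambda> powr (D / 2 - D / q - max s 0) \<le> K / v powr (1 / q)" if \<Lambda>: "\<Lambda> \<ge> 1" for \<Lambda> :: real
  proof -
    let ?l = "\<lambda>b::'a. \<Lambda>"
    let ?S = "ball (0::'a) (\<delta> / \<Lambda>)"
    have T: "diag_affine ?l 0 \<eta> = \<Lambda> *\<^sub>R \<eta>" for \<eta> :: 'a
      unfolding diag_affine_def scaleR_scaleR[symmetric] scaleR_sum_right[symmetric] euclidean_representation by simp
    \<comment> \<open>The supremum runs over positive times only; this one is so small that it moves
      the phase no more than the point \<open>x\<close> does.\<close>
    have t: "\<delta> / \<Lambda> \<in> {0<..<1}" using \<delta> \<Lambda> by (simp add: divide_less_eq)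
    have "measure lborel ?S powr (1 / q) \<le> K * (\<Lambda> powr max s 0) * (\<Prod>b\<in>(Basis::'a set). \<Lambda>) powr (- 1 / 2)"
    proof (rule test[of ?l \<Lambda> 0])
      show "?S \<subseteq> ball 0 1" using t by (intro subset_ball) simp
      fix x assume x: "x \<in> ?S"
      show "\<exists>t\<in>{0<..<1}. norm (wave t (gauss_packet ?l 0) x) \<ge> 1 / 2"
      proof (rule bexI[OF _ t], rule wave_gauss_packet_ge)
        show "integrable lborel (\<lambda>\<eta>::'a. \<delta> * (5 * norm \<eta> + (norm \<eta>)\<^sup>2) * exp (- ((norm \<eta>)\<^sup>2 / 2)))"
          unfolding mult.assoc[of \<delta>] by (intro integrable_mult_right gauss_moment_integrable)
        fix \<eta> :: 'a
        have nx: "norm x \<le> \<delta> / \<Lambda>" using x by simp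
        have "norm (cis (x \<bullet> diag_affine ?l 0 \<eta> + \<delta> / \<Lambda> * norm (diag_affine ?l 0 \<eta>)) - 1) \<le>
            \<bar>x \<bullet> (\<Lambda> *\<^sub>R \<eta>) + \<delta> / \<Lambda> * norm (\<Lambda> *\<^sub>R \<eta>)\<bar>"
          unfolding T by (rule norm_cis_minus_1_le)
        also have "\<dots> \<le> norm x * norm (\<Lambda> *\<^sub>R \<eta>) + \<delta> / \<Lambda> * norm (\<Lambda> *\<^sub>R \<eta>)"
          using Cauchy_Schwarz_ineq2[of x "\<Lambda> *\<^sub>R \<eta>"] \<delta> \<Lambda>
          by (intro order_trans[OF abs_triangle_ineq] add_mono) auto
        also have "\<dots> \<le> \<delta> / \<Lambda> * norm (\<Lambda> *\<^sub>R \<eta>) + \<delta> / \<Lambda> * norm (\<Lambda> *\<^sub>R \<eta>)"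
          using nx by (intro add_right_mono mult_right_mono) auto
        also have "\<dots> = \<delta> * (2 * norm \<eta>)" using \<Lambda> by simp
        also have "\<dots> \<le> \<delta> * (5 * norm \<eta> + (norm \<eta>)\<^sup>2)" using \<delta> by (intro mult_left_mono) auto
        finally show "norm (cis (x \<bullet> diag_affine ?l 0 \<eta> + \<delta> / \<Lambda> * norm (diag_affine ?l 0 \<eta>)) - 1) \<le>
            \<delta> * (5 * norm \<eta> + (norm \<eta>)\<^sup>2)" .
      qed (use small \<Lambda> in auto)
    qed (use \<Lambda> in auto)
    moreover have "measure lborel ?S = v * \<Lambda> powr (- D)"
    proof -
      have "measure lborel ?S = (\<delta> / \<Lambda>) ^ DIM('a) * measure lborel (ball (0::'a) 1)"
        using content_ball[of "\<delta> / \<Lambda>" "0::'a"] content_ball[of 1 "0::'a"] \<delta> \<Lambda> by simp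
      moreover have "v = \<delta> ^ DIM('a) * measure lborel (ball (0::'a) 1)"
        unfolding v_def using content_ball[of \<delta> "0::'a"] content_ball[of 1 "0::'a"] \<delta> by simp
      moreover have "\<Lambda> powr (- D) = 1 / \<Lambda> ^ DIM('a)"
        using \<Lambda> by (simp add: D_def powr_minus_divide powr_realpow)
      ultimately show ?thesis by (simp add: power_divide)
    qed
    moreover have "(\<Prod>b\<in>(Basis::'a set). \<Lambda>) powr (- 1 / 2) = \<Lambda> powr (- D / 2)"
      using \<Lambda> by (simp add: D_def powr_powr flip: powr_realpow)
    ultimately have "v powr (1 / q) * \<Lambda> powr (- D * (1 / q)) \<le> K * (\<Lambda> powr max s 0 * \<Lambda> powr (- D / 2))"
      by (simp only: powr_mult powr_powr mult.assoc)
    then have "v powr (1 / q) * \<Lambda> powr (- D / q) \<le> K * \<Lambda> powr (max s 0 - D / 2)"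
      by (simp add: powr_add[symmetric])
    then have "\<Lambda> powr (- D / q) / \<Lambda> powr (max s 0 - D / 2) \<le> K / v powr (1 / q)"
      using v \<Lambda> by (simp add: field_simps)
    then show ?thesis unfolding powr_diff[symmetric] by (simp add: algebra_simps)
  qed
  then have "D / 2 - D / q - max s 0 \<le> 0" by (rule powr_bounded_imp_nonpos)
  then show ?thesis unfolding D_def by simp
qed

text \<open>On the support of the packet, \<open>|\<xi>| - \<xi> \<bullet> e \<le> |\<xi>'|\<^sup>2 / \<Lambda>\<close> when \<open>\<xi> \<bullet> e \<ge> \<Lambda> / 2\<close>,
  where \<open>\<xi>'\<close> is the part of \<open>\<xi>\<close> orthogonal to \<open>e\<close>; otherwise the second term exceeds 2.\<close>

lemma knapp_phase_le:
  fixes \<xi> e :: "'a::euclidean_space"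
  assumes e: "e \<in> Basis" and \<Lambda>: "\<Lambda> > 0"
  shows "min 2 (norm \<xi> - \<xi> \<bullet> e) \<le> ((norm \<xi>)\<^sup>2 - (\<xi> \<bullet> e)\<^sup>2) / \<Lambda> + 4 * \<bar>\<xi> \<bullet> e - \<Lambda>\<bar> / \<Lambda>"
proof -
  define a where "a = \<xi> \<bullet> e"
  define n where "n = norm \<xi>"
  have an: "\<bar>a\<bar> \<le> n" unfolding a_def n_def using e by (rule Basis_le_norm)
  then have an2: "a\<^sup>2 \<le> n\<^sup>2" by (intro abs_le_square_iff[THEN iffD1]) simp
  show ?thesis
  proof (cases "a \<ge> \<Lambda> / 2")
    case True
    have "(n - a) * \<Lambda> \<le> (n - a) * (n + a)" using True an by (intro mult_left_mono) auto
    also have "\<dots> = n\<^sup>2 - a\<^sup>2" by (simp add: power2_eq_square algebra_simps)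
    finally have "n - a \<le> (n\<^sup>2 - a\<^sup>2) / \<Lambda>" using \<Lambda> by (simp add: pos_le_divide_eq)
    moreover have "0 \<le> 4 * \<bar>a - \<Lambda>\<bar> / \<Lambda>" using \<Lambda> by simp
    ultimately have "min 2 (n - a) \<le> (n\<^sup>2 - a\<^sup>2) / \<Lambda> + 4 * \<bar>a - \<Lambda>\<bar> / \<Lambda>" by linarith
    then show ?thesis unfolding a_def n_def .
  next
    case False
    then have "a - \<Lambda> \<le> - (\<Lambda> / 2)" by simp
    then have "\<Lambda> / 2 \<le> \<bar>a - \<Lambda>\<bar>" using abs_ge_minus_self[of "a - \<Lambda>"] by linarith
    then have "2 * \<Lambda> \<le> 4 * \<bar>a - \<Lambda>\<bar>" by simp
    then have "2 \<le> 4 * \<bar>a - \<Lambda>\<bar> / \<Lambda>" using \<Lambda> by (simp add: pos_le_divide_eq)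
    moreover have "0 \<le> (n\<^sup>2 - a\<^sup>2) / \<Lambda>" using \<Lambda> an2 by simp
    ultimately have "min 2 (n - a) \<le> (n\<^sup>2 - a\<^sup>2) / \<Lambda> + 4 * \<bar>a - \<Lambda>\<bar> / \<Lambda>" by linarith
    then show ?thesis unfolding a_def n_def .
  qed
qed

text \<open>The time \<open>t = - (x \<bullet> e)\<close> cancels the phase along the axis
  \<open>e\<close>, leaving the transversal part and
  \<open>t * (norm \<xi> - \<xi> \<bullet> e)\<close>. As the time may depend on \<open>x\<close>,
  the maximal function is large on a tube whose length does not shrink with \<Lambda>. The tube has
  volume of order \<open>\<Lambda> powr (- (d - 1) / 2)\<close> and the product of the widths is of
  order \<open>\<Lambda> powr ((d + 1) / 2)\<close>, which gives the two terms of the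
  exponent.\<close>

lemma knapp_example:
  fixes q s K :: real
  assumes q: "q > 0"
    and test: "\<And>(l :: 'a::euclidean_space \<Rightarrow> real) c \<Lambda> S. (\<And>b. b \<in> Basis \<Longrightarrow> 0 < l b \<and> l b \<le> \<Lambda>) \<Longrightarrow>
     \<Lambda> \<ge> 1 \<Longrightarrow> norm c \<le> \<Lambda> \<Longrightarrow> S \<in> sets borel \<Longrightarrow> S \<subseteq> ball 0 1 \<Longrightarrow>
     (\<And>x. x \<in> S \<Longrightarrow> \<exists>t\<in>{0<..<1}. norm (wave t (gauss_packet l c) x) \<ge> 1 / 2) \<Longrightarrow>
     measure lborel S powr (1 / q) \<le> K * (\<Lambda> powr max s 0) * (\<Prod>b\<in>Basis. l b) powr (- 1 / 2)"
  shows "(real DIM('a) + 1) / 4 - (real DIM('a) - 1) / (2 * q) \<le> max s 0"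
proof -
  define D where "D = real DIM('a)"
  have D1: "D \<ge> 1" unfolding D_def by (simp add: Suc_le_eq)
  obtain e :: 'a where e: "e \<in> Basis" using nonempty_Basis by blast
  obtain \<delta> :: real where \<delta>: "0 < \<delta>" "\<delta> < 1" and small:
    "(LINT \<eta>::'a|lborel. \<delta> * (5 * norm \<eta> + (norm \<eta>)\<^sup>2) * exp (- ((norm \<eta>)\<^sup>2 / 2))) \<le> sqrt (2 * pi) ^ DIM('a) / 2"
    by (rule gauss_moment_small)
  \<comment> \<open>The part of the volume of the tube that does not depend on \<Lambda>: length 1/2
    and \<open>DIM('a) - 1\<close> sides of length \<open>1 / (D * R)\<close>.\<close>
  define v where "v = (1 / 2) * (1 / D) ^ (DIM('a) - 1)"
  have v: "v > 0" unfolding v_def using D1 by simp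
  have Dn: "real (DIM('a) - 1) = D - 1" unfolding D_def by (simp add: of_nat_diff Suc_le_eq)
  have prod_e: "(\<Prod>b\<in>(Basis::'a set). if b = e then x else y) = x * y ^ (DIM('a) - 1)" for x y :: real
    by (subst prod.remove[OF finite_Basis e]) (simp add: card_Diff_singleton e)
  have "\<Lambda> powr ((D + 1) / 4 - (D - 1) / (2 * q) - max s 0) \<le> K * \<delta> powr (- D / 2) / v powr (1 / q)" if \<Lambda>: "\<Lambda> \<ge> 1" for \<Lambda> :: real
  proof -
    define R where "R = sqrt \<Lambda>"
    have R: "R \<ge> 1" "R * R = \<Lambda>" "R \<le> \<Lambda>"
    proof -
      show "R \<ge> 1" "R * R = \<Lambda>" unfolding R_def using \<Lambda> by simp_all
      then show "R \<le> \<Lambda>" using mult_left_mono[of 1 R R] by simp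
    qed
    \<comment> \<open>Width of order \<Lambda> along the axis and of order
      \<open>sqrt \<Lambda>\<close> across it: then the squared transversal frequency divided by
      \<Lambda>, which bounds the curvature error, stays bounded. The factor \<delta> makes all
      phase errors small.\<close>
    define l where "l b = (if b = e then \<delta> * \<Lambda> else \<delta> * R)" for b :: 'a
    \<comment> \<open>So small that the transversal coordinates of a point of the box add up to at
      most \<open>1 / (2 * R)\<close>, which balances the width \<open>\<delta> * R\<close>.\<close>
    define r where "r = 1 / (2 * D * R)"
    have r: "r > 0" unfolding r_def using D1 R by simp
    \<comment> \<open>Along \<open>e\<close> the box is the interval from -1/2 to 0, so that
      \<open>- (x \<bullet> e)\<close> is an admissible time and the box fits into the unit
      ball.\<close>
    define lo where "lo = (\<Sum>b\<in>Basis. (if b = e then - 1 / 2 else - r) *\<^sub>R b)"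
    define hi where "hi = (\<Sum>b\<in>Basis. (if b = e then 0 else r) *\<^sub>R b)"
    have lo: "lo \<bullet> b = (if b = e then - 1 / 2 else - r)" and hi: "hi \<bullet> b = (if b = e then 0 else r)" if "b \<in> Basis" for b
      unfolding lo_def hi_def using that by (simp_all add: inner_sum_left_Basis)
    let ?S = "box lo hi"
    have lb: "0 < l b \<and> l b \<le> \<Lambda>" for b
    proof -
      have "\<delta> * \<Lambda> \<le> 1 * \<Lambda>" using \<delta> \<Lambda> by (intro mult_right_mono) auto
      moreover have "\<delta> * R \<le> 1 * R" using \<delta> R by (intro mult_right_mono) auto
      ultimately show ?thesis unfolding l_def using \<delta> \<Lambda> R by auto
    qed
    have Sx: "- 1 / 2 < x \<bullet> e \<and> x \<bullet> e < 0" "\<And>b. b \<in> Basis \<Longrightarrow> b \<noteq> e \<Longrightarrow> \<bar>x \<bullet> b\<bar> \<le> r" if "x \<in> ?S" for x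
    proof -
      show "- 1 / 2 < x \<bullet> e \<and> x \<bullet> e < 0" using that e lo[OF e] hi[OF e] unfolding mem_box by auto
      fix b :: 'a assume b: "b \<in> Basis" "b \<noteq> e"
      then have "- r < x \<bullet> b" "x \<bullet> b < r" using that lo[OF b(1)] hi[OF b(1)] unfolding mem_box by auto
      then show "\<bar>x \<bullet> b\<bar> \<le> r" by simp
    qed
    have sum_e: "(\<Sum>b\<in>Basis - {e}. \<bar>x \<bullet> b\<bar>) \<le> 1 / (2 * R)" if x: "x \<in> ?S" for x
    proof -
      have "(\<Sum>b\<in>Basis - {e}. \<bar>x \<bullet> b\<bar>) \<le> (\<Sum>b\<in>(Basis::'a set) - {e}. r)"
        using Sx(2)[OF x] by (intro sum_mono) auto
      also have "\<dots> = (D - 1) * r" using e Dn by (simp add: card_Diff_singleton)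
      also have "\<dots> \<le> D * r" using r by (intro mult_right_mono) auto
      also have "\<dots> = 1 / (2 * R)" unfolding r_def using D1 by simp
      finally show ?thesis .
    qed
    have "measure lborel ?S powr (1 / q) \<le> K * (\<Lambda> powr max s 0) * (\<Prod>b\<in>Basis. l b) powr (- 1 / 2)"
    proof (rule test[of l \<Lambda> "\<Lambda> *\<^sub>R e"])
      show "0 < l b \<and> l b \<le> \<Lambda>" for b by (rule lb)
      show "norm (\<Lambda> *\<^sub>R e) \<le> \<Lambda>" using e \<Lambda> by simp
      show "?S \<subseteq> ball 0 1"
      proof
        fix x assume x: "x \<in> ?S"
        have "norm x \<le> (\<Sum>b\<in>Basis. \<bar>x \<bullet> b\<bar>)" by (rule norm_le_l1)
        also have "\<dots> = \<bar>x \<bullet> e\<bar> + (\<Sum>b\<in>Basis - {e}. \<bar>x \<bullet> b\<bar>)" by (rule sum.remove[OF finite_Basis e])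
        also have "\<dots> \<le> \<bar>x \<bullet> e\<bar> + 1 / (2 * R)" using sum_e[OF x] by simp
        also have "1 / (2 * R) \<le> 1 / 2" using R by (simp add: field_simps)
        also have "\<bar>x \<bullet> e\<bar> + 1 / 2 < 1" using Sx(1)[OF x] by auto
        finally show "x \<in> ball 0 1" by simp
      qed
      fix x assume x: "x \<in> ?S"
      have t: "- (x \<bullet> e) \<in> {0<..<1}" using Sx(1)[OF x] by auto
      show "\<exists>t\<in>{0<..<1}. norm (wave t (gauss_packet l (\<Lambda> *\<^sub>R e)) x) \<ge> 1 / 2"
      proof (rule bexI[OF _ t], rule wave_gauss_packet_ge)
        show "integrable lborel (\<lambda>\<eta>::'a. \<delta> * (5 * norm \<eta> + (norm \<eta>)\<^sup>2) * exp (- ((norm \<eta>)\<^sup>2 / 2)))"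
          unfolding mult.assoc[of \<delta>] by (intro integrable_mult_right gauss_moment_integrable)
        fix \<eta> :: 'a
        define \<xi> where "\<xi> = diag_affine l (\<Lambda> *\<^sub>R e) \<eta>"
        have \<xi>e: "\<xi> \<bullet> e = \<Lambda> + \<delta> * \<Lambda> * (\<eta> \<bullet> e)"
          unfolding \<xi>_def using e by (simp add: diag_affine_inner l_def)
        have \<xi>b: "\<xi> \<bullet> b = \<delta> * R * (\<eta> \<bullet> b)" if "b \<in> Basis" "b \<noteq> e" for b
          unfolding \<xi>_def using that e by (simp add: diag_affine_inner l_def inner_Basis)
        define p where "p = (\<Sum>b\<in>Basis - {e}. (x \<bullet> b) * (\<xi> \<bullet> b))"
        have xxi: "x \<bullet> \<xi> = (x \<bullet> e) * (\<xi> \<bullet> e) + p"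
          unfolding p_def euclidean_inner[of x \<xi>] by (rule sum.remove[OF finite_Basis e])
        have ph: "x \<bullet> \<xi> + - (x \<bullet> e) * norm \<xi> = p + - (x \<bullet> e) * (norm \<xi> - \<xi> \<bullet> e)"
          unfolding xxi by (simp add: algebra_simps)
        have pb: "\<bar>p\<bar> \<le> \<delta> * norm \<eta>"
        proof -
          have "\<bar>p\<bar> \<le> (\<Sum>b\<in>Basis - {e}. \<bar>x \<bullet> b\<bar> * (\<delta> * R * norm \<eta>))"
            unfolding p_def
          proof (rule order_trans[OF sum_abs], rule sum_mono)
            fix b :: 'a assume b: "b \<in> Basis - {e}"
            have "\<bar>\<xi> \<bullet> b\<bar> = \<delta> * R * \<bar>\<eta> \<bullet> b\<bar>" using \<xi>b[of b] b \<delta> R by (simp add: abs_mult)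
            also have "\<dots> \<le> \<delta> * R * norm \<eta>" using \<delta> R b by (intro mult_left_mono Basis_le_norm) auto
            finally show "\<bar>(x \<bullet> b) * (\<xi> \<bullet> b)\<bar> \<le> \<bar>x \<bullet> b\<bar> * (\<delta> * R * norm \<eta>)"
              unfolding abs_mult by (rule mult_left_mono) simp
          qed
          also have "\<dots> = (\<Sum>b\<in>Basis - {e}. \<bar>x \<bullet> b\<bar>) * (\<delta> * R * norm \<eta>)" by (rule sum_distrib_right[symmetric])
          also have "\<dots> \<le> 1 / (2 * R) * (\<delta> * R * norm \<eta>)"
            using sum_e[OF x] \<delta> R by (intro mult_right_mono) auto
          also have "\<dots> = \<delta> * norm \<eta> / 2" using R by simp
          also have "\<dots> \<le> \<delta> * norm \<eta>" using \<delta> by simp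
          finally show ?thesis .
        qed
        have dn: "0 \<le> norm \<xi> - \<xi> \<bullet> e" using Basis_le_norm[OF e, of \<xi>] by simp
        have perp: "(norm \<xi>)\<^sup>2 - (\<xi> \<bullet> e)\<^sup>2 \<le> \<delta>\<^sup>2 * \<Lambda> * (norm \<eta>)\<^sup>2"
        proof -
          have "(norm \<xi>)\<^sup>2 = (\<xi> \<bullet> e)\<^sup>2 + (\<Sum>b\<in>Basis - {e}. (\<xi> \<bullet> b)\<^sup>2)"
            unfolding norm_sq_eq_sum by (rule sum.remove[OF finite_Basis e])
          also have "(\<Sum>b\<in>Basis - {e}. (\<xi> \<bullet> b)\<^sup>2) = (\<Sum>b\<in>Basis - {e}. \<delta>\<^sup>2 * \<Lambda> * (\<eta> \<bullet> b)\<^sup>2)"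
            using \<xi>b R by (intro sum.cong refl) (simp add: power_mult_distrib power2_eq_square)
          also have "\<dots> \<le> (\<Sum>b\<in>Basis. \<delta>\<^sup>2 * \<Lambda> * (\<eta> \<bullet> b)\<^sup>2)"
            using \<Lambda> by (intro sum_mono2) auto
          also have "\<dots> = \<delta>\<^sup>2 * \<Lambda> * (norm \<eta>)\<^sup>2" unfolding norm_sq_eq_sum sum_distrib_left ..
          finally show ?thesis by simp
        qed
        have "norm (cis (- (x \<bullet> e) * (norm \<xi> - \<xi> \<bullet> e)) - 1) \<le> min 2 (norm \<xi> - \<xi> \<bullet> e)"
        proof -
          have "\<bar>- (x \<bullet> e) * (norm \<xi> - \<xi> \<bullet> e)\<bar> \<le> 1 * (norm \<xi> - \<xi> \<bullet> e)"
            unfolding abs_mult abs_of_nonneg[OF dn] using t dn by (intro mult_right_mono) auto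
          then have "norm (cis (- (x \<bullet> e) * (norm \<xi> - \<xi> \<bullet> e)) - 1) \<le> norm \<xi> - \<xi> \<bullet> e"
            unfolding mult_1 by (rule order_trans[OF norm_cis_minus_1_le])
          with norm_cis_minus_1_le_2 show ?thesis by (rule min.boundedI)
        qed
        also have "\<dots> \<le> ((norm \<xi>)\<^sup>2 - (\<xi> \<bullet> e)\<^sup>2) / \<Lambda> + 4 * \<bar>\<xi> \<bullet> e - \<Lambda>\<bar> / \<Lambda>"
          by (rule knapp_phase_le[OF e]) (use \<Lambda> in simp)
        also have "\<dots> \<le> \<delta> * (norm \<eta>)\<^sup>2 + 4 * (\<delta> * norm \<eta>)"
        proof (rule add_mono)
          have "((norm \<xi>)\<^sup>2 - (\<xi> \<bullet> e)\<^sup>2) / \<Lambda> \<le> \<delta>\<^sup>2 * \<Lambda> * (norm \<eta>)\<^sup>2 / \<Lambda>"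
            using \<Lambda> by (intro divide_right_mono perp) simp
          also have "\<dots> = (\<delta> * \<delta>) * (norm \<eta>)\<^sup>2" using \<Lambda> by (simp add: power2_eq_square)
          also have "\<dots> \<le> (\<delta> * 1) * (norm \<eta>)\<^sup>2" using \<delta> by (intro mult_right_mono mult_left_mono) auto
          finally show "((norm \<xi>)\<^sup>2 - (\<xi> \<bullet> e)\<^sup>2) / \<Lambda> \<le> \<delta> * (norm \<eta>)\<^sup>2" by simp
          have "\<bar>\<xi> \<bullet> e - \<Lambda>\<bar> = \<delta> * \<Lambda> * \<bar>\<eta> \<bullet> e\<bar>" unfolding \<xi>e using \<delta> \<Lambda> by (simp add: abs_mult)
          also have "\<dots> \<le> \<delta> * \<Lambda> * norm \<eta>" using \<delta> \<Lambda> by (intro mult_left_mono Basis_le_norm e) auto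
          finally have "\<bar>\<xi> \<bullet> e - \<Lambda>\<bar> / \<Lambda> \<le> \<delta> * \<Lambda> * norm \<eta> / \<Lambda>" using \<Lambda> by (intro divide_right_mono) auto
          also have "\<dots> = \<delta> * norm \<eta>" using \<Lambda> by simp
          finally show "4 * \<bar>\<xi> \<bullet> e - \<Lambda>\<bar> / \<Lambda> \<le> 4 * (\<delta> * norm \<eta>)" by simp
        qed
        finally have "norm (cis (x \<bullet> \<xi> + - (x \<bullet> e) * norm \<xi>) - 1) \<le> \<delta> * norm \<eta> + (\<delta> * (norm \<eta>)\<^sup>2 + 4 * (\<delta> * norm \<eta>))"
          unfolding ph using norm_cis_add_minus_1_le[of p "- (x \<bullet> e) * (norm \<xi> - \<xi> \<bullet> e)"] norm_cis_minus_1_le[of p] pb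
          by linarith
        also have "\<dots> = \<delta> * (5 * norm \<eta> + (norm \<eta>)\<^sup>2)" by (simp add: algebra_simps)
        finally show "norm (cis (x \<bullet> diag_affine l (\<Lambda> *\<^sub>R e) \<eta> + - (x \<bullet> e) * norm (diag_affine l (\<Lambda> *\<^sub>R e) \<eta>)) - 1) \<le>
            \<delta> * (5 * norm \<eta> + (norm \<eta>)\<^sup>2)" unfolding \<xi>_def .
      qed (use small lb in auto)
    qed (use \<Lambda> in auto)
    moreover have "measure lborel ?S = v * \<Lambda> powr (- ((D - 1) / 2))"
    proof -
      have "measure lborel ?S = (\<Prod>b\<in>Basis. (hi - lo) \<bullet> b)"
      proof (rule measure_lborel_box)
        show "lo \<bullet> b \<le> hi \<bullet> b" if "b \<in> Basis" for b using lo[OF that] hi[OF that] r by auto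
      qed
      also have "\<dots> = (\<Prod>b\<in>(Basis::'a set). if b = e then 1 / 2 else 2 * r)"
        by (intro prod.cong refl) (auto simp: inner_diff_left lo hi)
      also have "\<dots> = 1 / 2 * (2 * r) ^ (DIM('a) - 1)" by (rule prod_e)
      also have "2 * r = (1 / D) * (1 / R)" unfolding r_def by simp
      also have "((1 / D) * (1 / R)) ^ (DIM('a) - 1) = (1 / D) ^ (DIM('a) - 1) * (1 / R) ^ (DIM('a) - 1)"
        by (rule power_mult_distrib)
      also have "(1 / R) ^ (DIM('a) - 1) = \<Lambda> powr (- ((D - 1) / 2))"
      proof -
        have "1 / R = \<Lambda> powr (- 1 / 2)" unfolding R_def using \<Lambda> by (simp add: powr_minus_divide powr_half_sqrt minus_divide_left[symmetric])
        then have "(1 / R) ^ (DIM('a) - 1) = (\<Lambda> powr (- 1 / 2)) powr real (DIM('a) - 1)"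
          using \<Lambda> by (subst powr_realpow) auto
        also have "\<dots> = \<Lambda> powr (- 1 / 2 * (D - 1))" unfolding powr_powr Dn ..
        finally show ?thesis by (simp add: minus_divide_left[symmetric] diff_divide_distrib)
      qed
      finally show ?thesis unfolding v_def by simp
    qed
    moreover have "(\<Prod>b\<in>Basis. l b) powr (- 1 / 2) = \<delta> powr (- D / 2) * \<Lambda> powr (- ((D + 1) / 4))"
    proof -
      have "(\<Prod>b\<in>Basis. l b) = \<delta> * \<Lambda> * (\<delta> * R) ^ (DIM('a) - 1)" unfolding l_def by (rule prod_e)
      also have "\<dots> = (\<delta> powr 1 * \<Lambda> powr 1) * (\<delta> * \<Lambda> powr (1 / 2)) powr (D - 1)"
        using \<delta> \<Lambda> R unfolding Dn[symmetric] by (subst powr_realpow) (auto simp: R_def powr_half_sqrt)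
      also have "\<dots> = (\<delta> powr 1 * \<delta> powr (D - 1)) * (\<Lambda> powr 1 * \<Lambda> powr (1 / 2 * (D - 1)))"
        unfolding powr_mult powr_powr by (simp only: mult_ac)
      also have "\<dots> = \<delta> powr D * \<Lambda> powr ((D + 1) / 2)"
        unfolding powr_add[symmetric] by (simp add: field_simps)
      finally show ?thesis by (simp add: powr_mult powr_powr minus_divide_left[symmetric])
    qed
    ultimately have "(v * \<Lambda> powr (- ((D - 1) / 2))) powr (1 / q) \<le>
        K * (\<Lambda> powr max s 0) * (\<delta> powr (- D / 2) * \<Lambda> powr (- ((D + 1) / 4)))"
      by (simp only:)
    then have "v powr (1 / q) * \<Lambda> powr (- ((D - 1) / 2) * (1 / q)) \<le>
        K * \<delta> powr (- D / 2) * (\<Lambda> powr max s 0 * \<Lambda> powr (- ((D + 1) / 4)))"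
      unfolding powr_mult powr_powr by (simp only: mult_ac)
    then have "v powr (1 / q) * \<Lambda> powr (- ((D - 1) / 2) * (1 / q)) \<le> K * \<delta> powr (- D / 2) * \<Lambda> powr (max s 0 + - ((D + 1) / 4))"
      by (simp only: powr_add)
    then have "\<Lambda> powr (- ((D - 1) / 2) * (1 / q)) / \<Lambda> powr (max s 0 + - ((D + 1) / 4)) \<le> K * \<delta> powr (- D / 2) / v powr (1 / q)"
      using v \<Lambda> by (simp add: pos_divide_le_eq pos_le_divide_eq mult_ac)
    moreover have "- ((D - 1) / 2) * (1 / q) - (max s 0 + - ((D + 1) / 4)) = (D + 1) / 4 - (D - 1) / (2 * q) - max s 0"
      by simp
    ultimately show ?thesis unfolding powr_diff[symmetric] by (simp only:)
  qed
  then have "(D + 1) / 4 - (D - 1) / (2 * q) - max s 0 \<le> 0" by (rule powr_bounded_imp_nonpos)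
  then show ?thesis unfolding D_def by simp
qed

section \<open>The equivalence\<close>

text \<open>The examples bound the critical exponent by \<open>max s 0\<close>. As it is positive,
  the maximum must be \<open>s\<close> itself.\<close>

lemma s_crit_pos:
  assumes "d \<ge> 2" "q > 2"
  shows "s_crit q d > 0"
proof (cases "q < q_circ d")
  case True
  have "(real d - 1) / (2 * q) \<le> (real d - 1) / 4" using assms by (intro divide_left_mono) auto
  then show ?thesis using True unfolding s_crit_def by simp
next
  case False
  have "real d / q < real d / 2" using assms by (intro divide_strict_left_mono) auto
  then show ?thesis using False unfolding s_crit_def by simp
qed

lemma maximal_estimate_necessary:
  fixes q s C :: real
  assumes d: "DIM('a::euclidean_space) \<ge> 2" and q: "q > 2" and C: "C \<ge> 0"
    and est: "\<And>f :: 'a \<Rightarrow> complex. schwartz f \<Longrightarrow>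
       Lp_norm q (ball 0 1) (wave_maximal f) \<le> ennreal C * sobolev_norm s f"
  shows "s \<ge> s_crit q DIM('a)"
proof -
  have q0: "q > 0" using q by simp
  have "s_crit q DIM('a) \<le> max s 0"
  proof (rule maximal_estimate_test[OF C q0])
    show "Lp_norm q (ball 0 1) (wave_maximal f) \<le> ennreal C * sobolev_norm s f"
      if "schwartz f" for f :: "'a \<Rightarrow> complex" by (rule est[OF that])
    fix K :: real
    assume "K \<ge> 0" and test: "\<And>(l :: 'a \<Rightarrow> real) c \<Lambda> S. (\<And>b. b \<in> Basis \<Longrightarrow> 0 < l b \<and> l b \<le> \<Lambda>) \<Longrightarrow>
     \<Lambda> \<ge> 1 \<Longrightarrow> norm c \<le> \<Lambda> \<Longrightarrow> S \<in> sets borel \<Longrightarrow> S \<subseteq> ball 0 1 \<Longrightarrow>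
     (\<And>x. x \<in> S \<Longrightarrow> \<exists>t\<in>{0<..<1}. norm (wave t (gauss_packet l c) x) \<ge> 1 / 2) \<Longrightarrow>
     measure lborel S powr (1 / q) \<le> K * (\<Lambda> powr max s 0) * (\<Prod>b\<in>Basis. l b) powr (- 1 / 2)"
    show "s_crit q DIM('a) \<le> max s 0"
    proof (cases "q < q_circ DIM('a)")
      case True
      have "(real DIM('a) + 1) / 4 - (real DIM('a) - 1) / (2 * q) \<le> max s 0"
        by (rule knapp_example[where K = K and s = s and q = q]) (fact q0, fact test)
      then show ?thesis unfolding s_crit_def if_P[OF True] .
    next
      case False
      have "real DIM('a) / 2 - real DIM('a) / q \<le> max s 0"
        by (rule focusing_example[where K = K and s = s and q = q]) (fact q0, fact test)
      then show ?thesis unfolding s_crit_def if_not_P[OF False] .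
    qed
  qed
  then show ?thesis using s_crit_pos[OF d q] by (simp add: max_def split: if_splits)
qed

theorem corollary1p3:
  fixes d :: nat and q s :: real
  assumes "d = CARD('n::finite)" and "d \<ge> 2"
    and "q > 2" and "q \<noteq> q_circ d"
  shows "(\<exists>C\<ge>0. \<forall>f :: real ^ 'n \<Rightarrow> complex. schwartz f \<longrightarrow>
            Lp_norm q (ball 0 1) (wave_maximal f) \<le> ennreal C * sobolev_norm s f)
         \<longleftrightarrow> s \<ge> s_crit q d"
    (is "?estimate \<longleftrightarrow> _")
proof
  have d: "d = DIM(real ^ 'n)" using assms(1) by simp
  have dim: "DIM(real ^ 'n) \<ge> 2" using assms(2) unfolding d .
  show "s \<ge> s_crit q d" if ?estimate
  proof -
    from that obtain C where C: "C \<ge> 0" and est: "\<forall>f :: real ^ 'n \<Rightarrow> complex. schwartz f \<longrightarrow>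
      Lp_norm q (ball 0 1) (wave_maximal f) \<le> ennreal C * sobolev_norm s f"
      by (elim exE conjE)
    show ?thesis unfolding d
      by (rule maximal_estimate_necessary[OF dim assms(3) C]) (rule est[rule_format])
  qed
  show ?estimate if "s \<ge> s_crit q d"
    by (rule maximal_estimate_sufficient[OF dim assms(3) assms(4)[unfolded d] that[unfolded d]])
qed

end
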